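(* Let $N\ge 1$ be an integer and let $\widehat{\mathcal D^N}$ be the universal central extension of the Lie algebra of $N\times N$-matrix differential operators on the circle (defined explicitly in the context). (i) Every irreducible quasifinite module over $\widehat{\mathcal D^N}$ is either a highest weight module, or a lowest weight module, or a module of the intermediate series. Every nontrivial module of the intermediate series over $\widehat{\mathcal D^N}$ is isomorphic to $V(\alpha)$ or $\overline V(\alpha)$ for some $\alpha\in\mathbb C$. (ii) Every nontrivial indecomposable uniformly bounded module over $\widehat{\mathcal D^N}$ is isomorphic to $V(m,\alpha)$ or $\overline V(m,\alpha)$ for some integer $m\ge 1$ and some indecomposable linear transformation $\alpha$ of $\mathbb C^m$.
   Context: All vector spaces are over $\mathbb C$; $\mathbb Z_+=\{0,1,2,\dots\}$; $[1,N]=\{1,\dots,N\}$; $gl_N$ is the space of $N\times N$ complex matrices with standard basis $E_{p,q}$; $I$ is the identity matrix; $A^{\rm T}$ is the transpose. For $i\in\mathbb Z$, $\binom{i}{s}=i(i-1)\cdots(i-s+1)/s!$ if $s\ge0$, and $\binom is=0$ if $s<0$. The algebra $\mathcal D^N$. Put $D=t\frac{d}{dt}$. As a vector space $\mathcal D^N=\mathbb C[t,t^{-1}]\otimes\mathbb C[D]\otimes gl_N$, spanned by $t^iD^jA$ ($i\in\mathbb Z$, $j\in\mathbb Z_+$, $A\in gl_N$). It has the associative product $(t^iD^jA)\cdot(t^kD^lB)=t^{i+k}(D+k)^jD^lAB$, and $\mathcal D^N$ is the Lie algebra with the commutator bracket $[x,y]=x\cdot y-y\cdot x$. The central extension. $\widehat{\mathcal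 D^N}=\mathcal D^N\oplus\mathbb C\,C$ as a vector space, with $C$ central, and bracket $$[t^i[D]_jA,t^k[D]_lB]=(t^i[D]_jA)\cdot(t^k[D]_lB)-(t^k[D]_lB)\cdot(t^i[D]_jA)+\delta_{i,-k}(-1)^jj!\,l!\binom{i+j}{j+l+1}{\rm tr}(AB)\,C,$$ where $[D]_j=D(D-1)\cdots(D-j+1)$ and the products on the right are in the associative algebra $\mathcal D^N$. Principal gradation. $\widehat{\mathcal D^N}=\bigoplus_{i\in\mathbb Z}(\widehat{\mathcal D^N})_i$ with $$(\widehat{\mathcal D^N})_i={\rm span}\{t^kD^jE_{p,q}\mid k\in\mathbb Z,\ j\in\mathbb Z_+,\ p,q\in[1,N],\ kN+p-q=i\}\oplus\delta_{i,0}\mathbb C\,C.$$ Let $(\widehat{\mathcal D^N})_+$ (resp. $(\widehat{\mathcal D^N})_-$) be the span of the elements of positive (resp. negative) degree. Modules. A quasifinite module is a $\widehat{\mathcal D^N}$-module $V$ with a $\mathbb Z$-gradation $V=\bigoplus_{j\in\mathbb Z}V_j$ such that $(\widehat{\mathcal D^N})_iV_j\subset V_{i+j}$ and $\dim V_j<\infty$ for all $i,j\in\mathbb Z$. A quasifinite module $V$ is a module of the intermediate series if $\dim V_j\le 1$ for all $j\in\mathbb Z$; it is uniformly bounded if there is an integer $K>0$ with $\dim V_j\le K$ for all $j\in\mathbb Z$. A module is trivial if $\widehat{\mathcal D^N}V=0$. (No assumption is made that $(\widehat{\mathcal D^N})_0$, or $C$, $D$, $E_{p,p}$, act diagonalizably.)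 In a quasifinite module $V$, a nonzero homogeneous vector $v$ is a highest (resp. lowest) weight vector if $(\widehat{\mathcal D^N})_0v\subset\mathbb Cv$ and $(\widehat{\mathcal D^N})_+v=0$ (resp. $(\widehat{\mathcal D^N})_-v=0$). A highest (resp. lowest) weight module is a quasifinite module generated by a highest (resp. lowest) weight vector. The modules $V(m,\alpha)$, $\overline V(m,\alpha)$. Let $m\ge1$ and let $\alpha$ be an indecomposable linear transformation of $\mathbb C^m$, i.e. $\mathbb C^m$ is not a direct sum of two nonzero $\alpha$-invariant subspaces (equivalently $\alpha$ is a single Jordan block in a suitable basis). Let $A\in gl_N$ and $\alpha$ act on $\mathbb C^N\otimes\mathbb C^m$ by $A(u\otimes w)=Au\otimes w$ and $\alpha(u\otimes w)=u\otimes\alpha w$. Both $V(m,\alpha)$ and $\overline V(m,\alpha)$ have underlying space $\bigoplus_{k\in\mathbb Z}\{v_k\mid v\in\mathbb C^N\otimes\mathbb C^m\}$, where $v\mapsto v_k$ is a linear isomorphism from $\mathbb C^N\otimes\mathbb C^m$ onto the $k$-th summand. The element $C$ acts as $0$ on both, and for $i,k\in\mathbb Z$, $j\in\mathbb Z_+$, $A\in gl_N$, $v\in\mathbb C^N\otimes\mathbb C^m$: on $V(m,\alpha)$: $(t^iD^jA)v_k=\big((k+\alpha)^jAv\big)_{i+k}$; on $\overline V(m,\alpha)$: $(t^iD^jA)v_k=(-1)^{j+1}\big((i+k+\alpha)^jA^{\rm T}v\big)_{i+k}$, where integers are identified with scalar transformations. For $m=1$ and $\alpha\in\mathbb C$,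 write $V(\alpha)=V(1,\alpha)$ and $\overline V(\alpha)=\overline V(1,\alpha)$. With $\varepsilon_1,\dots,\varepsilon_N$ the standard basis of $\mathbb C^N$, these are graded by giving $(\varepsilon_r\otimes w)_k$ degree $kN+r-1$ in $V(m,\alpha)$ and degree $kN+N-r$ in $\overline V(m,\alpha)$. Isomorphism means isomorphism of $\widehat{\mathcal D^N}$-modules (gradations may differ by a shift). *)

theory Defs
  imports
    "HOL-Library.Poly_Mapping"
    "HOL-Library.Product_Plus"
    "HOL-Combinatorics.Stirling"
    "HOL-Computational_Algebra.Polynomial"
    "Jordan_Normal_Form.Matrix"
begin

section \<open>The algebra of matrix differential operators\<close>

text \<open>
  An element of \<open>\<complex>[t, 1/t] \<otimes> \<complex>[D] \<otimes> gl\<^sub>N\<close> is a finitely supported family of polynomials in \<open>D\<close>: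
  the entry at \<open>(i, p, q)\<close> is the polynomial \<open>f\<close> in the summand \<open>t\<^sup>i f(D) E\<^sub>p\<^sub>q\<close>.
  Matrix indices of \<open>gl\<^sub>N\<close> run over \<open>{1..N}\<close>.
\<close>

type_synonym diffop = "(int \<times> nat \<times> nat) \<Rightarrow>\<^sub>0 complex poly"

definition diffops :: "nat \<Rightarrow> diffop set" where
  "diffops N = {x. Poly_Mapping.keys x \<subseteq> UNIV \<times> {1..N} \<times> {1..N}}"

definition diffop_scale :: "complex \<Rightarrow> diffop \<Rightarrow> diffop" where
  "diffop_scale c x = Poly_Mapping.map (Polynomial.smult c) x"

text \<open>
  The bilinear extension of
  \<open>(t\<^sup>i f(D) E\<^sub>p\<^sub>q) \<cdot> (t\<^sup>k g(D) E\<^sub>r\<^sub>s) = t\<^sup>i\<^sup>+\<^sup>k f(D + k) g(D) E\<^sub>p\<^sub>q E\<^sub>r\<^sub>s\<close>.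
\<close>

definition diffop_mult :: "diffop \<Rightarrow> diffop \<Rightarrow> diffop" where
  "diffop_mult x y =
     (\<Sum>(i, p, q) \<in> Poly_Mapping.keys x. \<Sum>(k, r, s) \<in> Poly_Mapping.keys y.
        if q = r
        then Poly_Mapping.single (i + k, p, s)
               (pcompose (Poly_Mapping.lookup x (i, p, q)) [:of_int k, 1:] *
                Poly_Mapping.lookup y (k, r, s))
        else 0)"

section \<open>The central extension\<close>

definition ffall :: "nat \<Rightarrow> complex poly" where
  "ffall j = (\<Prod>s<j. [:- of_nat s, 1:])"

text \<open>
  The coefficient of \<open>[D]\<^sub>j\<close> in the expansion of \<open>f\<close> in the basis \<open>[D]\<^sub>0, [D]\<^sub>1, \<dots>\<close>;
  see \<open>poly_ffall_expansion\<close> and \<open>ffall_coeff_ffall\<close> below.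
\<close>

definition ffall_coeff :: "complex poly \<Rightarrow> nat \<Rightarrow> complex" where
  "ffall_coeff f j = (\<Sum>n\<le>degree f. coeff f n * of_nat (Stirling n j))"

text \<open>
  The coefficient of \<open>\<delta>\<^sub>i\<^sub>,\<^sub>-\<^sub>k tr(AB) C\<close> in the bracket of \<open>t\<^sup>i f(D) A\<close> and \<open>t\<^sup>k g(D) B\<close>,
  extended bilinearly from \<open>f = [D]\<^sub>j\<close>, \<open>g = [D]\<^sub>l\<close>.
\<close>

definition cocycle_poly :: "int \<Rightarrow> complex poly \<Rightarrow> complex poly \<Rightarrow> complex" where
  "cocycle_poly i f g =
     (\<Sum>j\<le>degree f. \<Sum>l\<le>degree g. ffall_coeff f j * ffall_coeff g l *
        ((-1) ^ j * fact j * fact l * (of_int (i + int j) gchoose (j + l + 1))))"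

definition cocycle :: "diffop \<Rightarrow> diffop \<Rightarrow> complex" where
  "cocycle x y =
     (\<Sum>(i, p, q) \<in> Poly_Mapping.keys x. \<Sum>(k, r, s) \<in> Poly_Mapping.keys y.
        if i = - k \<and> q = r \<and> p = s
        then cocycle_poly i (Poly_Mapping.lookup x (i, p, q)) (Poly_Mapping.lookup y (k, r, s))
        else 0)"

text \<open>The pair \<open>(x, c)\<close> stands for \<open>x + c C\<close>.\<close>

type_synonym cdiffop = "diffop \<times> complex"

definition cdiffops :: "nat \<Rightarrow> cdiffop set" where
  "cdiffops N = diffops N \<times> UNIV"

definition cdiffop_scale :: "complex \<Rightarrow> cdiffop \<Rightarrow> cdiffop" where
  "cdiffop_scale a z = (diffop_scale a (fst z), a * snd z)"

definition cdiffop_bracket :: "cdiffop \<Rightarrow> cdiffop \<Rightarrow> cdiffop" where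
  "cdiffop_bracket z w =
     (diffop_mult (fst z) (fst w) - diffop_mult (fst w) (fst z), cocycle (fst z) (fst w))"

lemma lookup_diffop_scale:
  "Poly_Mapping.lookup (diffop_scale c x) k = Polynomial.smult c (Poly_Mapping.lookup x k)"
  by (simp add: diffop_scale_def Poly_Mapping.map.rep_eq when_def)

interpretation cdiffop: vector_space cdiffop_scale
  by unfold_locales
    (auto simp: cdiffop_scale_def intro!: poly_mapping_eqI prod_eqI
      simp: lookup_diffop_scale lookup_add smult_add_right smult_add_left algebra_simps)

lemma smult_sum_right: "Polynomial.smult c (sum f A) = (\<Sum>x\<in>A. Polynomial.smult c (f x))"
  by (induction A rule: infinite_finite_induct) (simp_all add: smult_add_right)

lemma monom_ffall_expansion:
  "monom 1 n = (\<Sum>j\<le>n. Polynomial.smult (of_nat (Stirling n j)) (ffall j))"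
proof (induction n)
  case 0
  show ?case by (simp add: ffall_def one_pCons monom_0)
next
  case (Suc n)
  have X: "[:0, 1:] * ffall j = ffall (Suc j) + Polynomial.smult (of_nat j) (ffall j)" for j
    by (simp add: ffall_def algebra_simps)
  have "monom 1 (Suc n) = [:0, 1:] * (monom 1 n :: complex poly)"
    by (simp add: monom_Suc)
  also have "\<dots> = (\<Sum>j\<le>n. Polynomial.smult (of_nat (Stirling n j)) ([:0, 1:] * ffall j))"
    by (simp only: Suc sum_distrib_left mult_smult_right)
  also have "\<dots> = (\<Sum>j\<le>n. Polynomial.smult (of_nat (Stirling n j)) (ffall (Suc j)))
      + (\<Sum>j\<le>n. Polynomial.smult (of_nat (Stirling n j * j)) (ffall j))"
    by (simp only: X smult_add_right sum.distrib smult_smult of_nat_mult)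
  also have "(\<Sum>j\<le>n. Polynomial.smult (of_nat (Stirling n j * j)) (ffall j))
      = (\<Sum>j\<le>Suc n. Polynomial.smult (of_nat (Stirling n j * j)) (ffall j))"
    by simp
  also have "\<dots> = (\<Sum>j\<le>n. Polynomial.smult (of_nat (Stirling n (Suc j) * Suc j)) (ffall (Suc j)))"
    by (subst sum.atMost_Suc_shift) simp
  also have "(\<Sum>j\<le>n. Polynomial.smult (of_nat (Stirling n j)) (ffall (Suc j))) + \<dots>
      = (\<Sum>j\<le>n. Polynomial.smult (of_nat (Stirling (Suc n) (Suc j))) (ffall (Suc j)))"
    by (simp only: sum.distrib[symmetric] smult_add_left[symmetric] of_nat_add[symmetric]
        Stirling.simps add.commute mult.commute [of _ "Suc _"])
  also have "\<dots> = (\<Sum>j\<le>Suc n. Polynomial.smult (of_nat (Stirling (Suc n) j)) (ffall j))"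
    by (simp del: sum.atMost_Suc add: sum.atMost_Suc_shift)
  finally show ?case .
qed

lemma poly_ffall_expansion:
  "f = (\<Sum>j\<le>degree f. Polynomial.smult (ffall_coeff f j) (ffall j))"
proof -
  have *: "(\<Sum>j\<le>n. Polynomial.smult (of_nat (Stirling n j)) (ffall j))
      = (\<Sum>j\<le>degree f. Polynomial.smult (of_nat (Stirling n j)) (ffall j))" if "n \<le> degree f" for n
    using that by (intro sum.mono_neutral_left) auto
  have "f = (\<Sum>n\<le>degree f. Polynomial.smult (coeff f n) (monom 1 n))"
    by (simp add: smult_monom poly_as_sum_of_monoms)
  also have "\<dots> = (\<Sum>n\<le>degree f. \<Sum>j\<le>degree f.
      Polynomial.smult (coeff f n * of_nat (Stirling n j)) (ffall j))"
    by (intro sum.cong refl) (simp add: monom_ffall_expansion * smult_sum_right)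
  also have "\<dots> = (\<Sum>j\<le>degree f. Polynomial.smult (ffall_coeff f j) (ffall j))"
    by (subst sum.swap) (simp add: ffall_coeff_def smult_sum)
  finally show ?thesis .
qed

lemma ffall_coeff_le:
  assumes "degree f \<le> d"
  shows "ffall_coeff f j = (\<Sum>n\<le>d. coeff f n * of_nat (Stirling n j))"
  unfolding ffall_coeff_def using assms
  by (intro sum.mono_neutral_left) (auto simp: coeff_eq_0)

lemma degree_ffall [simp]: "degree (ffall j) = j"
  unfolding ffall_def by (subst degree_prod_eq_sum_degree) auto

lemma ffall_coeff_ffall: "ffall_coeff (ffall j) l = (if l = j then 1 else 0)"
proof (induction j arbitrary: l)
  case 0
  show ?case by (cases l) (simp_all add: ffall_coeff_def ffall_def)
next
  case (Suc j)
  let ?f = "ffall j"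
  have rec: "ffall (Suc j) = pCons 0 ?f - Polynomial.smult (of_nat j) ?f"
    by (simp add: ffall_def algebra_simps)
  have "ffall_coeff (ffall (Suc j)) l = (\<Sum>n\<le>Suc j. coeff (pCons 0 ?f) n * of_nat (Stirling n l))
      - of_nat j * (\<Sum>n\<le>Suc j. coeff ?f n * of_nat (Stirling n l))"
    unfolding ffall_coeff_def degree_ffall unfolding rec
    by (simp only: coeff_diff coeff_smult sum_subtractf left_diff_distrib sum_distrib_left mult.assoc)
  also have "(\<Sum>n\<le>Suc j. coeff ?f n * of_nat (Stirling n l)) = ffall_coeff ?f l"
    by (rule ffall_coeff_le [symmetric]) simp
  also have "(\<Sum>n\<le>Suc j. coeff (pCons 0 ?f) n * of_nat (Stirling n l))
      = (\<Sum>n\<le>j. coeff ?f n * of_nat (Stirling (Suc n) l))"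
    by (subst sum.atMost_Suc_shift) simp
  also have "\<dots> = of_nat l * ffall_coeff ?f l + (if l = 0 then 0 else ffall_coeff ?f (l - 1))"
    by (cases l) (simp_all add: ffall_coeff_def sum.distrib sum_distrib_left algebra_simps)
  finally show ?case by (cases l) (auto simp: Suc)
qed

lemma ffall_nonzero: "ffall j \<noteq> 0"
  by (simp add: ffall_def)

lemma cocycle_poly_ffall:
  "cocycle_poly i (ffall j) (ffall l) =
     (-1) ^ j * fact j * fact l * (of_int (i + int j) gchoose (j + l + 1))"
  by (simp add: cocycle_poly_def ffall_coeff_ffall if_distrib [of "\<lambda>a. a * _"]
      if_distrib [of "\<lambda>a. _ * a"] cong: if_cong)

lemma cdiffop_bracket_generators:
  "cdiffop_bracket
     (Poly_Mapping.single (i, p, q) (ffall j), a) (Poly_Mapping.single (k, r, s) (ffall l), b) =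
   ((if q = r then Poly_Mapping.single (i + k, p, s)
                     (pcompose (ffall j) [:of_int k, 1:] * ffall l) else 0)
    - (if s = p then Poly_Mapping.single (k + i, r, q)
                     (pcompose (ffall l) [:of_int i, 1:] * ffall j) else 0),
    if i = - k \<and> q = r \<and> p = s
    then (-1) ^ j * fact j * fact l * (of_int (i + int j) gchoose (j + l + 1)) else 0)"
  by (simp add: cdiffop_bracket_def diffop_mult_def cocycle_def ffall_nonzero cocycle_poly_ffall)

section \<open>The principal gradation\<close>

definition cdiffop_deg :: "nat \<Rightarrow> int \<Rightarrow> cdiffop set" where
  "cdiffop_deg N i = cdiffop.span
     ({(Poly_Mapping.single (k, p, q) (monom 1 j), 0) | k j p q.
         p \<in> {1..N} \<and> q \<in> {1..N} \<and> k * int N + int p - int q = i}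
      \<union> (if i = 0 then {(0, 1)} else {}))"

definition cdiffop_pos :: "nat \<Rightarrow> cdiffop set" where
  "cdiffop_pos N = cdiffop.span (\<Union>i\<in>{0<..}. cdiffop_deg N i)"

definition cdiffop_neg :: "nat \<Rightarrow> cdiffop set" where
  "cdiffop_neg N = cdiffop.span (\<Union>i\<in>{..<0}. cdiffop_deg N i)"

section \<open>Modules\<close>

text \<open>
  The underlying space is a subspace \<open>space\<close> of an ambient complex vector space, so that
  submodules live in the same type.
\<close>

record 'v cdiffop_rep =
  space :: "'v set"
  scale :: "complex \<Rightarrow> 'v \<Rightarrow> 'v"
  act :: "cdiffop \<Rightarrow> 'v \<Rightarrow> 'v"

definition cdiffop_module :: "nat \<Rightarrow> 'v::ab_group_add cdiffop_rep \<Rightarrow> bool" where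
  "cdiffop_module N M \<longleftrightarrow>
     vector_space (scale M) \<and> module.subspace (scale M) (space M) \<and>
     (\<forall>x\<in>cdiffops N. \<forall>v\<in>space M. act M x v \<in> space M) \<and>
     (\<forall>x\<in>cdiffops N. \<forall>v\<in>space M. \<forall>w\<in>space M. act M x (v + w) = act M x v + act M x w) \<and>
     (\<forall>x\<in>cdiffops N. \<forall>c. \<forall>v\<in>space M. act M x (scale M c v) = scale M c (act M x v)) \<and>
     (\<forall>x\<in>cdiffops N. \<forall>y\<in>cdiffops N. \<forall>v\<in>space M. act M (x + y) v = act M x v + act M y v) \<and>
     (\<forall>c. \<forall>x\<in>cdiffops N. \<forall>v\<in>space M. act M (cdiffop_scale c x) v = scale M c (act M x v)) \<and>
     (\<forall>x\<in>cdiffops N. \<forall>y\<in>cdiffops N. \<forall>v\<in>space M.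
        act M (cdiffop_bracket x y) v = act M x (act M y v) - act M y (act M x v))"

definition submodule :: "nat \<Rightarrow> 'v::ab_group_add cdiffop_rep \<Rightarrow> 'v set \<Rightarrow> bool" where
  "submodule N M U \<longleftrightarrow>
     module.subspace (scale M) U \<and> U \<subseteq> space M \<and> (\<forall>x\<in>cdiffops N. \<forall>v\<in>U. act M x v \<in> U)"

definition irreducible_module :: "nat \<Rightarrow> 'v::ab_group_add cdiffop_rep \<Rightarrow> bool" where
  "irreducible_module N M \<longleftrightarrow>
     cdiffop_module N M \<and> space M \<noteq> {0} \<and> (\<forall>U. submodule N M U \<longrightarrow> U = {0} \<or> U = space M)"

definition indecomposable_module :: "nat \<Rightarrow> 'v::ab_group_add cdiffop_rep \<Rightarrow> bool" where
  "indecomposable_module N M \<longleftrightarrow>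
     cdiffop_module N M \<and> space M \<noteq> {0} \<and>
     \<not> (\<exists>U W. submodule N M U \<and> submodule N M W \<and> U \<noteq> {0} \<and> W \<noteq> {0} \<and>
          U \<inter> W = {0} \<and> {u + w | u w. u \<in> U \<and> w \<in> W} = space M)"

definition trivial_module :: "nat \<Rightarrow> 'v::ab_group_add cdiffop_rep \<Rightarrow> bool" where
  "trivial_module N M \<longleftrightarrow> (\<forall>x\<in>cdiffops N. \<forall>v\<in>space M. act M x v = 0)"

definition module_iso ::
    "nat \<Rightarrow> 'v::ab_group_add cdiffop_rep \<Rightarrow> 'w::ab_group_add cdiffop_rep \<Rightarrow> bool" where
  "module_iso N M M' \<longleftrightarrow>
     (\<exists>\<phi>. bij_betw \<phi> (space M) (space M') \<and>
        (\<forall>v\<in>space M. \<forall>w\<in>space M. \<phi> (v + w) = \<phi> v + \<phi> w) \<and>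
        (\<forall>c. \<forall>v\<in>space M. \<phi> (scale M c v) = scale M' c (\<phi> v)) \<and>
        (\<forall>x\<in>cdiffops N. \<forall>v\<in>space M. \<phi> (act M x v) = act M' x (\<phi> v)))"

section \<open>Graded modules\<close>

text \<open>\<open>G j\<close> is the homogeneous component \<open>V\<^sub>j\<close>.\<close>

definition gradation :: "nat \<Rightarrow> 'v::ab_group_add cdiffop_rep \<Rightarrow> (int \<Rightarrow> 'v set) \<Rightarrow> bool" where
  "gradation N M G \<longleftrightarrow>
     (\<forall>j. module.subspace (scale M) (G j) \<and> G j \<subseteq> space M) \<and>
     (\<forall>v\<in>space M. \<exists>!w. (\<forall>j. w j \<in> G j) \<and> finite {j. w j \<noteq> 0} \<and> v = (\<Sum>j | w j \<noteq> 0. w j)) \<and>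
     (\<forall>i j. \<forall>x\<in>cdiffop_deg N i. \<forall>v\<in>G j. act M x v \<in> G (i + j))"

definition quasifinite :: "nat \<Rightarrow> 'v::ab_group_add cdiffop_rep \<Rightarrow> (int \<Rightarrow> 'v set) \<Rightarrow> bool" where
  "quasifinite N M G \<longleftrightarrow>
     cdiffop_module N M \<and> gradation N M G \<and>
     (\<forall>j. \<exists>B. finite B \<and> module.span (scale M) B = G j)"

text \<open>
  \<open>vector_space.dim\<close> is \<open>0\<close> on infinite-dimensional spaces; \<open>quasifinite\<close> excludes that case below.
\<close>

definition intermediate_series ::
    "nat \<Rightarrow> 'v::ab_group_add cdiffop_rep \<Rightarrow> (int \<Rightarrow> 'v set) \<Rightarrow> bool" where
  "intermediate_series N M G \<longleftrightarrow>
     quasifinite N M G \<and> (\<forall>j. vector_space.dim (scale M) (G j) \<le> 1)"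

definition uniformly_bounded ::
    "nat \<Rightarrow> 'v::ab_group_add cdiffop_rep \<Rightarrow> (int \<Rightarrow> 'v set) \<Rightarrow> bool" where
  "uniformly_bounded N M G \<longleftrightarrow>
     quasifinite N M G \<and> (\<exists>K>0. \<forall>j. vector_space.dim (scale M) (G j) \<le> K)"

definition highest_weight_vector ::
    "nat \<Rightarrow> 'v::ab_group_add cdiffop_rep \<Rightarrow> (int \<Rightarrow> 'v set) \<Rightarrow> 'v \<Rightarrow> bool" where
  "highest_weight_vector N M G v \<longleftrightarrow>
     v \<noteq> 0 \<and> (\<exists>j. v \<in> G j) \<and>
     (\<forall>x\<in>cdiffop_deg N 0. \<exists>c. act M x v = scale M c v) \<and> (\<forall>x\<in>cdiffop_pos N. act M x v = 0)"

definition lowest_weight_vector ::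
    "nat \<Rightarrow> 'v::ab_group_add cdiffop_rep \<Rightarrow> (int \<Rightarrow> 'v set) \<Rightarrow> 'v \<Rightarrow> bool" where
  "lowest_weight_vector N M G v \<longleftrightarrow>
     v \<noteq> 0 \<and> (\<exists>j. v \<in> G j) \<and>
     (\<forall>x\<in>cdiffop_deg N 0. \<exists>c. act M x v = scale M c v) \<and> (\<forall>x\<in>cdiffop_neg N. act M x v = 0)"

definition generated_by :: "nat \<Rightarrow> 'v::ab_group_add cdiffop_rep \<Rightarrow> 'v \<Rightarrow> bool" where
  "generated_by N M v \<longleftrightarrow>
     v \<in> space M \<and> (\<forall>U. submodule N M U \<and> v \<in> U \<longrightarrow> U = space M)"

definition highest_weight_module ::
    "nat \<Rightarrow> 'v::ab_group_add cdiffop_rep \<Rightarrow> (int \<Rightarrow> 'v set) \<Rightarrow> bool" where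
  "highest_weight_module N M G \<longleftrightarrow>
     quasifinite N M G \<and> (\<exists>v. highest_weight_vector N M G v \<and> generated_by N M v)"

definition lowest_weight_module ::
    "nat \<Rightarrow> 'v::ab_group_add cdiffop_rep \<Rightarrow> (int \<Rightarrow> 'v set) \<Rightarrow> bool" where
  "lowest_weight_module N M G \<longleftrightarrow>
     quasifinite N M G \<and> (\<exists>v. lowest_weight_vector N M G v \<and> generated_by N M v)"

section \<open>The modules \<open>V(m, \<alpha>)\<close> and \<open>Vbar(m, \<alpha>)\<close>\<close>

text \<open>
  A vector is a finitely supported family; the entry at \<open>(k, r, s)\<close> is the coefficient of
  \<open>(\<epsilon>\<^sub>r \<otimes> e\<^sub>s)\<^sub>k\<close> with \<open>r \<in> {1..N}\<close> and, following the indexing of \<open>mat\<close>, \<open>s \<in> {..<m}\<close>.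
\<close>

type_synonym tvec = "(int \<times> nat \<times> nat) \<Rightarrow>\<^sub>0 complex"

definition tvecs :: "nat \<Rightarrow> nat \<Rightarrow> tvec set" where
  "tvecs N m = {v. Poly_Mapping.keys v \<subseteq> UNIV \<times> {1..N} \<times> {..<m}}"

definition tvec_scale :: "complex \<Rightarrow> tvec \<Rightarrow> tvec" where
  "tvec_scale c v = Poly_Mapping.map ((*) c) v"

definition shift_mat :: "nat \<Rightarrow> complex mat \<Rightarrow> int \<Rightarrow> complex mat" where
  "shift_mat m \<alpha> k = of_int k \<cdot>\<^sub>m 1\<^sub>m m + \<alpha>"

text \<open>
  Linear extensions of
  \<open>(t\<^sup>i D\<^sup>j E\<^sub>p\<^sub>q) (\<epsilon>\<^sub>r \<otimes> e\<^sub>s)\<^sub>k = (E\<^sub>p\<^sub>q \<epsilon>\<^sub>r \<otimes> (k + \<alpha>)\<^sup>j e\<^sub>s)\<^sub>i\<^sub>+\<^sub>k\<close> and of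
  \<open>(t\<^sup>i D\<^sup>j E\<^sub>p\<^sub>q) (\<epsilon>\<^sub>r \<otimes> e\<^sub>s)\<^sub>k = (-1)\<^sup>j\<^sup>+\<^sup>1 (E\<^sub>q\<^sub>p \<epsilon>\<^sub>r \<otimes> (i + k + \<alpha>)\<^sup>j e\<^sub>s)\<^sub>i\<^sub>+\<^sub>k\<close>;
  the central component \<open>snd z\<close> acts as \<open>0\<close>.
\<close>

definition V_act :: "nat \<Rightarrow> complex mat \<Rightarrow> cdiffop \<Rightarrow> tvec \<Rightarrow> tvec" where
  "V_act m \<alpha> z v =
     (\<Sum>(i, p, q) \<in> Poly_Mapping.keys (fst z). \<Sum>(k, r, s) \<in> Poly_Mapping.keys v.
        let f = Poly_Mapping.lookup (fst z) (i, p, q) in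
        if q = r
        then \<Sum>u<m. Poly_Mapping.single (i + k, p, u)
               (Poly_Mapping.lookup v (k, r, s) *
                (\<Sum>j\<le>degree f. coeff f j * (shift_mat m \<alpha> k ^\<^sub>m j) $$ (u, s)))
        else 0)"

definition Vbar_act :: "nat \<Rightarrow> complex mat \<Rightarrow> cdiffop \<Rightarrow> tvec \<Rightarrow> tvec" where
  "Vbar_act m \<alpha> z v =
     (\<Sum>(i, p, q) \<in> Poly_Mapping.keys (fst z). \<Sum>(k, r, s) \<in> Poly_Mapping.keys v.
        let f = Poly_Mapping.lookup (fst z) (i, p, q) in
        if p = r
        then \<Sum>u<m. Poly_Mapping.single (i + k, q, u)
               (Poly_Mapping.lookup v (k, r, s) *
                (\<Sum>j\<le>degree f. coeff f j * (-1) ^ (j + 1) *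
                   (shift_mat m \<alpha> (i + k) ^\<^sub>m j) $$ (u, s)))
        else 0)"

lemma V_act_generators:
  "V_act m \<alpha> (Poly_Mapping.single (i, p, q) (monom 1 j), c) (Poly_Mapping.single (k, r, s) 1) =
     (if q = r
      then \<Sum>u<m. Poly_Mapping.single (i + k, p, u) ((shift_mat m \<alpha> k ^\<^sub>m j) $$ (u, s))
      else 0)"
  by (simp add: V_act_def Let_def monom_eq_0_iff degree_monom_eq if_distrib [of "\<lambda>a. a * _"]
      cong: if_cong)

lemma Vbar_act_generators:
  "Vbar_act m \<alpha> (Poly_Mapping.single (i, p, q) (monom 1 j), c) (Poly_Mapping.single (k, r, s) 1) =
     (if p = r
      then \<Sum>u<m. Poly_Mapping.single (i + k, q, u)
             ((-1) ^ (j + 1) * (shift_mat m \<alpha> (i + k) ^\<^sub>m j) $$ (u, s))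
      else 0)"
  by (simp add: sum_negf Vbar_act_def Let_def monom_eq_0_iff degree_monom_eq if_distrib [of "\<lambda>a. a * _"]
      cong: if_cong)

definition V_mod :: "nat \<Rightarrow> nat \<Rightarrow> complex mat \<Rightarrow> tvec cdiffop_rep" where
  "V_mod N m \<alpha> = \<lparr>space = tvecs N m, scale = tvec_scale, act = V_act m \<alpha>\<rparr>"

definition Vbar_mod :: "nat \<Rightarrow> nat \<Rightarrow> complex mat \<Rightarrow> tvec cdiffop_rep" where
  "Vbar_mod N m \<alpha> = \<lparr>space = tvecs N m, scale = tvec_scale, act = Vbar_act m \<alpha>\<rparr>"

definition scalar_mat1 :: "complex \<Rightarrow> complex mat" where
  "scalar_mat1 a = mat 1 1 (\<lambda>_. a)"

definition invariant_subspace :: "nat \<Rightarrow> complex mat \<Rightarrow> complex vec set \<Rightarrow> bool" where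
  "invariant_subspace m \<alpha> U \<longleftrightarrow>
     U \<subseteq> carrier_vec m \<and> 0\<^sub>v m \<in> U \<and> (\<forall>u\<in>U. \<forall>w\<in>U. u + w \<in> U) \<and>
     (\<forall>c. \<forall>u\<in>U. c \<cdot>\<^sub>v u \<in> U) \<and> (\<forall>u\<in>U. \<alpha> *\<^sub>v u \<in> U)"

definition indecomposable_mat :: "nat \<Rightarrow> complex mat \<Rightarrow> bool" where
  "indecomposable_mat m \<alpha> \<longleftrightarrow>
     \<alpha> \<in> carrier_mat m m \<and>
     \<not> (\<exists>U W. invariant_subspace m \<alpha> U \<and> invariant_subspace m \<alpha> W \<and>
          U \<noteq> {0\<^sub>v m} \<and> W \<noteq> {0\<^sub>v m} \<and> U \<inter> W = {0\<^sub>v m} \<and>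
          {u + w | u w. u \<in> U \<and> w \<in> W} = carrier_vec m)"

end

theory Submission
  imports Defs "HOL-Computational_Algebra.Fundamental_Theorem_Algebra"
begin

text \<open>
  Write \<open>E k p q f\<close> for the action of \<open>t\<^sup>k f(D) E\<^sub>p\<^sub>q\<close>; it maps the component of degree \<open>j\<close> to the
  one of degree \<open>j + k N + p - q\<close>. Graded submodules are families of subspaces of the components
  that are stable under these operators, and irreducibility and indecomposability are only ever
  applied to such families.

  Suppose first that the components have bounded dimension. For \<open>k \<noteq> 0\<close> the commutator of
  \<open>f(D) E\<^sub>q\<^sub>q\<close> with \<open>t\<^sup>k g(D) E\<^sub>q\<^sub>q\<close> is \<open>t\<^sup>k (f(D + k) - f(D)) g(D) E\<^sub>q\<^sub>q\<close>, and some \<open>f\<close> of bounded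
  degree acts by zero on both degrees involved; hence \<open>t\<^sup>k g(D) E\<^sub>q\<^sub>q\<close> acts by zero for all \<open>g\<close> in an
  ideal of bounded codimension. Commuting with \<open>t\<^sup>-\<^sup>k E\<^sub>q\<^sub>q\<close> shows that each functional
  \<open>\<lambda>(f) = f(D) E\<^sub>q\<^sub>q v\<close> satisfies \<open>\<lambda>(u(D - k) - u) + (u(-1) + \<dots> + u(-k)) C v = 0\<close> on such ideals. This is
  only possible if \<open>C v = 0\<close> and \<open>\<lambda>\<close> depends on finitely many Taylor coefficients of \<open>f\<close>
  (\<open>bounded_defect_finite_support\<close>). So the diagonal part acts in each degree through a finite set
  of points of \<open>\<complex>\<close>, of bounded size, and \<open>t\<^sup>\<plusminus>\<^sup>k E\<^sub>q\<^sub>q\<close> carry a point \<open>x\<close> to \<open>x + k\<close> in a neighbouring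
  degree. Since a given point occurs in only finitely many degrees (\<open>finite_occurrences\<close>), a common
  eigenvector of the diagonal part has as eigenvalues zero or plus or minus the evaluation at one
  point of one diagonal entry (\<open>weight_classification\<close>).

  The identity matrix, and the element \<open>\<Sum> (N D + q) E\<^sub>q\<^sub>q\<close> corrected by the degree, commute with
  everything, so by Fitting's lemma each has a single eigenvalue on an indecomposable module. If the
  eigenvalue of the identity matrix is not \<open>1\<close> or \<open>-1\<close>, the action is zero. If it is \<open>1\<close>, the
  points at different degrees are distinct; splitting polynomials by coprimality then turns the
  commutator relation into the relation of the associative algebra (\<open>assoc\<close>). The eigenvalue \<open>-1\<close> is
  reduced to \<open>1\<close> by the anti-automorphism of the algebra that exchanges \<open>V\<close> and \<open>Vbar\<close>. A graded module over
  the associative algebra is, up to isomorphism, given by the action of \<open>D\<close> on one component, which is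
  the statement that it is some \<open>V(m, \<alpha>)\<close> (\<open>V_iso\<close>, \<open>Vbar_iso\<close>). For an intermediate series module,
  the same applies to one block on which the action is nonzero, and this block is everything because
  the components have dimension at most one.

  For an irreducible module consider the vectors killed by \<open>t\<^sup>l f(D) E\<^sub>p\<^sub>q\<close> for all large \<open>l\<close>. If there is a nonzero
  one, there is a highest weight vector (\<open>top_degree_exists\<close>). If not, finitely many operators map the
  components of negative degree injectively to a fixed window, so that their dimensions are bounded.
  The flip \<open>t \<mapsto> 1/t\<close> gives the same alternative for lowest weight vectors and positive degrees, and the
  remaining irreducible modules are bounded.
\<close>

section \<open>Polynomials under integer translations\<close>

definition shiftp :: "int \<Rightarrow> complex poly \<Rightarrow> complex poly" where
  "shiftp k f = pcompose f [:of_int k, 1:]"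

lemma poly_ext: "(\<And>x. poly p x = poly q x) \<Longrightarrow> p = (q :: complex poly)"
  by (simp add: poly_eq_poly_eq_iff[symmetric] fun_eq_iff)

lemma poly_shiftp [simp]: "poly (shiftp k f) x = poly f (x + of_int k)"
  by (simp add: shiftp_def poly_pcompose add.commute)

lemma shiftp_algebra [simp]:
  "shiftp k 0 = 0" "shiftp k 1 = 1" "shiftp k (f + g) = shiftp k f + shiftp k g"
  "shiftp k (f - g) = shiftp k f - shiftp k g" "shiftp k (f * g) = shiftp k f * shiftp k g"
  "shiftp k (Polynomial.smult c f) = Polynomial.smult c (shiftp k f)" "shiftp k (- f) = - shiftp k f"
  "shiftp k (f ^ n) = shiftp k f ^ n" "shiftp k (shiftp l f) = shiftp (k + l) f" "shiftp 0 f = f"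
  by (rule poly_ext; simp add: algebra_simps)+

lemma shiftp_linear [simp]: "shiftp k [:a, 1:] = [:a + of_int k, 1:]"
  by (rule poly_ext) (simp add: algebra_simps)

lemma degree_shiftp [simp]: "degree (shiftp k f) = degree f"
  by (simp add: shiftp_def degree_pcompose)

lemma shiftp_eq_0_iff [simp]: "shiftp k f = 0 \<longleftrightarrow> f = 0"
proof
  assume "shiftp k f = 0"
  then have "shiftp (-k) (shiftp k f) = 0" by simp
  then show "f = 0" by (simp del: shiftp_algebra(1))
qed simp

lemma shiftp_dvd: "p dvd q \<Longrightarrow> shiftp k p dvd shiftp k q"
  by (auto simp: dvd_def)

lemma linear_power_dvd_shiftp:
  assumes "[:- z, 1:] ^ d dvd f"
  shows "[:- (z - of_int k), 1:] ^ d dvd shiftp k f"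
  using shiftp_dvd[OF assms, of k] by (simp add: algebra_simps)

text \<open>A set of polynomials closed under linear combinations contains all polynomials of degree at
  most \<open>d\<close> as soon as it contains one of each degree, by descent on the leading coefficient.\<close>

lemma degree_filling:
  fixes S :: "complex poly set"
  assumes add: "\<And>f g. f \<in> S \<Longrightarrow> g \<in> S \<Longrightarrow> f + g \<in> S"
    and smult: "\<And>c f. f \<in> S \<Longrightarrow> Polynomial.smult c f \<in> S"
    and ex: "\<And>i. i \<le> d \<Longrightarrow> \<exists>p\<in>S. p \<noteq> 0 \<and> degree p = i"
    and deg: "degree f \<le> d"
  shows "f \<in> S"
  using deg ex
proof (induction d arbitrary: f)
  case 0
  then obtain p where p: "p \<in> S" "p \<noteq> 0" "degree p = 0" by auto
  obtain a where a: "p = [:a:]" using p(3) degree_eq_zeroE by blast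
  obtain b where b: "f = [:b:]" using 0(1) degree_eq_zeroE by blast
  have "f = Polynomial.smult (b / a) p" using a b p(2) by simp
  then show ?case using smult[OF p(1)] by simp
next
  case (Suc d)
  obtain p where p: "p \<in> S" "p \<noteq> 0" "degree p = Suc d" using Suc.prems(2)[of "Suc d"] by auto
  define c where "c = coeff f (Suc d) / coeff p (Suc d)"
  have lp: "coeff p (Suc d) \<noteq> 0" using p by (metis leading_coeff_0_iff)
  have "degree (f - Polynomial.smult c p) \<le> d"
  proof (rule degree_le, intro allI impI)
    fix i assume "d < i"
    then consider "i = Suc d" | "i > Suc d" by linarith
    then show "coeff (f - Polynomial.smult c p) i = 0"
    proof cases
      case 1 then show ?thesis using lp by (simp add: c_def)
    next
      case 2 then show ?thesis using Suc.prems(1) p(3) by (simp add: coeff_eq_0)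
    qed
  qed
  then have "f - Polynomial.smult c p \<in> S" using Suc.IH Suc.prems(2) by auto
  then have "(f - Polynomial.smult c p) + Polynomial.smult c p \<in> S" using add smult p(1) by blast
  then show ?case by simp
qed

text \<open>The rising factorials with step \<open>k\<close> are mapped to multiples of each other, with the degree
  dropping by one, so every degree occurs in the image of a difference operator.\<close>

lemma shiftp_difference_surj:
  assumes "k \<noteq> 0"
  shows "\<exists>u. u - shiftp k u = g"
proof -
  define S where "S = {g. \<exists>u. u - shiftp k u = g}"
  have "g \<in> S"
  proof (rule degree_filling[where d = "degree g"])
    show "f + g \<in> S" if "f \<in> S" "g \<in> S" for f g
    proof -
      obtain u v where "u - shiftp k u = f" "v - shiftp k v = g" using \<open>f \<in> S\<close> \<open>g \<in> S\<close> S_def by auto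
      then have "(u + v) - shiftp k (u + v) = f + g" by auto
      then show ?thesis unfolding S_def by blast
    qed
    show "Polynomial.smult c f \<in> S" if "f \<in> S" for c f
    proof -
      obtain u where "u - shiftp k u = f" using \<open>f \<in> S\<close> S_def by auto
      then have "Polynomial.smult c u - shiftp k (Polynomial.smult c u) = Polynomial.smult c f"
        by (simp flip: smult_diff_right)
      then show ?thesis unfolding S_def by blast
    qed
    show "\<exists>p\<in>S. p \<noteq> 0 \<and> degree p = i" for i
    proof -
      define u where "u = (\<Prod>j<Suc i. [:of_nat j * of_int k :: complex, 1:])"
      define w where "w = (\<Prod>j<i. [:of_nat (Suc j) * of_int k :: complex, 1:])"
      have "u - shiftp k u = Polynomial.smult (- of_nat (Suc i) * of_int k) w"
      proof (rule poly_ext)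
        fix x :: complex
        have A: "poly (shiftp k u) x = (\<Prod>j<Suc i. x + of_nat (Suc j) * of_int k)"
          by (simp add: u_def poly_prod algebra_simps)
        have B: "poly u x = x * (\<Prod>j<i. x + of_nat (Suc j) * of_int k)"
          by (simp only: u_def poly_prod prod.lessThan_Suc_shift) (simp add: poly_prod algebra_simps)
        have C: "poly w x = (\<Prod>j<i. x + of_nat (Suc j) * of_int k)"
          by (simp add: w_def poly_prod algebra_simps)
        show "poly (u - shiftp k u) x = poly (Polynomial.smult (- of_nat (Suc i) * of_int k) w) x"
          by (simp only: poly_diff A B poly_smult C prod.lessThan_Suc) (simp add: algebra_simps)
      qed
      moreover have "degree w = i" unfolding w_def by (subst degree_prod_eq_sum_degree) auto
      moreover have "w \<noteq> 0" unfolding w_def by simp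
      moreover have "- of_nat (Suc i) * of_int k \<noteq> (0::complex)" using assms by (simp del: of_nat_Suc)
      ultimately show ?thesis unfolding S_def by (intro bexI[of _ "u - shiftp k u"]) (auto simp del: of_nat_Suc)
    qed
  qed simp
  then show ?thesis by (simp add: S_def)
qed

section \<open>Ideals of polynomials\<close>

lemma poly_ideal_principal:
  fixes I :: "complex poly set"
  assumes add: "\<And>f g. f \<in> I \<Longrightarrow> g \<in> I \<Longrightarrow> f + g \<in> I"
    and mult: "\<And>f g. f \<in> I \<Longrightarrow> f * g \<in> I"
    and nz: "p \<in> I" "p \<noteq> 0"
  obtains d where "d \<in> I" "d \<noteq> 0" "\<And>f. f \<in> I \<Longrightarrow> d dvd f"
proof -
  define d where "d = arg_min degree (\<lambda>f. f \<in> I \<and> f \<noteq> 0)"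
  have d: "d \<in> I" "d \<noteq> 0"
    using arg_min_natI[of "\<lambda>f. f \<in> I \<and> f \<noteq> 0" p degree] nz unfolding d_def by auto
  have min: "degree d \<le> degree f" if "f \<in> I" "f \<noteq> 0" for f
    using arg_min_nat_le[of "\<lambda>f. f \<in> I \<and> f \<noteq> 0" f degree] that unfolding d_def by auto
  have "d dvd f" if "f \<in> I" for f
  proof (rule ccontr)
    assume n: "\<not> d dvd f"
    have "f mod d = f + d * (- (f div d))" by (simp add: minus_div_mult_eq_mod[symmetric] algebra_simps)
    then have "f mod d \<in> I" using add mult d(1) that by metis
    moreover have "f mod d \<noteq> 0" using n by (simp add: dvd_eq_mod_eq_0)
    ultimately show False using min degree_mod_less[OF d(2), of f] by fastforce
  qed
  then show ?thesis using that d by blast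
qed

lemma bezout_no_common_root:
  fixes p q :: "complex poly"
  assumes "p \<noteq> 0" "\<And>x. poly p x = 0 \<Longrightarrow> poly q x \<noteq> 0"
  shows "\<exists>s t. s * p + t * q = 1"
proof -
  define I where "I = {s * p + t * q | s t. True}"
  have 1: "f + g \<in> I" if fI: "f \<in> I" and gI: "g \<in> I" for f g
  proof -
    obtain s t where f: "f = s * p + t * q" using fI unfolding I_def by blast
    obtain s' t' where g: "g = s' * p + t' * q" using gI unfolding I_def by blast
    have "f + g = (s + s') * p + (t + t') * q" unfolding f g by (simp add: algebra_simps)
    then show ?thesis unfolding I_def by blast
  qed
  have 2: "f * g \<in> I" if fI: "f \<in> I" for f g
  proof -
    obtain s t where "f = s * p + t * q" using fI unfolding I_def by blast
    then have "f * g = (s * g) * p + (t * g) * q" by (simp add: algebra_simps)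
    then show ?thesis unfolding I_def by blast
  qed
  have p: "p \<in> I" and q: "q \<in> I"
    unfolding I_def by (force intro: exI[of _ 1] exI[of _ 0])+
  obtain d where d: "d \<in> I" "d \<noteq> 0" "\<And>f. f \<in> I \<Longrightarrow> d dvd f"
    using poly_ideal_principal[of I p] 1 2 p assms(1) by metis
  have "\<not> (\<exists>x. poly d x = 0)"
    using d(3)[OF p] d(3)[OF q] assms(2) by (metis dvd_trans poly_eq_0_iff_dvd)
  then have "constant (poly d)" using fundamental_theorem_of_algebra by blast
  then have "degree d = 0" by (simp add: constant_degree)
  then obtain c where c: "d = [:c:]" using degree_eq_zeroE by blast
  have "d * [:1 / c:] \<in> I" using 2 d(1) by blast
  then have "1 \<in> I" using c d(2) by (simp add: one_pCons)
  then show ?thesis unfolding I_def by force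
qed

lemma crt_no_common_root:
  fixes p q :: "complex poly"
  assumes "p \<noteq> 0" "\<And>x. poly p x = 0 \<Longrightarrow> poly q x \<noteq> 0"
  shows "\<exists>h. p dvd h - a \<and> q dvd h - b"
proof -
  obtain s t where st: "s * p + t * q = 1" using bezout_no_common_root[OF assms] by auto
  define h where "h = b * (s * p) + a * (t * q)"
  have tq: "t * q = 1 - s * p" using st by (simp add: eq_diff_eq algebra_simps)
  have "h - a = (b - a) * (s * p)" unfolding h_def tq by (simp add: algebra_simps)
  then have "p dvd h - a" by simp
  moreover have "h - b = (a - b) * (t * q)"
  proof -
    have sp: "s * p = 1 - t * q" using st by (simp add: eq_diff_eq algebra_simps)
    show ?thesis unfolding h_def sp by (simp add: algebra_simps)
  qed
  then have "q dvd h - b" by simp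
  ultimately show ?thesis by blast
qed

lemma mult_dvd_no_common_root:
  fixes p q :: "complex poly"
  assumes "p \<noteq> 0" "\<And>x. poly p x = 0 \<Longrightarrow> poly q x \<noteq> 0" "p dvd f" "q dvd f"
  shows "p * q dvd f"
proof -
  obtain s t where st: "s * p + t * q = 1" using bezout_no_common_root[OF assms(1,2)] by auto
  obtain u where u: "f = p * u" using assms(3) by (rule dvdE)
  obtain v where v: "f = q * v" using assms(4) by (rule dvdE)
  have "f = f * (s * p + t * q)" using st by simp
  also have "\<dots> = (q * v) * (s * p) + (p * u) * (t * q)" using u v by (simp add: algebra_simps)
  also have "\<dots> = (p * q) * (s * v + t * u)" by (simp add: algebra_simps)
  finally have "f = (p * q) * (s * v + t * u)" .
  then show ?thesis by (metis dvd_triv_left)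
qed

lemma prod_linear_power_dvd:
  fixes Q :: "complex poly"
  assumes "finite Y" "\<And>y. y \<in> Y \<Longrightarrow> [:- y, 1:] ^ d dvd Q"
  shows "(\<Prod>y\<in>Y. [:- y, 1:] ^ d) dvd Q"
  using assms
proof (induction Y)
  case (insert y Y)
  have "[:- y, 1:] ^ d * (\<Prod>y\<in>Y. [:- y, 1:] ^ d) dvd Q"
    using insert by (intro mult_dvd_no_common_root)
      (auto simp: poly_prod)
  then show ?case using insert by simp
qed simp

lemma poly_split_root:
  fixes b :: "complex poly"
  assumes "b \<noteq> 0"
  obtains b' m where "b = [:- x, 1:] ^ m * b'" "poly b' x \<noteq> 0"
  using order_decomp[OF assms, of x] by (metis poly_eq_0_iff_dvd)

section \<open>Functionals with bounded translation defect\<close>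

text \<open>The orbit sums of \<open>\<chi>\<close> equal \<open>1\<close> to high order at every root of \<open>B\<close>, while \<open>\<chi>\<close> avoids the few
  roots of \<open>A\<close>: among more than \<open>deg A\<close> disjoint vertical unit strips one contains no root of
  \<open>A\<close>, each class modulo \<open>\<int>\<close> of roots of \<open>B\<close> meets that strip in one point, and \<open>\<chi>\<close> is
  prescribed to be \<open>1\<close> there and \<open>0\<close> at all other translates.\<close>

lemma orbit_partition_of_unity:
  fixes B :: "complex poly"
  assumes "B \<noteq> 0"
  obtains n0 where "\<And>n A. n \<ge> n0 \<Longrightarrow> A \<noteq> 0 \<Longrightarrow> degree A \<le> M \<Longrightarrow>
    \<exists>\<chi>. A dvd \<chi> \<and> B dvd (\<Sum>i<n. shiftp (- int i) \<chi>) - 1"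
proof -
  define Y where "Y = {y. poly B y = 0}"
  have finY: "finite Y" unfolding Y_def by (rule poly_roots_finite[OF assms])
  define \<rho> where "\<rho> = Max (insert 0 ((\<lambda>y. nat \<bar>\<lfloor>Re y\<rfloor>\<bar>) ` Y))"
  have \<rho>: "\<bar>\<lfloor>Re y\<rfloor>\<bar> \<le> int \<rho>" if "y \<in> Y" for y
  proof -
    have "nat \<bar>\<lfloor>Re y\<rfloor>\<bar> \<le> \<rho>" unfolding \<rho>_def using that finY by (intro Max_ge) auto
    then show ?thesis by linarith
  qed
  have "\<exists>\<chi>. A dvd \<chi> \<and> B dvd (\<Sum>i<n. shiftp (- int i) \<chi>) - 1"
    if n: "n \<ge> 2 * \<rho> + M + 1" and A: "A \<noteq> 0" "degree A \<le> M" for n and A :: "complex poly"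
  proof -
    let ?R = "{z. poly A z = 0}"
    have "card ((\<lambda>z. \<lfloor>Re z\<rfloor>) ` ?R) \<le> M"
      using card_image_le[OF poly_roots_finite[OF A(1)], of "\<lambda>z. \<lfloor>Re z\<rfloor>"]
        card_poly_roots_bound[OF A(1)] A(2) by linarith
    moreover have "card {- int (\<rho> + M).. - int \<rho>} = M + 1" by simp
    ultimately have "\<not> {- int (\<rho> + M).. - int \<rho>} \<subseteq> (\<lambda>z. \<lfloor>Re z\<rfloor>) ` ?R"
      using card_mono[OF finite_imageI[OF poly_roots_finite[OF A(1)]]] by fastforce
    then obtain s' where s': "s' \<in> {- int (\<rho> + M).. - int \<rho>}" "s' \<notin> (\<lambda>z. \<lfloor>Re z\<rfloor>) ` ?R"
      by blast
    define s where "s = - s'"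
    have s: "int \<rho> \<le> s" "s \<le> int (\<rho> + M)" using s' unfolding s_def by auto
    have sA: "\<lfloor>Re z\<rfloor> \<noteq> - s" if "poly A z = 0" for z using s'(2) that unfolding s_def by force
    define ii where "ii y = nat (\<lfloor>Re y\<rfloor> + s)" for y
    have ii: "int (ii y) = \<lfloor>Re y\<rfloor> + s" "ii y < n" if "y \<in> Y" for y
      using \<rho>[OF that] s n unfolding ii_def by linarith+
    define d where "d = degree B"
    define Z where "Z = (\<lambda>(y, i). y - of_nat i) ` (Y \<times> {..<n})"
    have finZ: "finite Z" unfolding Z_def using finY by auto
    define Z1 where "Z1 = {z\<in>Z. \<lfloor>Re z\<rfloor> = - s}"
    define Z2 where "Z2 = {z\<in>Z. \<lfloor>Re z\<rfloor> \<noteq> - s}"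
    have fin: "finite Z1" "finite Z2" using finZ unfolding Z1_def Z2_def by auto
    define A1 where "A1 = (\<Prod>z\<in>Z1. [:- z, 1:] ^ d)"
    define A2 where "A2 = A * (\<Prod>z\<in>Z2. [:- z, 1:] ^ d)"
    have A1: "A1 \<noteq> 0" unfolding A1_def by (simp add: fin)
    have no: "poly A2 x \<noteq> 0" if "poly A1 x = 0" for x
    proof -
      have "x \<in> Z1" using that fin by (auto simp: A1_def poly_prod)
      then show ?thesis using fin sA by (auto simp: A2_def poly_prod Z1_def Z2_def)
    qed
    obtain \<chi> where \<chi>: "A1 dvd \<chi> - 1" "A2 dvd \<chi> - 0" using crt_no_common_root[OF A1 no] by metis
    have "A dvd \<chi>" using \<chi>(2) unfolding A2_def by (metis diff_zero dvd_mult_left)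
    moreover have "B dvd (\<Sum>i<n. shiftp (- int i) \<chi>) - 1" (is "B dvd ?Q")
    proof -
      have "[:- y, 1:] ^ d dvd ?Q" if y: "y \<in> Y" for y
      proof -
        have one: "[:- y, 1:] ^ d dvd shiftp (- int (ii y)) \<chi> - 1"
        proof -
          have "y - of_nat (ii y) \<in> Z" unfolding Z_def using y ii(2)[OF y] by force
          moreover have "\<lfloor>Re (y - of_nat (ii y))\<rfloor> = - s" using ii(1)[OF y]
            by (simp) linarith
          ultimately have "y - of_nat (ii y) \<in> Z1" by (simp add: Z1_def)
          then have "[:- (y - of_nat (ii y)), 1:] ^ d dvd A1"
            unfolding A1_def using fin by (intro dvd_prodI)
          then have "[:- (y - of_nat (ii y)), 1:] ^ d dvd \<chi> - 1" using \<chi>(1) dvd_trans by blast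
          from linear_power_dvd_shiftp[OF this, of "- int (ii y)"] show ?thesis by simp
        qed
        have zero: "[:- y, 1:] ^ d dvd shiftp (- int i) \<chi>" if i: "i < n" "i \<noteq> ii y" for i
        proof -
          have "y - of_nat i \<in> Z" unfolding Z_def using y i by force
          moreover have "\<lfloor>Re (y - of_nat i)\<rfloor> \<noteq> - s"
          proof
            assume "\<lfloor>Re (y - of_nat i)\<rfloor> = - s"
            then have "int i = \<lfloor>Re y\<rfloor> + s" by simp linarith
            then show False using i(2) ii(1)[OF y] by linarith
          qed
          ultimately have "y - of_nat i \<in> Z2" by (simp add: Z2_def)
          then have "[:- (y - of_nat i), 1:] ^ d dvd A2"
            unfolding A2_def using fin by (intro dvd_mult dvd_prodI)
          then have "[:- (y - of_nat i), 1:] ^ d dvd \<chi>" using \<chi>(2) dvd_trans by fastforce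
          from linear_power_dvd_shiftp[OF this, of "- int i"] show ?thesis by simp
        qed
        have "?Q = (shiftp (- int (ii y)) \<chi> - 1) + (\<Sum>i\<in>{..<n} - {ii y}. shiftp (- int i) \<chi>)"
          using ii(2)[OF y] by (subst sum.remove[of _ "ii y"]) auto
        also have "[:- y, 1:] ^ d dvd \<dots>" using one zero by (intro dvd_add dvd_sum) auto
        finally show ?thesis .
      qed
      then have *: "(\<Prod>y\<in>Y. [:- y, 1:] ^ d) dvd ?Q" using prod_linear_power_dvd[OF finY] by blast
      have "\<forall>x. poly B x = 0 \<longrightarrow> poly (\<Prod>y\<in>Y. [:- y, 1:]) x = 0"
        using finY by (auto simp: poly_prod Y_def)
      then have "B dvd (\<Prod>y\<in>Y. [:- y, 1:]) ^ d"
        using nullstellensatz_univariate assms unfolding d_def by blast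
      from dvd_trans[OF this[unfolded prod_power_distrib] *] show ?thesis .
    qed
    ultimately show ?thesis by blast
  qed
  then show ?thesis using that by blast
qed

locale complex_space = vector_space scale
  for scale :: "complex \<Rightarrow> 'b::ab_group_add \<Rightarrow> 'b" (infixr \<open>*s\<close> 75)
begin

text \<open>
  A map on polynomials that is invariant under each translation, up to a central term, on an ideal
  of bounded codimension, has finite support. With \<open>\<eta>(u) = \<lambda>(u(X - 1) - u) + u(-1) c\<close>, which
  factors through the quotient by \<open>B 1\<close>, the defect for the translation by \<open>n\<close> is the sum of
  \<open>\<eta>\<close> over \<open>n\<close> translates. Testing it on \<open>\<chi> u\<close> for a \<open>\<chi>\<close> of orbit sum \<open>1\<close> shows that \<open>\<eta>\<close>
  vanishes on polynomials \<open>u\<close> that look periodic near the support. The choice \<open>u = 1\<close> gives \<open>c = 0\<close>.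
\<close>

lemma bounded_defect_finite_support:
  fixes lam :: "complex poly \<Rightarrow> 'b" and B :: "nat \<Rightarrow> complex poly" and c :: 'b
  assumes add: "\<And>f g. lam (f + g) = lam f + lam g"
    and B: "\<And>n. n \<ge> 1 \<Longrightarrow> B n \<noteq> 0 \<and> degree (B n) \<le> M"
    and rel: "\<And>n u. n \<ge> 1 \<Longrightarrow> B n dvd u \<Longrightarrow>
      lam (shiftp (- int n) u - u) + (\<Sum>i=1..n. poly u (- of_nat i) *s c) = 0"
  shows "c = 0 \<and> (\<exists>n0. \<forall>n\<ge>n0. \<forall>u. B n dvd u \<longrightarrow> lam u = 0)"
proof -
  have lam0: "lam 0 = 0" using add[of 0 0] by simp
  have lamd: "lam (f - g) = lam f - lam g" for f g using add[of "f - g" g] by (simp add: algebra_simps)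
  define \<eta> where "\<eta> u = lam (shiftp (- 1) u - u) + poly u (- 1) *s c" for u
  have \<eta>add: "\<eta> (u + v) = \<eta> u + \<eta> v" for u v
    unfolding \<eta>_def by (simp add: add lamd scale_left_distrib algebra_simps)
  have \<eta>0: "\<eta> 0 = 0" unfolding \<eta>_def by (simp add: lam0)
  have \<eta>sum: "\<eta> (sum F S) = (\<Sum>i\<in>S. \<eta> (F i))" for F :: "nat \<Rightarrow> _" and S
    by (induction S rule: infinite_finite_induct) (simp_all add: \<eta>add \<eta>0)
  have \<theta>: "(\<Sum>i<n. \<eta> (shiftp (- int i) u))
      = lam (shiftp (- int n) u - u) + (\<Sum>i=1..n. poly u (- of_nat i) *s c)" for n u
  proof (induction n)
    case (Suc n)
    have "\<eta> (shiftp (- int n) u) = lam (shiftp (- int (Suc n)) u) - lam (shiftp (- int n) u)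
       + poly u (- of_nat (Suc n)) *s c"
      unfolding \<eta>_def by (simp add: lamd algebra_simps)
    then show ?case using Suc by (simp add: lamd del: of_nat_Suc)
  qed (simp add: lam0)
  have B1: "B 1 \<noteq> 0" using B by auto
  have \<eta>B: "\<eta> u = 0" if "B 1 dvd u" for u using rel[OF _ that] unfolding \<eta>_def by simp
  obtain n1 where n1: "\<And>n A. n \<ge> n1 \<Longrightarrow> A \<noteq> 0 \<Longrightarrow> degree A \<le> M \<Longrightarrow>
      \<exists>\<chi>. A dvd \<chi> \<and> B 1 dvd (\<Sum>i<n. shiftp (- int i) \<chi>) - 1"
    using orbit_partition_of_unity[OF B1] by metis
  define n where "n = n1 + 1"
  have n: "n \<ge> 1" "n \<ge> n1" unfolding n_def by auto
  obtain \<chi> where \<chi>: "B n dvd \<chi>" "B 1 dvd (\<Sum>i<n. shiftp (- int i) \<chi>) - 1"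
    using n1[OF n(2), of "B n"] B[OF n(1)] by blast
  define p where "p = (\<Prod>k<n. shiftp (int k) (B 1))"
  have p0: "p \<noteq> 0" unfolding p_def using B1 by simp
  have key: "\<eta> u = 0" if u: "p dvd shiftp (- 1) u - u" for u
  proof -
    have per: "B 1 dvd shiftp (- int i) u - u" if "i \<le> n" for i
      using that
    proof (induction i)
      case (Suc i)
      have "shiftp (int i) (B 1) dvd p" unfolding p_def using Suc.prems by (intro dvd_prodI) auto
      then have "shiftp (int i) (B 1) dvd shiftp (- 1) u - u" using u dvd_trans by blast
      from shiftp_dvd[OF this, of "- int i"]
      have "B 1 dvd shiftp (- int (Suc i)) u - shiftp (- int i) u" by (simp add: algebra_simps)
      moreover have "B 1 dvd shiftp (- int i) u - u" using Suc by simp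
      ultimately have "B 1 dvd (shiftp (- int (Suc i)) u - shiftp (- int i) u) + (shiftp (- int i) u - u)"
        using dvd_add by blast
      then show ?case by (simp del: of_nat_Suc)
    qed simp
    have "(\<Sum>i<n. \<eta> (shiftp (- int i) (\<chi> * u))) = 0"
      unfolding \<theta> using \<chi>(1) by (intro rel[OF n(1)]) auto
    moreover have "\<eta> (shiftp (- int i) (\<chi> * u)) = \<eta> (shiftp (- int i) \<chi> * u)" if "i < n" for i
    proof -
      have "shiftp (- int i) (\<chi> * u) = shiftp (- int i) \<chi> * u + shiftp (- int i) \<chi> * (shiftp (- int i) u - u)"
        by (simp add: algebra_simps)
      then have "\<eta> (shiftp (- int i) (\<chi> * u)) = \<eta> (shiftp (- int i) \<chi> * u)
          + \<eta> (shiftp (- int i) \<chi> * (shiftp (- int i) u - u))" by (simp only: \<eta>add)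
      moreover have "\<eta> (shiftp (- int i) \<chi> * (shiftp (- int i) u - u)) = 0"
        using per[of i] that by (intro \<eta>B dvd_mult) simp
      ultimately show ?thesis by simp
    qed
    ultimately have "(\<Sum>i<n. \<eta> (shiftp (- int i) \<chi> * u)) = 0" by simp
    then have s0: "\<eta> ((\<Sum>i<n. shiftp (- int i) \<chi>) * u) = 0"
      unfolding sum_distrib_right \<eta>sum .
    have "(\<Sum>i<n. shiftp (- int i) \<chi>) * u = u + ((\<Sum>i<n. shiftp (- int i) \<chi>) - 1) * u"
      by (simp add: algebra_simps)
    then have "\<eta> ((\<Sum>i<n. shiftp (- int i) \<chi>) * u)
        = \<eta> u + \<eta> (((\<Sum>i<n. shiftp (- int i) \<chi>) - 1) * u)" by (simp only: \<eta>add)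
    moreover have "\<eta> (((\<Sum>i<n. shiftp (- int i) \<chi>) - 1) * u) = 0"
      using \<chi>(2) by (intro \<eta>B dvd_mult2)
    ultimately show ?thesis using s0 by simp
  qed
  have c0: "c = 0" using key[of 1] unfolding \<eta>_def by (simp add: lam0)
  have lp: "lam w = 0" if w: "p dvd w" for w
  proof -
    obtain u where u: "u - shiftp (- 1) u = - w" using shiftp_difference_surj[of "-1"] by fastforce
    then have "shiftp (- 1) u - u = w" by (simp add: algebra_simps)
    then show ?thesis using key[of u] w c0 unfolding \<eta>_def by simp
  qed
  \<comment> \<open>Once the translation moves the roots of \<open>p\<close> off themselves, its defect sees all of \<open>\<lambda>\<close>.\<close>
  have "\<exists>n0. \<forall>n\<ge>n0. \<forall>x. poly p x = 0 \<longrightarrow> poly (shiftp (int n) p) x \<noteq> 0"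
  proof -
    define D where "D = (\<lambda>(x, y). nat \<lceil>cmod (x - y)\<rceil>) ` ({x. poly p x = 0} \<times> {x. poly p x = 0})"
    have finD: "finite D" unfolding D_def using poly_roots_finite[OF p0] by auto
    have "poly (shiftp (int n) p) x \<noteq> 0" if n: "n \<ge> Suc (Max (insert 0 D))" and x: "poly p x = 0" for n x
    proof
      assume "poly (shiftp (int n) p) x = 0"
      then have "nat \<lceil>cmod ((x + of_nat n) - x)\<rceil> \<in> D" using x unfolding D_def by force
      then have "n \<in> D" by simp
      then have "n \<le> Max (insert 0 D)" using finD by (intro Max_ge) auto
      then show False using n by simp
    qed
    then show ?thesis by blast
  qed
  then obtain n2 where n2: "\<And>n x. n \<ge> n2 \<Longrightarrow> poly p x = 0 \<Longrightarrow> poly (shiftp (int n) p) x \<noteq> 0" by blast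
  have "lam u = 0" if n: "n \<ge> Suc n2" and u: "B n dvd u" for n u
  proof -
    obtain s t where st: "s * p + t * shiftp (int n) p = 1"
      using bezout_no_common_root[OF p0] n2[of n] n by (meson Suc_leD)
    define w where "w = t * shiftp (int n) p * u"
    have "p dvd shiftp (- int n) w" unfolding w_def by simp
    then have l0: "lam (shiftp (- int n) w) = 0" using lp by blast
    have "lam w = 0" using rel[of n w] n u l0 c0 unfolding w_def by (auto simp: lamd dvd_mult)
    moreover have "u = s * u * p + w"
    proof -
      have "u = u * (s * p + t * shiftp (int n) p)" using st by simp
      then show ?thesis unfolding w_def by (simp add: algebra_simps)
    qed
    ultimately show ?thesis using lp[of "s * u * p"] add[of "s * u * p" w] by simp
  qed
  then show ?thesis using c0 by blast
qed

end

section \<open>Finite-dimensional linear algebra inside a vector space\<close>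

context complex_space
begin

definition rank_le :: "nat \<Rightarrow> 'b set \<Rightarrow> bool" where
  "rank_le K S \<longleftrightarrow> (\<exists>B\<subseteq>S. finite B \<and> card B \<le> K \<and> S \<subseteq> span B)"

lemma rank_leI:
  assumes "finite B" "card B \<le> K" "S \<subseteq> span B"
  shows "rank_le K S"
proof -
  obtain C where C: "C \<subseteq> S" "independent C" "S \<subseteq> span C" by (rule basis_exists[of S]) blast
  then have "C \<subseteq> span B" using assms(3) by blast
  from independent_span_bound[OF assms(1) C(2) this] have "finite C" "card C \<le> K" using assms(2) by auto
  then show ?thesis unfolding rank_le_def using C(1,3) by blast
qed

lemma rank_le_mono: "rank_le K S \<Longrightarrow> K \<le> K' \<Longrightarrow> rank_le K' S"
  unfolding rank_le_def using le_trans by blast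

lemma rank_le_subset: "rank_le K S \<Longrightarrow> T \<subseteq> S \<Longrightarrow> rank_le K T"
  unfolding rank_le_def by (metis rank_leI rank_le_def subset_trans)

lemma linear_relation_exists:
  assumes B: "finite B" "card B \<le> K" and x: "\<And>i. i < n \<Longrightarrow> x i \<in> span B" and n: "K < n"
  shows "\<exists>c. (\<exists>i<n. c i \<noteq> 0) \<and> (\<Sum>i<n. c i *s x i) = 0"
proof (cases "inj_on x {..<n}")
  case False
  then obtain i j where ij: "i < n" "j < n" "i \<noteq> j" "x i = x j" unfolding inj_on_def by auto
  define c where "c l = (if l = i then 1 else if l = j then -1 else 0 :: complex)" for l
  have "(\<Sum>l<n. c l *s x l) = (\<Sum>l\<in>{i, j}. c l *s x l)"
    using ij by (intro sum.mono_neutral_right) (auto simp: c_def)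
  also have "\<dots> = 0" using ij by (simp add: c_def)
  finally show ?thesis using ij(1) by (intro exI[of _ c]) (auto simp: c_def)
next
  case True
  have "\<not> independent (x ` {..<n})"
  proof
    assume "independent (x ` {..<n})"
    then have "card (x ` {..<n}) \<le> card B"
      using independent_span_bound[OF B(1), of "x ` {..<n}"] x by auto
    then show False using True B(2) n by (simp add: card_image)
  qed
  then obtain u where u: "\<exists>v\<in>x ` {..<n}. u v \<noteq> 0" "(\<Sum>v\<in>x ` {..<n}. u v *s v) = 0"
    using dependent_finite[of "x ` {..<n}"] by auto
  then have "(\<Sum>i<n. u (x i) *s x i) = 0" using True by (simp add: sum.reindex)
  then show ?thesis using u(1) by (intro exI[of _ "u \<circ> x"]) auto
qed

lemma rank_le_if_relations:
  assumes S: "subspace S" and n: "n \<ge> 1"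
    and rel: "\<And>x. (\<And>i. i < n \<Longrightarrow> x i \<in> S) \<Longrightarrow> \<exists>c. (\<exists>i<n. c i \<noteq> 0) \<and> (\<Sum>i<n. c i *s x i) = 0"
  shows "rank_le (n - 1) S"
proof -
  obtain C where C: "C \<subseteq> S" "independent C" "S \<subseteq> span C" by (rule basis_exists[of S]) blast
  have "finite C \<and> card C < n"
  proof (rule ccontr)
    assume "\<not> (finite C \<and> card C < n)"
    have "\<exists>D. D \<subseteq> C \<and> finite D \<and> card D = n"
    proof (cases "finite C")
      case True
      then have "n \<le> card C" using \<open>\<not> (finite C \<and> card C < n)\<close> by simp
      then show ?thesis using obtain_subset_with_card_n True finite_subset by metis
    next
      case False
      then show ?thesis using infinite_arbitrarily_large[of C n] by blast
    qed
    then obtain D where D: "D \<subseteq> C" "finite D" "card D = n" by blast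
    then obtain x where x: "bij_betw x {..<n} D" using ex_bij_betw_nat_finite[OF D(2)]
      by (auto simp: atLeast0LessThan)
    have "x i \<in> D" if "i < n" for i using bij_betwE[OF x] that by auto
    then have "x i \<in> S" if "i < n" for i using that D(1) C(1) by blast
    then obtain c where c: "\<exists>i<n. c i \<noteq> 0" "(\<Sum>i<n. c i *s x i) = 0" using rel by blast
    define u where "u = c \<circ> inv_into {..<n} x"
    have inj: "inj_on x {..<n}" and img: "x ` {..<n} = D" using x by (auto simp: bij_betw_def)
    have "(\<Sum>v\<in>D. u v *s v) = (\<Sum>i<n. c i *s x i)"
      unfolding img[symmetric] using inj by (simp add: sum.reindex u_def)
    moreover have "\<exists>v\<in>D. u v \<noteq> 0" using c(1) inj unfolding img[symmetric] u_def by auto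
    ultimately have "dependent D" using D(2) c(2) dependent_finite by auto
    then show False using C(2) D(1) dependent_mono by blast
  qed
  then show ?thesis unfolding rank_le_def using C n by (intro exI[of _ C]) auto
qed

lemma proper_subspace_dim_less:
  assumes U: "subspace U" and V: "subspace V" and UV: "U \<subseteq> V" "U \<noteq> V" and fin: "rank_le K V"
  shows "dim U < dim V"
proof -
  obtain B where B: "B \<subseteq> V" "independent B" "V \<subseteq> span B" "card B = dim V" by (rule basis_exists[of V]) blast
  have finB: "finite B" using fin B independent_span_bound unfolding rank_le_def by (meson subset_trans)
  obtain C where C: "C \<subseteq> U" "independent C" "U \<subseteq> span C" "card C = dim U" by (rule basis_exists[of U]) blast
  obtain v where v: "v \<in> V" "v \<notin> U" using UV by blast
  have "span C \<subseteq> U" using C(1) U span_minimal by blast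
  then have "v \<notin> span C" using v(2) by blast
  then have ind: "independent (insert v C)" using C(2) by (rule independent_insertI)
  have sub: "insert v C \<subseteq> span B" using v C(1) UV B(3) by blast
  have le: "finite (insert v C)" "card (insert v C) \<le> card B"
    using independent_span_bound[OF finB ind sub] by auto
  moreover have "v \<notin> C" using C(1) v(2) by blast
  ultimately show ?thesis using B(4) C(4) by auto
qed

text \<open>
  Finitely many linear maps into spaces of bounded dimension have a common kernel of bounded
  codimension: group the vectors into \<open>K + 1\<close> blocks, take in each block a combination killed by
  all maps but the first, and combine these.
\<close>

lemma common_kernel_combination:
  fixes scaleA :: "complex \<Rightarrow> 'a::ab_group_add \<Rightarrow> 'a" and maps :: "('a \<Rightarrow> 'b) list"
  assumes vs: "vector_space scaleA"
    and cl: "\<And>n c h. (\<And>i. i < n \<Longrightarrow> h i \<in> S) \<Longrightarrow> (\<Sum>i<(n::nat). scaleA (c i) (h i)) \<in> S"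
    and lin: "\<And>F n c h. F \<in> set maps \<Longrightarrow> (\<And>i. i < n \<Longrightarrow> h i \<in> S) \<Longrightarrow>
      F (\<Sum>i<(n::nat). scaleA (c i) (h i)) = (\<Sum>i<n. c i *s F (h i))"
    and rng: "\<And>F. F \<in> set maps \<Longrightarrow> \<exists>B. finite B \<and> card B \<le> K \<and> F ` S \<subseteq> span B"
    and h: "\<And>i. i < (K + 1) ^ length maps \<Longrightarrow> h i \<in> S"
  shows "\<exists>c. (\<exists>i<(K + 1) ^ length maps. c i \<noteq> 0) \<and>
    (\<forall>F\<in>set maps. F (\<Sum>i<(K + 1) ^ length maps. scaleA (c i) (h i)) = 0)"
  using lin rng h
proof (induction maps arbitrary: h)
  case Nil
  show ?case by (intro exI[of _ "\<lambda>_. 1"]) auto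
next
  case (Cons F maps)
  interpret A: vector_space scaleA by (rule vs)
  define m where "m = (K + 1) ^ length maps"
  have m: "m > 0" unfolding m_def by simp
  have ex: "\<exists>c. (\<exists>i<m. c i \<noteq> 0) \<and>
      (\<forall>G\<in>set maps. G (\<Sum>i<m. scaleA (c i) (h (b * m + i))) = 0)" if b: "b < K + 1" for b
  proof -
    have "b * m + i < (K + 1) ^ length (F # maps)" if "i < m" for i
    proof -
      have "b * m + i < (b + 1) * m" using that by simp
      also have "\<dots> \<le> (K + 1) * m" using b by (intro mult_right_mono) auto
      finally show ?thesis by (simp add: m_def)
    qed
    then show ?thesis unfolding m_def
      by (intro Cons.IH) (use Cons.prems in \<open>auto simp: m_def\<close>)
  qed
  then obtain c where c: "\<And>b. b < K + 1 \<Longrightarrow> \<exists>i<m. c b i \<noteq> 0"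
    "\<And>b G. b < K + 1 \<Longrightarrow> G \<in> set maps \<Longrightarrow> G (\<Sum>i<m. scaleA (c b i) (h (b * m + i))) = 0"
    by metis
  define g where "g b = (\<Sum>i<m. scaleA (c b i) (h (b * m + i)))" for b
  have hin: "h (b * m + i) \<in> S" if "b < K + 1" "i < m" for b i
  proof (rule Cons.prems(3))
    have "b * m + i < (b + 1) * m" using that by simp
    also have "\<dots> \<le> (K + 1) * m" using that by (intro mult_right_mono) auto
    finally show "b * m + i < (K + 1) ^ length (F # maps)" by (simp add: m_def)
  qed
  then have gS: "g b \<in> S" if "b < K + 1" for b unfolding g_def using that by (intro cl) auto
  obtain B where B: "finite B" "card B \<le> K" "F ` S \<subseteq> span B" using Cons.prems(2)[of F] by auto
  obtain d where d: "\<exists>b<K+1. d b \<noteq> 0" "(\<Sum>b<K+1. d b *s F (g b)) = 0"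
    using linear_relation_exists[OF B(1,2), of "K + 1" "F \<circ> g"] gS B(3) by fastforce
  define C where "C j = d (j div m) * c (j div m) (j mod m)" for j
  have len: "(K + 1) ^ length (F # maps) = (K + 1) * m" by (simp add: m_def)
  have sumC: "(\<Sum>j<(K + 1) * m. scaleA (C j) (h j)) = (\<Sum>b<K+1. scaleA (d b) (g b))"
  proof -
    have "(\<Sum>j<(K + 1) * m. scaleA (C j) (h j)) = (\<Sum>b<K+1. \<Sum>j=b*m..<b*m+m. scaleA (C j) (h j))"
      by (rule sum.nat_group[symmetric])
    also have "\<dots> = (\<Sum>b<K+1. scaleA (d b) (g b))"
    proof (rule sum.cong[OF refl])
      fix b
      have "(\<Sum>j=b*m..<b*m+m. scaleA (C j) (h j)) = (\<Sum>i<m. scaleA (C (b*m+i)) (h (b*m+i)))"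
        using sum.shift_bounds_nat_ivl[of "\<lambda>j. scaleA (C j) (h j)" 0 "b*m" m]
        by (simp add: add.commute atLeast0LessThan)
      also have "\<dots> = (\<Sum>i<m. scaleA (d b) (scaleA (c b i) (h (b*m+i))))"
        using m by (intro sum.cong) (auto simp: C_def)
      finally show "(\<Sum>j=b*m..<b*m+m. scaleA (C j) (h j)) = scaleA (d b) (g b)"
        by (simp add: g_def A.scale_sum_right)
    qed
    finally show ?thesis .
  qed
  have "\<exists>j<(K + 1) * m. C j \<noteq> 0"
  proof -
    obtain b where b: "b < K + 1" "d b \<noteq> 0" using d(1) by blast
    obtain i where i: "i < m" "c b i \<noteq> 0" using c(1)[OF b(1)] by blast
    have "b * m + i < (b + 1) * m" using i by simp
    also have "\<dots> \<le> (K + 1) * m" using b by (intro mult_right_mono) auto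
    finally show ?thesis using b i m by (intro exI[of _ "b * m + i"]) (simp add: C_def)
  qed
  moreover have "G (\<Sum>b<K+1. scaleA (d b) (g b)) = 0" if G: "G \<in> set (F # maps)" for G
  proof -
    have "G (\<Sum>b<K+1. scaleA (d b) (g b)) = (\<Sum>b<K+1. d b *s G (g b))"
      using Cons.prems(1)[OF G] gS by blast
    moreover have "(\<Sum>b<K+1. d b *s G (g b)) = 0"
    proof (cases "G = F")
      case True then show ?thesis using d(2) by simp
    next
      case False
      then have "G \<in> set maps" using G by auto
      then show ?thesis using c(2) by (intro sum.neutral) (auto simp: g_def)
    qed
    ultimately show ?thesis by simp
  qed
  ultimately show ?case unfolding len sumC[symmetric] by blast
qed

end

section \<open>Polynomials in one endomorphism\<close>

locale endo = complex_space scale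
  for scale :: "complex \<Rightarrow> 'b::ab_group_add \<Rightarrow> 'b" (infixr \<open>*s\<close> 75) +
  fixes S :: "'b set" and T :: "'b \<Rightarrow> 'b"
  assumes S: "subspace S"
    and T_in: "v \<in> S \<Longrightarrow> T v \<in> S"
    and T_add: "v \<in> S \<Longrightarrow> w \<in> S \<Longrightarrow> T (v + w) = T v + T w"
    and T_scale: "v \<in> S \<Longrightarrow> T (c *s v) = c *s T v"
begin

definition opp :: "complex poly \<Rightarrow> 'b \<Rightarrow> 'b" where
  "opp p v = (\<Sum>i\<le>degree p. coeff p i *s (T ^^ i) v)"

lemma pow_in: "v \<in> S \<Longrightarrow> (T ^^ i) v \<in> S"
  by (induction i) (auto simp: T_in)

lemma pow_add: "v \<in> S \<Longrightarrow> w \<in> S \<Longrightarrow> (T ^^ i) (v + w) = (T ^^ i) v + (T ^^ i) w"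
  by (induction i) (auto simp: T_add pow_in)

lemma pow_scale: "v \<in> S \<Longrightarrow> (T ^^ i) (c *s v) = c *s (T ^^ i) v"
  by (induction i) (auto simp: T_scale pow_in)

lemma T_zero: "T 0 = 0"
  using T_scale[of 0 0] subspace_0[OF S] by simp

lemma T_sum: "(\<And>i. i \<in> I \<Longrightarrow> x i \<in> S) \<Longrightarrow> T (sum x I) = (\<Sum>i\<in>I. T (x i))"
proof (induction I rule: infinite_finite_induct)
  case (insert i I)
  then show ?case using subspace_sum[OF S, of I x] by (simp add: T_add)
qed (simp_all add: T_zero)

lemma opp_in: "v \<in> S \<Longrightarrow> opp p v \<in> S"
  unfolding opp_def by (intro subspace_sum[OF S] subspace_scale[OF S] pow_in)

lemma opp_bound: "degree p \<le> n \<Longrightarrow> opp p v = (\<Sum>i\<le>n. coeff p i *s (T ^^ i) v)"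
  unfolding opp_def by (intro sum.mono_neutral_left) (auto simp: coeff_eq_0)

lemma opp_add: "opp (p + q) v = opp p v + opp q v"
proof -
  let ?n = "max (degree p) (degree q)"
  have "opp (p + q) v = (\<Sum>i\<le>?n. coeff (p + q) i *s (T ^^ i) v)"
    by (rule opp_bound) (simp add: degree_add_le)
  then show ?thesis using opp_bound[of p ?n v] opp_bound[of q ?n v]
    by (simp add: scale_left_distrib sum.distrib)
qed

lemma opp_smult: "opp (Polynomial.smult c p) v = c *s opp p v"
proof -
  have "opp (Polynomial.smult c p) v = (\<Sum>i\<le>degree p. coeff (Polynomial.smult c p) i *s (T ^^ i) v)"
    by (rule opp_bound) simp
  then show ?thesis by (simp add: opp_def scale_sum_right)
qed

lemma opp_pCons: "v \<in> S \<Longrightarrow> opp (pCons a p) v = a *s v + T (opp p v)"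
proof -
  assume v: "v \<in> S"
  have "opp (pCons a p) v = (\<Sum>i\<le>Suc (degree p). coeff (pCons a p) i *s (T ^^ i) v)"
    by (rule opp_bound) (simp add: degree_pCons_le)
  also have "\<dots> = a *s v + (\<Sum>i\<le>degree p. coeff p i *s T ((T ^^ i) v))"
    by (simp only: sum.atMost_Suc_shift) simp
  also have "(\<Sum>i\<le>degree p. coeff p i *s T ((T ^^ i) v)) = T (opp p v)"
    unfolding opp_def using v
    by (subst T_sum) (auto intro!: sum.cong subspace_scale[OF S] pow_in simp: T_scale pow_in)
  finally show ?thesis .
qed

lemma opp_0 [simp]: "opp 0 v = 0"
  by (simp add: opp_def)

lemma opp_const: "v \<in> S \<Longrightarrow> opp [:a:] v = a *s v"
  by (simp add: opp_pCons T_zero)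

lemma opp_1 [simp]: "opp 1 v = v"
  by (simp add: opp_def)

lemma opp_mult: "v \<in> S \<Longrightarrow> opp (p * q) v = opp p (opp q v)"
proof (induction p)
  case (pCons a p)
  then show ?case
    by (simp add: opp_add opp_smult opp_pCons opp_in)
qed simp

lemma opp_X_power: "v \<in> S \<Longrightarrow> opp ([:0, 1:] ^ n) v = (T ^^ n) v"
  by (induction n) (simp_all add: opp_mult opp_pCons opp_in opp_const T_zero pow_in)

lemma annihilating_poly:
  assumes "rank_le K S" "v \<in> S"
  shows "\<exists>p. p \<noteq> 0 \<and> opp p v = 0"
proof -
  obtain B where B: "finite B" "card B \<le> K" "S \<subseteq> span B" using assms(1) rank_le_def by auto
  obtain c where c: "\<exists>i<K+1. c i \<noteq> 0" "(\<Sum>i<K+1. c i *s (T ^^ i) v) = 0"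
    using linear_relation_exists[OF B(1,2), of "K + 1" "\<lambda>i. (T ^^ i) v"] B(3) pow_in[OF assms(2)]
    by fastforce
  define p where "p = (\<Sum>i\<le>K. monom (c i) i)"
  have cp: "coeff p i = (if i \<le> K then c i else 0)" for i
    unfolding p_def by (simp add: coeff_sum)
  have "degree p \<le> K" by (rule degree_le) (simp add: cp)
  then have "opp p v = (\<Sum>i\<le>K. coeff p i *s (T ^^ i) v)" by (rule opp_bound)
  also have "\<dots> = (\<Sum>i<K+1. c i *s (T ^^ i) v)"
    by (intro sum.cong) (auto simp: cp)
  finally have "opp p v = 0" using c(2) by simp
  moreover have "p \<noteq> 0"
  proof
    assume "p = 0"
    then have "c i = 0" if "i \<le> K" for i using cp[of i] that by simp
    then show False using c(1) by auto
  qed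
  ultimately show ?thesis by blast
qed

lemma fitting_decomposition:
  assumes "rank_le K S" "v \<in> S"
  shows "\<exists>a\<in>S. \<exists>b\<in>S. v = a + b \<and> (\<exists>n. (T ^^ n) a = 0) \<and> (\<exists>m. poly m 0 \<noteq> 0 \<and> opp m b = 0)"
proof -
  obtain p where p: "p \<noteq> 0" "opp p v = 0" using annihilating_poly[OF assms] by blast
  obtain m n where m: "p = [:- 0, 1:] ^ n * m" "poly m 0 \<noteq> 0" using poly_split_root[OF p(1), of 0] by blast
  let ?X = "[:0, 1:] ^ n :: complex poly"
  have "poly m x \<noteq> 0" if "poly ?X x = 0" for x
    using that m(2) by (auto simp: poly_power)
  then obtain s t where st: "s * ?X + t * m = 1" using bezout_no_common_root[of ?X m] by auto
  have z: "opp r 0 = 0" for r using opp_smult[of 0 r v] opp_mult[OF assms(2), of r 0] by simp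
  have e1: "?X * (t * m) = t * p" and e2: "m * (s * ?X) = s * p" using m(1) by (simp_all add: ac_simps)
  have "opp (?X * (t * m)) v = opp t (opp p v)" unfolding e1 by (rule opp_mult[OF assms(2)])
  then have 1: "(T ^^ n) (opp (t * m) v) = 0"
    by (simp only: opp_mult[OF assms(2), of ?X] opp_X_power[OF opp_in[OF assms(2)]] p(2) z)
  have "opp (m * (s * ?X)) v = opp s (opp p v)" unfolding e2 by (rule opp_mult[OF assms(2)])
  then have 2: "opp m (opp (s * ?X) v) = 0"
    by (simp only: opp_mult[OF assms(2), of m] p(2) z)
  have "v = opp (t * m + s * ?X) v" using st by (simp add: add.commute)
  then have "v = opp (t * m) v + opp (s * ?X) v" by (simp only: opp_add)
  then show ?thesis using 1 2 m(2) opp_in[OF assms(2)] by blast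
qed

lemma fitting_disjoint:
  assumes "v \<in> S" "(T ^^ n) v = 0" "poly m 0 \<noteq> 0" "opp m v = 0"
  shows "v = 0"
proof -
  let ?X = "[:0, 1:] ^ n :: complex poly"
  have "poly m x \<noteq> 0" if "poly ?X x = 0" for x
    using that assms(3) by (auto simp: poly_power)
  then obtain s t where st: "s * ?X + t * m = 1" using bezout_no_common_root[of ?X m] by auto
  have "v = opp (s * ?X + t * m) v" using st by simp
  also have "\<dots> = opp s ((T ^^ n) v) + opp t (opp m v)"
    using assms(1) by (simp only: opp_add opp_mult opp_X_power)
  also have "\<dots> = opp s 0 + opp t 0" using assms by simp
  also have "\<dots> = 0"
    using opp_mult[OF subspace_0[OF S], of s 0] opp_mult[OF subspace_0[OF S], of t 0] by simp
  finally show ?thesis .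
qed

lemma quotient_eigenvector_single:
  assumes fin: "rank_le K S" and A: "subspace A" "A \<subseteq> S" "\<And>v. v \<in> A \<Longrightarrow> T v \<in> A" "A \<noteq> S"
  shows "\<exists>v\<in>S - A. \<exists>c. T v - c *s v \<in> A"
proof -
  obtain x where x: "x \<in> S" "x \<notin> A" using A by blast
  obtain p0 where p0: "p0 \<noteq> 0" "opp p0 x = 0" using annihilating_poly[OF fin x(1)] by blast
  let ?P = "\<lambda>p. p \<noteq> 0 \<and> opp p x \<in> A"
  define p where "p = arg_min degree ?P"
  have P0: "?P p0" using p0 subspace_0[OF A(1)] by simp
  have p: "?P p" unfolding p_def by (rule arg_min_natI[of ?P, OF P0])
  have min: "degree p \<le> degree q" if "?P q" for q unfolding p_def by (rule arg_min_nat_le[of ?P, OF that])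
  have "degree p \<noteq> 0"
  proof
    assume "degree p = 0"
    then obtain a where a: "p = [:a:]" using degree_eq_zeroE by blast
    then have "a *s x \<in> A" using p opp_const[OF x(1)] by simp
    then have "(1 / a) *s (a *s x) \<in> A" by (rule subspace_scale[OF A(1)])
    then show False using x(2) p a by simp
  qed
  then obtain z where "poly p z = 0" using fundamental_theorem_of_algebra constant_degree by metis
  then obtain q where q: "p = [:- z, 1:] * q" by (metis poly_eq_0_iff_dvd dvdE)
  have "q \<noteq> 0" using p q by auto
  then have "degree q < degree p" unfolding q
    by (subst degree_mult_eq) auto
  then have "opp q x \<notin> A" using min[of q] \<open>q \<noteq> 0\<close> by fastforce
  moreover have "T (opp q x) - z *s opp q x \<in> A"
  proof -
    have "opp p x = T (opp q x) - z *s opp q x"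
      unfolding q by (subst opp_mult[OF x(1)]) (simp add: opp_pCons opp_in x(1) T_zero)
    then show ?thesis using p by simp
  qed
  ultimately show ?thesis using opp_in[OF x(1)] by blast
qed

end

context complex_space
begin

text \<open>
  For a commuting family, a smallest invariant subspace strictly above \<open>A\<close> consists of common
  eigenvectors modulo \<open>A\<close>, because the eigenspaces of each member modulo \<open>A\<close> are invariant.
\<close>

lemma common_quotient_eigenvector:
  fixes T :: "'i \<Rightarrow> 'b \<Rightarrow> 'b"
  assumes endo: "\<And>i. endo scale S (T i)" and fin: "rank_le K S"
    and comm: "\<And>i j v. v \<in> S \<Longrightarrow> T i (T j v) = T j (T i v)"
    and A: "subspace A" "A \<subseteq> S" "A \<noteq> S" "\<And>i v. v \<in> A \<Longrightarrow> T i v \<in> A"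
  obtains v c where "v \<in> S" "v \<notin> A" "\<And>i. T i v - c i *s v \<in> A"
proof -
  have S: "subspace S" using endo[THEN endo.S] .
  let ?P = "\<lambda>X. subspace X \<and> A \<subseteq> X \<and> A \<noteq> X \<and> X \<subseteq> S \<and> (\<forall>i. \<forall>v\<in>X. T i v \<in> X)"
  define X where "X = arg_min dim ?P"
  have PS: "?P S" using A S endo.T_in[OF endo] by blast
  have PX: "?P X" unfolding X_def by (rule arg_min_natI[of ?P, OF PS])
  have min: "dim X \<le> dim Y" if "?P Y" for Y unfolding X_def by (rule arg_min_nat_le[of ?P, OF that])
  have finX: "rank_le K X" using rank_le_subset fin PX by blast
  have XS: "v \<in> S" if "v \<in> X" for v using PX that by blast
  have ei: "\<exists>c. \<forall>v\<in>X. T i v - c *s v \<in> A" for i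
  proof -
    interpret i: endo scale S "T i" by (rule endo)
    interpret X: endo scale X "T i"
      using PX i.T_add i.T_scale by unfold_locales (auto simp: subset_iff)
    obtain w c where w: "w \<in> X" "w \<notin> A" "T i w - c *s w \<in> A"
      using X.quotient_eigenvector_single[OF finX A(1)] PX A(4) by blast
    define Y where "Y = {v\<in>X. T i v - c *s v \<in> A}"
    have "subspace Y"
    proof (rule subspaceI)
      show "0 \<in> Y" using PX subspace_0[OF A(1)] subspace_0 by (auto simp: Y_def i.T_zero)
      fix u v assume u: "u \<in> Y" and v: "v \<in> Y"
      have uv: "T i (u + v) = T i u + T i v" using u v XS by (auto simp: Y_def i.T_add)
      have "T i (u + v) - c *s (u + v) = (T i u - c *s u) + (T i v - c *s v)"
        unfolding uv by (simp add: scale_right_distrib)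
      then show "u + v \<in> Y" using u v PX subspace_add[OF A(1)] subspace_add[of X u v] by (auto simp: Y_def)
    next
      fix a u assume u: "u \<in> Y"
      have us: "T i (a *s u) = a *s T i u" using u XS by (auto simp: Y_def i.T_scale)
      have "T i (a *s u) - c *s (a *s u) = a *s (T i u - c *s u)"
        unfolding us by (simp add: scale_right_diff_distrib mult.commute)
      then show "a *s u \<in> Y" using u PX subspace_scale[OF A(1)] subspace_scale[of X u a] by (auto simp: Y_def)
    qed
    moreover have "A \<subseteq> Y" using PX A by (auto simp: Y_def intro: subspace_diff subspace_scale)
    moreover have "A \<noteq> Y" using w by (auto simp: Y_def)
    moreover have "T j v \<in> Y" if v: "v \<in> Y" for j v
    proof -
      interpret j: endo scale S "T j" by (rule endo)
      have vX: "v \<in> X" "v \<in> S" using v XS by (auto simp: Y_def)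
      have d: "T j (T i v - c *s v) = T j (T i v) - c *s T j v"
        using j.T_add[of "T i v" "- c *s v"] vX i.T_in[of v] j.T_scale[of v "- c"] subspace_scale[OF S, of v "-c"]
        by (simp add: scale_minus_left)
      have "T i (T j v) - c *s T j v = T j (T i v - c *s v)" unfolding d using comm[OF vX(2)] by simp
      then show ?thesis using v A(4) PX by (auto simp: Y_def)
    qed
    moreover have YX: "Y \<subseteq> X" "Y \<subseteq> S" using PX by (auto simp: Y_def)
    ultimately have "?P Y" by blast
    then have "dim X \<le> dim Y" by (rule min)
    then have "Y = X" using proper_subspace_dim_less[OF \<open>subspace Y\<close> _ YX(1) _ finX] PX by fastforce
    then show ?thesis by (auto simp: Y_def)
  qed
  then obtain c where c: "\<And>i v. v \<in> X \<Longrightarrow> T i v - c i *s v \<in> A" by metis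
  obtain v where "v \<in> X" "v \<notin> A" using PX by blast
  then show ?thesis using that[of v c] c XS by blast
qed

end

section \<open>Graded families of operators\<close>

locale gmod = complex_space scale
  for scale :: "complex \<Rightarrow> 'b::ab_group_add \<Rightarrow> 'b" (infixr \<open>*s\<close> 75) +
  fixes N :: nat and E :: "int \<Rightarrow> nat \<Rightarrow> nat \<Rightarrow> complex poly \<Rightarrow> 'b \<Rightarrow> 'b" and Z :: "'b \<Rightarrow> 'b"
    and \<psi> :: "int \<Rightarrow> complex poly \<Rightarrow> complex poly \<Rightarrow> complex" and W :: "int \<Rightarrow> 'b set"
  assumes N: "N \<ge> 1"
    and W_sub: "subspace (W j)"
    and W_fin: "\<exists>K. rank_le K (W j)"
    and E_in: "p \<in> {1..N} \<Longrightarrow> q \<in> {1..N} \<Longrightarrow> v \<in> W j \<Longrightarrow> E k p q f v \<in> W (j + k * int N + int p - int q)"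
    and E_add: "p \<in> {1..N} \<Longrightarrow> q \<in> {1..N} \<Longrightarrow> v \<in> W j \<Longrightarrow> w \<in> W j \<Longrightarrow>
      E k p q f (v + w) = E k p q f v + E k p q f w"
    and E_scale: "p \<in> {1..N} \<Longrightarrow> q \<in> {1..N} \<Longrightarrow> v \<in> W j \<Longrightarrow> E k p q f (c *s v) = c *s E k p q f v"
    and E_addf: "p \<in> {1..N} \<Longrightarrow> q \<in> {1..N} \<Longrightarrow> v \<in> W j \<Longrightarrow> E k p q (f + g) v = E k p q f v + E k p q g v"
    and E_smult: "p \<in> {1..N} \<Longrightarrow> q \<in> {1..N} \<Longrightarrow> v \<in> W j \<Longrightarrow> E k p q (Polynomial.smult c f) v = c *s E k p q f v"
    and Z_in: "v \<in> W j \<Longrightarrow> Z v \<in> W j"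
    and Z_add: "v \<in> W j \<Longrightarrow> w \<in> W j \<Longrightarrow> Z (v + w) = Z v + Z w"
    and Z_scale: "v \<in> W j \<Longrightarrow> Z (c *s v) = c *s Z v"
    and Z_E: "p \<in> {1..N} \<Longrightarrow> q \<in> {1..N} \<Longrightarrow> v \<in> W j \<Longrightarrow> Z (E k p q f v) = E k p q f (Z v)"
    and \<psi>_0: "\<psi> 0 f g = 0"
    and E_comm: "p \<in> {1..N} \<Longrightarrow> q \<in> {1..N} \<Longrightarrow> r \<in> {1..N} \<Longrightarrow> s \<in> {1..N} \<Longrightarrow> v \<in> W j \<Longrightarrow>
      E k p q f (E l r s g v) - E l r s g (E k p q f v) =
        (if q = r then E (k + l) p s (shiftp l f * g) v else 0)
        - (if s = p then E (k + l) r q (shiftp k g * f) v else 0)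
        + (if k + l = 0 \<and> q = r \<and> p = s then \<psi> k f g *s Z v else 0)"
begin

abbreviation idx :: "nat set" where "idx \<equiv> {1..N}"

lemma E_in': "p \<in> idx \<Longrightarrow> q \<in> idx \<Longrightarrow> v \<in> W j \<Longrightarrow> j' = j + k * int N + int p - int q \<Longrightarrow> E k p q f v \<in> W j'"
  using E_in by simp

lemma E_in_diag: "q \<in> idx \<Longrightarrow> v \<in> W j \<Longrightarrow> E 0 q q f v \<in> W j"
  using E_in[of q q v j 0 f] by simp

lemma W_0 [simp]: "0 \<in> W j"
  using W_sub subspace_0 by blast

lemma W_add: "v \<in> W j \<Longrightarrow> w \<in> W j \<Longrightarrow> v + w \<in> W j"
  using W_sub subspace_add by blast

lemma W_scale: "v \<in> W j \<Longrightarrow> c *s v \<in> W j"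
  using W_sub subspace_scale by blast

lemma W_diff: "v \<in> W j \<Longrightarrow> w \<in> W j \<Longrightarrow> v - w \<in> W j"
  using W_sub subspace_diff by blast

lemma W_sum: "(\<And>i. i \<in> I \<Longrightarrow> x i \<in> W j) \<Longrightarrow> sum x I \<in> W j"
  using W_sub subspace_sum by blast

lemma E_0 [simp]: "p \<in> idx \<Longrightarrow> q \<in> idx \<Longrightarrow> E k p q f 0 = 0"
  using E_scale[of p q 0 0 k f 0] by simp

lemma E_0f [simp]: "p \<in> idx \<Longrightarrow> q \<in> idx \<Longrightarrow> v \<in> W j \<Longrightarrow> E k p q 0 v = 0"
  using E_smult[of p q v j k 0 0] by simp

lemma E_diff: "p \<in> idx \<Longrightarrow> q \<in> idx \<Longrightarrow> v \<in> W j \<Longrightarrow> w \<in> W j \<Longrightarrow> E k p q f (v - w) = E k p q f v - E k p q f w"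
  using E_add[of p q "v - w" j w k f] by (simp add: W_diff)

lemma E_difff: "p \<in> idx \<Longrightarrow> q \<in> idx \<Longrightarrow> v \<in> W j \<Longrightarrow> E k p q (f - g) v = E k p q f v - E k p q g v"
  using E_addf[of p q v j k "f - g" g] by simp

lemma E_uminusf: "p \<in> idx \<Longrightarrow> q \<in> idx \<Longrightarrow> v \<in> W j \<Longrightarrow> E k p q (- f) v = - E k p q f v"
  using E_difff[of p q v j k 0 f] by simp

lemma E_sum: "p \<in> idx \<Longrightarrow> q \<in> idx \<Longrightarrow> (\<And>i. i \<in> I \<Longrightarrow> x i \<in> W j) \<Longrightarrow>
    E k p q f (sum x I) = (\<Sum>i\<in>I. E k p q f (x i))"
proof (induction I rule: infinite_finite_induct)
  case (insert i I)
  have "E k p q f (x i + sum x I) = E k p q f (x i) + E k p q f (sum x I)"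
    using insert.prems by (intro E_add[where j = j] W_sum) auto
  then show ?case using insert by simp
qed simp_all

lemma E_sumf: "p \<in> idx \<Longrightarrow> q \<in> idx \<Longrightarrow> v \<in> W j \<Longrightarrow>
    E k p q (\<Sum>i\<in>I. f i) v = (\<Sum>i\<in>I. E k p q (f i) v)"
  by (induction I rule: infinite_finite_induct) (simp_all add: E_addf)

lemma Z_0 [simp]: "Z 0 = 0"
  using Z_scale[of 0 0 0] by simp

lemma E_subspace_kernel: "p \<in> idx \<Longrightarrow> q \<in> idx \<Longrightarrow> subspace {v \<in> W j. E k p q f v = 0}"
  by (intro subspaceI) (auto simp: W_add W_scale E_add E_scale)

lemma kill_span:
  assumes "p \<in> idx" "q \<in> idx" "B \<subseteq> W j" "W j \<subseteq> span B" "\<And>b. b \<in> B \<Longrightarrow> E k p q f b = 0" "v \<in> W j"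
  shows "E k p q f v = 0"
proof -
  have "span B \<subseteq> {v \<in> W j. E k p q f v = 0}"
    using assms by (intro span_minimal E_subspace_kernel) auto
  then show ?thesis using assms by blast
qed

lemma diag_comm: "q \<in> idx \<Longrightarrow> r \<in> idx \<Longrightarrow> v \<in> W j \<Longrightarrow> E 0 q q f (E 0 r r g v) = E 0 r r g (E 0 q q f v)"
  using E_comm[of q q r r v j 0 f 0 g] by (auto simp: \<psi>_0 mult.commute split: if_splits)

section \<open>Annihilating ideals\<close>

text \<open>Powers of bounded exponent satisfy a relation on both degrees. Starting them at exponent \<open>1\<close>
  makes the polynomial nonconstant, so that its differences do not vanish.\<close>

lemma kill_pair:
  assumes q: "q \<in> idx" and rk: "rank_le K (W j)" "rank_le K (W j')"
  shows "\<exists>f. f \<noteq> 0 \<and> poly f 0 = 0 \<and> degree f \<le> (K + 1) ^ (2 * K) \<and> (\<forall>v\<in>W j \<union> W j'. E 0 q q f v = 0)"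
proof -
  obtain B B' where B: "B \<subseteq> W j" "finite B" "card B \<le> K" "W j \<subseteq> span B"
    and B': "B' \<subseteq> W j'" "finite B'" "card B' \<le> K" "W j' \<subseteq> span B'"
    using rk unfolding rank_le_def by blast
  obtain bs where bs: "set bs = B" "distinct bs" using finite_distinct_list[OF B(2)] by blast
  obtain bs' where bs': "set bs' = B'" "distinct bs'" using finite_distinct_list[OF B'(2)] by blast
  define maps where "maps = map (\<lambda>b f. E 0 q q f b) (bs @ bs')"
  have len: "length maps \<le> 2 * K"
    using bs bs' B(3) B'(3) distinct_card[of bs] distinct_card[of bs'] unfolding maps_def by simp
  define n where "n = (K + 1) ^ length maps"
  have nle: "n \<le> (K + 1) ^ (2 * K)" unfolding n_def using len by (intro power_increasing) auto
  have vs: "vector_space (Polynomial.smult :: complex \<Rightarrow> _)"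
    by unfold_locales (simp_all add: smult_add_left smult_add_right)
  have "\<exists>c. (\<exists>i<n. c i \<noteq> 0) \<and> (\<forall>F\<in>set maps. F (\<Sum>i<n. Polynomial.smult (c i) (monom 1 (Suc i))) = 0)"
    unfolding n_def
  proof (rule common_kernel_combination[where S = UNIV and K = K, OF vs])
    fix F n c and h :: "nat \<Rightarrow> complex poly"
    assume F: "F \<in> set maps"
    then obtain b where b: "b \<in> W j \<union> W j'" "F = (\<lambda>f. E 0 q q f b)"
      using bs bs' B(1) B'(1) by (auto simp: maps_def)
    then show "F (\<Sum>i<(n::nat). Polynomial.smult (c i) (h i)) = (\<Sum>i<n. c i *s F (h i))"
      using q by (auto simp: E_sumf E_smult)
  next
    fix F assume "F \<in> set maps"
    then consider b where "b \<in> W j" "F = (\<lambda>f. E 0 q q f b)" | b where "b \<in> W j'" "F = (\<lambda>f. E 0 q q f b)"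
      using bs bs' B(1) B'(1) by (auto simp: maps_def)
    then show "\<exists>B. finite B \<and> card B \<le> K \<and> F ` UNIV \<subseteq> span B"
    proof cases
      case 1
      then show ?thesis using B E_in_diag[OF q] by (intro exI[of _ B]) blast
    next
      case 2
      then show ?thesis using B' E_in_diag[OF q] by (intro exI[of _ B']) blast
    qed
  qed auto
  then obtain c where c: "\<exists>i<n. c i \<noteq> 0"
    "\<And>F. F \<in> set maps \<Longrightarrow> F (\<Sum>i<n. Polynomial.smult (c i) (monom 1 (Suc i))) = 0" by blast
  define f where "f = (\<Sum>i<n. Polynomial.smult (c i) (monom 1 (Suc i)))"
  have cf: "coeff f (Suc i) = (if i < n then c i else 0)" for i
  proof -
    have "coeff f (Suc i) = (\<Sum>l<n. if l = i then c l else 0)"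
      unfolding f_def by (simp add: coeff_sum coeff_monom if_distrib eq_commute cong: if_cong)
    then show ?thesis by (simp add: sum.delta)
  qed
  have "f \<noteq> 0" using c(1) cf by (metis coeff_0)
  moreover have "poly f 0 = 0" unfolding f_def by (simp add: poly_sum poly_monom)
  moreover have "degree f \<le> n"
  proof (rule degree_le, intro allI impI)
    fix i assume "n < i"
    then show "coeff f i = 0" using cf[of "i - 1"] by (cases i) auto
  qed
  moreover have "E 0 q q f v = 0" if "v \<in> W j \<union> W j'" for v
  proof -
    have "E 0 q q f b = 0" if "b \<in> B \<union> B'" for b
      using c(2)[of "\<lambda>f. E 0 q q f b"] that bs bs' unfolding f_def maps_def by auto
    then show ?thesis using kill_span[OF q q B(1,4)] kill_span[OF q q B'(1,4)] that by blast
  qed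
  ultimately show ?thesis using nle le_trans by blast
qed

lemma shift_kill:
  assumes q: "q \<in> idx" and rk: "rank_le K (W j)" "rank_le K (W (j + k * int N))" and k: "k \<noteq> 0"
  shows "\<exists>b. b \<noteq> 0 \<and> degree b \<le> (K + 1) ^ (2 * K) \<and> (\<forall>u. b dvd u \<longrightarrow> (\<forall>v\<in>W j. E k q q u v = 0))"
proof -
  obtain f where f: "f \<noteq> 0" "poly f 0 = 0" "degree f \<le> (K + 1) ^ (2 * K)"
    "\<And>v. v \<in> W j \<union> W (j + k * int N) \<Longrightarrow> E 0 q q f v = 0"
    using kill_pair[OF q rk] by blast
  define b where "b = shiftp k f - f"
  have "b \<noteq> 0"
  proof
    assume "b = 0"
    then have per: "poly f (x + of_int k) = poly f x" for x
      unfolding b_def using poly_shiftp[of k f x] by simp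
    have "poly f (of_nat n * of_int k) = 0" for n
    proof (induction n)
      case (Suc n)
      then show ?case using per[of "of_nat n * of_int k"] by (simp add: algebra_simps)
    qed (simp add: f(2))
    then have "range (\<lambda>n. of_nat n * of_int k :: complex) \<subseteq> {x. poly f x = 0}" by auto
    moreover have "infinite (range (\<lambda>n. of_nat n * of_int k :: complex))"
      by (rule range_inj_infinite) (use k in \<open>auto simp: inj_on_def\<close>)
    ultimately show False using poly_roots_finite[OF f(1)] finite_subset by blast
  qed
  moreover have "degree b \<le> (K + 1) ^ (2 * K)"
    unfolding b_def using f(3) by (intro degree_diff_le) auto
  moreover have "E k q q u v = 0" if u: "b dvd u" and v: "v \<in> W j" for u v
  proof -
    obtain g where g: "u = b * g" using u by (rule dvdE)
    have "E 0 q q f (E k q q g v) - E k q q g (E 0 q q f v)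
        = E k q q (shiftp k f * g) v - E k q q (g * f) v"
      using E_comm[OF q q q q v, of 0 f k g] k by simp
    moreover have "E k q q g v \<in> W (j + k * int N)" using E_in'[OF q q v] by simp
    ultimately have "E k q q (shiftp k f * g) v - E k q q (g * f) v = 0" using f(4) v q by simp
    moreover have "u = shiftp k f * g - g * f" unfolding g b_def by (simp add: algebra_simps)
    ultimately show ?thesis using E_difff[OF q q v] by simp
  qed
  ultimately show ?thesis by blast
qed

end

text \<open>Components of bounded dimension, with the cocycle normalised on the pairs \<open>(u, 1)\<close>.\<close>

locale bmod = gmod scale N E Z \<psi> W
  for scale :: "complex \<Rightarrow> 'b::ab_group_add \<Rightarrow> 'b" (infixr \<open>*s\<close> 75) and N E Z \<psi> W +
  fixes K :: nat
  assumes bounded: "rank_le K (W j)"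
    and \<psi>_1: "k \<ge> 1 \<Longrightarrow> \<psi> (int k) u 1 = (\<Sum>i=1..k. poly u (- of_nat i))"
begin

definition defect_poly :: "int \<Rightarrow> nat \<Rightarrow> nat \<Rightarrow> complex poly" where
  "defect_poly j q k = (SOME b. b \<noteq> 0 \<and> degree b \<le> 2 * (K + 1) ^ (2 * K) \<and>
     (\<forall>u. b dvd u \<longrightarrow> (\<forall>v\<in>W j \<union> W (j - int k * int N). E (int k) q q u v = 0)))"

lemma defect_poly:
  assumes q: "q \<in> idx" and k: "k \<ge> 1"
  shows "defect_poly j q k \<noteq> 0" "degree (defect_poly j q k) \<le> 2 * (K + 1) ^ (2 * K)"
    "defect_poly j q k dvd u \<Longrightarrow> v \<in> W j \<union> W (j - int k * int N) \<Longrightarrow> E (int k) q q u v = 0"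
proof -
  have k0: "int k \<noteq> 0" using k by simp
  obtain b1 where b1: "b1 \<noteq> 0" "degree b1 \<le> (K + 1) ^ (2 * K)"
      "\<And>u v. b1 dvd u \<Longrightarrow> v \<in> W j \<Longrightarrow> E (int k) q q u v = 0"
    using shift_kill[OF q bounded bounded k0, of j] by blast
  obtain b2 where b2: "b2 \<noteq> 0" "degree b2 \<le> (K + 1) ^ (2 * K)"
      "\<And>u v. b2 dvd u \<Longrightarrow> v \<in> W (j - int k * int N) \<Longrightarrow> E (int k) q q u v = 0"
    using shift_kill[OF q bounded bounded k0, of "j - int k * int N"] by blast
  have "degree (b1 * b2) \<le> 2 * (K + 1) ^ (2 * K)"
    using degree_mult_le[of b1 b2] b1(2) b2(2) by linarith
  moreover have "E (int k) q q u v = 0" if "b1 * b2 dvd u" "v \<in> W j \<union> W (j - int k * int N)" for u v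
    using that b1(3) b2(3) by (meson UnE dvd_mult_left dvd_mult_right)
  ultimately have "\<exists>b. b \<noteq> 0 \<and> degree b \<le> 2 * (K + 1) ^ (2 * K) \<and>
     (\<forall>u. b dvd u \<longrightarrow> (\<forall>v\<in>W j \<union> W (j - int k * int N). E (int k) q q u v = 0))"
    using b1(1) b2(1) by (intro exI[of _ "b1 * b2"]) auto
  from someI_ex[OF this, folded defect_poly_def]
  show "defect_poly j q k \<noteq> 0" "degree (defect_poly j q k) \<le> 2 * (K + 1) ^ (2 * K)"
    "defect_poly j q k dvd u \<Longrightarrow> v \<in> W j \<union> W (j - int k * int N) \<Longrightarrow> E (int k) q q u v = 0"
    by auto
qed

text \<open>
  The commutators of \<open>t\<^sup>n u E\<^sub>q\<^sub>q\<close> with \<open>t\<^sup>-\<^sup>n E\<^sub>q\<^sub>q\<close> vanish for \<open>u\<close> in the ideal of the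
  defect polynomial, so the functionals \<open>f \<mapsto> E 0 q q f v\<close> have bounded translation defect.
\<close>

lemma diag_functional:
  assumes q: "q \<in> idx" and v: "v \<in> W j"
  shows "Z v = 0 \<and> (\<exists>n0. \<forall>n\<ge>n0. \<forall>u. defect_poly j q n dvd u \<longrightarrow> E 0 q q u v = 0)"
proof (rule bounded_defect_finite_support[where M = "2 * (K + 1) ^ (2 * K)"])
  show "E 0 q q (f + g) v = E 0 q q f v + E 0 q q g v" for f g using E_addf q v by blast
  show "defect_poly j q n \<noteq> 0 \<and> degree (defect_poly j q n) \<le> 2 * (K + 1) ^ (2 * K)" if "n \<ge> 1" for n
    using defect_poly q that by blast
  fix n u assume n: "1 \<le> n" and u: "defect_poly j q n dvd u"
  have "E (int n) q q u (E (- int n) q q 1 v) = 0"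
    using defect_poly(3)[OF q n u] E_in'[OF q q v, of "j - int n * int N" "- int n" 1] by simp
  moreover have "E (int n) q q u v = 0" using defect_poly(3)[OF q n u] v by simp
  moreover have "E (int n) q q u (E (- int n) q q 1 v) - E (- int n) q q 1 (E (int n) q q u v)
      = E 0 q q (shiftp (- int n) u * 1) v - E 0 q q (shiftp (int n) 1 * u) v + \<psi> (int n) u 1 *s Z v"
    using E_comm[OF q q q q v, of "int n" u "- int n" 1] by simp
  ultimately have "E 0 q q (shiftp (- int n) u) v - E 0 q q u v + \<psi> (int n) u 1 *s Z v = 0"
    using q by simp
  then show "E 0 q q (shiftp (- int n) u - u) v + (\<Sum>i = 1..n. poly u (- of_nat i) *s Z v) = 0"
    using E_difff[OF q q v] \<psi>_1[OF n] by (simp add: scale_sum_left)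
qed

lemma diag_ideal:
  assumes q: "q \<in> idx"
  shows "\<exists>b. b \<noteq> 0 \<and> degree b \<le> 2 * (K + 1) ^ (2 * K) \<and> (\<forall>u. b dvd u \<longrightarrow> (\<forall>v\<in>W j. E 0 q q u v = 0))"
proof -
  obtain B where B: "B \<subseteq> W j" "finite B" "W j \<subseteq> span B" using bounded unfolding rank_le_def by blast
  have "\<forall>v\<in>B. \<exists>n0. \<forall>n\<ge>n0. \<forall>u. defect_poly j q n dvd u \<longrightarrow> E 0 q q u v = 0"
    using diag_functional[OF q] B(1) by blast
  then obtain n0 where n0: "\<And>v n u. v \<in> B \<Longrightarrow> n \<ge> n0 v \<Longrightarrow> defect_poly j q n dvd u \<Longrightarrow> E 0 q q u v = 0"
    by metis
  define n where "n = Max (insert 1 (n0 ` B))"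
  have n: "n \<ge> n0 v" if "v \<in> B" for v using B(2) that unfolding n_def by auto
  have n1: "n \<ge> 1" using B(2) unfolding n_def by auto
  have "E 0 q q u v = 0" if "defect_poly j q n dvd u" "v \<in> W j" for u v
    using kill_span[OF q q B(1,3) _ that(2)] n0 n that(1) by blast
  then have "\<forall>u. defect_poly j q n dvd u \<longrightarrow> (\<forall>v\<in>W j. E 0 q q u v = 0)" by blast
  then show ?thesis using defect_poly(1,2)[OF q n1, of j] by (intro exI[of _ "defect_poly j q n"] conjI)
qed

end

text \<open>The diagonal part acts through functions of finite support, and the centre acts by zero.\<close>

locale smod = gmod scale N E Z \<psi> W
  for scale :: "complex \<Rightarrow> 'b::ab_group_add \<Rightarrow> 'b" (infixr \<open>*s\<close> 75) and N E Z \<psi> W +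
  fixes M :: nat
  assumes Z_zero: "v \<in> W j \<Longrightarrow> Z v = 0"
    and supp: "q \<in> {1..N} \<Longrightarrow> \<exists>b. b \<noteq> 0 \<and> degree b \<le> M \<and> (\<forall>u. b dvd u \<longrightarrow> (\<forall>v\<in>W j. E 0 q q u v = 0))"

lemma (in bmod) smod: "smod scale N E Z \<psi> W (2 * (K + 1) ^ (2 * K))"
  using diag_functional diag_ideal N by unfold_locales auto

context smod
begin

lemma comm0:
  assumes "p \<in> idx" "q \<in> idx" "r \<in> idx" "s \<in> idx" "v \<in> W j"
  shows "E k p q f (E l r s g v) - E l r s g (E k p q f v) =
        (if q = r then E (k + l) p s (shiftp l f * g) v else 0)
        - (if s = p then E (k + l) r q (shiftp k g * f) v else 0)"
  using E_comm[OF assms, of k f l g] Z_zero[OF assms(5)] by simp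

definition kills :: "int \<Rightarrow> int \<Rightarrow> nat \<Rightarrow> nat \<Rightarrow> complex poly \<Rightarrow> bool" where
  "kills j k p q b \<longleftrightarrow> (\<forall>u. b dvd u \<longrightarrow> (\<forall>v\<in>W j. E k p q u v = 0))"

lemma kills_mult: "kills j k p q b \<Longrightarrow> kills j k p q (b * c)"
  unfolding kills_def by (meson dvd_mult_left)

lemma kills_mult2: "kills j k p q b \<Longrightarrow> kills j k p q (c * b)"
  unfolding kills_def by (meson dvd_mult_right)

lemma kills_dvd: "kills j k p q b \<Longrightarrow> b dvd c \<Longrightarrow> kills j k p q c"
  unfolding kills_def by (meson dvd_trans)

lemma kills_add:
  assumes "p \<in> idx" "q \<in> idx" "kills j k p q b" "kills j k p q c"
  shows "kills j k p q (b + c)"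
  unfolding kills_def
proof (intro allI impI ballI)
  fix u v assume "b + c dvd u" and v: "v \<in> W j"
  then obtain g where g: "u = b * g + c * g" by (auto simp: dvd_def distrib_right)
  show "E k p q u v = 0" unfolding g using E_addf[OF assms(1,2) v] assms(3,4) v
    by (simp add: kills_def)
qed

lemma kills_bezout:
  assumes "p \<in> idx" "q \<in> idx" "kills j k p q (d * b)" "kills j k p q (d * c)" "s * b + t * c = 1"
  shows "kills j k p q d"
proof -
  have "d = d * b * s + d * c * t" using assms(5) by (metis (no_types, lifting) mult.assoc mult.commute distrib_left mult.right_neutral)
  then show ?thesis using kills_add kills_mult assms by metis
qed

definition bm :: "int \<Rightarrow> nat \<Rightarrow> complex poly" where
  "bm j q = (SOME d. kills j 0 q q d \<and> d \<noteq> 0 \<and> (\<forall>f. kills j 0 q q f \<longrightarrow> d dvd f))"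

lemma bm:
  assumes q: "q \<in> idx"
  shows "kills j 0 q q (bm j q)" "bm j q \<noteq> 0" "kills j 0 q q f \<Longrightarrow> bm j q dvd f" "degree (bm j q) \<le> M"
proof -
  obtain b where b: "b \<noteq> 0" "degree b \<le> M" "kills j 0 q q b"
    using supp[OF q, of j] unfolding kills_def by blast
  have "\<exists>d. kills j 0 q q d \<and> d \<noteq> 0 \<and> (\<forall>f. kills j 0 q q f \<longrightarrow> d dvd f)"
  proof -
    obtain d where "d \<in> Collect (kills j 0 q q)" "d \<noteq> 0" "\<And>f. f \<in> Collect (kills j 0 q q) \<Longrightarrow> d dvd f"
      using poly_ideal_principal[of "Collect (kills j 0 q q)" b] b kills_add[OF q q] kills_mult by auto
    then show ?thesis by auto
  qed
  note d = someI_ex[OF this, folded bm_def]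
  show "kills j 0 q q (bm j q)" "bm j q \<noteq> 0" using d by auto
  show dv: "bm j q dvd f" if "kills j 0 q q f" for f using d that by blast
  show "degree (bm j q) \<le> M" using dvd_imp_degree_le[OF dv[OF b(3)] b(1)] b(2) by linarith
qed

definition S :: "int \<Rightarrow> nat \<Rightarrow> complex set" where
  "S j q = {x. poly (bm j q) x = 0}"

lemma S_finite: "q \<in> idx \<Longrightarrow> finite (S j q)"
  unfolding S_def using bm(2) poly_roots_finite by blast

lemma S_card: "q \<in> idx \<Longrightarrow> card (S j q) \<le> M"
  unfolding S_def using card_poly_roots_bound[OF bm(2)] bm(4) le_trans by blast

text \<open>
  The ideal annihilating \<open>t\<^sup>k E\<^sub>p\<^sub>q\<close> contains the ideals of the diagonal parts at source and
  target. For \<open>p = q\<close> it contains \<open>b(X+k) h(X+k) - b h\<close> for all \<open>h\<close>; the choices \<open>h = 1, X\<close>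
  isolate both terms.
\<close>

lemma offdiag_kill:
  assumes pq: "p \<in> idx" "q \<in> idx" and nz: "k \<noteq> 0 \<or> p \<noteq> q"
    and j': "j' = j + k * int N + int p - int q"
  shows "kills j 0 q q b \<Longrightarrow> kills j' 0 q q b \<Longrightarrow> kills j k p q b"
    and "kills j 0 p p b \<Longrightarrow> kills j' 0 p p b \<Longrightarrow> kills j k p q (shiftp k b)"
proof -
  have c1: "E k p q ((if p = q then shiftp k f else 0) * g - f * g) v = 0"
    if k1: "kills j 0 q q b" and k2: "kills j' 0 q q b" and f: "b dvd f" and v: "v \<in> W j" for b f g v
  proof -
    have "E 0 q q f (E k p q g v) = 0"
      using k2 f E_in'[OF pq v j'] unfolding kills_def by blast
    moreover have "E 0 q q f v = 0" using k1 f v unfolding kills_def by blast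
    ultimately have "(if q = p then E k p q (shiftp k f * g) v else 0) - E k p q (g * f) v = 0"
      using comm0[OF pq(2) pq(2) pq v, of 0 f k g] pq by auto
    then show ?thesis using E_difff[OF pq v, of k] E_uminusf[OF pq v, of k "g * f"] E_0f[OF pq v]
      by (auto simp: mult.commute)
  qed
  have c2: "E k p q (shiftp k f * g - (if p = q then f else 0) * g) v = 0"
    if k1: "kills j 0 p p b" and k2: "kills j' 0 p p b" and f: "b dvd f" and v: "v \<in> W j" for b f g v
  proof -
    have "E 0 p p f (E k p q g v) = 0"
      using k2 f E_in'[OF pq v j'] unfolding kills_def by blast
    moreover have "E 0 p p f v = 0" using k1 f v unfolding kills_def by blast
    ultimately have "E k p q (shiftp k f * g) v - (if q = p then E k p p (g * f) v else 0) = 0"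
      using comm0[OF pq(1) pq(1) pq v, of 0 f k g] pq by auto
    then show ?thesis using E_difff[OF pq v, of k] E_0f[OF pq v] by (auto simp: mult.commute)
  qed
  have same: "kills j k p q b \<and> kills j k p q (shiftp k b)"
    if eq: "p = q" and k1: "kills j 0 q q b" and k2: "kills j' 0 q q b" for b
  proof -
    have k: "k \<noteq> 0" using nz eq by simp
    have A: "E k p q (shiftp k b * g - b * g) v = 0" if "v \<in> W j" for v g
      using c1[OF k1 k2 dvd_refl that, of g] eq by simp
    have B: "E k p q (shiftp k (b * [:0, 1:]) * g - b * [:0, 1:] * g) v = 0" if "v \<in> W j" for v g
      using c1[OF k1 k2 dvd_triv_left that, of "[:0, 1:]" g] unfolding eq if_P[OF refl] .
    have C: "E k p q (shiftp k b * g) v = 0" if v: "v \<in> W j" for v g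
    proof -
      let ?g = "Polynomial.smult (1 / of_int k) g"
      define X1 where "X1 = shiftp k (b * [:0, 1:]) * ?g - b * [:0, 1:] * ?g"
      define X2 where "X2 = shiftp k b * ([:0, 1:] * ?g) - b * ([:0, 1:] * ?g)"
      have "shiftp k b * g = X1 - X2"
        unfolding X1_def X2_def by (rule poly_ext) (use k in \<open>simp add: field_simps\<close>)
      moreover have "E k p q X1 v = 0" "E k p q X2 v = 0" unfolding X1_def X2_def by (rule A[OF v] B[OF v])+
      ultimately show ?thesis by (simp add: E_difff[OF pq v])
    qed
    have D: "E k p q (b * g) v = 0" if v: "v \<in> W j" for v g
    proof -
      have "E k p q (shiftp k b * g) v - E k p q (b * g) v = 0"
        using A[OF v, of g] by (simp add: E_difff[OF pq v])
      then show ?thesis using C[OF v, of g] by simp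
    qed
    show ?thesis unfolding kills_def using C D by (auto simp: dvd_def)
  qed
  show "kills j 0 q q b \<Longrightarrow> kills j' 0 q q b \<Longrightarrow> kills j k p q b"
  proof (cases "p = q")
    case False
    assume k: "kills j 0 q q b" "kills j' 0 q q b"
    show ?thesis unfolding kills_def
    proof (intro allI impI ballI)
      fix u v assume u: "b dvd u" and v: "v \<in> W j"
      show "E k p q u v = 0" using c1[OF k u v, of 1] False E_uminusf[OF pq v, of k u] by simp
    qed
  qed (use same in blast)
  show "kills j 0 p p b \<Longrightarrow> kills j' 0 p p b \<Longrightarrow> kills j k p q (shiftp k b)"
  proof (cases "p = q")
    case False
    assume k: "kills j 0 p p b" "kills j' 0 p p b"
    show ?thesis unfolding kills_def
    proof (intro allI impI ballI)
      fix u v assume u: "shiftp k b dvd u" and v: "v \<in> W j"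
      then obtain g where g: "u = shiftp k b * g" by (auto simp: dvd_def)
      show "E k p q u v = 0" using c2[OF k dvd_refl v, of g] False g by simp
    qed
  qed (use same in blast)
qed

end

section \<open>A counting lemma\<close>

text \<open>
  Each occurrence of a fixed \<open>y\<close> in \<open>P j\<close> forces, for most \<open>n\<close>, an occurrence of \<open>y + n\<close> in
  \<open>P (j + n)\<close> or \<open>P (j - n)\<close>, and different \<open>j\<close> force different ones. So more than \<open>2M\<close>
  occurrences of \<open>y\<close> would exceed the total capacity of the sets \<open>P k\<close> in a long range.
\<close>

lemma finite_occurrences:
  fixes P :: "int \<Rightarrow> complex set"
  assumes fin: "\<And>k. finite (P k)" and card: "\<And>k. card (P k) \<le> M"
    and step: "\<And>x j n. x \<in> P j \<Longrightarrow> n \<noteq> 0 \<Longrightarrow>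
      x + of_int n \<in> P j \<or> x + of_int n \<in> P (j + n) \<or> x + of_int n \<in> P (j - n)"
  shows "finite {j. y \<in> P j}"
proof (rule ccontr)
  assume "infinite {j. y \<in> P j}"
  then obtain J where J: "J \<subseteq> {j. y \<in> P j}" "finite J" "card J = 2 * M + 1"
    using infinite_arbitrarily_large by blast
  define J0 where "J0 = Max (insert 0 ((\<lambda>j. nat \<bar>j\<bar>) ` J))"
  have J0: "\<bar>j\<bar> \<le> int J0" if "j \<in> J" for j
  proof -
    have "nat \<bar>j\<bar> \<le> J0" unfolding J0_def using that J(2) by (intro Max_ge) auto
    then show ?thesis by linarith
  qed
  define L where "L = (2 * M + 1) * M + 2 * M * (2 * J0 + 1) + 1"
  define T where "T = J \<times> {1..int L}"
  define T0 where "T0 = {(j, n) \<in> T. y + of_int n \<in> P j}"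
  define T1 where "T1 = {(j, n) \<in> T. y + of_int n \<in> P (j + n)}"
  define T2 where "T2 = {(j, n) \<in> T. y + of_int n \<in> P (j - n)}"
  have finT: "finite T" unfolding T_def using J(2) by simp
  have sub: "T \<subseteq> T0 \<union> T1 \<union> T2"
  proof (rule subsetI)
    fix a assume a: "a \<in> T"
    obtain j n where jn: "a = (j, n)" by (cases a)
    have "y \<in> P j" "n \<noteq> 0" using a J(1) unfolding T_def jn by auto
    from step[OF this] show "a \<in> T0 \<union> T1 \<union> T2" using a unfolding T0_def T1_def T2_def jn by blast
  qed
  have cardS: "card (SIGMA k:I. P k) \<le> card I * M" if "finite I" for I
    using that fin card sum_bounded_above[of I "\<lambda>k. card (P k)" M] by (simp add: card_SigmaI)
  have bound: "card X \<le> card I * M"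
    if X: "X \<subseteq> T" and I: "finite I" and f: "inj_on f X" "f ` X \<subseteq> (SIGMA k:I. P k)" for X I
      and f :: "int \<times> int \<Rightarrow> int \<times> complex"
  proof -
    have "card X = card (f ` X)" using f(1) by (simp add: card_image)
    also have "\<dots> \<le> card (SIGMA k:I. P k)" using f(2) I fin by (intro card_mono) auto
    finally show ?thesis using cardS[OF I] by linarith
  qed
  have "card T0 \<le> card J * M"
    by (rule bound[where f = "\<lambda>(j, n). (j, y + of_int n)"]) (auto simp: T0_def T_def J(2) inj_on_def)
  moreover have "card T1 \<le> card {- int J0..int J0 + int L} * M"
  proof (rule bound[where f = "\<lambda>(j, n). (j + n, y + of_int n)"])
    show "(\<lambda>(j, n). (j + n, y + of_int n)) ` T1 \<subseteq> (SIGMA k:{- int J0..int J0 + int L}. P k)"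
    proof (clarsimp simp: T1_def T_def)
      fix a b :: int assume "a \<in> J" "1 \<le> b" "b \<le> int L"
      then show "- int J0 \<le> a + b \<and> a + b \<le> int J0 + int L" using J0[of a] by linarith
    qed
  qed (auto simp: T1_def inj_on_def)
  moreover have "card T2 \<le> card {- int J0 - int L..int J0} * M"
  proof (rule bound[where f = "\<lambda>(j, n). (j - n, y + of_int n)"])
    show "(\<lambda>(j, n). (j - n, y + of_int n)) ` T2 \<subseteq> (SIGMA k:{- int J0 - int L..int J0}. P k)"
    proof (clarsimp simp: T2_def T_def)
      fix a b :: int assume "a \<in> J" "1 \<le> b" "b \<le> int L"
      then show "- int J0 - int L \<le> a - b \<and> a - b \<le> int J0" using J0[of a] by linarith
    qed
  qed (auto simp: T2_def inj_on_def)
  moreover have "card T \<le> card T0 + card T1 + card T2"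
  proof -
    have "finite (T0 \<union> T1 \<union> T2)"
      by (rule finite_subset[OF _ finT]) (auto simp: T0_def T1_def T2_def)
    from card_mono[OF this sub] show ?thesis
      using card_Un_le[of "T0 \<union> T1" T2] card_Un_le[of T0 T1] by linarith
  qed
  moreover have "card T = (2 * M + 1) * L" unfolding T_def using J(3) by (simp add: card_cartesian_product)
  moreover have "card {- int J0..int J0 + int L} = 2 * J0 + L + 1" "card {- int J0 - int L..int J0} = 2 * J0 + L + 1"
    by (auto simp: nat_eq_iff)
  ultimately have "(2 * M + 1) * L \<le> (2 * M + 1) * M + 2 * ((2 * J0 + L + 1) * M)"
    using J(3) by simp
  then have "L \<le> (2 * M + 1) * M + 2 * M * (2 * J0 + 1)" by (simp add: algebra_simps)
  then show False unfolding L_def by simp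
qed

section \<open>Weights of the diagonal part\<close>

context smod
begin

text \<open>
  The point \<open>x\<close> lies in the support of \<open>t\<^sup>k E\<^sub>p\<^sub>q\<close> on degree \<open>j\<close>: all polynomials that annihilate it vanish at \<open>x\<close>.
\<close>

definition sup_at :: "int \<Rightarrow> int \<Rightarrow> nat \<Rightarrow> nat \<Rightarrow> complex \<Rightarrow> bool" where
  "sup_at j k p q x \<longleftrightarrow> (\<forall>b. kills j k p q b \<longrightarrow> poly b x = 0)"

lemma S_iff: "q \<in> idx \<Longrightarrow> x \<in> S j q \<longleftrightarrow> sup_at j 0 q q x"
  unfolding S_def sup_at_def using bm by (auto simp: poly_eq_0_iff_dvd intro: dvd_trans)

lemma shift_kills_ex:
  assumes q: "q \<in> idx" and k: "k \<noteq> 0"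
  shows "\<exists>b. b \<noteq> 0 \<and> kills j k q q b"
proof -
  have "kills j k q q (bm j q * bm (j + k * int N) q)"
    using offdiag_kill(1)[OF q q, of k "j + k * int N" j] k kills_mult kills_mult2 bm[OF q] by auto
  then show ?thesis using bm(2)[OF q] by (metis mult_eq_0_iff)
qed

text \<open>
  Unless the point \<open>x + k\<close> is itself in the support, a point \<open>x\<close> of the support of the diagonal
  part can be moved to \<open>x + k\<close> by one of the two elements \<open>t\<^sup>\<plusminus>\<^sup>k E\<^sub>q\<^sub>q\<close>, since their
  commutator is the difference of the diagonal elements at \<open>x\<close> and \<open>x + k\<close>.
\<close>

lemma support_moves:
  assumes q: "q \<in> idx" and x: "x \<in> S j q" and xk: "x + of_int k \<notin> S j q"
  shows "sup_at j k q q x \<or> sup_at j (- k) q q (x + of_int k)"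
proof (rule ccontr)
  assume "\<not> ?thesis"
  then obtain a d where a: "kills j k q q a" "poly a x \<noteq> 0"
    and d: "kills j (- k) q q d" "poly d (x + of_int k) \<noteq> 0" unfolding sup_at_def by blast
  define B where "B = bm j q"
  have "E 0 q q (a * shiftp k B * shiftp k d * h) v = 0" if v: "v \<in> W j" for v h
  proof -
    let ?f = "a * shiftp k B * h" and ?g = d
    have "E k q q ?f v = 0" "E (- k) q q ?g v = 0"
      using a(1) d(1) v unfolding kills_def by (auto simp: mult.assoc)
    then have "E 0 q q (shiftp (- k) ?f * ?g) v - E 0 q q (shiftp k ?g * ?f) v = 0"
      using comm0[OF q q q q v, of k ?f "- k" ?g] q by simp
    moreover have "E 0 q q (shiftp (- k) ?f * ?g) v = 0"
    proof -
      have "B dvd shiftp (- k) ?f * ?g" by (simp add: B_def)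
      then show ?thesis using bm(1)[OF q, of j] v unfolding kills_def B_def by blast
    qed
    moreover have "shiftp k ?g * ?f = a * shiftp k B * shiftp k d * h" by (simp add: ac_simps)
    ultimately show ?thesis by simp
  qed
  then have "kills j 0 q q (a * shiftp k B * shiftp k d)" unfolding kills_def by (auto simp: dvd_def)
  then have "poly (a * shiftp k B * shiftp k d) x = 0"
    using x S_iff[OF q] sup_at_def by blast
  then show False using a(2) d(2) xk by (simp add: S_def B_def)
qed

text \<open>
  A moved point lies in the support of \<open>t\<^sup>\<plusminus>\<^sup>k E\<^sub>q\<^sub>q\<close>, hence in the support of the diagonal part at the
  source or at the target of this operator.
\<close>

lemma support_step:
  assumes q: "q \<in> idx" and x: "x \<in> S j q" and k: "k \<noteq> 0"
  shows "x + of_int k \<in> S j q \<or> x + of_int k \<in> S (j + k * int N) q \<or> x + of_int k \<in> S (j - k * int N) q"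
proof (rule ccontr)
  assume n: "\<not> ?thesis"
  then consider "sup_at j k q q x" | "sup_at j (- k) q q (x + of_int k)" using support_moves[OF q x] by blast
  then show False
  proof cases
    case 1
    have "kills j k q q (shiftp k (bm j q * bm (j + k * int N) q))"
      using k kills_mult kills_mult2 bm(1)[OF q] by (intro offdiag_kill(2)[OF q q]) auto
    then have "poly (shiftp k (bm j q * bm (j + k * int N) q)) x = 0" using 1 sup_at_def by blast
    then show False using n by (simp add: S_def)
  next
    case 2
    have "kills j (- k) q q (bm j q * bm (j - k * int N) q)"
      using offdiag_kill(1)[OF q q, of "- k" "j - k * int N" j] k kills_mult kills_mult2 bm[OF q] by auto
    then have "poly (bm j q * bm (j - k * int N) q) (x + of_int k) = 0" using 2 sup_at_def by blast
    then show False using n by (simp add: S_def)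
  qed
qed

lemma point_rarely_in_support:
  assumes q: "q \<in> idx"
  shows "finite {k::int. y \<in> S (j + k * int N) q}"
proof (rule finite_occurrences[where M = M])
  fix x :: complex and k n :: int
  assume "x \<in> S (j + k * int N) q" "n \<noteq> 0"
  from support_step[OF q this]
  show "x + of_int n \<in> S (j + k * int N) q \<or> x + of_int n \<in> S (j + (k + n) * int N) q
      \<or> x + of_int n \<in> S (j + (k - n) * int N) q"
    by (simp add: algebra_simps)
qed (use S_finite S_card q in auto)

lemma translates_rarely_hit: "finite X \<Longrightarrow> finite {k::int. x + of_int k \<in> (X :: complex set)}"
  by (rule finite_imageD[of "\<lambda>k. x + of_int k"], rule finite_subset[of _ X]) (auto simp: inj_on_def)

definition weight :: "int \<Rightarrow> 'b set \<Rightarrow> 'b \<Rightarrow> (nat \<Rightarrow> complex poly \<Rightarrow> complex) \<Rightarrow> bool" where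
  "weight j A v lam \<longleftrightarrow> subspace A \<and> v \<in> W j \<and> v \<notin> A \<and>
     (\<forall>q\<in>idx. \<forall>f. E 0 q q f v - lam q f *s v \<in> A)"

lemma weight_unique:
  assumes w: "weight j A v lam" and q: "q \<in> idx" and c: "E 0 q q f v - c *s v \<in> A"
  shows "lam q f = c"
proof (rule ccontr)
  assume ne: "lam q f \<noteq> c"
  have A: "subspace A" and vA: "v \<notin> A" using w by (auto simp: weight_def)
  have "(E 0 q q f v - c *s v) - (E 0 q q f v - lam q f *s v) \<in> A"
  proof (rule subspace_diff[OF A c])
    show "E 0 q q f v - lam q f *s v \<in> A" using w q unfolding weight_def by blast
  qed
  then have "(lam q f - c) *s v \<in> A" by (simp add: scale_left_diff_distrib)
  then have "(1 / (lam q f - c)) *s ((lam q f - c) *s v) \<in> A" by (rule subspace_scale[OF A])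
  then show False using ne vA by simp
qed

lemma weight_add:
  assumes w: "weight j A v lam" and q: "q \<in> idx"
  shows "lam q (f + g) = lam q f + lam q g"
proof (rule weight_unique[OF w q])
  have A: "subspace A" and v: "v \<in> W j" using w by (auto simp: weight_def)
  have "E 0 q q (f + g) v - (lam q f + lam q g) *s v
      = (E 0 q q f v - lam q f *s v) + (E 0 q q g v - lam q g *s v)"
    by (simp add: E_addf[OF q q v] scale_left_distrib)
  then show "E 0 q q (f + g) v - (lam q f + lam q g) *s v \<in> A"
    using w q subspace_add[OF A] by (simp add: weight_def)
qed

lemma weight_kills:
  assumes w: "weight j A v lam" and q: "q \<in> idx" and k: "kills j 0 q q b" "b dvd f"
  shows "lam q f = 0"
proof (rule weight_unique[OF w q])
  have A: "subspace A" and v: "v \<in> W j" using w by (auto simp: weight_def)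
  show "E 0 q q f v - 0 *s v \<in> A" using k v subspace_0[OF A] by (simp add: kills_def)
qed

lemma weight_diff: "weight j A v lam \<Longrightarrow> q \<in> idx \<Longrightarrow> lam q (f - g) = lam q f - lam q g"
  using weight_add[of j A v lam q "f - g" g] by simp

lemma weight_exists:
  assumes A: "subspace A" "A \<subseteq> W j" "A \<noteq> W j"
    and stable: "\<And>q f v. q \<in> idx \<Longrightarrow> v \<in> A \<Longrightarrow> E 0 q q f v \<in> A"
  obtains v lam where "weight j A v lam"
proof -
  define T where "T i v = (if fst i \<in> idx then E 0 (fst i) (fst i) (snd i) v else 0)"
    for i :: "nat \<times> complex poly" and v
  have endo: "endo scale (W j) (T i)" for i
    by unfold_locales (auto simp: T_def W_sub E_in_diag E_add E_scale simp del: atLeastAtMost_iff)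
  obtain K where K: "rank_le K (W j)" using W_fin by blast
  have comm: "T i (T i' v) = T i' (T i v)" if "v \<in> W j" for i i' v
    using that diag_comm by (simp add: T_def del: atLeastAtMost_iff)
  have st: "T i v \<in> A" if "v \<in> A" for i v
    using that stable subspace_0[OF A(1)] by (simp add: T_def)
  have "\<exists>v c. v \<in> W j \<and> v \<notin> A \<and> (\<forall>i. T i v - c i *s v \<in> A)"
  proof (rule common_quotient_eigenvector[where T = T, OF endo K comm A st])
    fix v c assume "v \<in> W j" "v \<notin> A" "\<And>i. T i v - c i *s v \<in> A"
    then show ?thesis by blast
  qed assumption+
  then obtain v c where v: "v \<in> W j" "v \<notin> A" and c: "\<And>i. T i v - c i *s v \<in> A" by blast
  have "E 0 q q f v - c (q, f) *s v \<in> A" if "q \<in> idx" for q f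
    using c[of "(q, f)"] that by (simp add: T_def)
  then have "weight j A v (\<lambda>q f. c (q, f))" unfolding weight_def using v A(1) by blast
  then show ?thesis using that by blast
qed

text \<open>
  Applying \<open>t\<^sup>k E\<^sub>r\<^sub>r\<close>, localised at \<open>x\<close>, moves a weight by the difference of the evaluations
  at \<open>x + k\<close> and \<open>x\<close>. The power of \<open>X - x\<close> that is still nonzero but the next is zero makes the
  image a true eigenvector.
\<close>

lemma weight_shift:
  assumes w: "weight j A v lam" and r: "r \<in> idx" and nz: "E k r r f0 v \<noteq> 0"
    and nil: "\<And>h. E k r r ([:- x, 1:] ^ m * (f0 * h)) v = 0"
    and kA: "\<And>a h. a \<in> A \<Longrightarrow> a \<in> W j \<Longrightarrow> E k r r (f0 * h) a = 0"
  shows "\<exists>u. weight (j + k * int N) {0} u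
    (\<lambda>q g. lam q g + (if q = r then poly g (x + of_int k) - poly g x else 0))"
proof -
  have A: "subspace A" and v: "v \<in> W j" using w by (auto simp: weight_def)
  let ?P = "\<lambda>i. \<exists>h. E k r r ([:- x, 1:] ^ i * (f0 * h)) v \<noteq> 0"
  have "\<exists>i. ?P i \<and> \<not> ?P (Suc i)"
  proof (rule ccontr)
    assume "\<not> (\<exists>i. ?P i \<and> \<not> ?P (Suc i))"
    then have step: "?P i \<Longrightarrow> ?P (Suc i)" for i by blast
    have "?P 0" using nz by (intro exI[of _ 1]) simp
    then have "?P m" using step by (induction m) blast+
    then show False using nil by blast
  qed
  then obtain i h where ih: "E k r r ([:- x, 1:] ^ i * (f0 * h)) v \<noteq> 0"
    "\<And>h. E k r r ([:- x, 1:] ^ Suc i * (f0 * h)) v = 0" by blast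
  define f1 where "f1 = [:- x, 1:] ^ i * (f0 * h)"
  define u where "u = E k r r f1 v"
  have uW: "u \<in> W (j + k * int N)" unfolding u_def using E_in'[OF r r v] by simp
  have "E 0 q q g u = (lam q g + (if q = r then poly g (x + of_int k) - poly g x else 0)) *s u"
    if q: "q \<in> idx" for q g
  proof -
    have e1: "E k r r f1 (E 0 q q g v) = lam q g *s u"
    proof -
      define a where "a = E 0 q q g v - lam q g *s v"
      have a: "a \<in> A" "a \<in> W j" using w q v E_in_diag[OF q v] W_diff W_scale
        by (auto simp: weight_def a_def simp del: atLeastAtMost_iff)
      have "f1 = f0 * ([:- x, 1:] ^ i * h)" unfolding f1_def by (simp add: ac_simps)
      then have "E k r r f1 a = 0" using kA[OF a] by metis
      moreover have "E 0 q q g v = a + lam q g *s v" by (simp add: a_def)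
      ultimately show ?thesis
        using E_add[OF r r a(2) W_scale[OF v]] E_scale[OF r r v] by (simp add: u_def)
    qed
    have e2: "E 0 q q g u - E k r r f1 (E 0 q q g v)
        = (if q = r then E k r r ((shiftp k g - g) * f1) v else 0)"
    proof -
      have "(shiftp k g - g) * f1 = shiftp k g * f1 - f1 * g" by (simp add: algebra_simps)
      then show ?thesis using comm0[OF q q r r v, of 0 g k f1] E_difff[OF r r v, of k "shiftp k g * f1" "f1 * g"]
        by (auto simp: u_def)
    qed
    have e3: "E k r r ((shiftp k g - g) * f1) v = (poly g (x + of_int k) - poly g x) *s u"
    proof -
      let ?c = "poly g (x + of_int k) - poly g x"
      have "poly (shiftp k g - g - [:?c:]) x = 0" by simp
      then obtain e where e: "shiftp k g - g - [:?c:] = [:- x, 1:] * e"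
        by (metis poly_eq_0_iff_dvd dvdE)
      have "(shiftp k g - g) * f1 = (shiftp k g - g - [:?c:]) * f1 + Polynomial.smult ?c f1"
        by (simp add: algebra_simps)
      also have "(shiftp k g - g - [:?c:]) * f1 = [:- x, 1:] ^ Suc i * (f0 * (h * e))"
        unfolding e f1_def by (simp only: power_Suc ac_simps)
      finally show ?thesis using E_addf[OF r r v] E_smult[OF r r v] ih(2) by (simp add: u_def)
    qed
    show ?thesis using e1 e2 e3 by (auto simp: scale_left_distrib algebra_simps)
  qed
  moreover have "u \<noteq> 0" using ih(1) by (simp add: u_def f1_def)
  ultimately have "weight (j + k * int N) {0} u
    (\<lambda>q g. lam q g + (if q = r then poly g (x + of_int k) - poly g x else 0))"
    unfolding weight_def using uW by (auto simp del: atLeastAtMost_iff)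
  then show ?thesis by blast
qed

text \<open>A point in the support of an off-diagonal element yields a weight at the target degree.\<close>

lemma sup_weight:
  assumes q: "q \<in> idx" and k: "k \<noteq> 0" and sup: "sup_at j k q q y"
  shows "\<exists>u lam. (\<forall>f. bm j q dvd f \<longrightarrow> lam q f = 0) \<and> weight (j + k * int N) {0} u
    (\<lambda>r g. lam r g + (if r = q then poly g (y + of_int k) - poly g y else 0))"
proof -
  obtain b where b: "b \<noteq> 0" "kills j k q q b" using shift_kills_ex[OF q k] by blast
  obtain b' m where b': "b = [:- y, 1:] ^ m * b'" "poly b' y \<noteq> 0" using poly_split_root[OF b(1)] by blast
  define A where "A = {v \<in> W j. \<forall>h. E k q q (b' * h) v = 0}"
  have "A \<noteq> W j"
  proof
    assume "A = W j"
    then have "kills j k q q b'" unfolding kills_def A_def by (auto simp: dvd_def)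
    then show False using sup b'(2) by (simp add: sup_at_def)
  qed
  moreover have "subspace A"
    unfolding A_def using q by (intro subspaceI) (auto simp: W_add W_scale E_add E_scale)
  moreover have "E 0 r r g v \<in> A" if r: "r \<in> idx" and v: "v \<in> A" for r g v
  proof -
    have vW: "v \<in> W j" using v by (simp add: A_def)
    have "E k q q (b' * h) (E 0 r r g v) = 0" for h
    proof -
      have z: "E k q q (b' * h') v = 0" for h' using v by (simp add: A_def)
      have "E k q q (b' * h) (E 0 r r g v) - E 0 r r g (E k q q (b' * h) v)
         = (if q = r then E k q q (b' * (h * g)) v else 0) - (if q = r then E k q q (b' * (h * shiftp k g)) v else 0)"
        using comm0[OF q q r r vW, of k "b' * h" 0 g] by (auto simp: ac_simps)
      then show ?thesis using z r by (simp split: if_splits)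
    qed
    then show ?thesis using E_in_diag[OF r vW] by (simp add: A_def)
  qed
  moreover have "A \<subseteq> W j" by (auto simp: A_def)
  ultimately obtain v lam where w: "weight j A v lam" using weight_exists[of A j] by metis
  then obtain h0 where h0: "E k q q (b' * h0) v \<noteq> 0" by (auto simp: weight_def A_def)
  have vW: "v \<in> W j" using w by (simp add: weight_def)
  have "\<exists>u. weight (j + k * int N) {0} u
    (\<lambda>r g. lam r g + (if r = q then poly g (y + of_int k) - poly g y else 0))"
  proof (rule weight_shift[OF w q h0])
    show "E k q q ([:- y, 1:] ^ m * (b' * h0 * h)) v = 0" for h
    proof -
      have "[:- y, 1:] ^ m * (b' * h0 * h) = b * (h0 * h)" by (simp add: b'(1) ac_simps)
      then show ?thesis using b(2) vW unfolding kills_def by (metis dvd_triv_left)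
    qed
    show "E k q q (b' * h0 * h) a = 0" if "a \<in> A" for a h
      using that by (simp add: A_def mult.assoc)
  qed
  moreover have "lam q f = 0" if "bm j q dvd f" for f
    using weight_kills[OF w q bm(1)[OF q] that] .
  ultimately show ?thesis by blast
qed

text \<open>
  An essential point of a true weight moves by every generic \<open>k\<close>, in one of the two directions:
  localise \<open>t\<^sup>k E\<^sub>q\<^sub>q\<close> at \<open>x\<close> and \<open>t\<^sup>-\<^sup>k E\<^sub>q\<^sub>q\<close> at \<open>x + k\<close>; their commutator does not kill the
  eigenvector.
\<close>

lemma weight_moves:
  assumes w: "weight j {0} v lam" and q: "q \<in> idx"
    and f: "lam q f \<noteq> 0" "\<And>h. lam q ([:- x, 1:] ^ m * (f * h)) = 0"
    and k: "k \<noteq> 0" and xk: "x + of_int k \<notin> S j q"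
  shows "\<exists>\<kappa>\<in>{1, -1}. \<exists>u. weight (j + \<kappa> * k * int N) {0} u
    (\<lambda>r g. lam r g + (if r = q then of_int \<kappa> * (poly g (x + of_int k) - poly g x) else 0))"
proof -
  have v: "v \<in> W j" "v \<noteq> 0" using w by (auto simp: weight_def)
  have k': "- k \<noteq> 0" using k by simp
  obtain b where b: "b \<noteq> 0" "kills j k q q b" using shift_kills_ex[OF q k] by blast
  obtain a where a: "a \<noteq> 0" "kills j (- k) q q a" using shift_kills_ex[OF q k'] by blast
  obtain b1 m1 where b1: "b = [:- x, 1:] ^ m1 * b1" "poly b1 x \<noteq> 0" using poly_split_root[OF b(1)] by blast
  obtain a1 m2 where a1: "a = [:- (x + of_int k), 1:] ^ m2 * a1" "poly a1 (x + of_int k) \<noteq> 0"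
    using poly_split_root[OF a(1)] by blast
  define B where "B = bm j q"
  define P where "P = b1 * shiftp k B * shiftp k a1"
  have P: "poly P x \<noteq> 0" using b1(2) a1(2) xk by (simp add: P_def B_def S_def)
  have "poly P y \<noteq> 0" if "poly ([:- x, 1:] ^ m) y = 0" for y
  proof -
    have "y = x" using that by (auto simp: poly_power)
    then show ?thesis using P by simp
  qed
  then obtain s t where st: "s * [:- x, 1:] ^ m + t * P = 1"
    using bezout_no_common_root[of "[:- x, 1:] ^ m" P] by auto
  define f' where "f' = b1 * (f * shiftp k B * t)"
  have fP: "shiftp k a1 * f' = f - [:- x, 1:] ^ m * (f * s)"
  proof -
    have "shiftp k a1 * f' = f * (t * P)" by (simp add: f'_def P_def ac_simps)
    also have "t * P = 1 - s * [:- x, 1:] ^ m" using st by (simp add: eq_diff_eq add.commute)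
    finally show ?thesis by (simp add: algebra_simps)
  qed
  have "lam q (shiftp k a1 * f') = lam q f"
    unfolding fP using weight_diff[OF w q] f(2) by simp
  then have "E 0 q q (shiftp k a1 * f') v = lam q f *s v"
    using w q by (auto simp: weight_def simp del: atLeastAtMost_iff)
  moreover have "E 0 q q (shiftp (- k) f' * a1) v = 0"
  proof -
    have "B dvd shiftp (- k) f' * a1" by (simp add: f'_def B_def)
    then show ?thesis using bm(1)[OF q, of j] v unfolding kills_def B_def by blast
  qed
  ultimately have c: "E k q q f' (E (- k) q q a1 v) - E (- k) q q a1 (E k q q f' v) = - (lam q f *s v)"
    using comm0[OF q q q q v(1), of k f' "- k" a1] by simp
  have "E k q q f' v \<noteq> 0 \<or> E (- k) q q a1 v \<noteq> 0"
  proof (rule ccontr)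
    assume "\<not> ?thesis"
    then have "lam q f *s v = 0" using c q by simp
    then show False using f(1) v(2) by simp
  qed
  then show ?thesis
  proof
    assume nz: "E k q q f' v \<noteq> 0"
    have "\<exists>u. weight (j + k * int N) {0} u
      (\<lambda>r g. lam r g + (if r = q then poly g (x + of_int k) - poly g x else 0))"
    proof (rule weight_shift[OF w q nz, where m = m1])
      fix h
      have "b dvd [:- x, 1:] ^ m1 * (f' * h)" by (simp add: b1(1) f'_def mult_dvd_mono mult.assoc)
      then show "E k q q ([:- x, 1:] ^ m1 * (f' * h)) v = 0" using b(2) v unfolding kills_def by blast
    qed (use q in simp)
    then show ?thesis by (intro bexI[of _ 1]) (simp_all cong: if_cong)
  next
    assume nz: "E (- k) q q a1 v \<noteq> 0"
    have "\<exists>u. weight (j + (- k) * int N) {0} u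
      (\<lambda>r g. lam r g + (if r = q then poly g (x + of_int k + of_int (- k)) - poly g (x + of_int k) else 0))"
    proof (rule weight_shift[OF w q nz, where m = m2])
      fix h
      have "a dvd [:- (x + of_int k), 1:] ^ m2 * (a1 * h)" by (simp only: a1(1) mult.assoc[symmetric] dvd_triv_left)
      then show "E (- k) q q ([:- (x + of_int k), 1:] ^ m2 * (a1 * h)) v = 0"
        using a(2) v unfolding kills_def by blast
    qed (use q in simp)
    then show ?thesis by (intro bexI[of _ "-1"]) (simp_all cong: if_cong)
  qed
qed

text \<open>
  A nonzero weight is, up to sign, an evaluation: an essential point \<open>x\<close> can be moved far away,
  to degrees where the remaining support, which stays put, is no longer allowed. So nothing
  remains, neither other points nor higher multiplicity at \<open>x\<close>.
\<close>

lemma weight_classification: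
  assumes w: "weight j {0} v lam"
  shows "(\<forall>r\<in>idx. \<forall>h. lam r h = 0) \<or>
    (\<exists>\<kappa>\<in>{1, -1}. \<exists>q\<in>idx. \<exists>x. \<forall>r\<in>idx. \<forall>h. lam r h = (if r = q then \<kappa> * poly h x else 0))"
proof (cases "\<forall>r\<in>idx. \<forall>h. lam r h = 0")
  case False
  then obtain q g0 where q: "q \<in> idx" and g0: "lam q g0 \<noteq> 0" by blast
  define D where "D = {d. \<forall>h. lam q (d * h) = 0}"
  have D1: "f + g \<in> D" if "f \<in> D" "g \<in> D" for f g
    using that weight_add[OF w q] by (simp add: D_def distrib_right)
  have D2: "f * g \<in> D" if "f \<in> D" for f g using that by (simp add: D_def mult.assoc)
  have D3: "bm j q \<in> D" using weight_kills[OF w q bm(1)[OF q]] by (simp add: D_def)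
  obtain d where d: "d \<in> D" "d \<noteq> 0" "\<And>f. f \<in> D \<Longrightarrow> d dvd f"
    using poly_ideal_principal[of D "bm j q"] D1 D2 D3 bm(2)[OF q] by metis
  have "\<exists>x. poly d x = 0"
  proof (rule ccontr)
    assume "\<nexists>x. poly d x = 0"
    then have "constant (poly d)" using fundamental_theorem_of_algebra by blast
    then have "degree d = 0" by (simp add: constant_degree)
    then obtain a where a: "d = [:a:]" using degree_eq_zeroE by blast
    then have "g0 = d * Polynomial.smult (1 / a) g0" using d(2) by simp
    then show False using d(1) g0 unfolding D_def by (metis (mono_tags, lifting) mem_Collect_eq)
  qed
  then obtain x where x: "poly d x = 0" by blast
  obtain d' m where d': "d = [:- x, 1:] ^ m * d'" "poly d' x \<noteq> 0" using poly_split_root[OF d(2)] by blast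
  have "d' \<notin> D"
  proof
    assume "d' \<in> D"
    then have "d dvd d'" using d(3) by blast
    then have "poly d' x = 0" using x by (metis dvdE mult_zero_left poly_mult)
    then show False using d'(2) by simp
  qed
  then obtain h0 where h0: "lam q (d' * h0) \<noteq> 0" by (auto simp: D_def)
  have nil: "lam q ([:- x, 1:] ^ m * (d' * h0 * h)) = 0" for h
  proof -
    have eq: "[:- x, 1:] ^ m * (d' * h0 * h) = d * (h0 * h)" by (simp add: d'(1) ac_simps)
    have "lam q (d * (h0 * h)) = 0" using d(1) by (simp add: D_def)
    then show ?thesis by (simp only: eq)
  qed
  define G where "G \<kappa> = {k. \<exists>u. weight (j + \<kappa> * k * int N) {0} u
    (\<lambda>r g. lam r g + (if r = q then of_int \<kappa> * (poly g (x + of_int k) - poly g x) else 0))}" for \<kappa> :: int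
  have "- (G 1 \<union> G (- 1)) \<subseteq> insert 0 {k. x + of_int k \<in> S j q}"
    using weight_moves[OF w q h0 nil] unfolding G_def by auto
  then have "finite (- (G 1 \<union> G (- 1)))"
    using translates_rarely_hit[OF S_finite[OF q], of x j] finite_subset by blast
  then have "infinite (G 1 \<union> G (- 1))"
    using infinite_UNIV_int by (metis Compl_partition finite_UnI)
  then obtain \<kappa> :: int where \<kappa>: "\<kappa> \<in> {1, -1}" "infinite (G \<kappa>)" by auto
  have "lam r h = (if r = q then of_int \<kappa> * poly h x else 0)" if r: "r \<in> idx" for r h
  proof -
    define R where "R = insert x (S j r)"
    have finR: "finite R" unfolding R_def using S_finite[OF r] by simp
    have rare: "finite {k. y \<in> S (j + \<kappa> * k * int N) r}" for y
    proof (cases "\<kappa> = 1")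
      case True then show ?thesis using point_rarely_in_support[OF r, of y j] by simp
    next
      case False
      then have "{k. y \<in> S (j + \<kappa> * k * int N) r} = uminus ` {k. y \<in> S (j + k * int N) r}"
        using \<kappa>(1) by (auto intro: image_eqI[of _ uminus "- k" for k])
      then show ?thesis using point_rarely_in_support[OF r, of y j] by simp
    qed
    define bad where "bad = (\<Union>y\<in>R. {k. y \<in> S (j + \<kappa> * k * int N) r}) \<union> {k. x + of_int k \<in> R}"
    have "finite bad" unfolding bad_def using finR rare translates_rarely_hit[OF finR] by blast
    then have "\<not> G \<kappa> \<subseteq> bad" using \<kappa>(2) finite_subset by blast
    then obtain k where k: "k \<in> G \<kappa>" "\<And>y. y \<in> R \<Longrightarrow> y \<notin> S (j + \<kappa> * k * int N) r" "x + of_int k \<notin> R"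
      unfolding bad_def by blast
    define j' where "j' = j + \<kappa> * k * int N"
    obtain u where u: "weight j' {0} u
      (\<lambda>r g. lam r g + (if r = q then of_int \<kappa> * (poly g (x + of_int k) - poly g x) else 0))"
      using k(1) by (auto simp: G_def j'_def)
    let ?b = "bm j r * [:- x, 1:]" and ?b' = "bm j' r * [:- (x + of_int k), 1:]"
    have "?b \<noteq> 0" by (subst mult_eq_0_iff) (use bm(2)[OF r] in auto)
    moreover have "poly ?b' y \<noteq> 0" if "poly ?b y = 0" for y
    proof -
      have "y \<in> R" using that by (auto simp: R_def S_def)
      then have "poly (bm j' r) y \<noteq> 0" "y \<noteq> x + of_int k" using k(2,3) by (auto simp: S_def j'_def)
      moreover have "poly [:- (x + of_int k), 1:] y = y - (x + of_int k)" by simp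
      ultimately show ?thesis by (simp only: poly_mult mult_eq_0_iff right_minus_eq) simp
    qed
    ultimately obtain h' where h': "?b dvd h' - h" "?b' dvd h' - 0" using crt_no_common_root by metis
    have "lam r (h' - h) = 0" using h'(1) weight_kills[OF w r bm(1)[OF r]] by (meson dvd_mult_left)
    then have l: "lam r h' = lam r h" using weight_diff[OF w r] by simp
    have "bm j' r dvd h'" using h'(2) by (metis diff_zero dvd_mult_left)
    from weight_kills[OF u r bm(1)[OF r] this]
    have z: "lam r h' + (if r = q then of_int \<kappa> * (poly h' (x + of_int k) - poly h' x) else 0) = 0" .
    have "poly h' (x + of_int k) = 0"
      using dvd_mult_right[OF h'(2)] unfolding poly_eq_0_iff_dvd by simp
    moreover have "poly (h' - h) x = 0"
      using dvd_mult_right[OF h'(1)] unfolding poly_eq_0_iff_dvd .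
    ultimately show ?thesis using z l by (auto simp: eq_neg_iff_add_eq_0)
  qed
  then show ?thesis using \<kappa>(1) q by (intro disjI2 bexI[of _ "of_int \<kappa> :: complex"] bexI[of _ q] exI[of _ x]) auto
qed simp

end

section \<open>Blocks\<close>

lemma small_multiple:
  assumes "l * int N = a" "\<bar>a\<bar> < int N"
  shows "l = 0"
proof (rule ccontr)
  assume "l \<noteq> 0"
  then have "1 * int N \<le> \<bar>l\<bar> * int N" by (intro mult_right_mono) auto
  then show False using assms by (simp add: abs_mult flip: assms(1))
qed

text \<open>
  The identity matrix \<open>\<Sum> E\<^sub>q\<^sub>q\<close> and the grading-corrected element \<open>\<Sum> (N D + q - (N+1)/2) E\<^sub>q\<^sub>q - j\<close>
  commute with everything; a block is a family on which each has one eigenvalue. The constant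
  \<open>(N+1)/2\<close> makes the second element invariant under the duality \<open>q \<mapsto> N + 1 - q\<close>.
\<close>

definition grade_poly :: "nat \<Rightarrow> nat \<Rightarrow> complex poly" where
  "grade_poly N q = [:of_nat q - (of_nat N + 1) / 2, of_nat N:]"

context gmod
begin

definition Iop :: "complex \<Rightarrow> 'b \<Rightarrow> 'b" where
  "Iop \<omega> v = (\<Sum>q\<in>idx. E 0 q q 1 v) - \<omega> *s v"

definition Dop :: "complex \<Rightarrow> 'b \<Rightarrow> 'b" where
  "Dop c v = (\<Sum>q\<in>idx. E 0 q q (grade_poly N q) v) - c *s v"

end

text \<open>The shift by the degree \<open>j\<close> in the second condition makes the grading element central.\<close>

locale block = smod +
  fixes \<omega> z :: complex
  assumes I_nil: "v \<in> W j \<Longrightarrow> \<exists>n. (Iop \<omega> ^^ n) v = 0"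
    and D_nil: "v \<in> W j \<Longrightarrow> \<exists>n. (Dop (z + of_int j) ^^ n) v = 0"
begin

lemma weight_trace:
  assumes w: "weight j {0} v lam"
  shows "(\<Sum>q\<in>idx. lam q 1) = \<omega>" "(\<Sum>q\<in>idx. lam q (grade_poly N q)) = z + of_int j"
proof -
  have v: "v \<in> W j" "v \<noteq> 0" using w by (auto simp: weight_def)
  have ev: "E 0 q q f v = lam q f *s v" if "q \<in> idx" for q f
    using w that by (auto simp: weight_def simp del: atLeastAtMost_iff)
  have eigen: "c = 0" if T: "\<And>a. T (a *s v) = (a * c) *s v" and n: "(T ^^ n) v = 0" for T c n
  proof -
    have "(T ^^ i) v = c ^ i *s v" for i by (induction i) (simp_all add: T mult.commute)
    then show ?thesis using n v(2) by simp
  qed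
  have "Iop \<omega> (a *s v) = (a * ((\<Sum>q\<in>idx. lam q 1) - \<omega>)) *s v" for a
    unfolding Iop_def by (simp add: E_scale[OF _ _ v(1)] ev scale_sum_left sum_distrib_left
      scale_left_diff_distrib right_diff_distrib mult.commute)
  then have "(\<Sum>q\<in>idx. lam q 1) - \<omega> = 0" using eigen I_nil[OF v(1)] by blast
  then show "(\<Sum>q\<in>idx. lam q 1) = \<omega>" by simp
  have "Dop (z + of_int j) (a *s v) = (a * ((\<Sum>q\<in>idx. lam q (grade_poly N q)) - (z + of_int j))) *s v" for a
    unfolding Dop_def by (simp add: E_scale[OF _ _ v(1)] ev scale_sum_left sum_distrib_left
      scale_left_diff_distrib right_diff_distrib mult.commute)
  then have "(\<Sum>q\<in>idx. lam q (grade_poly N q)) - (z + of_int j) = 0" using eigen D_nil[OF v(1)] by blast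
  then show "(\<Sum>q\<in>idx. lam q (grade_poly N q)) = z + of_int j" by simp
qed

lemma moved_weight:
  assumes w: "weight j' {0} u lam" and q: "q \<in> idx" and B: "poly B y \<noteq> 0" and \<epsilon>: "\<epsilon> \<in> {1, -1}"
    and lam: "\<And>h. lam q (B * h) = \<epsilon> * poly (B * h) y" and \<omega>: "\<omega> \<noteq> -1"
  shows "\<epsilon> = 1 \<and> \<omega> = 1 \<and> of_nat N * y + of_nat q - (of_nat N + 1) / 2 = z + of_int j'"
proof -
  have "lam q (B * 1) \<noteq> 0" unfolding lam using B \<epsilon> by auto
  then obtain \<kappa> r x where c: "\<kappa> \<in> {1, -1}" "r \<in> idx"
    "\<And>s h. s \<in> idx \<Longrightarrow> lam s h = (if s = r then \<kappa> * poly h x else 0)"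
    using weight_classification[OF w] q by blast
  have r: "r = q" using \<open>lam q (B * 1) \<noteq> 0\<close> c(3)[OF q] by (auto split: if_splits)
  have "(\<Sum>s\<in>idx. lam s 1) = (\<Sum>s\<in>idx. if s = r then \<kappa> else 0)" using c(3) by (intro sum.cong) auto
  then have \<kappa>: "\<kappa> = \<omega>" using weight_trace(1)[OF w] c(2) by simp
  then have one: "\<kappa> = 1" "\<omega> = 1" using c(1) \<omega> by auto
  have "poly (B * [:- x, 1:]) x = 0" by simp
  then have "\<epsilon> * poly (B * [:- x, 1:]) y = 0"
    using lam[of "[:- x, 1:]"] c(3)[OF q, of "B * [:- x, 1:]"] r by (simp only: mult_zero_right if_cancel)
  moreover have "poly (B * [:- x, 1:]) y = poly B y * (y - x)" by (simp add: algebra_simps)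
  ultimately have x: "x = y" using B \<epsilon> by auto
  have "\<epsilon> * poly (B * 1) y = poly (B * 1) y" using lam[of 1] c(3)[OF q] r x one by simp
  then have "\<epsilon> = 1" using B by simp
  moreover have "(\<Sum>s\<in>idx. lam s (grade_poly N s)) = (\<Sum>s\<in>idx. if s = q then poly (grade_poly N s) y else 0)"
    using c(3) one x r by (intro sum.cong) auto
  then have "poly (grade_poly N q) y = z + of_int j'" using weight_trace(2)[OF w] q by simp
  ultimately show ?thesis using one by (simp add: grade_poly_def algebra_simps)
qed

lemma block_support:
  assumes q: "q \<in> idx" and x: "x \<in> S j q" and \<omega>: "\<omega> \<noteq> -1"
  shows "\<omega> = 1 \<and> of_nat N * x + of_nat q - (of_nat N + 1) / 2 = z + of_int j"
proof -
  define B where "B = bm j q"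
  have "finite (insert 0 {k. x + of_int k \<in> S j q})"
    using translates_rarely_hit[OF S_finite[OF q]] by blast
  then obtain k where k: "k \<noteq> 0" "x + of_int k \<notin> S j q"
    using ex_new_if_finite[OF infinite_UNIV_int] by blast
  have k': "- k \<noteq> 0" using k(1) by simp
  have Bk: "poly B (x + of_int k) \<noteq> 0" using k(2) by (simp add: S_def B_def)
  have Bx: "poly B x = 0" using x by (simp add: S_def B_def)
  from support_moves[OF q x k(2)] show ?thesis
  proof
    assume "sup_at j k q q x"
    from sup_weight[OF q k(1) this] obtain u lam where
      lam: "\<And>f. B dvd f \<Longrightarrow> lam q f = 0" and w: "weight (j + k * int N) {0} u
      (\<lambda>r g. lam r g + (if r = q then poly g (x + of_int k) - poly g x else 0))"
      unfolding B_def by blast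
    have "(1 :: complex) = 1 \<and> \<omega> = 1 \<and> of_nat N * (x + of_int k) + of_nat q - (of_nat N + 1) / 2 = z + of_int (j + k * int N)"
      by (rule moved_weight[OF w q Bk _ _ \<omega>]) (simp_all add: lam Bx)
    then show ?thesis by (simp add: algebra_simps)
  next
    assume "sup_at j (- k) q q (x + of_int k)"
    from sup_weight[OF q k' this] obtain u lam where
      lam: "\<And>f. B dvd f \<Longrightarrow> lam q f = 0" and w: "weight (j + (- k) * int N) {0} u
      (\<lambda>r g. lam r g + (if r = q then poly g (x + of_int k + of_int (- k)) - poly g (x + of_int k) else 0))"
      unfolding B_def by blast
    have "(- 1 :: complex) = 1 \<and> \<omega> = 1 \<and> of_nat N * (x + of_int k) + of_nat q - (of_nat N + 1) / 2 = z + of_int (j + (- k) * int N)"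
      by (rule moved_weight[OF w q Bk _ _ \<omega>]) (simp_all add: lam Bx)
    then show ?thesis by simp
  qed
qed

lemma bm_power_dvd:
  assumes q: "q \<in> idx" and S: "S j q \<subseteq> {x}"
  shows "\<exists>m. kills j 0 q q ([:- x, 1:] ^ m)"
proof -
  have "\<forall>y. poly (bm j q) y = 0 \<longrightarrow> poly [:- x, 1:] y = 0" using S by (auto simp: S_def)
  then have "bm j q dvd [:- x, 1:] ^ degree (bm j q)"
    using nullstellensatz_univariate bm(2)[OF q] by blast
  then show ?thesis using kills_dvd bm(1)[OF q] by blast
qed

text \<open>The diagonal parts have empty support, so their annihilating ideals contain \<open>1\<close>, and with them
  those of all other operators.\<close>

lemma block_trivial:
  assumes \<omega>: "\<omega> \<noteq> 1" "\<omega> \<noteq> -1" and pq: "p \<in> idx" "q \<in> idx" and v: "v \<in> W j"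
  shows "E k p q f v = 0"
proof -
  have diag: "kills j 0 q q 1" if q: "q \<in> idx" for j q
  proof -
    have "x \<notin> S j q" for x using block_support[OF q _ \<omega>(2)] \<omega>(1) by blast
    then have "poly (bm j q) x \<noteq> 0" for x by (simp add: S_def)
    then have "\<not> (\<exists>x. poly (bm j q) x = 0)" by blast
    then have "constant (poly (bm j q))" using fundamental_theorem_of_algebra by blast
    then have "degree (bm j q) = 0" by (simp add: constant_degree)
    then have "bm j q dvd 1" using bm(2)[OF q] is_unit_iff_degree by blast
    then show ?thesis using kills_dvd bm(1)[OF q] by blast
  qed
  have "kills j k p q 1"
  proof (cases "k \<noteq> 0 \<or> p \<noteq> q")
    case True show ?thesis by (rule offdiag_kill(1)[OF pq True refl]) (rule diag[OF pq(2)])+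
  next
    case False then show ?thesis using diag pq by auto
  qed
  then show ?thesis using v by (simp add: kills_def)
qed

end

text \<open>
  In a block where the identity matrix has eigenvalue \<open>1\<close> the supports of \<open>t\<^sup>k E\<^sub>p\<^sub>q\<close> at
  different degrees are disjoint. A polynomial can then be split into a part that kills the source
  and a part that kills the middle degree of a product of two operators, and the commutator
  relation turns into associativity.
\<close>

locale assoc_block = block scale N E Z \<psi> W M 1 z
  for scale :: "complex \<Rightarrow> 'b::ab_group_add \<Rightarrow> 'b" (infixr \<open>*s\<close> 75)
    and N E Z \<psi> W M z
begin

definition pt :: "int \<Rightarrow> nat \<Rightarrow> complex" where
  "pt j q = (z + of_int j - of_nat q + (of_nat N + 1) / 2) / of_nat N"

lemma N_nonzero: "(of_nat N :: complex) \<noteq> 0"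
  using N by simp

lemma kills_diag:
  assumes q: "q \<in> idx"
  shows "\<exists>m. kills j 0 q q ([:- pt j q, 1:] ^ m)"
proof (rule bm_power_dvd[OF q])
  show "S j q \<subseteq> {pt j q}"
  proof
    fix x assume "x \<in> S j q"
    then have "of_nat N * x + of_nat q - (of_nat N + 1) / 2 = z + of_int j" using block_support[OF q] by auto
    then have "x * of_nat N = z + of_int j - of_nat q + (of_nat N + 1) / 2" by (simp add: algebra_simps)
    then show "x \<in> {pt j q}" using N_nonzero by (simp add: pt_def nonzero_eq_divide_eq)
  qed
qed

lemma pt_mult: "pt j q * of_nat N = z + of_int j - of_nat q + (of_nat N + 1) / 2"
  using N_nonzero by (simp add: pt_def)

lemma pt_target:
  assumes "j' = j + k * int N + int p - int q"
  shows "pt j' p - of_int k = pt j q"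
proof -
  have "(pt j' p - of_int k) * of_nat N = pt j q * of_nat N"
    unfolding left_diff_distrib pt_mult assms by simp
  then show ?thesis using N_nonzero by (metis mult_right_cancel)
qed

lemma pt_eq_iff: "pt j q = pt j' q \<longleftrightarrow> j = j'"
  using N_nonzero by (simp add: pt_def)

lemma kills_pt:
  assumes pq: "p \<in> idx" "q \<in> idx"
  shows "\<exists>m. kills j k p q ([:- pt j q, 1:] ^ m)"
proof (cases "k \<noteq> 0 \<or> p \<noteq> q")
  case False then show ?thesis using kills_diag pq by auto
next
  case nz: True
  define j' where "j' = j + k * int N + int p - int q"
  obtain m1 where m1: "kills j 0 q q ([:- pt j q, 1:] ^ m1)" using kills_diag[OF pq(2)] by blast
  obtain m2 where m2: "kills j' 0 q q ([:- pt j' q, 1:] ^ m2)" using kills_diag[OF pq(2)] by blast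
  obtain m3 where m3: "kills j 0 p p ([:- pt j p, 1:] ^ m3)" using kills_diag[OF pq(1)] by blast
  obtain m4 where m4: "kills j' 0 p p ([:- pt j' p, 1:] ^ m4)" using kills_diag[OF pq(1)] by blast
  note m = m1 m2 m3 m4
  let ?P = "[:- pt j q, 1:]" and ?Q = "[:- pt j' q, 1:] ^ m2" and ?R = "[:- (pt j p - of_int k), 1:] ^ m3"
  have 1: "kills j k p q (?P ^ m1 * ?Q)"
    using offdiag_kill(1)[OF pq nz j'_def kills_mult[OF m(1)] kills_mult2[OF m(2)]] .
  have "kills j k p q (shiftp k ([:- pt j p, 1:] ^ m3 * [:- pt j' p, 1:] ^ m4))"
    using offdiag_kill(2)[OF pq nz j'_def kills_mult[OF m(3)] kills_mult2[OF m(4)]] .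
  moreover have "shiftp k ([:- pt j p, 1:] ^ m3 * [:- pt j' p, 1:] ^ m4) = ?R * ?P ^ m4"
    using pt_target[OF j'_def] by (simp add: algebra_simps)
  ultimately have 2: "kills j k p q (?R * ?P ^ m4)" by simp
  let ?n = "m1 + m4"
  have Q: "kills j k p q (?P ^ ?n * ?Q)" using kills_mult[OF 1, of "?P ^ m4"] by (simp add: power_add ac_simps)
  have R: "kills j k p q (?P ^ ?n * ?R)" using kills_mult[OF 2, of "?P ^ m1"] by (simp add: power_add ac_simps)
  have ne: "pt j' q \<noteq> pt j p - of_int k"
  proof
    assume "pt j' q = pt j p - of_int k"
    then have "pt j' q * of_nat N = (pt j p - of_int k) * of_nat N" by simp
    then have "(of_int (2 * (k * int N + int p - int q)) :: complex) = 0"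
      unfolding left_diff_distrib pt_mult j'_def by (simp add: algebra_simps)
    then have d: "k * int N = int q - int p" by (simp only: of_int_eq_0_iff) simp
    have "\<bar>int q - int p\<bar> < int N" using pq by auto
    then have "k = 0" by (rule small_multiple[OF d])
    then show False using nz d by simp
  qed
  have "poly ?R y \<noteq> 0" if "poly ?Q y = 0" for y
  proof -
    have "y = pt j' q" using that by (auto simp: poly_power)
    moreover have "poly ?R y = (y - (pt j p - of_int k)) ^ m3" by (simp add: algebra_simps)
    ultimately show ?thesis using ne by simp
  qed
  then obtain s t where "s * ?Q + t * ?R = 1" using bezout_no_common_root[of ?Q ?R] by auto
  then show ?thesis using kills_bezout[OF pq Q R] by blast
qed

lemma assoc_offdegree:
  assumes pqrs: "p \<in> idx" "q \<in> idx" "r \<in> idx" "s \<in> idx" and v: "v \<in> W j"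
    and d: "l * int N + int r - int s \<noteq> 0"
  shows "E k p q f (E l r s g v) = (if q = r then E (k + l) p s (shiftp l f * g) v else 0)"
proof -
  define j1 where "j1 = j + l * int N + int r - int s"
  have u: "E l r s g v \<in> W j1" using E_in'[OF pqrs(3,4) v j1_def] .
  obtain m1 where m1: "kills j k p q ([:- pt j q, 1:] ^ m1)" using kills_pt[OF pqrs(1,2)] by blast
  obtain m2 where m2: "kills j1 k p q ([:- pt j1 q, 1:] ^ m2)" using kills_pt[OF pqrs(1,2)] by blast
  obtain m3 where m3: "kills j (k + l) r q ([:- pt j q, 1:] ^ m3)" using kills_pt[OF pqrs(3,2)] by blast
  obtain m4 where m4: "kills j (k + l) p s ([:- pt j s, 1:] ^ m4)" using kills_pt[OF pqrs(1,4)] by blast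
  note m = m1 m2 m3 m4
  let ?b = "[:- pt j q, 1:] ^ (m1 + m3)" and ?c = "[:- pt j1 q, 1:] ^ (m2 + m4)"
  have "pt j q \<noteq> pt j1 q" using d by (simp add: pt_eq_iff j1_def)
  then have nc: "poly ?c y \<noteq> 0" if "poly ?b y = 0" for y using that by (auto simp: poly_power)
  have nb: "?b \<noteq> 0" by simp
  from crt_no_common_root[OF nb nc, of 0 f] obtain f1 where f1: "?b dvd f1 - 0" "?c dvd f1 - f" by blast
  have b1: "[:- pt j q, 1:] ^ m1 dvd f1" "[:- pt j q, 1:] ^ m3 dvd f1"
    by (rule dvd_trans[OF _ f1(1)[unfolded diff_zero]]; simp add: power_add)+
  have c1: "[:- pt j1 q, 1:] ^ m2 dvd f1 - f" "[:- pt j1 q, 1:] ^ m4 dvd f1 - f"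
    by (rule dvd_trans[OF _ f1(2)]; simp add: power_add)+
  have "E k p q (f1 - f) (E l r s g v) = 0" using m(2) c1(1) u unfolding kills_def by blast
  then have e1: "E k p q f (E l r s g v) = E k p q f1 (E l r s g v)" using E_difff[OF pqrs(1,2) u] by simp
  have e2: "E k p q f1 v = 0" using m(1) b1(1) v unfolding kills_def by blast
  have e3: "E (k + l) r q (shiftp k g * f1) v = 0"
    using m(3) b1(2) v unfolding kills_def by (meson dvd_mult)
  have e4: "E (k + l) p s (shiftp l f1 * g) v = E (k + l) p s (shiftp l f * g) v" if "q = r"
  proof -
    have "pt j1 q - of_int l = pt j s" using pt_target[OF j1_def] that by simp
    then have "[:- pt j s, 1:] ^ m4 dvd shiftp l (f1 - f)"
      using linear_power_dvd_shiftp[OF c1(2), of l] by simp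
    then have "[:- pt j s, 1:] ^ m4 dvd shiftp l (f1 - f) * g" by simp
    then have "E (k + l) p s (shiftp l (f1 - f) * g) v = 0" using m(4) v unfolding kills_def by blast
    then show ?thesis using E_difff[OF pqrs(1,4) v] by (simp add: left_diff_distrib)
  qed
  show ?thesis using comm0[OF pqrs v, of k f1 l g] e1 e2 e3 e4 pqrs by (auto split: if_splits)
qed

theorem assoc:
  assumes pqrs: "p \<in> idx" "q \<in> idx" "r \<in> idx" "s \<in> idx" and v: "v \<in> W j"
  shows "E k p q f (E l r s g v) = (if q = r then E (k + l) p s (shiftp l f * g) v else 0)"
proof (cases "l * int N + int r - int s = 0")
  case False then show ?thesis using assoc_offdegree[OF pqrs v] by blast
next
  case True
  \<comment> \<open>A factor of degree \<open>0\<close> is written as a product of factors of degrees \<open>-N\<close> and \<open>N\<close>.\<close>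
  have d: "l * int N = int s - int r" using True by simp
  have "\<bar>int s - int r\<bar> < int N" using pqrs by auto
  then have l: "l = 0" by (rule small_multiple[OF d])
  then have r: "r = s" using d by simp
  have N0: "int N \<noteq> 0" using N by simp
  define u where "u = E 1 s s 1 v"
  have u: "u \<in> W (j + int N)" unfolding u_def using E_in'[OF pqrs(4,4) v, of "j + int N" 1] by simp
  have "E 0 s s g v = E (- 1) s s (shiftp (- 1) g) u"
    unfolding u_def using assoc_offdegree[OF pqrs(4,4,4,4) v, of 1 "- 1" "shiftp (- 1) g" 1] N0 by simp
  then have "E k p q f (E l r s g v) = E k p q f (E (- 1) s s (shiftp (- 1) g) u)" using l r by simp
  also have "\<dots> = (if q = s then E (k - 1) p s (shiftp (- 1) f * shiftp (- 1) g) u else 0)"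
    using assoc_offdegree[OF pqrs(1,2,4,4) u, of "- 1" k f "shiftp (- 1) g"] N0 by simp
  also have "E (k - 1) p s (shiftp (- 1) f * shiftp (- 1) g) u = E k p s (f * g) v"
    unfolding u_def using assoc_offdegree[OF pqrs(1,4,4,4) v, of 1 "k - 1" "shiftp (- 1) f * shiftp (- 1) g" 1] N0
    by simp
  finally show ?thesis using l r by simp
qed

end

section \<open>Stable families and highest weight vectors\<close>

lemma int_mult_ge1: "a \<ge> 1 \<Longrightarrow> b \<ge> 1 \<Longrightarrow> a * b \<ge> (1 :: int)"
  using mult_mono[of 1 a 1 b] by simp

context gmod
begin

definition stable :: "(int \<Rightarrow> 'b set) \<Rightarrow> bool" where
  "stable A \<longleftrightarrow> (\<forall>j. subspace (A j) \<and> A j \<subseteq> W j) \<and>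
     (\<forall>j k. \<forall>p\<in>idx. \<forall>q\<in>idx. \<forall>f. \<forall>v\<in>A j. E k p q f v \<in> A (j + k * int N + int p - int q)) \<and>
     (\<forall>j. \<forall>v\<in>A j. Z v \<in> A j)"

definition gsimple :: bool where
  "gsimple \<longleftrightarrow> (\<exists>j. W j \<noteq> {0}) \<and> (\<forall>A. stable A \<longrightarrow> (\<forall>j. A j = {0}) \<or> (\<forall>j. A j = W j))"

definition top_degree :: "int \<Rightarrow> bool" where
  "top_degree j \<longleftrightarrow> W j \<noteq> {0} \<and> (\<forall>k. \<forall>p\<in>idx. \<forall>q\<in>idx. \<forall>f. \<forall>v\<in>W j.
     k * int N + int p - int q > 0 \<longrightarrow> E k p q f v = 0)"

definition good :: "int \<Rightarrow> nat \<Rightarrow> 'b \<Rightarrow> bool" where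
  "good l d v \<longleftrightarrow> (\<forall>p\<in>idx. \<forall>q\<in>idx. \<forall>f. degree f \<le> d \<longrightarrow> E l p q f v = 0)"

definition eventually_killed :: "int \<Rightarrow> 'b set" where
  "eventually_killed j = {v \<in> W j. \<forall>d. \<exists>n0. \<forall>l\<ge>n0. good l d v}"

lemma goodD: "good l d v \<Longrightarrow> p \<in> idx \<Longrightarrow> q \<in> idx \<Longrightarrow> degree f \<le> d \<Longrightarrow> E l p q f v = 0"
  by (auto simp: good_def simp del: atLeastAtMost_iff)

lemma good_mono: "good l d v \<Longrightarrow> d' \<le> d \<Longrightarrow> good l d' v"
  using le_trans by (auto simp: good_def simp del: atLeastAtMost_iff)

text \<open>Commutation lowers the index \<open>l\<close> by a bounded amount and raises the degree by a bounded
  amount, so the vectors that are killed in every degree from some index on form a stable family.\<close>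

lemma stable_eventually_killed: "stable eventually_killed"
  unfolding stable_def
proof (intro conjI allI ballI)
  fix j
  show "subspace (eventually_killed j)"
  proof (rule subspaceI)
    show "0 \<in> eventually_killed j" by (auto simp: eventually_killed_def good_def)
    fix v w assume v: "v \<in> eventually_killed j" and w: "w \<in> eventually_killed j"
    have "\<exists>n0. \<forall>l\<ge>n0. good l d (v + w)" for d
    proof -
      obtain n1 where "\<forall>l\<ge>n1. good l d v" using v unfolding eventually_killed_def by blast
      moreover obtain n2 where "\<forall>l\<ge>n2. good l d w" using w unfolding eventually_killed_def by blast
      ultimately have "\<forall>l\<ge>max n1 n2. good l d (v + w)"
        using v w by (auto simp: eventually_killed_def good_def E_add simp del: atLeastAtMost_iff)
      then show ?thesis by blast
    qed
    then show "v + w \<in> eventually_killed j" using v w by (simp add: eventually_killed_def W_add)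
  next
    fix c v assume v: "v \<in> eventually_killed j"
    have "good l d (c *s v)" if "good l d v" for l d
      using v that by (auto simp: eventually_killed_def good_def E_scale simp del: atLeastAtMost_iff)
    then have "\<exists>n0. \<forall>l\<ge>n0. good l d (c *s v)" for d
      using v unfolding eventually_killed_def by blast
    then show "c *s v \<in> eventually_killed j" using v by (simp add: eventually_killed_def W_scale)
  qed
  show "eventually_killed j \<subseteq> W j" by (auto simp: eventually_killed_def)
next
  fix j k r s g v
  assume rs: "r \<in> idx" "s \<in> idx" and v: "v \<in> eventually_killed j"
  have vW: "v \<in> W j" using v by (simp add: eventually_killed_def)
  have "\<exists>n0. \<forall>l\<ge>n0. good l d (E k r s g v)" for d
  proof -
    obtain n1 n2 where n: "\<And>l. l \<ge> n1 \<Longrightarrow> good l d v" "\<And>l. l \<ge> n2 \<Longrightarrow> good l (d + degree g) v"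
      using v by (fastforce simp: eventually_killed_def)
    define n0 where "n0 = max n1 (max (n2 - k) (1 - k))"
    have "good l d (E k r s g v)" if l: "l \<ge> n0" for l
      unfolding good_def
    proof (intro ballI allI impI)
      fix p q and f :: "complex poly" assume pq: "p \<in> idx" "q \<in> idx" and f: "degree f \<le> d"
      have d1: "degree (shiftp k f * g) \<le> d + degree g"
        using degree_mult_le[of "shiftp k f" g] f by simp
      have d2: "degree (shiftp l g * f) \<le> d + degree g"
        using degree_mult_le[of "shiftp l g" f] f by simp
      have z1: "E l p q f v = 0" using goodD[OF n(1) pq f] l by (simp add: n0_def)
      have gl: "good (l + k) (d + degree g) v" using n(2) l by (simp add: n0_def)
      have "E l p q f (E k r s g v) - E k r s g (E l p q f v) = 0"
        using E_comm[OF pq rs vW, of l f k g] goodD[OF gl pq(1) rs(2) d1] goodD[OF gl rs(1) pq(2) d2] l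
        by (auto simp: n0_def)
      then show "E l p q f (E k r s g v) = 0" using z1 rs by simp
    qed
    then show ?thesis by blast
  qed
  then show "E k r s g v \<in> eventually_killed (j + k * int N + int r - int s)"
    using E_in[OF rs vW] by (simp add: eventually_killed_def)
next
  fix j v assume v: "v \<in> eventually_killed j"
  then have vW: "v \<in> W j" by (simp add: eventually_killed_def)
  have "good l d (Z v)" if "good l d v" for l d
    using that Z_E[OF _ _ vW] by (auto simp: good_def simp flip: Z_E[OF _ _ vW] simp del: atLeastAtMost_iff)
  then have "\<exists>n0. \<forall>l\<ge>n0. good l d (Z v)" for d using v unfolding eventually_killed_def by blast
  then show "Z v \<in> eventually_killed j" using Z_in[OF vW] by (simp add: eventually_killed_def)
qed

text \<open>
  The vectors killed by two operators are killed by their commutator; one factor is diagonal, so that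
  the commutator has a single matrix unit.
\<close>

lemma killed_bracket:
  assumes pq: "p \<in> idx" "q \<in> idx" and v: "v \<in> W j" and xy: "x + y \<noteq> 0"
    and f: "E x p q f v = 0" and g: "E y q q g v = 0"
  shows "E (x + y) p q (shiftp y f * g - (if p = q then shiftp x g * f else 0)) v = 0"
proof -
  have "E x p q f (E y q q g v) - E y q q g (E x p q f v) = 0" using f g pq by simp
  then have "E (x + y) p q (shiftp y f * g) v - (if q = p then E (x + y) q q (shiftp x g * f) v else 0) = 0"
    using E_comm[OF pq pq(2) pq(2) v, of x f y g] xy by simp
  then show ?thesis using E_difff[OF pq v] E_0f[OF pq v] by (auto split: if_splits)
qed

lemma good_by_degrees:
  assumes v: "v \<in> W j"
    and ex: "\<And>p q i. p \<in> idx \<Longrightarrow> q \<in> idx \<Longrightarrow> i \<le> d \<Longrightarrow> \<exists>f. f \<noteq> 0 \<and> degree f = i \<and> E l p q f v = 0"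
  shows "good l d v"
  unfolding good_def
proof (intro ballI allI impI)
  fix p q and f :: "complex poly" assume pq: "p \<in> idx" "q \<in> idx" and f: "degree f \<le> d"
  have "f \<in> {f. E l p q f v = 0}"
  proof (rule degree_filling[OF _ _ _ f])
    show "g + h \<in> {f. E l p q f v = 0}" if "g \<in> {f. E l p q f v = 0}" "h \<in> {f. E l p q f v = 0}" for g h
      using that E_addf[OF pq v] by simp
    show "Polynomial.smult c g \<in> {f. E l p q f v = 0}" if "g \<in> {f. E l p q f v = 0}" for c g
      using that E_smult[OF pq v] by simp
    show "\<exists>g\<in>{f. E l p q f v = 0}. g \<noteq> 0 \<and> degree g = i" if "i \<le> d" for i
      using ex[OF pq that] by blast
  qed
  then show "E l p q f v = 0" by simp
qed

lemma good_add:
  assumes v: "v \<in> W j" and xy: "x \<ge> 1" "y \<ge> 1" and g: "good x 2 v" "good y 2 v"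
  shows "good (x + y) 2 v"
proof (rule good_by_degrees[OF v])
  fix p q :: nat and i :: nat assume pq: "p \<in> idx" "q \<in> idx" and i: "i \<le> 2"
  have xy0: "x + y \<noteq> 0" using xy by simp
  have br: "E (x + y) p q (shiftp y f * g - (if p = q then shiftp x g * f else 0)) v = 0"
    if "degree f \<le> 2" "degree g \<le> 2" for f g
    using killed_bracket[OF pq v xy0 goodD[OF g(1) pq that(1)] goodD[OF g(2) pq(2) pq(2) that(2)]] .
  show "\<exists>f. f \<noteq> 0 \<and> degree f = i \<and> E (x + y) p q f v = 0"
  proof (cases "p = q")
    case False
    have "degree ([:0, 1:] ^ i :: complex poly) = i" by (simp add: degree_power_eq)
    then show ?thesis using br[of "[:0, 1:] ^ i" 1] False i
      by (intro exI[of _ "shiftp y ([:0, 1:] ^ i)"]) (simp del: shiftp_algebra(8))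
  next
    case True
    let ?x = "of_int x :: complex" and ?y = "of_int y :: complex"
    have x0: "?x \<noteq> 0" using xy by simp
    consider "i = 0" | "i = 1" | "i = 2" using i by linarith
    then show ?thesis
    proof cases
      case 1
      have "shiftp y 1 * [:0, 1:] - shiftp x [:0, 1:] * 1 = [:- ?x:]" by (rule poly_ext) simp
      then show ?thesis using br[of 1 "[:0, 1:]"] True 1 x0 by (intro exI[of _ "[:- ?x:]"]) simp
    next
      case 2
      have "shiftp y 1 * [:0, 0, 1:] - shiftp x [:0, 0, 1:] * 1 = [:- ?x * ?x, - 2 * ?x:]"
        by (rule poly_ext) (simp add: algebra_simps)
      then show ?thesis using br[of 1 "[:0, 0, 1:]"] True 2 x0
        by (intro exI[of _ "[:- ?x * ?x, - 2 * ?x:]"]) simp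
    next
      case 3
      have a: "shiftp y [:0, 1:] * [:0, 0, 1:] - shiftp x [:0, 0, 1:] * [:0, 1:] = [:0, - ?x * ?x, ?y - 2 * ?x:]"
        by (rule poly_ext) (simp add: algebra_simps)
      have b: "shiftp y [:0, 0, 1:] * [:0, 1:] - shiftp x [:0, 1:] * [:0, 0, 1:] = [:0, ?y * ?y, 2 * ?y - ?x:]"
        by (rule poly_ext) (simp add: algebra_simps)
      have "?y - 2 * ?x \<noteq> 0 \<or> 2 * ?y - ?x \<noteq> 0"
      proof (rule ccontr)
        assume "\<not> ?thesis"
        then have "of_int (y - 2 * x) = (0 :: complex)" "of_int (2 * y - x) = (0 :: complex)" by auto
        then have "y - 2 * x = 0" "2 * y - x = 0" by (simp_all only: of_int_eq_0_iff)
        then show False using xy by simp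
      qed
      then show ?thesis
      proof
        assume "?y - 2 * ?x \<noteq> 0"
        then show ?thesis using br[of "[:0, 1:]" "[:0, 0, 1:]"] a True 3
          by (intro exI[of _ "[:0, - ?x * ?x, ?y - 2 * ?x:]"]) simp
      next
        assume "2 * ?y - ?x \<noteq> 0"
        then show ?thesis using br[of "[:0, 0, 1:]" "[:0, 1:]"] b True 3
          by (intro exI[of _ "[:0, ?y * ?y, 2 * ?y - ?x:]"]) simp
      qed
    qed
  qed
qed

lemma linear_power_expansion:
  fixes y :: complex
  assumes "d \<ge> 2"
  shows "\<exists>Q. degree Q \<le> d - 2 \<and> [:y, 1:] ^ d = [:0, 1:] ^ d + Polynomial.smult (of_nat d * y) ([:0, 1:] ^ (d - 1)) + Q"
  using assms
proof (induction d rule: nat_induct_at_least)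
  case base
  show ?case by (intro exI[of _ "[:y * y:]"]) (simp add: power2_eq_square)
next
  case (Suc d)
  then obtain Q where Q: "degree Q \<le> d - 2"
    "[:y, 1:] ^ d = [:0, 1:] ^ d + Polynomial.smult (of_nat d * y) ([:0, 1:] ^ (d - 1)) + Q" by blast
  define R where "R = [:y, 1:] * Q + Polynomial.smult (of_nat d * y * y) ([:0, 1:] ^ (d - 1))"
  have X: "[:0, 1:] * [:0, 1:] ^ (d - 1) = ([:0, 1:] ^ d :: complex poly)"
    using Suc.hyps by (cases d) auto
  have "degree ([:y, 1:] * Q) \<le> d - 1"
    using degree_mult_le[of "[:y, 1:]" Q] Q(1) Suc.hyps by simp
  moreover have "degree (Polynomial.smult (of_nat d * y * y) ([:0, 1:] ^ (d - 1))) \<le> d - 1"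
    using degree_smult_le[of "of_nat d * y * y" "[:0, 1:] ^ (d - 1)"] by (simp add: degree_power_eq)
  ultimately have "degree R \<le> Suc d - 2" unfolding R_def by (simp add: degree_add_le)
  moreover have "[:y, 1:] ^ Suc d = [:0, 1:] ^ Suc d + Polynomial.smult (of_nat (Suc d) * y) ([:0, 1:] ^ (Suc d - 1)) + R"
  proof (rule poly_ext)
    fix t :: complex
    have "poly ([:0, 1:] * [:0, 1:] ^ (d - 1)) t = poly ([:0, 1:] ^ d) t" by (simp only: X)
    then have t: "t * t ^ (d - 1) = t ^ d" by (simp add: poly_power)
    show "poly ([:y, 1:] ^ Suc d) t = poly ([:0, 1:] ^ Suc d + Polynomial.smult (of_nat (Suc d) * y) ([:0, 1:] ^ (Suc d - 1)) + R) t"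
      unfolding power_Suc Q(2) R_def by (simp add: poly_power algebra_simps flip: t)
  qed
  ultimately show ?case by blast
qed

text \<open>
  The terms of degree \<open>d + 2\<close> of the two products cancel, and what remains has leading coefficient
  \<open>d y - 2 x\<close>; this is how brackets raise the degree by one.
\<close>

lemma bracket_degree:
  fixes x y :: complex
  assumes d: "d \<ge> 2" and ne: "of_nat d * y \<noteq> 2 * x"
  defines "P \<equiv> [:y, 1:] ^ d * [:0, 1:] ^ 2 - [:x, 1:] ^ 2 * [:0, 1:] ^ d"
  shows "P \<noteq> 0 \<and> degree P = d + 1"
proof -
  obtain Q where Q: "degree Q \<le> d - 2"
    "[:y, 1:] ^ d = [:0, 1:] ^ d + Polynomial.smult (of_nat d * y) ([:0, 1:] ^ (d - 1)) + Q"
    using linear_power_expansion[OF d] by blast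
  have t: "t * t ^ (d - 1) = t ^ d" for t :: complex using d by (cases d) auto
  have P: "P = Q * [:0, 1:] ^ 2 + Polynomial.smult (of_nat d * y - 2 * x) ([:0, 1:] ^ (d + 1))
      - Polynomial.smult (x * x) ([:0, 1:] ^ d)"
    unfolding P_def Q(2)
    by (rule poly_ext) (simp add: poly_power algebra_simps power2_eq_square flip: t)
  have mon: "[:0, 1:] ^ n = (monom 1 n :: complex poly)" for n
    by (rule poly_ext) (simp add: poly_power poly_monom)
  have dQ: "degree (Q * [:0, 1:] ^ 2) \<le> d"
    using degree_mult_le[of Q "[:0, 1:] ^ 2"] Q(1) d by (simp add: degree_power_eq)
  have "\<And>i. i > d \<Longrightarrow> coeff (Q * [:0, 1:] ^ 2) i = 0" using dQ by (intro coeff_eq_0) simp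
  then have c: "coeff P i = (if i = d + 1 then of_nat d * y - 2 * x else 0)" if "i > d" for i
    unfolding P mon coeff_add coeff_diff coeff_smult coeff_monom
    using that \<open>\<And>i. i > d \<Longrightarrow> coeff (Q * [:0, 1:] ^ 2) i = 0\<close>[of i] by (simp add: mon)
  have "coeff P (d + 1) \<noteq> 0" using c[of "d + 1"] ne by simp
  moreover from this have "d + 1 \<le> degree P" by (rule le_degree)
  moreover have "degree P \<le> d + 1" by (rule degree_le) (simp add: c)
  ultimately show ?thesis by auto
qed

text \<open>
  Bracketing \<open>D\<^sup>d\<close> at \<open>x\<close> with \<open>D\<^sup>2\<close> at \<open>y\<close> gives degree \<open>d + 1\<close> at \<open>x + y\<close>, unless \<open>d y = 2 x\<close>; then the
  roles of \<open>x\<close> and \<open>y\<close> are exchanged, and both fail only for \<open>d = 2\<close>, \<open>x = y\<close>.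
\<close>

lemma good_raise:
  assumes v: "v \<in> W j" and d: "d \<ge> 2" and xy: "x \<ge> 1" "y \<ge> 1" "x \<noteq> y"
    and g: "good x d v" "good y d v" "good (x + y) d v"
  shows "good (x + y) (Suc d) v"
proof (rule good_by_degrees[OF v])
  fix p q :: nat and i :: nat assume pq: "p \<in> idx" "q \<in> idx" and i: "i \<le> Suc d"
  have xy0: "x + y \<noteq> 0" using xy by simp
  have mon: "degree ([:0, 1:] ^ n :: complex poly) = n" for n by (simp add: degree_power_eq)
  have br: "E (x + y) p q (shiftp y f * g - (if p = q then shiftp x g * f else 0)) v = 0"
    if "degree f \<le> d" "degree g \<le> d" for f g
    using killed_bracket[OF pq v xy0 goodD[OF g(1) pq that(1)] goodD[OF g(2) pq(2) pq(2) that(2)]] .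
  show "\<exists>f. f \<noteq> 0 \<and> degree f = i \<and> E (x + y) p q f v = 0"
  proof (cases "i \<le> d")
    case True
    then show ?thesis using goodD[OF g(3) pq, of "[:0, 1:] ^ i"] mon by (intro exI[of _ "[:0, 1:] ^ i"]) auto
  next
    case False
    then have i: "i = d + 1" using i by simp
    show ?thesis
    proof (cases "p = q")
      case False
      have "degree (shiftp y ([:0, 1:] ^ d) * [:0, 1:]) = d + 1"
        by (subst degree_mult_eq) (auto simp: degree_power_eq)
      moreover have "shiftp y ([:0, 1:] ^ d) * [:0, 1:] \<noteq> (0 :: complex poly)"
        by (simp only: mult_eq_0_iff shiftp_eq_0_iff) auto
      moreover have "E (x + y) p q (shiftp y ([:0, 1:] ^ d) * [:0, 1:]) v = 0"
        using br[of "[:0, 1:] ^ d" "[:0, 1:]"] False d mon[of d] by (simp only: if_False diff_zero) simp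
      ultimately show ?thesis using i by blast
    next
      case True
      have "of_nat d * (of_int y :: complex) \<noteq> 2 * of_int x \<or> of_nat d * (of_int x :: complex) \<noteq> 2 * of_int y"
      proof (rule ccontr)
        assume "\<not> ?thesis"
        then have "(of_int (int d * y - 2 * x) :: complex) = 0" "(of_int (int d * x - 2 * y) :: complex) = 0" by auto
        then have e: "int d * y = 2 * x" "int d * x = 2 * y" by (simp_all only: of_int_eq_0_iff)
        then have "int d * (x + y) = 2 * (x + y)" by (simp add: algebra_simps)
        then have "int d = 2" unfolding mult_right_cancel[OF xy0] .
        then show False using e xy(3) by simp
      qed
      then show ?thesis
      proof
        assume ne: "of_nat d * (of_int y :: complex) \<noteq> 2 * of_int x"
        have "E (x + y) p q ([:of_int y, 1:] ^ d * [:0, 1:] ^ 2 - [:of_int x, 1:] ^ 2 * [:0, 1:] ^ d) v = 0"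
          using br[of "[:0, 1:] ^ d" "[:0, 1:] ^ 2"] True d mon[of d] mon[of 2] by (simp only: if_True) simp
        then show ?thesis using bracket_degree[OF d ne] i by blast
      next
        assume ne: "of_nat d * (of_int x :: complex) \<noteq> 2 * of_int y"
        have "E (x + y) p q ([:of_int y, 1:] ^ 2 * [:0, 1:] ^ d - [:of_int x, 1:] ^ d * [:0, 1:] ^ 2) v = 0"
          using br[of "[:0, 1:] ^ 2" "[:0, 1:] ^ d"] True d mon[of d] mon[of 2] by (simp only: if_True) simp
        then have "- E (x + y) p q ([:of_int y, 1:] ^ 2 * [:0, 1:] ^ d - [:of_int x, 1:] ^ d * [:0, 1:] ^ 2) v = 0"
          by simp
        then have "E (x + y) p q ([:of_int x, 1:] ^ d * [:0, 1:] ^ 2 - [:of_int y, 1:] ^ 2 * [:0, 1:] ^ d) v = 0"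
          using E_uminusf[OF pq v, symmetric] by (simp only: minus_diff_eq)
        then show ?thesis using bracket_degree[OF d ne] i by blast
      qed
    qed
  qed
qed

text \<open>
  The \<open>l\<close> with \<open>t\<^sup>l f E\<^sub>p\<^sub>q v = 0\<close> for all \<open>f\<close> of degree at most \<open>2\<close> are closed under addition;
  two consecutive ones generate all large integers, and brackets then raise the degree.
\<close>

lemma good_imp_eventually_killed:
  assumes v: "v \<in> W j" and a: "a \<ge> 1" and g: "good a 2 v" "good (a + 1) 2 v"
  shows "v \<in> eventually_killed j"
proof -
  have mult: "good (int n * x) 2 v" if "n \<ge> 1" "x \<ge> 1" "good x 2 v" for n x
    using that(1)
  proof (induction n rule: nat_induct_at_least)
    case (Suc n)
    have "int n * x \<ge> 1" using Suc.hyps that(2) by (intro int_mult_ge1) auto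
    then show ?case using good_add[OF v _ that(2) Suc.IH that(3)] by (simp add: algebra_simps)
  qed (use that in simp)
  have two: "good n 2 v" if n: "n \<ge> a * a" for n
  proof -
    define r where "r = n mod a"
    define q where "q = n div a"
    have r: "0 \<le> r" "r < a" using a by (simp_all add: r_def)
    have "(a * a) div a \<le> n div a" using n a by (intro zdiv_mono1) auto
    then have "q \<ge> a" unfolding q_def using a by simp
    then have qr: "q - r \<ge> 1" using r by simp
    have n': "n = (q - r) * a + r * (a + 1)" unfolding q_def r_def
      by (simp add: algebra_simps)
    have A: "good ((q - r) * a) 2 v" using mult[of "nat (q - r)" a] qr a g(1) by simp
    show ?thesis
    proof (cases "r = 0")
      case True then show ?thesis using A n' by simp
    next
      case False
      have "good (r * (a + 1)) 2 v" using mult[of "nat r" "a + 1"] False r a g(2) by simp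
      moreover have "(q - r) * a \<ge> 1" "r * (a + 1) \<ge> 1" using qr a r False by (auto intro!: int_mult_ge1)
      ultimately show ?thesis unfolding n' using good_add[OF v] A by blast
    qed
  qed
  have "\<exists>n0. \<forall>l\<ge>n0. good l (d + 2) v" for d
  proof (induction d)
    case 0 show ?case unfolding add_0 using two by blast
  next
    case (Suc d)
    then obtain n0 where n0: "\<And>l. l \<ge> n0 \<Longrightarrow> good l (d + 2) v" by blast
    define y where "y = max n0 1"
    have "good l (Suc d + 2) v" if l: "l \<ge> 2 * y + 1" for l
    proof -
      have "good ((l - y) + y) (Suc (d + 2)) v"
        using l n0 unfolding y_def by (intro good_raise[OF v]) auto
      then show ?thesis by simp
    qed
    then show ?case by blast
  qed
  then have "\<exists>n0. \<forall>l\<ge>n0. good l d v" for d using good_mono[of _ "d + 2" v d] by (meson le_add1)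
  then show ?thesis using v by (simp add: eventually_killed_def)
qed

lemma eventually_killed_uniform:
  assumes "eventually_killed j = W j"
  shows "\<exists>n. \<forall>l\<ge>n. \<forall>p\<in>idx. \<forall>q\<in>idx. \<forall>v\<in>W j. E l p q 1 v = 0"
proof -
  obtain K where "rank_le K (W j)" using W_fin by blast
  then obtain B where B: "B \<subseteq> W j" "finite B" "W j \<subseteq> span B" unfolding rank_le_def by blast
  have "\<forall>b\<in>B. \<exists>n0. \<forall>l\<ge>n0. good l 0 b" using B(1) assms by (auto simp: eventually_killed_def)
  then obtain n0 where n0: "\<And>b l. b \<in> B \<Longrightarrow> l \<ge> n0 b \<Longrightarrow> good l 0 b" by metis
  define n where "n = Max (insert 0 (n0 ` B))"
  have n: "n0 b \<le> n" if "b \<in> B" for b unfolding n_def using that B(2) by (intro Max_ge) auto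
  have "E l p q 1 v = 0" if l: "l \<ge> n" and pq: "p \<in> idx" "q \<in> idx" and v: "v \<in> W j" for l p q v
  proof (rule kill_span[OF pq B(1,3) _ v])
    fix b assume b: "b \<in> B"
    have "good l 0 b" using n0[OF b] n[OF b] l by simp
    then show "E l p q 1 b = 0" using goodD[OF _ pq] by simp
  qed
  then show ?thesis by blast
qed

lemma eventually_killed_window:
  assumes ek: "\<And>j. eventually_killed j = W j"
  shows "\<exists>n\<ge>1. \<forall>j\<in>{a..b}. \<forall>l\<ge>n. \<forall>p\<in>idx. \<forall>q\<in>idx. \<forall>v\<in>W j. E l p q 1 v = 0"
proof -
  obtain n where n: "\<And>j l p q v. l \<ge> n j \<Longrightarrow> p \<in> idx \<Longrightarrow> q \<in> idx \<Longrightarrow> v \<in> W j \<Longrightarrow> E l p q 1 v = 0"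
    using eventually_killed_uniform[OF ek] by metis
  define m where "m = Max (insert 1 (n ` {a..b}))"
  have "m \<ge> 1" unfolding m_def by (intro Max_ge) auto
  moreover have "n j \<le> m" if "j \<in> {a..b}" for j unfolding m_def using that by (intro Max_ge) auto
  ultimately show ?thesis using n by (intro exI[of _ m]) (meson order_trans)
qed

text \<open>
  The commutator of \<open>t\<^sup>l\<^sup>-\<^sup>1 E\<^sub>p\<^sub>p\<close>, which acts by zero, with \<open>t g(D) E\<^sub>p\<^sub>r\<close> is \<open>t\<^sup>l\<close> times an arbitrary
  polynomial, because differences \<open>g - g(X + l - 1)\<close> exhaust all polynomials.
\<close>

lemma all_killed_window:
  assumes n: "n \<ge> 1" and kill: "\<And>j l p q v. j \<in> {c..c + 4 * int N} \<Longrightarrow> l \<ge> n \<Longrightarrow> p \<in> idx \<Longrightarrow> q \<in> idx \<Longrightarrow>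
      v \<in> W j \<Longrightarrow> E l p q 1 v = 0"
    and j: "j \<in> {c..c + 2 * int N}" and pq: "p \<in> idx" "r \<in> idx" and l: "l \<ge> n + 1" and v: "v \<in> W j"
  shows "E l p r f v = 0"
proof -
  have br: "E l p r (g - (if p = r then shiftp (l - 1) g else 0)) v = 0" for g
  proof -
    have u: "E 1 p r g v \<in> W (j + int N + int p - int r)" using E_in'[OF pq v, of _ 1] by simp
    have "E (l - 1) p p 1 (E 1 p r g v) = 0"
      using j pq l by (intro kill[OF _ _ pq(1) pq(1) u]) auto
    moreover have "E (l - 1) p p 1 v = 0" using j pq l by (intro kill[OF _ _ pq(1) pq(1) v]) auto
    ultimately have "E l p r g v - (if r = p then E l p p (shiftp (l - 1) g) v else 0) = 0"
      using E_comm[OF pq(1) pq(1) pq v, of "l - 1" 1 1 g] l n pq by simp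
    then show ?thesis using E_difff[OF pq v] E_0f[OF pq v] by (auto split: if_splits)
  qed
  show ?thesis
  proof (cases "p = r")
    case True
    obtain u where "u - shiftp (l - 1) u = f" using shiftp_difference_surj[of "l - 1" f] l n by auto
    then show ?thesis using br[of u] True by simp
  next
    case False
    then show ?thesis using br[of f] by simp
  qed
qed

text \<open>
  The span of everything obtained from the degrees up to \<open>c + 2 N\<close> by operators of degree between
  \<open>0\<close> and \<open>2 N\<close>.
\<close>

inductive generated_up :: "int \<Rightarrow> int \<Rightarrow> 'b \<Rightarrow> bool" for c where
  base: "v \<in> W j \<Longrightarrow> j \<le> c + 2 * int N \<Longrightarrow> generated_up c j v"
| add: "generated_up c j v \<Longrightarrow> generated_up c j w \<Longrightarrow> generated_up c j (v + w)"
| scale: "generated_up c j v \<Longrightarrow> generated_up c j (a *s v)"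
| step: "generated_up c j v \<Longrightarrow> p \<in> {1..N} \<Longrightarrow> q \<in> {1..N} \<Longrightarrow> 0 \<le> k * int N + int p - int q \<Longrightarrow>
    k * int N + int p - int q \<le> 2 * int N \<Longrightarrow> j' = j + k * int N + int p - int q \<Longrightarrow>
    generated_up c j' (E k p q f v)"

lemma generated_up_W: "generated_up c j v \<Longrightarrow> v \<in> W j"
  by (induction rule: generated_up.induct) (auto intro: W_add W_scale E_in')

lemma generated_up_diff: "generated_up c j v \<Longrightarrow> generated_up c j w \<Longrightarrow> generated_up c j (v - w)"
  using generated_up.add[of c j v "(-1) *s w"] generated_up.scale[of c j w "-1"] by (simp add: scale_minus_left)

lemma generated_up_0: "generated_up c j v \<Longrightarrow> generated_up c j 0"
  using generated_up.scale[of c j v 0] by simp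

lemma generated_up_Z: "generated_up c j v \<Longrightarrow> generated_up c j (Z v)"
proof (induction rule: generated_up.induct)
  case (base v j) then show ?case using Z_in generated_up.base by blast
next
  case (add j v w)
  then show ?case using Z_add[OF generated_up_W generated_up_W, OF add.hyps(1,2)] generated_up.add by simp
next
  case (scale j v a)
  then show ?case using Z_scale[OF generated_up_W, OF scale.hyps(1)] generated_up.scale by simp
next
  case (step j v p q k j' f)
  then show ?case using Z_E[OF step.hyps(2,3) generated_up_W, OF step.hyps(1)] generated_up.step by simp
qed

text \<open>
  Operators of large degree are iterated commutators of those of degree at most \<open>2 N\<close>.
\<close>

lemma generated_up_pos:
  assumes "generated_up c j v" "p \<in> idx" "q \<in> idx" "0 \<le> k * int N + int p - int q"
    "j' = j + k * int N + int p - int q"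
  shows "generated_up c j' (E k p q f v)"
proof -
  have k0: "k \<ge> 0"
  proof (rule ccontr)
    assume "\<not> k \<ge> 0"
    then have "k * int N \<le> - 1 * int N" by (intro mult_right_mono) auto
    then show False using assms(2-4) by auto
  qed
  have "generated_up c (j + int n * int N + int p - int q) (E (int n) p q f v)"
    if "generated_up c j v" "p \<in> idx" "q \<in> idx" "0 \<le> int n * int N + int p - int q" for n j v p q f
    using that
  proof (induction n arbitrary: j v p q f rule: less_induct)
    case (less n)
    show ?case
    proof (cases "n \<le> 1")
      case True
      then consider "n = 0" | "n = 1" by linarith
      then have "int n * int N + int p - int q \<le> 2 * int N" using less.prems(2,3) by cases auto
      then show ?thesis using less.prems by (intro generated_up.step) auto
    next
      case False
      have vW: "v \<in> W j" using generated_up_W less.prems(1) by blast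
      have m: "n - 1 < n" "1 < n" using False by auto
      have im: "int (n - 1) = int n - 1" using False by simp
      have nn: "0 \<le> int (n - 1) * int N + int p - int p" "0 \<le> int 1 * int N + int p - int q"
        using less.prems(2,3) by auto
      have br: "generated_up c (j + int n * int N + int p - int q)
          (E (int n) p q (g - (if p = q then shiftp (int n - 1) g else 0)) v)" for g
      proof -
        have ix1: "j + int 1 * int N + int p - int q + int (n - 1) * int N + int p - int p = j + int n * int N + int p - int q"
          and ix2: "j + int (n - 1) * int N + int p - int p + int 1 * int N + int p - int q = j + int n * int N + int p - int q"
          unfolding im by (simp_all add: algebra_simps)
        have a: "generated_up c (j + int 1 * int N + int p - int q) (E (int 1) p q g v)"
          using less.IH[OF m(2) less.prems(1-3) nn(2)] .
        have b: "generated_up c (j + int (n - 1) * int N + int p - int p) (E (int (n - 1)) p p 1 v)"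
          using less.IH[OF m(1) less.prems(1,2,2) nn(1)] .
        have "generated_up c (j + int n * int N + int p - int q) (E (int (n - 1)) p p 1 (E (int 1) p q g v))"
          using less.IH[OF m(1) a less.prems(2,2) nn(1)] unfolding ix1 .
        moreover have "generated_up c (j + int n * int N + int p - int q) (E (int 1) p q g (E (int (n - 1)) p p 1 v))"
          using less.IH[OF m(2) b less.prems(2,3) nn(2)] unfolding ix2 .
        ultimately have "generated_up c (j + int n * int N + int p - int q)
          (E (int (n - 1)) p p 1 (E (int 1) p q g v) - E (int 1) p q g (E (int (n - 1)) p p 1 v))"
          by (rule generated_up_diff)
        moreover have "E (int (n - 1)) p p 1 (E (int 1) p q g v) - E (int 1) p q g (E (int (n - 1)) p p 1 v)
          = E (int n) p q g v - (if p = q then E (int n) p p (shiftp (int n - 1) g) v else 0)"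
          using E_comm[OF less.prems(2,2,2,3) vW, of "int (n - 1)" 1 1 g] False im less.prems by auto
        ultimately show ?thesis using E_difff[OF less.prems(2,3) vW] E_0f[OF less.prems(2,3) vW] by (auto split: if_splits)
      qed
      show ?thesis
      proof (cases "p = q")
        case True
        obtain u where "u - shiftp (int n - 1) u = f"
          using shiftp_difference_surj[of "int n - 1" f] \<open>\<not> n \<le> 1\<close> by auto
        then show ?thesis using br[of u] True by simp
      next
        case False
        then show ?thesis using br[of f] by simp
      qed
    qed
  qed
  from this[OF assms(1-3), of "nat k" f] assms(4,5) k0 show ?thesis by simp
qed

text \<open>
  A lowering operator is commuted past the last raising one; the commutator has smaller degree than
  the raising operator and is covered by the induction hypothesis or by the nonnegative case.
\<close>

lemma generated_up_neg:
  assumes "generated_up c j v" "p \<in> idx" "q \<in> idx" "k * int N + int p - int q < 0"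
    "j' = j + k * int N + int p - int q"
  shows "generated_up c j' (E k p q f v)"
  using assms
proof (induction arbitrary: k p q f j' rule: generated_up.induct)
  case (base v j)
  then show ?case using E_in'[OF base.prems(1,2) base.hyps(1) base.prems(4)] by (intro generated_up.base) auto
next
  case (add j v w)
  have "E k p q f (v + w) = E k p q f v + E k p q f w"
    using E_add[OF add.prems(1,2) generated_up_W generated_up_W, OF add.hyps(1,2)] .
  then show ?case using add.IH add.prems generated_up.add by simp
next
  case (scale j v a)
  have "E k p q f (a *s v) = a *s E k p q f v" using E_scale[OF scale.prems(1,2) generated_up_W, OF scale.hyps(1)] .
  then show ?case using scale.IH scale.prems generated_up.scale by simp
next
  case (step j v r s l j1 g)
  have vW: "v \<in> W j" using generated_up_W step.hyps(1) by blast
  define u where "u = E k p q f v"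
  have u: "generated_up c (j + k * int N + int p - int q) u"
    unfolding u_def using step.IH[OF step.prems(1-3) refl] .
  have t1: "generated_up c j' (E l r s g u)"
    using generated_up.step[OF u step.hyps(2-5), of j' g] step.prems(4) step.hyps(6) by simp
  have any: "generated_up c (j + m * int N + int a - int b) (E m a b h v)"
    if ab: "a \<in> idx" "b \<in> idx" for m a b h
  proof (cases "0 \<le> m * int N + int a - int b")
    case True then show ?thesis using generated_up_pos[OF step.hyps(1) ab True refl] by simp
  next
    case False then show ?thesis using step.IH[OF ab _ refl, of m h] by simp
  qed
  have z: "generated_up c j' 0" using generated_up_0[OF t1] .
  have t2: "generated_up c j' (if q = r then E (k + l) p s (shiftp l f * g) v else 0)"
  proof (cases "q = r")
    case True
    have "j + (k + l) * int N + int p - int s = j'"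
      unfolding step.prems(4) step.hyps(6) True by (simp add: algebra_simps)
    then show ?thesis using any[OF step.prems(1) step.hyps(3), of "k + l" "shiftp l f * g"] True by simp
  qed (use z in simp)
  have t3: "generated_up c j' (if s = p then E (k + l) r q (shiftp k g * f) v else 0)"
  proof (cases "s = p")
    case True
    have "j + (k + l) * int N + int r - int q = j'"
      unfolding step.prems(4) step.hyps(6) True by (simp add: algebra_simps)
    then show ?thesis using any[OF step.hyps(2) step.prems(2), of "k + l" "shiftp k g * f"] True by simp
  qed (use z in simp)
  have t4: "generated_up c j' (if k + l = 0 \<and> q = r \<and> p = s then \<psi> k f g *s Z v else 0)"
  proof (cases "k + l = 0 \<and> q = r \<and> p = s")
    case True
    then have kl: "k = - l" and pq: "q = r" "p = s" by auto
    have "j' = j" unfolding step.prems(4) step.hyps(6) pq kl by simp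
    then show ?thesis using generated_up.scale[OF generated_up_Z[OF step.hyps(1)]] z by auto
  next
    case False
    show ?thesis unfolding if_not_P[OF False] by (rule z)
  qed
  have "E k p q f (E l r s g v) = E l r s g u + ((if q = r then E (k + l) p s (shiftp l f * g) v else 0)
        - (if s = p then E (k + l) r q (shiftp k g * f) v else 0)
        + (if k + l = 0 \<and> q = r \<and> p = s then \<psi> k f g *s Z v else 0))"
    unfolding u_def E_comm[OF step.prems(1,2) step.hyps(2,3) vW, of k f l g, symmetric] by simp
  then show ?case using generated_up.add[OF t1 generated_up.add[OF generated_up_diff[OF t2 t3] t4]] by simp
qed

lemma stable_generated_up: "stable (\<lambda>j. {v. generated_up c j v})"
  unfolding stable_def
proof (intro conjI allI ballI)
  fix j
  show "subspace {v. generated_up c j v}"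
  proof (rule subspaceI)
    show "0 \<in> {v. generated_up c j v}"
    proof (cases "j \<le> c + 2 * int N")
      case True then show ?thesis using generated_up.base[of 0 j c] by simp
    next
      case False
      define k where "k = (j - c) div int N"
      have "generated_up c (j - (k * int N)) 0"
      proof (rule generated_up.base)
        have "j - k * int N = c + (j - c) mod int N" unfolding k_def by (simp add: minus_div_mult_eq_mod[symmetric])
        moreover have "(j - c) mod int N < int N" using N by simp
        ultimately show "j - k * int N \<le> c + 2 * int N" by linarith
      qed simp
      moreover have "0 \<le> k" unfolding k_def using False N by (intro pos_imp_zdiv_nonneg_iff[THEN iffD2]) auto
      ultimately have "generated_up c j (E k 1 1 0 0)"
        using N by (intro generated_up_pos[where k = k and p = 1 and q = 1]) auto
      then show ?thesis using N by simp
    qed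
  qed (auto intro: generated_up.add generated_up.scale)
  show "{v. generated_up c j v} \<subseteq> W j" using generated_up_W by blast
next
  fix j k p q f v assume "p \<in> idx" "q \<in> idx" "v \<in> {v. generated_up c j v}"
  then show "E k p q f v \<in> {v. generated_up c (j + k * int N + int p - int q) v}"
    using generated_up_pos generated_up_neg by (cases "0 \<le> k * int N + int p - int q") auto
qed (use generated_up_Z in auto)

text \<open>
  Operators of degree at least \<open>n\<close> are preserved under commutators with operators of nonnegative
  degree, so annihilation propagates from the window to all that is generated from it.
\<close>

lemma generated_up_killed:
  assumes n: "n \<ge> 1"
    and kill: "\<And>j k p q f v. j \<in> {c..c + 2 * int N} \<Longrightarrow> p \<in> idx \<Longrightarrow> q \<in> idx \<Longrightarrow> v \<in> W j \<Longrightarrow>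
      k * int N + int p - int q \<ge> n \<Longrightarrow> E k p q f v = 0"
    and up: "generated_up c j v" and j: "j \<ge> c" and pq: "p \<in> idx" "q \<in> idx"
    and deg: "k * int N + int p - int q \<ge> n"
  shows "E k p q f v = 0"
  using up j pq deg
proof (induction arbitrary: k p q f rule: generated_up.induct)
  case (base v j)
  then show ?case using kill[of j p q v k f] by simp
next
  case (add j v w)
  then show ?case using E_add[OF add.prems(2,3) generated_up_W generated_up_W, OF add.hyps(1,2)] by simp
next
  case (scale j v a)
  then show ?case using E_scale[OF scale.prems(2,3) generated_up_W, OF scale.hyps(1)] by simp
next
  case (step j v r s l j1 g)
  have vW: "v \<in> W j" using generated_up_W step.hyps(1) by blast
  show ?case
  proof (cases "j \<ge> c")
    case False
    then have "j1 \<in> {c..c + 2 * int N}" using step.prems(1) step.hyps(5,6) by simp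
    moreover have "E l r s g v \<in> W j1" using E_in'[OF step.hyps(2,3) vW step.hyps(6)] .
    ultimately show ?thesis using kill step.prems by blast
  next
    case True
    have i: "E m a b h v = 0" if "a \<in> idx" "b \<in> idx" "m * int N + int a - int b \<ge> n" for m a b h
      using step.IH[OF True that] .
    have d: "(k + l) * int N + (int p - int q) + (int r - int s) \<ge> n"
      using step.prems(4) step.hyps(4) by (simp add: algebra_simps)
    have "E k p q f (E l r s g v) - E l r s g (E k p q f v) = 0"
    proof -
      have 1: "E (k + l) p s (shiftp l f * g) v = 0" if "q = r"
        using i[OF step.prems(2) step.hyps(3)] d that by simp
      have 2: "E (k + l) r q (shiftp k g * f) v = 0" if "s = p"
        using i[OF step.hyps(2) step.prems(3)] d that by simp
      have 3: "\<not> (k + l = 0 \<and> q = r \<and> p = s)" using d n by auto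
      show ?thesis using E_comm[OF step.prems(2,3) step.hyps(2,3) vW, of k f l g] 1 2 3 by auto
    qed
    moreover have "E k p q f v = 0" using i step.prems by blast
    ultimately show ?thesis using step.hyps(2,3) by simp
  qed
qed

text \<open>
  If some nonzero vector is eventually killed, all are, and a window of degrees is killed by all
  operators of large degree \<open>\<ge> n\<close>. Everything above the window is generated from it by operators
  of nonnegative degree, which preserve this property. Far above the window every operator of
  positive degree is then a commutator of one of degree \<open>\<ge> n\<close> with one of negative degree, so it
  acts by zero. Hence there is a degree annihilated by all operators of positive degree, or the
  degrees are bounded above.
\<close>

lemma top_degree_exists:
  assumes simple: gsimple and v0: "v0 \<in> eventually_killed j0" "v0 \<noteq> 0"
  shows "\<exists>j. top_degree j"
proof -
  have ek: "eventually_killed j = W j" for j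
  proof -
    have "eventually_killed j0 \<noteq> {0}" using v0 by blast
    then show ?thesis using simple stable_eventually_killed unfolding gsimple_def by blast
  qed
  obtain c where c: "W c \<noteq> {0}" using simple unfolding gsimple_def by blast
  obtain n where n: "n \<ge> 1" "\<And>j l p q v. j \<in> {c..c + 4 * int N} \<Longrightarrow> l \<ge> n \<Longrightarrow> p \<in> idx \<Longrightarrow> q \<in> idx \<Longrightarrow>
      v \<in> W j \<Longrightarrow> E l p q 1 v = 0"
    using eventually_killed_window[OF ek, of c "c + 4 * int N"] by meson
  define n1 where "n1 = (n + 2) * int N"
  have N1: "int N \<ge> 1" using N by simp
  have n1: "n1 \<ge> 1" unfolding n1_def using n(1) N1 by (intro int_mult_ge1) auto
  have kill: "E k p q f v = 0" if "j \<in> {c..c + 2 * int N}" "p \<in> idx" "q \<in> idx" "v \<in> W j"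
    "k * int N + int p - int q \<ge> n1" for j k p q f v
  proof (rule all_killed_window[OF n that(1,2,3) _ that(4)])
    show "k \<ge> n + 1"
    proof (rule ccontr)
      assume "\<not> k \<ge> n + 1"
      then have "k * int N \<le> n * int N" by (intro mult_right_mono) auto
      then show False using that(2,3,5) by (auto simp: n1_def algebra_simps)
    qed
  qed
  have gen: "generated_up c j v" if "v \<in> W j" for j v
  proof -
    obtain w where w: "w \<in> W c" "w \<noteq> 0" using c W_0 by blast
    have "{v. generated_up c c v} \<noteq> {0}" using generated_up.base[OF w(1), of c] w(2) by auto
    then have "\<forall>j. {v. generated_up c j v} = W j"
      using simple stable_generated_up[of c] unfolding gsimple_def by meson
    then show ?thesis using that by blast
  qed
  have up: "E k p q f v = 0" if "j \<ge> c" "p \<in> idx" "q \<in> idx" "v \<in> W j" "k * int N + int p - int q \<ge> n1" for j k p q f v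
    by (rule generated_up_killed[OF n1 _ gen[OF that(4)] that(1,2,3,5)]) (rule kill)
  \<comment> \<open>from degree \<open>J\<close> on, \<open>t\<close> to the power \<open>-n1\<close> times a matrix unit does not leave the degrees \<open>\<ge> c\<close>\<close>
  define J where "J = c + (n1 + 1) * int N"
  have far: "E l p r f v = 0" if j: "j \<ge> J" and pr: "p \<in> idx" "r \<in> idx" and v: "v \<in> W j"
    and pos: "l * int N + int p - int r > 0" for j l p r f v
  proof -
    have l: "l \<ge> 0"
    proof (rule ccontr)
      assume "\<not> l \<ge> 0"
      then have "l * int N \<le> - 1 * int N" by (intro mult_right_mono) auto
      then show False using pos pr by auto
    qed
    have Nn: "n1 * int N \<ge> n1 * 1" using n1 N1 by (intro mult_left_mono) auto
    have big: "(l + n1) * int N + int p - int p \<ge> n1"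
      using mult_nonneg_nonneg[OF l, of "int N"] Nn by (simp add: distrib_right)
    have j1: "j \<ge> c"
      using j n1 mult_nonneg_nonneg[of "n1 + 1" "int N"] unfolding J_def by linarith
    have j2: "j + (- n1) * int N + int p - int r \<ge> c"
      using j pr unfolding J_def by (simp add: algebra_simps)
    have br: "E l p r (g - (if p = r then shiftp (l + n1) g else 0)) v = 0" for g
    proof -
      have u: "E (- n1) p r g v \<in> W (j + (- n1) * int N + int p - int r)" by (rule E_in[OF pr v])
      have "E (l + n1) p p 1 (E (- n1) p r g v) = 0" using up[OF j2 pr(1,1) u big] .
      moreover have "E (l + n1) p p 1 v = 0" using up[OF j1 pr(1,1) v big] .
      moreover have "\<not> (l = 0 \<and> p = r)" using pos by auto
      ultimately have "E l p r g v - (if r = p then E l p p (shiftp (l + n1) g) v else 0) = 0"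
        using E_comm[OF pr(1,1) pr v, of "l + n1" 1 "- n1" g] pr by auto
      then show ?thesis using E_difff[OF pr v] E_0f[OF pr v] by (auto split: if_splits)
    qed
    show ?thesis
    proof (cases "p = r")
      case True
      obtain u where "u - shiftp (l + n1) u = f" using shiftp_difference_surj[of "l + n1" f] l n1 by auto
      then show ?thesis using br[of u] True by simp
    next
      case False
      then show ?thesis using br[of f] by simp
    qed
  qed
  show ?thesis
  proof (cases "\<exists>j\<ge>J. W j \<noteq> {0}")
    case True
    then show ?thesis unfolding top_degree_def using far by blast
  next
    case False
    define D where "D = {j \<in> {c..J}. W j \<noteq> {0}}"
    have "c \<le> J" unfolding J_def using n1 mult_nonneg_nonneg[of "n1 + 1" "int N"] by linarith
    then have cD: "c \<in> D" using c unfolding D_def by simp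
    have finD: "finite D" unfolding D_def by (rule finite_subset[of _ "{c..J}"]) auto
    define m where "m = Max D"
    have m: "m \<in> D" unfolding m_def using finD cD by (intro Max_in) auto
    have "W j = {0}" if "j > m" for j
    proof (rule ccontr)
      assume "W j \<noteq> {0}"
      then have "j < J" using False by (auto simp: not_le)
      then have "j \<in> D" using \<open>W j \<noteq> {0}\<close> that m unfolding D_def by auto
      then show False using that finD Max_ge unfolding m_def by (metis not_le)
    qed
    then have "E k p q f v = 0" if "p \<in> idx" "q \<in> idx" "v \<in> W m" "k * int N + int p - int q > 0" for k p q f v
      using E_in[OF that(1-3), of k f] that(4) by (auto simp: add_diff_eq[symmetric] add.assoc)
    moreover have "W m \<noteq> {0}" using m unfolding D_def by simp
    ultimately show ?thesis unfolding top_degree_def by blast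
  qed
qed

text \<open>Without a highest weight vector, finitely many operators, their number independent of the
  degree, map \<open>W j\<close> for \<open>j < 0\<close> injectively into a fixed window.\<close>

lemma bounded_below_zero:
  assumes simple: gsimple and no: "\<nexists>j. top_degree j"
  shows "\<exists>K. \<forall>j<0. rank_le K (W j)"
proof -
  obtain Kf where Kf: "\<And>j. rank_le (Kf j) (W j)" using W_fin by metis
  define K0 where "K0 = Max (Kf ` {- int N..3 * int N})"
  have K0: "rank_le K0 (W j)" if "j \<in> {- int N..3 * int N}" for j
  proof (rule rank_le_mono[OF Kf])
    show "Kf j \<le> K0" unfolding K0_def using that by (intro Max_ge) auto
  qed
  \<comment> \<open>two exponents of \<open>t\<close>, \<open>N\<^sup>2\<close> matrix units and the polynomials \<open>1\<close>, \<open>X\<close>, \<open>X\<^sup>2\<close>\<close>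
  define len where "len = 2 * N * N * 3"
  define n where "n = (K0 + 1) ^ len"
  have "rank_le (n - 1) (W j)" if j: "j < 0" for j
  proof (rule rank_le_if_relations[OF W_sub])
    show "n \<ge> 1" unfolding n_def by simp
    fix x :: "nat \<Rightarrow> 'b" assume x: "\<And>i. i < n \<Longrightarrow> x i \<in> W j"
    define a where "a = - (j div int N)"
    define r where "r = j mod int N"
    have N1: "int N \<ge> 1" using N by simp
    have r: "0 \<le> r" "r < int N" using N1 by (simp_all add: r_def)
    have jar: "j = - a * int N + r" unfolding a_def r_def by simp
    have a: "a \<ge> 1"
    proof (rule ccontr)
      assume "\<not> a \<ge> 1"
      then have "- a * int N \<ge> 0" by (intro mult_nonneg_nonneg) auto
      then show False using jar j r by simp
    qed
    define T where "T = List.product [a, a + 1] (List.product [1..<N+1] (List.product [1..<N+1] [0..<3]))"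
    have setT: "set T = {a, a + 1} \<times> idx \<times> idx \<times> {..<3}" unfolding T_def by auto
    define maps where "maps = map (\<lambda>(l, p, q, i). E l p q (monom 1 i)) T"
    have len: "length maps = len" by (simp add: maps_def T_def len_def length_product)
    have elem: "\<exists>l p q i. F = E l p q (monom 1 i) \<and> l \<in> {a, a + 1} \<and> p \<in> idx \<and> q \<in> idx" if F: "F \<in> set maps" for F
    proof -
      obtain t where t: "t \<in> set T" "F = (case t of (l, p, q, i) \<Rightarrow> E l p q (monom 1 i))"
        using F unfolding maps_def set_map by blast
      obtain l p q i where lpqi: "t = (l, p, q, i)" by (cases t)
      have "l \<in> {a, a + 1} \<and> p \<in> idx \<and> q \<in> idx" using t(1) unfolding setT lpqi by blast
      moreover have "F = E l p q (monom 1 i)" using t(2) lpqi by simp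
      ultimately show ?thesis by blast
    qed
    have "\<exists>c. (\<exists>i<n. c i \<noteq> 0) \<and> (\<forall>F\<in>set maps. F (\<Sum>i<n. c i *s x i) = 0)"
      unfolding n_def len[symmetric]
    proof (rule common_kernel_combination[where S = "W j"])
      show "vector_space scale" by unfold_locales
      show "(\<Sum>i<(m::nat). c i *s h i) \<in> W j" if "\<And>i. i < m \<Longrightarrow> h i \<in> W j" for m :: nat and c h
        using that by (intro W_sum W_scale) auto
    next
      fix F and m :: nat and c h assume "F \<in> set maps" and h: "\<And>i. i < m \<Longrightarrow> h i \<in> W j"
      then obtain l p q i where F: "F = E l p q (monom 1 i)" "p \<in> idx" "q \<in> idx" using elem by blast
      have "E l p q (monom 1 i) (\<Sum>i<m. c i *s h i) = (\<Sum>t<m. E l p q (monom 1 i) (c t *s h t))"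
        using h by (intro E_sum[OF F(2,3), where j = j] W_scale) auto
      also have "\<dots> = (\<Sum>t<m. c t *s E l p q (monom 1 i) (h t))"
        using h by (intro sum.cong refl E_scale[OF F(2,3)]) auto
      finally show "F (\<Sum>i<(m::nat). c i *s h i) = (\<Sum>i<m. c i *s F (h i))" unfolding F(1) .
    next
      fix F assume "F \<in> set maps"
      then obtain l p q i where F: "F = E l p q (monom 1 i)" "l \<in> {a, a + 1}" "p \<in> idx" "q \<in> idx" using elem by blast
      let ?t = "j + l * int N + int p - int q"
      have "l * int N = a * int N \<or> l * int N = a * int N + int N" using F(2) by (auto simp: distrib_right)
      then have "?t \<in> {- int N..3 * int N}" using jar r F(3,4) by auto
      then have "rank_le K0 (W ?t)" by (rule K0)
      then obtain B where "finite B" "card B \<le> K0" "W ?t \<subseteq> span B" unfolding rank_le_def by blast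
      moreover have "F ` W j \<subseteq> W ?t" unfolding F(1) using E_in[OF F(3,4)] by blast
      ultimately show "\<exists>B. finite B \<and> card B \<le> K0 \<and> F ` W j \<subseteq> span B" by (meson subset_trans)
    next
      fix i assume "i < (K0 + 1) ^ length maps"
      then show "x i \<in> W j" using x by (simp add: n_def len)
    qed
    then obtain c where c: "\<exists>i<n. c i \<noteq> 0" "\<And>F. F \<in> set maps \<Longrightarrow> F (\<Sum>i<n. c i *s x i) = 0" by blast
    define v where "v = (\<Sum>i<n. c i *s x i)"
    have v: "v \<in> W j" unfolding v_def using x by (intro W_sum W_scale) auto
    have g: "good l 2 v" if l: "l \<in> {a, a + 1}" for l
    proof (rule good_by_degrees[OF v])
      fix p q i :: nat assume pq: "p \<in> idx" "q \<in> idx" "i \<le> 2"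
      have "E l p q (monom 1 i) \<in> set maps"
        unfolding maps_def set_map setT using l pq by (force simp: image_iff)
      then show "\<exists>f. f \<noteq> 0 \<and> degree f = i \<and> E l p q f v = 0"
        using c(2) unfolding v_def by (intro exI[of _ "monom 1 i"]) (auto simp: degree_monom_eq monom_eq_0_iff)
    qed
    have "v \<in> eventually_killed j" using good_imp_eventually_killed[OF v a] g by simp
    then have "v = 0" using top_degree_exists[OF simple] no by blast
    then show "\<exists>c. (\<exists>i<n. c i \<noteq> 0) \<and> (\<Sum>i<n. c i *s x i) = 0" using c(1) unfolding v_def by blast
  qed
  then show ?thesis by blast
qed

end

section \<open>Two symmetries\<close>

definition negp :: "complex poly \<Rightarrow> complex poly" where
  "negp f = pcompose f [:0, -1:]"

definition dualp :: "int \<Rightarrow> complex poly \<Rightarrow> complex poly" where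
  "dualp k f = pcompose f [:- of_int k, -1:]"

lemma poly_negp [simp]: "poly (negp f) x = poly f (- x)"
  by (simp add: negp_def poly_pcompose)

lemma poly_dualp [simp]: "poly (dualp k f) x = poly f (- x - of_int k)"
  by (simp add: dualp_def poly_pcompose algebra_simps)

lemma negp_algebra: "negp (f + g) = negp f + negp g" "negp (Polynomial.smult c f) = Polynomial.smult c (negp f)"
  "negp (f * g) = negp f * negp g" "negp (shiftp l f) = shiftp (- l) (negp f)" "negp (negp f) = f"
  by (rule poly_ext; simp add: algebra_simps)+

lemma dualp_algebra: "dualp k (f + g) = dualp k f + dualp k g"
  "dualp k (Polynomial.smult c f) = Polynomial.smult c (dualp k f)"
  "dualp (k + l) (shiftp l f * g) = shiftp k (dualp l g) * dualp k f" "dualp k (dualp k f) = f"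
  "dualp 0 f = negp f"
  by (rule poly_ext; simp add: algebra_simps)+

lemma degree_negp [simp]: "degree (negp f) = degree f"
  by (simp add: negp_def degree_pcompose)

lemma negp_eq_0_iff [simp]: "negp f = 0 \<longleftrightarrow> f = 0"
  by (metis negp_algebra(5) negp_def pcompose_0)

context gmod
begin

text \<open>The automorphism \<open>t \<mapsto> 1/t\<close>, \<open>D \<mapsto> -D\<close>, \<open>E\<^sub>p\<^sub>q \<mapsto> E\<^sub>N\<^sub>+\<^sub>1\<^sub>-\<^sub>p\<^sub>,\<^sub>N\<^sub>+\<^sub>1\<^sub>-\<^sub>q\<close> reverses the gradation.\<close>

definition flipE :: "int \<Rightarrow> nat \<Rightarrow> nat \<Rightarrow> complex poly \<Rightarrow> 'b \<Rightarrow> 'b" where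
  "flipE k p q f = E (- k) (N + 1 - p) (N + 1 - q) (negp f)"

lemma idx_flip: "p \<in> idx \<Longrightarrow> N + 1 - p \<in> idx"
  by auto

lemma idx_flip_eq: "p \<in> idx \<Longrightarrow> q \<in> idx \<Longrightarrow> N + 1 - p = N + 1 - q \<longleftrightarrow> p = q"
  by auto

lemma int_flip: "p \<in> idx \<Longrightarrow> int (N + 1 - p) = int N + 1 - int p"
  by auto

text \<open>
  The cocycle is transported along, and becomes the one with \<open>k\<close> and \<open>D\<close> negated.
\<close>

lemma flip_gmod: "gmod scale N flipE Z (\<lambda>k f g. \<psi> (- k) (negp f) (negp g)) (\<lambda>j. W (- j))"
proof (unfold_locales, goal_cases)
  case 1 show ?case by (rule N)
next
  case (2 j) show ?case by (rule W_sub)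
next
  case (3 j) show ?case by (rule W_fin)
next
  case (4 p q v j k f)
  then show ?case unfolding flipE_def
    by (intro E_in'[OF idx_flip idx_flip]) (simp_all add: int_flip)
next
  case (5 p q v j w k f)
  show ?case unfolding flipE_def by (rule E_add[OF 5(1,2)[THEN idx_flip] 5(3,4)])
next
  case (6 p q v j k f c)
  show ?case unfolding flipE_def by (rule E_scale[OF 6(1,2)[THEN idx_flip] 6(3)])
next
  case (7 p q v j k f g)
  show ?case unfolding flipE_def negp_algebra by (rule E_addf[OF 7(1,2)[THEN idx_flip] 7(3)])
next
  case (8 p q v j k c f)
  show ?case unfolding flipE_def negp_algebra by (rule E_smult[OF 8(1,2)[THEN idx_flip] 8(3)])
next
  case (9 v j) then show ?case by (rule Z_in)
next
  case (10 v j w) then show ?case by (rule Z_add)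
next
  case (11 v j c) then show ?case by (rule Z_scale)
next
  case (12 p q v j k f)
  show ?case unfolding flipE_def by (rule Z_E[OF 12(1,2)[THEN idx_flip] 12(3)])
next
  case (13 f g) show ?case using \<psi>_0 by simp
next
  case (14 p q r s v j k f l g)
  note i = 14(1-4)[THEN idx_flip]
  have e: "- k + - l = - (k + l)" "(- (k + l) = 0) = (k + l = 0)" by auto
  show ?case
    unfolding flipE_def E_comm[OF i 14(5)] idx_flip_eq[OF 14(2,3)] idx_flip_eq[OF 14(4,1)]
      idx_flip_eq[OF 14(1,4)] e negp_algebra ..
qed

lemma flip_stable:
  assumes "gmod.stable scale N flipE Z (\<lambda>j. W (- j)) A"
  shows "stable (\<lambda>j. A (- j))"
proof -
  interpret F: gmod scale N flipE Z "\<lambda>k f g. \<psi> (- k) (negp f) (negp g)" "\<lambda>j. W (- j)" by (rule flip_gmod)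
  show ?thesis unfolding stable_def
  proof (intro conjI allI ballI)
    fix j k p q f v assume pq: "p \<in> idx" "q \<in> idx" and v: "v \<in> A (- j)"
    have a: "flipE (- k) (N + 1 - p) (N + 1 - q) (negp f) v \<in> A (- j + (- k) * int N + int (N + 1 - p) - int (N + 1 - q))"
      using assms idx_flip[OF pq(1)] idx_flip[OF pq(2)] v unfolding F.stable_def by blast
    have b: "flipE (- k) (N + 1 - p) (N + 1 - q) (negp f) v = E k p q f v"
      using pq by (simp add: flipE_def negp_algebra)
    have c: "- j + (- k) * int N + int (N + 1 - p) - int (N + 1 - q) = - (j + k * int N + int p - int q)"
      unfolding int_flip[OF pq(1)] int_flip[OF pq(2)] by simp
    show "E k p q f v \<in> A (- (j + k * int N + int p - int q))" using a unfolding b c .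
  next
    fix j show "A (- j) \<subseteq> W j" using assms unfolding F.stable_def by (metis minus_minus)
  qed (use assms in \<open>auto simp: F.stable_def\<close>)
qed

definition bottom_degree :: "int \<Rightarrow> bool" where
  "bottom_degree j \<longleftrightarrow> W j \<noteq> {0} \<and> (\<forall>k. \<forall>p\<in>idx. \<forall>q\<in>idx. \<forall>f. \<forall>v\<in>W j.
     k * int N + int p - int q < 0 \<longrightarrow> E k p q f v = 0)"

lemma bounded_above_zero:
  assumes simple: gsimple and no: "\<nexists>j. bottom_degree j"
  shows "\<exists>K. \<forall>j>0. rank_le K (W j)"
proof -
  interpret F: gmod scale N flipE Z "\<lambda>k f g. \<psi> (- k) (negp f) (negp g)" "\<lambda>j. W (- j)" by (rule flip_gmod)
  have "F.gsimple" unfolding F.gsimple_def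
  proof (intro conjI allI impI)
    obtain j where "W j \<noteq> {0}" using simple unfolding gsimple_def by blast
    then have "W (- (- j)) \<noteq> {0}" by simp
    then show "\<exists>j. W (- j) \<noteq> {0}" by blast
    fix A assume "F.stable A"
    from flip_stable[OF this] consider "\<forall>j. A (- j) = {0}" | "\<forall>j. A (- j) = W j"
      using simple unfolding gsimple_def by blast
    then show "(\<forall>j. A j = {0}) \<or> (\<forall>j. A j = W (- j))"
      by cases (metis minus_minus)+
  qed
  moreover have "\<nexists>j. F.top_degree j"
  proof
    assume "\<exists>j. F.top_degree j"
    then obtain j where j: "F.top_degree j" by blast
    have "bottom_degree (- j)" unfolding bottom_degree_def
    proof (intro conjI allI ballI impI)
      show "W (- j) \<noteq> {0}" using j by (simp add: F.top_degree_def)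
      fix k p q f v assume pq: "p \<in> idx" "q \<in> idx" and v: "v \<in> W (- j)" and d: "k * int N + int p - int q < 0"
      have "(- k) * int N + int (N + 1 - p) - int (N + 1 - q) > 0"
        unfolding int_flip[OF pq(1)] int_flip[OF pq(2)] using d by simp
      then have "flipE (- k) (N + 1 - p) (N + 1 - q) (negp f) v = 0"
        using j idx_flip[OF pq(1)] idx_flip[OF pq(2)] v unfolding F.top_degree_def by blast
      then show "E k p q f v = 0" using pq by (simp add: flipE_def negp_algebra)
    qed
    then show False using no by blast
  qed
  ultimately obtain K where K: "\<And>j. j < 0 \<Longrightarrow> rank_le K (W (- j))" using F.bounded_below_zero by blast
  have "rank_le K (W j)" if "j > 0" for j using K[of "- j"] that by simp
  then show ?thesis by blast
qed

theorem top_bottom_or_bounded: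
  assumes simple: gsimple and "\<nexists>j. top_degree j" "\<nexists>j. bottom_degree j"
  shows "\<exists>K. \<forall>j. rank_le K (W j)"
proof -
  obtain K1 where K1: "\<And>j. j < 0 \<Longrightarrow> rank_le K1 (W j)" using bounded_below_zero assms by blast
  obtain K2 where K2: "\<And>j. j > 0 \<Longrightarrow> rank_le K2 (W j)" using bounded_above_zero assms by blast
  obtain K3 where K3: "rank_le K3 (W 0)" using W_fin by blast
  have "rank_le (max K1 (max K2 K3)) (W j)" for j
  proof (cases j "0 :: int" rule: linorder_cases)
    case less show ?thesis by (rule rank_le_mono[OF K1[OF less]]) simp
  next
    case equal then show ?thesis using rank_le_mono[OF K3] by simp
  next
    case greater show ?thesis by (rule rank_le_mono[OF K2[OF greater]]) simp
  qed
  then show ?thesis by blast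
qed

section \<open>Decomposition into blocks\<close>

definition gindec :: bool where
  "gindec \<longleftrightarrow> (\<forall>A B. stable A \<longrightarrow> stable B \<longrightarrow> (\<forall>j. A j \<inter> B j = {0}) \<longrightarrow>
     (\<forall>j. \<forall>v\<in>W j. \<exists>a\<in>A j. \<exists>b\<in>B j. v = a + b) \<longrightarrow> (\<forall>j. A j = {0}) \<or> (\<forall>j. B j = {0}))"

lemma gsimple_gindec: "gsimple \<Longrightarrow> gindec"
  unfolding gindec_def
proof (intro allI impI)
  fix A B assume g: gsimple and A: "stable A" and B: "stable B" and d: "\<forall>j. A j \<inter> B j = {0}"
  have "(\<forall>j. A j = {0}) \<or> (\<forall>j. A j = W j)" using g A unfolding gsimple_def by blast
  moreover have "B j \<subseteq> W j" for j using B unfolding stable_def by blast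
  ultimately show "(\<forall>j. A j = {0}) \<or> (\<forall>j. B j = {0})" using d by blast
qed

lemma stableI:
  assumes "\<And>j. subspace (A j)" "\<And>j. A j \<subseteq> W j"
    and "\<And>j k p q f v. p \<in> idx \<Longrightarrow> q \<in> idx \<Longrightarrow> v \<in> A j \<Longrightarrow> E k p q f v \<in> A (j + k * int N + int p - int q)"
    and "\<And>j v. v \<in> A j \<Longrightarrow> Z v \<in> A j"
  shows "stable A"
  unfolding stable_def using assms by blast

text \<open>An operator of degree \<open>0\<close> that commutes with everything and has a kernel is nilpotent on every
  degree of an indecomposable family, by Fitting's lemma.\<close>

lemma commuting_nilpotent:
  fixes T :: "int \<Rightarrow> 'b \<Rightarrow> 'b"
  assumes indec: gindec and endo: "\<And>j. endo scale (W j) (T j)"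
    and comm: "\<And>j k p q f v. p \<in> idx \<Longrightarrow> q \<in> idx \<Longrightarrow> v \<in> W j \<Longrightarrow>
      T (j + k * int N + int p - int q) (E k p q f v) = E k p q f (T j v)"
    and commZ: "\<And>j v. v \<in> W j \<Longrightarrow> T j (Z v) = Z (T j v)"
    and ker: "v0 \<in> W j0" "v0 \<noteq> 0" "T j0 v0 = 0" and v: "v \<in> W j"
  shows "\<exists>n. (T j ^^ n) v = 0"
proof -
  define P where "P j m w = endo.opp scale (T j) m w" for j m w
  define A where "A j = {v \<in> W j. \<exists>n. (T j ^^ n) v = 0}" for j
  define B where "B j = {v \<in> W j. \<exists>m. poly m 0 \<noteq> 0 \<and> P j m v = 0}" for j
  have pow: "(T (j + k * int N + int p - int q) ^^ n) (E k p q f v) = E k p q f ((T j ^^ n) v)"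
    if "p \<in> idx" "q \<in> idx" "v \<in> W j" for j k p q f v n
  proof (induction n)
    case (Suc n)
    interpret endo scale "W j" "T j" by (rule endo)
    show ?case using comm[OF that(1,2) pow_in[OF that(3), of n], of k f] Suc by simp
  qed simp
  have powZ: "(T j ^^ n) (Z v) = Z ((T j ^^ n) v)" if "v \<in> W j" for j v n
  proof (induction n)
    case (Suc n)
    interpret endo scale "W j" "T j" by (rule endo)
    show ?case using commZ[OF pow_in[OF that, of n]] Suc by simp
  qed simp
  have P: "P j m w = (\<Sum>i\<le>degree m. coeff m i *s (T j ^^ i) w)" for j m w
    unfolding P_def by (rule endo.opp_def[OF endo])
  have stA: "stable A"
  proof (rule stableI)
    fix j
    interpret T: endo scale "W j" "T j" by (rule endo)
    have mono: "(T j ^^ (n + n')) v = 0" if "(T j ^^ n) v = 0" for n n' v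
      using that by (subst add.commute) (simp add: funpow_add, induction n', auto simp: T.T_zero)
    show "subspace (A j)"
    proof (rule subspaceI)
      show "0 \<in> A j" by (auto simp: A_def intro: exI[of _ 0])
      fix u v assume u: "u \<in> A j" and v: "v \<in> A j"
      then obtain n n' where n: "(T j ^^ n) u = 0" "(T j ^^ n') v = 0" unfolding A_def by blast
      have "(T j ^^ (n + n')) (u + v) = (T j ^^ (n + n')) u + (T j ^^ (n + n')) v"
        using u v by (intro T.pow_add) (auto simp: A_def)
      also have "\<dots> = 0" using mono[OF n(1), of n'] mono[OF n(2), of n] by (simp add: add.commute)
      finally show "u + v \<in> A j" using u v W_add by (auto simp: A_def)
    next
      fix c u assume u: "u \<in> A j"
      then obtain n where "(T j ^^ n) u = 0" by (auto simp: A_def)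
      then have "(T j ^^ n) (c *s u) = 0" using T.pow_scale[of u n c] u by (simp add: A_def)
      then show "c *s u \<in> A j" using u W_scale by (auto simp: A_def)
    qed
  next
    fix j k p q f v assume pq: "p \<in> idx" "q \<in> idx" and v: "v \<in> A j"
    then obtain n where n: "v \<in> W j" "(T j ^^ n) v = 0" by (auto simp: A_def)
    then have "(T (j + k * int N + int p - int q) ^^ n) (E k p q f v) = 0" using pow[OF pq n(1)] pq by simp
    then show "E k p q f v \<in> A (j + k * int N + int p - int q)" using E_in[OF pq n(1)] by (auto simp: A_def)
  next
    fix j v assume v: "v \<in> A j"
    then obtain n where n: "v \<in> W j" "(T j ^^ n) v = 0" by (auto simp: A_def)
    then have "(T j ^^ n) (Z v) = 0" using powZ[OF n(1), of n] by simp
    then show "Z v \<in> A j" using Z_in[OF n(1)] by (auto simp: A_def)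
  qed (auto simp: A_def)
  have stB: "stable B"
  proof (rule stableI)
    fix j
    interpret T: endo scale "W j" "T j" by (rule endo)
    have Z0: "T.opp m 0 = 0" for m using T.opp_smult[of 0 m 0] T.opp_mult[of 0 m 0] by simp
    have lin: "T.opp m (u + v) = T.opp m u + T.opp m v" if "u \<in> W j" "v \<in> W j" for m u v
      unfolding T.opp_def using that by (simp add: T.pow_add scale_right_distrib sum.distrib)
    have sc: "T.opp m (c *s u) = c *s T.opp m u" if "u \<in> W j" for m c u
      unfolding T.opp_def using that by (simp add: T.pow_scale scale_sum_right mult.commute)
    show "subspace (B j)"
    proof (rule subspaceI)
      show "0 \<in> B j" using Z0 by (auto simp: B_def P_def intro: exI[of _ 1])
      fix u v assume u: "u \<in> B j" and v: "v \<in> B j"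
      then obtain m m' where m: "poly m 0 \<noteq> 0" "T.opp m u = 0" "poly m' 0 \<noteq> 0" "T.opp m' v = 0"
        unfolding B_def P_def by blast
      have uv: "u \<in> W j" "v \<in> W j" using u v by (auto simp: B_def)
      have "T.opp (m * m') (u + v) = T.opp (m' * m) u + T.opp (m * m') v"
        using lin[OF uv] by (simp add: mult.commute)
      also have "\<dots> = 0" using m uv by (simp add: T.opp_mult Z0)
      finally show "u + v \<in> B j" using uv m W_add unfolding B_def P_def
        by (auto intro!: exI[of _ "m * m'"])
    next
      fix c u assume u: "u \<in> B j"
      then obtain m where "poly m 0 \<noteq> 0" "T.opp m u = 0" by (auto simp: B_def P_def)
      then show "c *s u \<in> B j" using u sc[of u m c] W_scale by (auto simp: B_def P_def)
    qed
  next
    fix j k p q f v assume pq: "p \<in> idx" "q \<in> idx" and v: "v \<in> B j"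
    then obtain m where m: "v \<in> W j" "poly m 0 \<noteq> 0" "P j m v = 0" by (auto simp: B_def)
    interpret T: endo scale "W j" "T j" by (rule endo)
    have "P (j + k * int N + int p - int q) m (E k p q f v) = (\<Sum>i\<le>degree m. E k p q f (coeff m i *s (T j ^^ i) v))"
      unfolding P using pow[OF pq m(1)] E_scale[OF pq T.pow_in[OF m(1)]] by simp
    also have "\<dots> = E k p q f (P j m v)"
      unfolding P by (rule E_sum[OF pq, where j = j, symmetric]) (intro W_scale T.pow_in[OF m(1)])
    finally have "P (j + k * int N + int p - int q) m (E k p q f v) = 0" using m(3) pq by simp
    then show "E k p q f v \<in> B (j + k * int N + int p - int q)" using E_in[OF pq m(1)] m(2) by (auto simp: B_def)
  next
    fix j v assume v: "v \<in> B j"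
    then obtain m where m: "v \<in> W j" "poly m 0 \<noteq> 0" "P j m v = 0" by (auto simp: B_def)
    interpret T: endo scale "W j" "T j" by (rule endo)
    have Zsum: "Z (sum x I) = (\<Sum>i\<in>I. Z (x i))" if "\<And>i. i \<in> I \<Longrightarrow> x i \<in> W j" for x and I :: "nat set"
      using that
    proof (induction I rule: infinite_finite_induct)
      case (insert i I)
      have "Z (x i + sum x I) = Z (x i) + Z (sum x I)"
        using insert.prems by (intro Z_add[where j = j] W_sum) auto
      then show ?case using insert by simp
    qed simp_all
    have "P j m (Z v) = (\<Sum>i\<le>degree m. Z (coeff m i *s (T j ^^ i) v))"
      unfolding P using powZ[OF m(1)] Z_scale[OF T.pow_in[OF m(1)]] by simp
    also have "\<dots> = Z (P j m v)"
      unfolding P using Zsum W_scale T.pow_in[OF m(1)] by simp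
    finally have "P j m (Z v) = 0" using m(3) by simp
    then show "Z v \<in> B j" using Z_in[OF m(1)] m(2) by (auto simp: B_def)
  qed (auto simp: B_def)
  have "A j \<inter> B j = {0}" for j
  proof -
    have "0 \<in> A j" "0 \<in> B j" using stA stB subspace_0 by (auto simp: stable_def)
    moreover have "w = 0" if "w \<in> A j" "w \<in> B j" for w
      using that endo.fitting_disjoint[OF endo, of w j] unfolding A_def B_def P_def by blast
    ultimately show ?thesis by blast
  qed
  moreover have dec: "\<exists>a\<in>A j. \<exists>b\<in>B j. w = a + b" if "w \<in> W j" for j w
  proof -
    obtain K where "rank_le K (W j)" using W_fin by blast
    from endo.fitting_decomposition[OF endo this that] show ?thesis
      unfolding A_def B_def P_def by blast
  qed
  ultimately have "(\<forall>j. A j = {0}) \<or> (\<forall>j. B j = {0})"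
    using indec stA stB unfolding gindec_def by blast
  moreover have "v0 \<in> A j0" unfolding A_def using ker by (auto intro!: exI[of _ 1])
  ultimately have "B j = {0}" using ker(2) by blast
  then have "v \<in> A j" using dec[OF v] by auto
  then show ?thesis by (simp add: A_def)
qed

lemma sum_idx_delta: "p \<in> idx \<Longrightarrow> (\<Sum>r\<in>idx. if r = p then x r else 0) = (x p :: 'b)"
  by (subst sum.delta) auto

lemma sum_idx_delta': "p \<in> idx \<Longrightarrow> (\<Sum>r\<in>idx. if p = r then x r else 0) = (x p :: 'b)"
  by (subst sum.delta') auto

lemma diag_sum_comm:
  assumes pq: "p \<in> idx" "q \<in> idx" and v: "v \<in> W j"
  shows "(\<Sum>r\<in>idx. E 0 r r (h r) (E k p q f v)) - E k p q f (\<Sum>r\<in>idx. E 0 r r (h r) v)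
     = E k p q (shiftp k (h p) * f - f * h q) v"
proof -
  have "E k p q f (\<Sum>r\<in>idx. E 0 r r (h r) v) = (\<Sum>r\<in>idx. E k p q f (E 0 r r (h r) v))"
    using E_in_diag[OF _ v] by (intro E_sum[OF pq]) blast
  then have "(\<Sum>r\<in>idx. E 0 r r (h r) (E k p q f v)) - E k p q f (\<Sum>r\<in>idx. E 0 r r (h r) v)
      = (\<Sum>r\<in>idx. E 0 r r (h r) (E k p q f v) - E k p q f (E 0 r r (h r) v))"
    by (simp add: sum_subtractf)
  also have "\<dots> = (\<Sum>r\<in>idx. (if r = p then E k p q (shiftp k (h p) * f) v else 0)
      - (if q = r then E k p q (f * h q) v else 0))"
  proof (rule sum.cong[OF refl])
    fix r assume r: "r \<in> idx"
    show "E 0 r r (h r) (E k p q f v) - E k p q f (E 0 r r (h r) v)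
      = (if r = p then E k p q (shiftp k (h p) * f) v else 0) - (if q = r then E k p q (f * h q) v else 0)"
      using E_comm[OF r r pq v, of 0 "h r" k f] by (auto simp: \<psi>_0)
  qed
  also have "\<dots> = E k p q (shiftp k (h p) * f) v - E k p q (f * h q) v"
    by (simp only: sum_subtractf sum_idx_delta[OF pq(1)] sum_idx_delta'[OF pq(2)])
  finally show ?thesis using E_difff[OF pq v] by simp
qed

lemma Iop_comm:
  assumes pq: "p \<in> idx" "q \<in> idx" and v: "v \<in> W j"
  shows "Iop \<omega> (E k p q f v) = E k p q f (Iop \<omega> v)"
proof -
  have s: "(\<Sum>r\<in>idx. E 0 r r 1 v) \<in> W j" using E_in_diag[OF _ v] by (intro W_sum) blast
  have "E k p q f (Iop \<omega> v) = E k p q f (\<Sum>r\<in>idx. E 0 r r 1 v) - \<omega> *s E k p q f v"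
    unfolding Iop_def using E_diff[OF pq s W_scale[OF v]] E_scale[OF pq v] by simp
  then show ?thesis using diag_sum_comm[OF pq v, of "\<lambda>_. 1" k f] E_0f[OF pq v]
    unfolding Iop_def by simp
qed

lemma Dop_comm:
  assumes pq: "p \<in> idx" "q \<in> idx" and v: "v \<in> W j"
  shows "Dop (c + of_int (k * int N + int p - int q)) (E k p q f v) = E k p q f (Dop c v)"
proof -
  have s: "(\<Sum>r\<in>idx. E 0 r r (grade_poly N r) v) \<in> W j" using E_in_diag[OF _ v] by (intro W_sum) blast
  have e: "E k p q f (Dop c v) = E k p q f (\<Sum>r\<in>idx. E 0 r r (grade_poly N r) v) - c *s E k p q f v"
    unfolding Dop_def using E_diff[OF pq s W_scale[OF v]] E_scale[OF pq v] by simp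
  have "shiftp k (grade_poly N p) * f - f * grade_poly N q
      = Polynomial.smult (of_int (k * int N + int p - int q)) f"
    by (rule poly_ext) (simp add: grade_poly_def algebra_simps)
  then show ?thesis using diag_sum_comm[OF pq v, of "grade_poly N" k f] E_smult[OF pq v] e
    unfolding Dop_def by (simp add: algebra_simps)
qed

lemma endo_Iop: "endo scale (W j) (Iop \<omega>)"
proof (unfold_locales, goal_cases)
  case 1 show ?case by (rule W_sub)
next
  case (2 v) then show ?case unfolding Iop_def using E_in_diag by (intro W_diff W_sum W_scale) blast+
next
  case (3 v w)
  have "(\<Sum>q\<in>idx. E 0 q q 1 (v + w)) = (\<Sum>q\<in>idx. E 0 q q 1 v + E 0 q q 1 w)"
    using E_add[OF _ _ 3] by (intro sum.cong) auto
  then show ?case unfolding Iop_def by (simp add: sum.distrib scale_right_distrib)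
next
  case (4 v c)
  have "(\<Sum>q\<in>idx. E 0 q q 1 (c *s v)) = (\<Sum>q\<in>idx. c *s E 0 q q 1 v)"
    using E_scale[OF _ _ 4] by (intro sum.cong) auto
  then show ?case unfolding Iop_def by (simp add: scale_right_diff_distrib scale_sum_right mult.commute)
qed

lemma endo_Dop: "endo scale (W j) (Dop c)"
proof (unfold_locales, goal_cases)
  case 1 show ?case by (rule W_sub)
next
  case (2 v) then show ?case unfolding Dop_def using E_in_diag by (intro W_diff W_sum W_scale) blast+
next
  case (3 v w)
  have "(\<Sum>q\<in>idx. E 0 q q (grade_poly N q) (v + w))
      = (\<Sum>q\<in>idx. E 0 q q (grade_poly N q) v + E 0 q q (grade_poly N q) w)"
    using E_add[OF _ _ 3] by (intro sum.cong) auto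
  then show ?case unfolding Dop_def by (simp add: sum.distrib scale_right_distrib)
next
  case (4 v a)
  have "(\<Sum>q\<in>idx. E 0 q q (grade_poly N q) (a *s v)) = (\<Sum>q\<in>idx. a *s E 0 q q (grade_poly N q) v)"
    using E_scale[OF _ _ 4] by (intro sum.cong) auto
  then show ?case unfolding Dop_def by (simp add: scale_right_diff_distrib scale_sum_right mult.commute)
qed

lemma restrict_gmod:
  assumes A: "stable A"
  shows "gmod scale N E Z \<psi> A"
proof -
  have sub: "v \<in> W j" if "v \<in> A j" for v j using A that unfolding stable_def by blast
  show ?thesis
  proof (unfold_locales, goal_cases)
    case 1 show ?case by (rule N)
  next
    case (2 j) then show ?case using A unfolding stable_def by blast
  next
    case (3 j) then show ?case using W_fin[of j] rank_le_subset[OF _ subsetI[OF sub]] by blast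
  next
    case (4 p q v j k f) then show ?case using A unfolding stable_def by blast
  next
    case (5 p q v j w k f) show ?case by (rule E_add[OF 5(1,2) 5(3,4)[THEN sub]])
  next
    case (6 p q v j k f c) show ?case by (rule E_scale[OF 6(1,2) 6(3)[THEN sub]])
  next
    case (7 p q v j k f g) show ?case by (rule E_addf[OF 7(1,2) 7(3)[THEN sub]])
  next
    case (8 p q v j k c f) show ?case by (rule E_smult[OF 8(1,2) 8(3)[THEN sub]])
  next
    case (9 v j) then show ?case using A unfolding stable_def by blast
  next
    case (10 v j w) show ?case by (rule Z_add[OF 10[THEN sub]])
  next
    case (11 v j c) show ?case by (rule Z_scale[OF 11[THEN sub]])
  next
    case (12 p q v j k f) show ?case by (rule Z_E[OF 12(1,2) 12(3)[THEN sub]])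
  next
    case (13 f g) show ?case by (rule \<psi>_0)
  next
    case (14 p q r s v j k f l g) show ?case by (rule E_comm[OF 14(1-4) 14(5)[THEN sub]])
  qed
qed

end

context smod
begin

lemma restrict_smod: "stable A \<Longrightarrow> smod scale N E Z \<psi> A M"
proof -
  assume A: "stable A"
  interpret A: gmod scale N E Z \<psi> A by (rule restrict_gmod[OF A])
  have sub: "v \<in> W j" if "v \<in> A j" for v j using A that unfolding stable_def by blast
  show ?thesis
  proof (unfold_locales, goal_cases)
    case (1 v j) then show ?case using Z_zero sub by blast
  next
    case (2 q j)
    obtain b where b: "b \<noteq> 0" "degree b \<le> M" "\<And>u v. b dvd u \<Longrightarrow> v \<in> W j \<Longrightarrow> E 0 q q u v = 0"
      using supp[OF 2, of j] by blast
    have "\<forall>u. b dvd u \<longrightarrow> (\<forall>v\<in>A j. E 0 q q u v = 0)" using b(3) sub by blast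
    then show ?case using b(1,2) by blast
  qed
qed

text \<open>The identity matrix and the grading element have eigenvectors in some degree, and on an
  indecomposable family this makes them nilpotent everywhere after subtraction of the eigenvalue.\<close>

lemma indecomposable_block:
  assumes indec: gindec and nz: "W j0 \<noteq> {0}"
  shows "\<exists>\<omega> z. block scale N E Z \<psi> W M \<omega> z"
proof -
  have ei: "\<exists>v\<in>W j0 - {0}. \<exists>c. T v = c *s v" if "endo scale (W j0) T" for T
  proof -
    interpret T: endo scale "W j0" T by (rule that)
    obtain K where "rank_le K (W j0)" using W_fin by blast
    from T.quotient_eigenvector_single[OF this, of "{0}"] show ?thesis using nz T.T_zero by auto
  qed
  obtain v \<omega> where v: "v \<in> W j0" "v \<noteq> 0" "Iop 0 v = \<omega> *s v" using ei[OF endo_Iop] by blast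
  obtain w d where w: "w \<in> W j0" "w \<noteq> 0" "Dop 0 w = d *s w" using ei[OF endo_Dop] by blast
  have v1: "Iop \<omega> v = 0" using v(3) by (simp add: Iop_def)
  have w1: "Dop (d - of_int j0 + of_int j0) w = 0" using w(3) by (simp add: Dop_def)
  have "block scale N E Z \<psi> W M \<omega> (d - of_int j0)"
  proof (unfold_locales, goal_cases)
    case (1 u j)
    show ?case
    proof (rule commuting_nilpotent[OF indec, of "\<lambda>_. Iop \<omega>" v j0, OF endo_Iop Iop_comm _ v(1,2) v1 1])
      fix j v assume v: "v \<in> W j"
      show "Iop \<omega> (Z v) = Z (Iop \<omega> v)"
        unfolding Z_zero[OF v] Z_zero[OF endo.T_in[OF endo_Iop v]] by (rule endo.T_zero[OF endo_Iop])
    qed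
  next
    case (2 u j)
    show ?case
    proof (rule commuting_nilpotent[OF indec, of "\<lambda>j. Dop (d - of_int j0 + of_int j)" w j0, OF endo_Dop _ _ w(1,2) w1 2])
      fix j k p q f v assume "p \<in> idx" "q \<in> idx" "v \<in> W j"
      from Dop_comm[OF this, of "d - of_int j0 + of_int j" k f]
      show "Dop (d - of_int j0 + of_int (j + k * int N + int p - int q)) (E k p q f v)
          = E k p q f (Dop (d - of_int j0 + of_int j) v)" by (simp add: algebra_simps)
    next
      fix j v assume v: "v \<in> W j"
      show "Dop (d - of_int j0 + of_int j) (Z v) = Z (Dop (d - of_int j0 + of_int j) v)"
        unfolding Z_zero[OF v] Z_zero[OF endo.T_in[OF endo_Dop v]] by (rule endo.T_zero[OF endo_Dop])
    qed
  qed
  then show ?thesis by blast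
qed

section \<open>Duality\<close>

text \<open>The anti-automorphism \<open>t\<^sup>k f(D) E\<^sub>p\<^sub>q \<mapsto> t\<^sup>k f(-D - k) E\<^sub>q\<^sub>p\<close>, with the sign \<open>-1\<close> and the relabelling
  \<open>p \<mapsto> N + 1 - p\<close>, is an automorphism of the Lie algebra that preserves the gradation.\<close>

definition dualE :: "int \<Rightarrow> nat \<Rightarrow> nat \<Rightarrow> complex poly \<Rightarrow> 'b \<Rightarrow> 'b" where
  "dualE k p q f v = - E k (N + 1 - q) (N + 1 - p) (dualp k f) v"

lemma dual_gmod: "gmod scale N dualE Z \<psi> W"
proof (unfold_locales, goal_cases)
  case 1 show ?case by (rule N)
next
  case (2 j) show ?case by (rule W_sub)
next
  case (3 j) show ?case by (rule W_fin)
next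
  case (4 p q v j k f)
  have "E k (N + 1 - q) (N + 1 - p) (dualp k f) v \<in> W (j + k * int N + int p - int q)"
    using 4 by (intro E_in'[OF idx_flip idx_flip]) (simp_all add: int_flip)
  then show ?case unfolding dualE_def using W_scale[of _ _ "-1"] by (simp add: scale_minus_left)
next
  case (5 p q v j w k f)
  show ?case unfolding dualE_def E_add[OF 5(2,1)[THEN idx_flip] 5(3,4)] by simp
next
  case (6 p q v j k f c)
  show ?case unfolding dualE_def E_scale[OF 6(2,1)[THEN idx_flip] 6(3)] by (simp add: scale_minus_right)
next
  case (7 p q v j k f g)
  show ?case unfolding dualE_def dualp_algebra E_addf[OF 7(2,1)[THEN idx_flip] 7(3)] by simp
next
  case (8 p q v j k c f)
  show ?case unfolding dualE_def dualp_algebra E_smult[OF 8(2,1)[THEN idx_flip] 8(3)] by (simp add: scale_minus_right)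
next
  case (9 v j) then show ?case by (rule Z_in)
next
  case (10 v j w) then show ?case by (rule Z_add)
next
  case (11 v j c) then show ?case by (rule Z_scale)
next
  case (12 p q v j k f)
  have u: "E k (N + 1 - q) (N + 1 - p) (dualp k f) v \<in> W (j + k * int N + int (N + 1 - q) - int (N + 1 - p))"
    by (rule E_in[OF 12(2,1)[THEN idx_flip] 12(3)])
  have "Z (- E k (N + 1 - q) (N + 1 - p) (dualp k f) v) = - Z (E k (N + 1 - q) (N + 1 - p) (dualp k f) v)"
    using Z_scale[OF u, of "-1"] by (simp add: scale_minus_left)
  then show ?case unfolding dualE_def Z_zero[OF u] Z_zero[OF 12(3)] E_0[OF 12(2,1)[THEN idx_flip]] .
next
  case (13 f g) show ?case by (rule \<psi>_0)
next
  case (14 p q r s v j k f l g)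
  note i = 14(1-4)[THEN idx_flip]
  have m: "E a b c f (- w) = - E a b c f w" if "b \<in> idx" "c \<in> idx" "w \<in> W j" for a b c f w j
    using E_scale[OF that, of a f "-1"] by (simp add: scale_minus_left)
  have e: "k + l = l + k" by simp
  have "dualE k p q f (dualE l r s g v) - dualE l r s g (dualE k p q f v)
    = E k (N + 1 - q) (N + 1 - p) (dualp k f) (E l (N + 1 - s) (N + 1 - r) (dualp l g) v)
      - E l (N + 1 - s) (N + 1 - r) (dualp l g) (E k (N + 1 - q) (N + 1 - p) (dualp k f) v)"
    unfolding dualE_def m[OF i(2,1) E_in[OF i(4,3) 14(5)]] m[OF i(4,3) E_in[OF i(2,1) 14(5)]] by simp
  also have "\<dots> = (if p = s then E (k + l) (N + 1 - q) (N + 1 - r) (shiftp l (dualp k f) * dualp l g) v else 0)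
     - (if r = q then E (k + l) (N + 1 - s) (N + 1 - p) (shiftp k (dualp l g) * dualp k f) v else 0)"
    unfolding comm0[OF i(2,1,4,3) 14(5)] idx_flip_eq[OF 14(1,4)] idx_flip_eq[OF 14(3,2)] ..
  also have "shiftp k (dualp l g) * dualp k f = dualp (k + l) (shiftp l f * g)"
    by (simp only: dualp_algebra)
  also have "shiftp l (dualp k f) * dualp l g = dualp (k + l) (shiftp k g * f)"
    unfolding e by (simp only: dualp_algebra)
  finally show ?case using Z_zero[OF 14(5)] by (auto simp: dualE_def)
qed

lemma dual_smod: "smod scale N dualE Z \<psi> W M"
proof -
  interpret D: gmod scale N dualE Z \<psi> W by (rule dual_gmod)
  show ?thesis
  proof (unfold_locales, goal_cases)
    case (1 v j) then show ?case by (rule Z_zero)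
  next
    case (2 q j)
    obtain b where b: "b \<noteq> 0" "degree b \<le> M" "\<And>u v. b dvd u \<Longrightarrow> v \<in> W j \<Longrightarrow> E 0 (N + 1 - q) (N + 1 - q) u v = 0"
      using supp[OF idx_flip[OF 2], of j] by blast
    have "dualE 0 q q u v = 0" if bu: "negp b dvd u" and v: "v \<in> W j" for u v
    proof -
      obtain g where "u = negp b * g" using bu by (rule dvdE)
      then have "negp u = b * negp g" by (simp add: negp_algebra)
      then show ?thesis unfolding dualE_def dualp_algebra using b(3)[OF _ v] by simp
    qed
    then show ?case using b(1,2) by (intro exI[of _ "negp b"]) auto
  qed
qed

lemma sum_idx_flip: "(\<Sum>q\<in>idx. F (N + 1 - q)) = (\<Sum>q\<in>idx. (F q :: 'b))"
  by (rule sum.reindex_bij_witness[of _ "\<lambda>q. N + 1 - q" "\<lambda>q. N + 1 - q"]) auto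

lemma dual_Iop: "gmod.Iop scale N dualE \<omega> v = - Iop (- \<omega>) v"
proof -
  interpret D: gmod scale N dualE Z \<psi> W by (rule dual_gmod)
  have "dualp 0 1 = 1" by (rule poly_ext) simp
  then have "(\<Sum>q\<in>idx. dualE 0 q q 1 v) = - (\<Sum>q\<in>idx. E 0 (N + 1 - q) (N + 1 - q) 1 v)"
    by (simp add: dualE_def sum_negf)
  then show ?thesis unfolding D.Iop_def Iop_def using sum_idx_flip[of "\<lambda>q. E 0 q q 1 v"]
    by (simp add: scale_minus_left)
qed

lemma dual_Dop:
  assumes v: "v \<in> W j"
  shows "gmod.Dop scale N dualE c v = Dop c v"
proof -
  interpret D: gmod scale N dualE Z \<psi> W by (rule dual_gmod)
  have "dualE 0 q q (grade_poly N q) v = E 0 (N + 1 - q) (N + 1 - q) (grade_poly N (N + 1 - q)) v" if q: "q \<in> idx" for q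
  proof -
    have e: "(of_nat (Suc N - q) :: complex) = of_nat N + 1 - of_nat q" using q by (subst of_nat_diff) auto
    have "dualp 0 (grade_poly N q) = - grade_poly N (N + 1 - q)"
      by (intro poly_ext) (simp add: grade_poly_def e field_simps)
    then show ?thesis unfolding dualE_def using E_uminusf[OF idx_flip idx_flip v, OF q q] by simp
  qed
  then have "(\<Sum>q\<in>idx. dualE 0 q q (grade_poly N q) v) = (\<Sum>q\<in>idx. E 0 (N + 1 - q) (N + 1 - q) (grade_poly N (N + 1 - q)) v)"
    by (rule sum.cong[OF refl])
  also have "\<dots> = (\<Sum>q\<in>idx. E 0 q q (grade_poly N q) v)"
    by (rule sum_idx_flip[of "\<lambda>q. E 0 q q (grade_poly N q) v"])
  finally show ?thesis unfolding D.Dop_def Dop_def by simp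
qed

text \<open>
  The identity matrix changes its sign under the duality, while the grading element is invariant.
\<close>

lemma dual_block:
  assumes "block scale N E Z \<psi> W M (-1) z"
  shows "block scale N dualE Z \<psi> W M 1 z"
proof -
  interpret B: block scale N E Z \<psi> W M "-1" z by (rule assms)
  interpret D: smod scale N dualE Z \<psi> W M by (rule dual_smod)
  show ?thesis
  proof (unfold_locales, goal_cases)
    case (1 v j)
    interpret I: endo scale "W j" "Iop (-1)" by (rule endo_Iop)
    have "(D.Iop 1 ^^ n) v = (if even n then 1 else -1) *s (Iop (-1) ^^ n) v" for n
      by (induction n) (auto simp: dual_Iop I.T_scale[OF I.pow_in[OF 1]] scale_minus_left
        I.T_scale[OF I.pow_in[OF 1], of "-1", unfolded scale_minus_left scale_one])
    then show ?case using B.I_nil[OF 1] by (metis scale_zero_right)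
  next
    case (2 v j)
    interpret I: endo scale "W j" "Dop (z + of_int j)" by (rule endo_Dop)
    have "(D.Dop (z + of_int j) ^^ n) v = (Dop (z + of_int j) ^^ n) v" for n
      by (induction n) (auto simp: dual_Dop[OF I.pow_in[OF 2]])
    then show ?case using B.D_nil[OF 2] by simp
  qed
qed

end

lemma (in gmod) gindecD:
  assumes "gindec" "stable A" "stable B" "\<And>j. A j \<inter> B j = {0}"
    "\<And>j v. v \<in> W j \<Longrightarrow> \<exists>a\<in>A j. \<exists>b\<in>B j. v = a + b"
  shows "(\<forall>j. A j = {0}) \<or> (\<forall>j. B j = {0})"
  using assms unfolding gindec_def by simp

section \<open>Modules over the associative algebra\<close>

locale amod = gmod scale N E Z \<psi> W
  for scale :: "complex \<Rightarrow> 'b::ab_group_add \<Rightarrow> 'b" (infixr \<open>*s\<close> 75) and N E Z \<psi> W +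
  assumes product: "p \<in> {1..N} \<Longrightarrow> q \<in> {1..N} \<Longrightarrow> r \<in> {1..N} \<Longrightarrow> s \<in> {1..N} \<Longrightarrow> v \<in> W j \<Longrightarrow>
      E k p q f (E l r s g v) = (if q = r then E (k + l) p s (shiftp l f * g) v else 0)"
    and unit: "v \<in> W j \<Longrightarrow> (\<Sum>q\<in>{1..N}. E 0 q q 1 v) = v"
    and Z_zero: "v \<in> W j \<Longrightarrow> Z v = 0"

text \<open>
  It remains to see that the identity matrix acts as the identity: associativity makes it idempotent,
  and an idempotent whose only eigenvalue is \<open>1\<close> is the identity.
\<close>

lemma (in assoc_block) amod: "amod scale N E Z \<psi> W"
proof (unfold_locales, goal_cases)
  case (1 p q r s v j k f l g)
  then show ?case by (rule assoc)
next
  case (2 v j)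
  \<comment> \<open>The identity matrix is idempotent, and it is unipotent on the block.\<close>
  interpret I: endo scale "W j" "Iop 1" by (rule endo_Iop)
  have w: "(\<Sum>q\<in>idx. E 0 q q 1 u) \<in> W j" if "u \<in> W j" for u
    using E_in_diag[OF _ that] by (intro W_sum) blast
  have idem: "(\<Sum>q\<in>idx. E 0 q q 1 (\<Sum>r\<in>idx. E 0 r r 1 u)) = (\<Sum>q\<in>idx. E 0 q q 1 u)" if u: "u \<in> W j" for u
  proof (rule sum.cong[OF refl])
    fix q assume q: "q \<in> idx"
    have "E 0 q q 1 (\<Sum>r\<in>idx. E 0 r r 1 u) = (\<Sum>r\<in>idx. E 0 q q 1 (E 0 r r 1 u))"
      using E_in_diag[OF _ u] by (intro E_sum[OF q q]) blast
    also have "\<dots> = (\<Sum>r\<in>idx. if q = r then E 0 q q 1 u else 0)"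
      using assoc[OF q q _ _ u] by (intro sum.cong) auto
    finally show "E 0 q q 1 (\<Sum>r\<in>idx. E 0 r r 1 u) = E 0 q q 1 u" unfolding sum_idx_delta'[OF q] .
  qed
  have neg: "Iop 1 (Iop 1 u) = - Iop 1 u" if u: "u \<in> W j" for u
  proof -
    have "(\<Sum>q\<in>idx. E 0 q q 1 (Iop 1 u)) = (\<Sum>q\<in>idx. E 0 q q 1 (\<Sum>r\<in>idx. E 0 r r 1 u) - E 0 q q 1 u)"
      unfolding Iop_def using E_diff[OF _ _ w[OF u] u] by (intro sum.cong) auto
    then have "(\<Sum>q\<in>idx. E 0 q q 1 (Iop 1 u)) = 0" using idem[OF u] by (simp add: sum_subtractf)
    then show ?thesis unfolding Iop_def[of 1 "Iop 1 u"] by simp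
  qed
  obtain n where n: "(Iop 1 ^^ n) v = 0" using I_nil[OF 2] by blast
  have pw: "(Iop 1 ^^ Suc m) v = (-1) ^ m *s Iop 1 v" for m
  proof (induction m)
    case (Suc m)
    have "(Iop 1 ^^ Suc (Suc m)) v = Iop 1 ((-1) ^ m *s Iop 1 v)" using Suc by simp
    also have "\<dots> = (-1) ^ m *s Iop 1 (Iop 1 v)" by (rule I.T_scale[OF I.T_in[OF 2]])
    finally show ?case unfolding neg[OF 2] by (simp add: scale_minus_left scale_minus_right)
  qed simp
  have "(Iop 1 ^^ Suc n) v = 0" using n I.T_zero by simp
  then have "Iop 1 v = 0" unfolding pw by simp
  then show ?case unfolding Iop_def by simp
next
  case (3 v j)
  then show ?case by (rule Z_zero)
qed

context amod
begin

lemma column: "p \<in> idx \<Longrightarrow> q \<in> idx \<Longrightarrow> v \<in> W j \<Longrightarrow> E k p q f (E 0 q q 1 v) = E k p q f v"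
  by (simp add: product)

text \<open>Modulo \<open>N\<close>, the position \<open>q\<close> of a vector minus its degree is preserved by all operators.\<close>

definition residue_part :: "(int \<Rightarrow> bool) \<Rightarrow> int \<Rightarrow> 'b set" where
  "residue_part R j = {v \<in> W j. \<forall>q\<in>idx. \<not> R ((int q - 1 - j) mod int N) \<longrightarrow> E 0 q q 1 v = 0}"

lemma stable_residue_part: "stable (residue_part R)"
proof (rule stableI)
  fix j
  show "subspace (residue_part R j)"
    by (intro subspaceI) (auto simp: residue_part_def W_add W_scale E_add E_scale)
  show "residue_part R j \<subseteq> W j" by (auto simp: residue_part_def)
  show "Z v \<in> residue_part R j" if "v \<in> residue_part R j" for v
    using that Z_zero by (auto simp: residue_part_def)
next
  fix j k p q f v assume pq: "p \<in> idx" "q \<in> idx" and v: "v \<in> residue_part R j"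
  then have vW: "v \<in> W j" by (simp add: residue_part_def)
  let ?j = "j + k * int N + int p - int q"
  have "E 0 r r 1 (E k p q f v) = 0" if r: "r \<in> idx" and nR: "\<not> R ((int r - 1 - ?j) mod int N)" for r
  proof (cases "r = p")
    case True
    have "int r - 1 - ?j = (int q - 1 - j) + (- k) * int N" using True by simp
    then have "(int r - 1 - ?j) mod int N = (int q - 1 - j) mod int N" by (simp only: mod_mult_self1)
    then have "E 0 q q 1 v = 0" using v nR pq by (auto simp: residue_part_def simp del: atLeastAtMost_iff)
    then have "E k p q f v = 0" using column[OF pq vW, of k f] pq by simp
    then show ?thesis using r by simp
  next
    case False
    then show ?thesis using product[OF r r pq vW] by simp
  qed
  then show "E k p q f v \<in> residue_part R ?j" using E_in[OF pq vW] by (simp add: residue_part_def)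
qed

lemma residue_decomposition:
  assumes v: "v \<in> W j"
  shows "\<exists>a\<in>residue_part R j. \<exists>b\<in>residue_part (\<lambda>x. \<not> R x) j. v = a + b"
proof -
  let ?P = "\<lambda>q. R ((int q - 1 - j) mod int N)"
  define a where "a = (\<Sum>q\<in>idx. if ?P q then E 0 q q 1 v else 0)"
  define b where "b = (\<Sum>q\<in>idx. if ?P q then 0 else E 0 q q 1 v)"
  have "a + b = (\<Sum>q\<in>idx. E 0 q q 1 v)"
    unfolding a_def b_def sum.distrib[symmetric] by (intro sum.cong) auto
  then have "v = a + b" using unit[OF v] by simp
  have part: "E 0 r r 1 (\<Sum>q\<in>idx. if Q q then E 0 q q 1 v else 0) = (if Q r then E 0 r r 1 v else 0)"
    if r: "r \<in> idx" for r Q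
  proof -
    have "E 0 r r 1 (\<Sum>q\<in>idx. if Q q then E 0 q q 1 v else 0)
        = (\<Sum>q\<in>idx. E 0 r r 1 (if Q q then E 0 q q 1 v else 0))"
      using E_in_diag[OF _ v] by (intro E_sum[OF r r, where j = j]) auto
    also have "\<dots> = (\<Sum>q\<in>idx. if r = q then (if Q r then E 0 r r 1 v else 0) else 0)"
      using product[OF r r _ _ v] r by (intro sum.cong) auto
    finally show ?thesis unfolding sum_idx_delta'[OF r] .
  qed
  have "a \<in> residue_part R j"
    unfolding residue_part_def a_def using part[of _ ?P] E_in_diag[OF _ v] by (auto intro!: W_sum)
  moreover have "b = (\<Sum>q\<in>idx. if \<not> ?P q then E 0 q q 1 v else 0)"
    unfolding b_def by (intro sum.cong) auto
  then have "b \<in> residue_part (\<lambda>x. \<not> R x) j"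
    unfolding residue_part_def using part[of _ "\<lambda>q. \<not> ?P q"] E_in_diag[OF _ v] by (auto intro!: W_sum)
  ultimately show ?thesis using \<open>v = a + b\<close> by blast
qed

definition single_residue :: "int \<Rightarrow> bool" where
  "single_residue i \<longleftrightarrow> (\<forall>j. residue_part (\<lambda>x. x = (- i) mod int N) j = W j)"

lemma exists_position:
  assumes "v \<in> W j" "v \<noteq> 0"
  obtains q where "q \<in> idx" "E 0 q q 1 v \<noteq> 0"
  using unit[OF assms(1)] assms(2) sum.neutral[of idx "\<lambda>q. E 0 q q 1 v"] by metis

text \<open>
  The matrix units \<open>t\<^sup>k E\<^sub>r\<^sub>q\<close> are invertible and reach every degree from a vector at position \<open>q\<close>.
\<close>

lemma residue_part_nonzero:
  assumes v: "v \<in> W j0" and q: "q \<in> idx" and nz: "E 0 q q 1 v \<noteq> 0" and i: "i = j0 + 1 - int q"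
  shows "residue_part (\<lambda>x. x = (- i) mod int N) j \<noteq> {0}"
proof -
  define u where "u = E 0 q q 1 v"
  have u: "u \<in> W j0" unfolding u_def by (rule E_in_diag[OF q v])
  have uR: "u \<in> residue_part (\<lambda>x. x = (- i) mod int N) j0"
  proof -
    have "E 0 r r 1 u = 0" if r: "r \<in> idx" and n: "(int r - 1 - j0) mod int N \<noteq> (- i) mod int N" for r
    proof -
      have "int q - 1 - j0 = - i" using i by simp
      then have "r \<noteq> q" using n by auto
      then show ?thesis unfolding u_def using product[OF r r q q v] by simp
    qed
    then show ?thesis using u by (simp add: residue_part_def)
  qed
  define r where "r = nat ((j - i) mod int N) + 1"
  define k where "k = (j - i) div int N"
  have N0: "int N > 0" using N by simp
  have r1: "int r = (j - i) mod int N + 1" unfolding r_def using N0 by simp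
  have r: "r \<in> idx" unfolding r_def using N0 by (auto simp: Suc_le_eq nat_less_iff)
  have "j - i = k * int N + (j - i) mod int N" unfolding k_def by simp
  then have j: "j = j0 + k * int N + int r - int q" using r1 i by simp
  have "E (- k) q r 1 (E k r q 1 u) = u"
  proof -
    have "E (- k) q r 1 (E k r q 1 u) = E 0 q q 1 u" using product[OF q r r q u] by simp
    also have "\<dots> = u" unfolding u_def using product[OF q q q q v, of 0 1 0 1] by simp
    finally show ?thesis .
  qed
  then have "E k r q 1 u \<noteq> 0" using nz q r unfolding u_def by auto
  moreover have "E k r q 1 u \<in> residue_part (\<lambda>x. x = (- i) mod int N) j"
    using stable_residue_part r q uR unfolding stable_def j by blast
  ultimately show ?thesis by blast
qed

text \<open>
  The residue of one nonzero vector and the other residues give complementary stable families.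
\<close>

lemma single_residue_if_indecomposable:
  assumes indec: gindec and nz: "W j0 \<noteq> {0}"
  shows "\<exists>i. single_residue i"
proof -
  obtain v where v: "v \<in> W j0" "v \<noteq> 0" using nz W_0 by blast
  obtain q where q: "q \<in> idx" "E 0 q q 1 v \<noteq> 0" using exists_position[OF v] .
  define i where "i = j0 + 1 - int q"
  let ?R = "\<lambda>x. x = (- i) mod int N"
  have disj: "residue_part ?R j \<inter> residue_part (\<lambda>x. \<not> ?R x) j = {0}" for j
  proof -
    have "w = 0" if w: "w \<in> residue_part ?R j" "w \<in> residue_part (\<lambda>x. \<not> ?R x) j" for w
    proof -
      have "E 0 q q 1 w = 0" if "q \<in> idx" for q using w that unfolding residue_part_def by blast
      then have "(\<Sum>q\<in>idx. E 0 q q 1 w) = 0" by (intro sum.neutral) blast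
      then show ?thesis using unit w unfolding residue_part_def by force
    qed
    moreover have "0 \<in> residue_part ?R j" "0 \<in> residue_part (\<lambda>x. \<not> ?R x) j" by (auto simp: residue_part_def)
    ultimately show ?thesis by blast
  qed
  have "(\<forall>j. residue_part ?R j = {0}) \<or> (\<forall>j. residue_part (\<lambda>x. \<not> ?R x) j = {0})"
    by (rule gindecD[OF indec stable_residue_part stable_residue_part disj residue_decomposition])
  then have B: "residue_part (\<lambda>x. \<not> ?R x) j = {0}" for j
    using residue_part_nonzero[OF v(1) q i_def] by blast
  have "residue_part ?R j = W j" for j
  proof
    show "residue_part ?R j \<subseteq> W j" by (auto simp: residue_part_def)
    show "W j \<subseteq> residue_part ?R j"
    proof
      fix w assume "w \<in> W j"
      then obtain a b where "a \<in> residue_part ?R j" "b \<in> residue_part (\<lambda>x. \<not> ?R x) j" "w = a + b"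
        using residue_decomposition by blast
      then show "w \<in> residue_part ?R j" using B by auto
    qed
  qed
  then show ?thesis unfolding single_residue_def by blast
qed

end

text \<open>
  In a family with a single residue, each degree is spanned by vectors at one position, and all
  degrees are translates of \<open>W i\<close> by the invertible elements \<open>t\<^sup>k E\<^sub>r\<^sub>1\<close>.
\<close>

locale rmod = amod +
  fixes i :: int
  assumes single: "single_residue i"
begin

definition row :: "int \<Rightarrow> nat" where "row j = nat ((j - i) mod int N) + 1"
definition lev :: "int \<Rightarrow> int" where "lev j = (j - i) div int N"

lemma N_pos: "int N > 0" using N by simp

lemma row: "row j \<in> idx" "int (row j) = (j - i) mod int N + 1"
  using N_pos by (auto simp: row_def Suc_le_eq nat_less_iff)

lemma degree_eq: "j = i + lev j * int N + int (row j) - 1"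
  unfolding row lev_def by simp

lemma row_lev_unique:
  assumes "r \<in> idx" "j = i + k * int N + int r - 1"
  shows "row j = r" "lev j = k"
proof -
  have "(j - i) div int N = k \<and> (j - i) mod int N = int r - 1"
    using assms N_pos by (intro conjI; simp)
  then show "row j = r" "lev j = k" using assms(1) by (auto simp: row_def lev_def)
qed

lemma one_idx: "1 \<in> idx" using N by simp

lemma other_row:
  assumes w: "w \<in> W j" and q: "q \<in> idx" "q \<noteq> row j"
  shows "E 0 q q 1 w = 0"
proof -
  have "(int q - 1 - j) mod int N \<noteq> (- i) mod int N"
  proof
    assume "(int q - 1 - j) mod int N = (- i) mod int N"
    then have "int N dvd (int q - 1 - j) - (- i)" by (simp add: mod_eq_dvd_iff)
    then obtain d where d: "(int q - 1 - j) + i = int N * d" by (auto simp: dvd_def)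
    have "j = i + (- d) * int N + int q - 1" using d by (simp add: algebra_simps)
    then have "row j = q" using row_lev_unique(1)[OF q(1)] by blast
    then show False using q(2) by simp
  qed
  moreover have "w \<in> residue_part (\<lambda>x. x = (- i) mod int N) j" using single w unfolding single_residue_def by blast
  ultimately show ?thesis using q(1) unfolding residue_part_def by blast
qed

lemma own_row:
  assumes w: "w \<in> W j"
  shows "E 0 (row j) (row j) 1 w = w"
proof -
  have "(\<Sum>q\<in>idx. E 0 q q 1 w) = (\<Sum>q\<in>idx. if q = row j then E 0 q q 1 w else 0)"
    using other_row[OF w] by (intro sum.cong) auto
  then show ?thesis using unit[OF w] sum_idx_delta[OF row(1)[of j], of "\<lambda>q. E 0 q q 1 w"] by simp
qed

definition up :: "int \<Rightarrow> 'a \<Rightarrow> 'a" where "up j = E (lev j) (row j) 1 1"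
definition down :: "int \<Rightarrow> 'a \<Rightarrow> 'a" where "down j = E (- lev j) 1 (row j) 1"

lemma up_in: "v \<in> W i \<Longrightarrow> up j v \<in> W j"
  unfolding up_def using degree_eq[of j] by (intro E_in'[OF row(1) one_idx]) auto

lemma down_in: "w \<in> W j \<Longrightarrow> down j w \<in> W i"
  unfolding down_def using degree_eq[of j] by (intro E_in'[OF one_idx row(1)]) (auto simp: algebra_simps)

lemma row_i: "row i = 1" "lev i = 0"
  by (simp_all add: row_def lev_def)

lemma W_i: "v \<in> W i \<Longrightarrow> E 0 1 1 1 v = v"
  using own_row[of v i] row_i by simp

lemma down_up: "v \<in> W i \<Longrightarrow> down j (up j v) = v"
  unfolding up_def down_def using product[OF one_idx row(1) row(1) one_idx] W_i by simp

lemma up_down: "w \<in> W j \<Longrightarrow> up j (down j w) = w"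
  unfolding up_def down_def using product[OF row(1) one_idx one_idx row(1)] own_row by simp

abbreviation op1 :: "complex poly \<Rightarrow> 'a \<Rightarrow> 'a" where "op1 f \<equiv> E 0 1 1 f"

lemma op1_in: "v \<in> W i \<Longrightarrow> op1 f v \<in> W i"
  by (rule E_in_diag[OF one_idx])

lemma op1_mult: "v \<in> W i \<Longrightarrow> op1 (f * g) v = op1 f (op1 g v)"
  using product[OF one_idx one_idx one_idx one_idx] by simp

text \<open>
  Every operator is the composition of the identification \<open>up\<close> with an operator of \<open>\<complex>[D]\<close> on \<open>W i\<close>.
\<close>

lemma E_up:
  assumes pq: "p \<in> idx" "q \<in> idx" and v: "v \<in> W i" and j': "j' = j + k * int N + int p - int q"
  shows "E k p q f (up j v) = (if q = row j then up j' (op1 (shiftp (lev j) f) v) else 0)"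
proof (cases "q = row j")
  case True
  have "j' = i + (k + lev j) * int N + int p - 1"
    using degree_eq[of j] True unfolding j' by (simp add: algebra_simps)
  from row_lev_unique[OF pq(1) this] have r: "row j' = p" "lev j' = k + lev j" .
  have "E k p q f (up j v) = E (k + lev j) p 1 (shiftp (lev j) f) v"
    unfolding up_def using product[OF pq row(1) one_idx v] True by simp
  also have "\<dots> = up j' (op1 (shiftp (lev j) f) v)"
    unfolding up_def r using product[OF pq(1) one_idx one_idx one_idx v] by simp
  finally show ?thesis using True by simp
next
  case False
  then show ?thesis unfolding up_def using product[OF pq row(1) one_idx v] by simp
qed

lemma down_add: "v \<in> W j \<Longrightarrow> w \<in> W j \<Longrightarrow> down j (v + w) = down j v + down j w"
  unfolding down_def by (rule E_add[OF one_idx row(1)])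

lemma down_scale: "v \<in> W j \<Longrightarrow> down j (c *s v) = c *s down j v"
  unfolding down_def by (rule E_scale[OF one_idx row(1)])

lemma up_add: "v \<in> W i \<Longrightarrow> w \<in> W i \<Longrightarrow> up j (v + w) = up j v + up j w"
  unfolding up_def by (rule E_add[OF row(1) one_idx])

lemma up_scale: "v \<in> W i \<Longrightarrow> up j (c *s v) = c *s up j v"
  unfolding up_def by (rule E_scale[OF row(1) one_idx])

lemma up_0 [simp]: "up j 0 = 0"
  unfolding up_def by (rule E_0[OF row(1) one_idx])

lemma up_sum: "(\<And>t. t \<in> I \<Longrightarrow> x t \<in> W i) \<Longrightarrow> up j (sum x I) = (\<Sum>t\<in>I. up j (x t))"
  unfolding up_def by (rule E_sum[OF row(1) one_idx])

text \<open>Subspaces of \<open>W i\<close> that are invariant under \<open>D\<close> correspond to stable families.\<close>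

definition induced :: "'a set \<Rightarrow> int \<Rightarrow> 'a set" where
  "induced Y j = {w \<in> W j. down j w \<in> Y}"

lemma op1_invariant:
  assumes Y: "subspace Y" "Y \<subseteq> W i" and inv: "\<And>v. v \<in> Y \<Longrightarrow> op1 [:0, 1:] v \<in> Y" and v: "v \<in> Y"
  shows "op1 f v \<in> Y"
proof (induction f)
  case 0
  then show ?case using E_0f[OF one_idx one_idx, of v i] v Y subspace_0[OF Y(1)] by auto
next
  case (pCons a f)
  have vW: "v \<in> W i" using v Y by blast
  have "pCons a f = Polynomial.smult a 1 + [:0, 1:] * f" by simp
  then have "op1 (pCons a f) v = a *s v + op1 [:0, 1:] (op1 f v)"
    using E_addf[OF one_idx one_idx vW] E_smult[OF one_idx one_idx vW] op1_mult[OF vW] W_i[OF vW] by metis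
  then show ?case using inv[OF pCons.IH] subspace_add[OF Y(1)] subspace_scale[OF Y(1) v] by simp
qed

lemma stable_induced:
  assumes Y: "subspace Y" "Y \<subseteq> W i" and inv: "\<And>v. v \<in> Y \<Longrightarrow> op1 [:0, 1:] v \<in> Y"
  shows "stable (induced Y)"
proof (rule stableI)
  fix j
  show "subspace (induced Y j)"
  proof (rule subspaceI)
    have "down j 0 = 0" using down_scale[of 0 j 0] by simp
    then show "0 \<in> induced Y j" using subspace_0[OF Y(1)] by (simp add: induced_def)
  qed (use subspace_add[OF Y(1)] subspace_scale[OF Y(1)] in
      \<open>auto simp: induced_def W_add W_scale down_add down_scale\<close>)
  show "induced Y j \<subseteq> W j" by (auto simp: induced_def)
  show "Z v \<in> induced Y j" if "v \<in> induced Y j" for v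
  proof -
    have "down j 0 = 0" using down_scale[of 0 j 0] by simp
    then show ?thesis using that Z_zero subspace_0[OF Y(1)] by (auto simp: induced_def)
  qed
next
  fix j k p q f w assume pq: "p \<in> idx" "q \<in> idx" and w: "w \<in> induced Y j"
  let ?j = "j + k * int N + int p - int q"
  define v where "v = down j w"
  have v: "v \<in> Y" "v \<in> W i" using w Y unfolding induced_def v_def by auto
  have wv: "w = up j v" unfolding v_def using up_down w by (simp add: induced_def)
  have "down ?j (E k p q f w) \<in> Y"
  proof (cases "q = row j")
    case True
    have "down ?j (E k p q f w) = op1 (shiftp (lev j) f) v"
      unfolding wv using E_up[OF pq v(2) refl] True down_up[OF op1_in[OF v(2)]] by simp
    then show ?thesis using op1_invariant[OF Y inv v(1)] by simp
  next
    case False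
    have "down ?j 0 = 0" using down_scale[of 0 ?j 0] by simp
    then show ?thesis unfolding wv using E_up[OF pq v(2) refl] False subspace_0[OF Y(1)] by simp
  qed
  then show "E k p q f w \<in> induced Y ?j"
    using E_in[OF pq] w by (simp add: induced_def)
qed

lemma induced_i: "Y \<subseteq> W i \<Longrightarrow> induced Y i = Y"
proof -
  have "down i w = w" if "w \<in> W i" for w unfolding down_def row_i using W_i that by simp
  then show "Y \<subseteq> W i \<Longrightarrow> induced Y i = Y" by (auto simp: induced_def)
qed

lemma indecomposable_base:
  assumes indec: gindec
    and Y1: "subspace Y1" "Y1 \<subseteq> W i" "\<And>v. v \<in> Y1 \<Longrightarrow> op1 [:0, 1:] v \<in> Y1"
    and Y2: "subspace Y2" "Y2 \<subseteq> W i" "\<And>v. v \<in> Y2 \<Longrightarrow> op1 [:0, 1:] v \<in> Y2"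
    and disj: "Y1 \<inter> Y2 = {0}" and sum: "\<And>v. v \<in> W i \<Longrightarrow> \<exists>a\<in>Y1. \<exists>b\<in>Y2. v = a + b"
  shows "Y1 = {0} \<or> Y2 = {0}"
proof -
  have d0: "down j 0 = 0" for j using down_scale[of 0 j 0] by simp
  have "induced Y1 j \<inter> induced Y2 j = {0}" for j
  proof -
    have "w = 0" if w: "w \<in> induced Y1 j" "w \<in> induced Y2 j" for w
    proof -
      have "down j w = 0" using w disj unfolding induced_def by blast
      then have "up j (down j w) = 0" by simp
      then show ?thesis using up_down w unfolding induced_def by auto
    qed
    moreover have "0 \<in> induced Y1 j" "0 \<in> induced Y2 j"
      using d0 subspace_0[OF Y1(1)] subspace_0[OF Y2(1)] by (auto simp: induced_def)
    ultimately show ?thesis by blast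
  qed
  note dj = this
  have dec: "\<exists>a\<in>induced Y1 j. \<exists>b\<in>induced Y2 j. w = a + b" if w: "w \<in> W j" for w j
  proof -
    obtain a b where ab: "a \<in> Y1" "b \<in> Y2" "down j w = a + b" using sum[OF down_in[OF w]] by blast
    have "a \<in> W i" "b \<in> W i" using ab Y1(2) Y2(2) by auto
    then have "w = up j a + up j b" using up_down[OF w] ab(3) up_add by simp
    moreover have "up j a \<in> induced Y1 j" "up j b \<in> induced Y2 j"
      using ab \<open>a \<in> W i\<close> \<open>b \<in> W i\<close> up_in down_up by (auto simp: induced_def)
    ultimately show ?thesis by blast
  qed
  have "(\<forall>j. induced Y1 j = {0}) \<or> (\<forall>j. induced Y2 j = {0})"
    by (rule gindecD[OF indec stable_induced[OF Y1] stable_induced[OF Y2] dj dec])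
  then show ?thesis using induced_i Y1(2) Y2(2) by metis
qed

lemma simple_base:
  assumes simple: gsimple and Y: "subspace Y" "Y \<subseteq> W i" "\<And>v. v \<in> Y \<Longrightarrow> op1 [:0, 1:] v \<in> Y"
  shows "Y = {0} \<or> Y = W i"
proof -
  have "(\<forall>j. induced Y j = {0}) \<or> (\<forall>j. induced Y j = W j)"
    using simple stable_induced[OF Y] unfolding gsimple_def by simp
  then show ?thesis using induced_i[OF Y(2)] by metis
qed

lemma rank_translate: "rank_le m (W i) \<Longrightarrow> rank_le m (W j)"
proof -
  assume "rank_le m (W i)"
  then obtain B where B: "B \<subseteq> W i" "finite B" "card B \<le> m" "W i \<subseteq> span B" unfolding rank_le_def by blast
  have "W j \<subseteq> span (up j ` B)"
  proof
    fix w assume w: "w \<in> W j"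
    have "down j w \<in> span B" using down_in[OF w] B(4) by blast
    then obtain c where c: "down j w = (\<Sum>b\<in>B. c b *s b)" unfolding span_finite[OF B(2)] by blast
    have "w = up j (\<Sum>b\<in>B. c b *s b)" using up_down[OF w] c by simp
    also have "\<dots> = (\<Sum>b\<in>B. c b *s up j b)"
      using B(1) W_scale by (subst up_sum) (auto simp: up_scale subset_iff intro!: sum.cong)
    also have "\<dots> \<in> span (up j ` B)" by (intro span_sum span_scale span_base) auto
    finally show "w \<in> span (up j ` B)" .
  qed
  then show ?thesis using B(2,3) card_image_le[OF B(2), of "up j"]
    by (intro rank_leI[of "up j ` B"]) auto
qed

text \<open>An eigenline of \<open>D\<close> on \<open>W i\<close> generates a stable family.\<close>

lemma simple_rank_1:
  assumes simple: gsimple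
  shows "rank_le 1 (W j)"
proof (rule rank_translate)
  obtain K where K: "rank_le K (W i)" using W_fin by blast
  interpret X: endo scale "W i" "op1 [:0, 1:]"
    using W_sub op1_in E_add[OF one_idx one_idx] E_scale[OF one_idx one_idx] by unfold_locales auto
  show "rank_le 1 (W i)"
  proof (cases "W i = {0}")
    case True
    then show ?thesis by (intro rank_leI[of "{}"]) auto
  next
    case False
    obtain v c where v: "v \<in> W i" "v \<noteq> 0" "op1 [:0, 1:] v - c *s v \<in> {0}"
      using X.quotient_eigenvector_single[OF K, of "{0}"] False X.T_zero by auto
    have sub: "span {v} \<subseteq> W i" using v(1) W_sub by (intro span_minimal) auto
    have "op1 [:0, 1:] w \<in> span {v}" if w: "w \<in> span {v}" for w
    proof -
      obtain a where "w = a *s v" using w unfolding span_singleton by blast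
      then have "op1 [:0, 1:] w = (a * c) *s v" using X.T_scale[OF v(1)] v(3) by simp
      then show ?thesis by (simp add: span_base span_scale)
    qed
    then have "span {v} = {0} \<or> span {v} = W i" using simple_base[OF simple subspace_span sub] by blast
    then have "span {v} = W i" using v(2) span_base[of v "{v}"] by auto
    then show ?thesis by (intro rank_leI[of "{v}"]) auto
  qed
qed

section \<open>Coordinates\<close>

text \<open>A basis \<open>u\<close> of \<open>W i\<close>, indexed like the columns of a matrix, and the matrix \<open>\<alpha>\<close> of \<open>D\<close> in it.\<close>

definition coordinates :: "nat \<Rightarrow> (nat \<Rightarrow> 'a) \<Rightarrow> complex mat \<Rightarrow> bool" where
  "coordinates m u \<alpha> \<longleftrightarrow> \<alpha> \<in> carrier_mat m m \<and> (\<forall>s<m. u s \<in> W i) \<and>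
     (\<forall>v\<in>W i. \<exists>c. v = (\<Sum>s<m. c s *s u s)) \<and>
     (\<forall>c. (\<Sum>s<m. c s *s u s) = 0 \<longrightarrow> (\<forall>s<m. c s = 0)) \<and>
     (\<forall>s<m. op1 [:0, 1:] (u s) = (\<Sum>t<m. (\<alpha> $$ (t, s)) *s u t))"

lemma coordinates_exist:
  assumes "rank_le K (W i)"
  obtains m u \<alpha> where "m \<le> K" "coordinates m u \<alpha>"
proof -
  obtain C where C: "C \<subseteq> W i" "independent C" "W i \<subseteq> span C" by (rule basis_exists[of "W i"]) blast
  obtain B where B: "finite B" "card B \<le> K" "W i \<subseteq> span B" using assms unfolding rank_le_def by blast
  have "C \<subseteq> span B" using C(1) B(3) by blast
  from independent_span_bound[OF B(1) C(2) this] have fin: "finite C" and cK: "card C \<le> K" using B(2) by auto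
  define m where "m = card C"
  obtain u where u: "bij_betw u {..<m} C" using ex_bij_betw_nat_finite[OF fin] by (auto simp: m_def atLeast0LessThan)
  have inj: "inj_on u {..<m}" and img: "u ` {..<m} = C" using u by (auto simp: bij_betw_def)
  have uW: "u s \<in> W i" if "s < m" for s using img that C(1) by auto
  have sp: "\<exists>c. v = (\<Sum>s<m. c s *s u s)" if "v \<in> W i" for v
  proof -
    have "v \<in> span C" using that C(3) by blast
    then obtain c where "v = (\<Sum>b\<in>C. c b *s b)" unfolding span_finite[OF fin] by blast
    also have "\<dots> = (\<Sum>s<m. c (u s) *s u s)" unfolding img[symmetric] by (simp add: sum.reindex[OF inj])
    finally show ?thesis by (rule exI[of _ "\<lambda>s. c (u s)"])
  qed
  have ind: "\<forall>s<m. c s = 0" if z: "(\<Sum>s<m. c s *s u s) = 0" for c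
  proof -
    define d where "d b = c (inv_into {..<m} u b)" for b
    have "(\<Sum>b\<in>C. d b *s b) = 0"
      unfolding img[symmetric] using z inj by (simp add: sum.reindex[OF inj] d_def)
    then have "\<forall>b\<in>C. d b = 0" using C(2) dependent_finite[OF fin] by blast
    then show ?thesis using inj img unfolding d_def by (metis imageI inv_into_f_f lessThan_iff)
  qed
  have "\<forall>s\<in>{..<m}. \<exists>c. op1 [:0, 1:] (u s) = (\<Sum>t<m. c t *s u t)"
    using sp op1_in uW by simp
  then obtain a where a: "\<And>s. s < m \<Longrightarrow> op1 [:0, 1:] (u s) = (\<Sum>t<m. a s t *s u t)" by (metis lessThan_iff)
  define \<alpha> where "\<alpha> = mat m m (\<lambda>(t, s). a s t)"
  have "coordinates m u \<alpha>" unfolding coordinates_def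
    using uW sp ind a by (auto simp: \<alpha>_def)
  then show ?thesis using that cK m_def by blast
qed

lemma shift_mat_carrier: "\<alpha> \<in> carrier_mat m m \<Longrightarrow> shift_mat m \<alpha> k \<in> carrier_mat m m"
  by (simp add: shift_mat_def)

lemma op1_power:
  assumes c: "coordinates m u \<alpha>" and s: "s < m"
  shows "op1 ([:of_int k, 1:] ^ n) (u s) = (\<Sum>t<m. ((shift_mat m \<alpha> k ^\<^sub>m n) $$ (t, s)) *s u t)"
  using s
proof (induction n arbitrary: s)
  case 0
  have "(\<Sum>t<m. ((1\<^sub>m m) $$ (t, s)) *s u t) = (\<Sum>t<m. if t = s then u t else 0)"
    using 0 by (intro sum.cong) auto
  also have "\<dots> = u s" using 0 by (subst sum.delta) auto
  finally have *: "u s = (\<Sum>t<m. ((1\<^sub>m m) $$ (t, s)) *s u t)" by (rule sym)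
  have "\<alpha> \<in> carrier_mat m m" "u s \<in> W i" using c 0 by (auto simp: coordinates_def)
  then have "shift_mat m \<alpha> k ^\<^sub>m 0 = 1\<^sub>m m" by (simp add: shift_mat_def)
  then show ?case unfolding power_0 W_i[OF \<open>u s \<in> W i\<close>] using * by (simp only:)
next
  case (Suc n)
  define P where "P = shift_mat m \<alpha> k"
  have \<alpha>: "\<alpha> \<in> carrier_mat m m" and uW: "\<And>s. s < m \<Longrightarrow> u s \<in> W i" using c by (auto simp: coordinates_def)
  have P: "P \<in> carrier_mat m m" unfolding P_def by (rule shift_mat_carrier[OF \<alpha>])
  have lin: "op1 [:of_int k, 1:] (u s) = (\<Sum>t<m. (P $$ (t, s)) *s u t)"
  proof -
    have "[:of_int k, 1:] = Polynomial.smult (of_int k) 1 + [:0, 1:]" by simp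
    then have "op1 [:of_int k, 1:] (u s) = of_int k *s u s + (\<Sum>t<m. (\<alpha> $$ (t, s)) *s u t)"
      using E_addf[OF one_idx one_idx uW[OF Suc.prems]] E_smult[OF one_idx one_idx uW[OF Suc.prems]]
        W_i[OF uW[OF Suc.prems]] c Suc.prems unfolding coordinates_def by metis
    also have "of_int k *s u s = (\<Sum>t<m. if t = s then of_int k *s u t else 0)"
      using Suc.prems by (subst sum.delta) auto
    also have "\<dots> = (\<Sum>t<m. (of_int k * (1\<^sub>m m) $$ (t, s)) *s u t)"
      using Suc.prems by (intro sum.cong) auto
    also have "\<dots> + (\<Sum>t<m. (\<alpha> $$ (t, s)) *s u t) = (\<Sum>t<m. (P $$ (t, s)) *s u t)"
      unfolding sum.distrib[symmetric] scale_left_distrib[symmetric]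
      using \<alpha> Suc.prems by (intro sum.cong) (auto simp: P_def shift_mat_def)
    finally show ?thesis .
  qed
  have "op1 ([:of_int k, 1:] ^ Suc n) (u s) = op1 ([:of_int k, 1:] ^ n * [:of_int k, 1:]) (u s)"
    by (simp only: power_Suc2)
  also have "\<dots> = op1 ([:of_int k, 1:] ^ n) (\<Sum>t<m. (P $$ (t, s)) *s u t)"
    unfolding op1_mult[OF uW[OF Suc.prems]] lin ..
  also have "\<dots> = (\<Sum>t<m. op1 ([:of_int k, 1:] ^ n) ((P $$ (t, s)) *s u t))"
    using uW W_scale by (intro E_sum[OF one_idx one_idx]) auto
  also have "\<dots> = (\<Sum>t<m. (P $$ (t, s)) *s (\<Sum>t'<m. ((P ^\<^sub>m n) $$ (t', t)) *s u t'))"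
    by (intro sum.cong refl) (simp only: E_scale[OF one_idx one_idx uW] Suc.IH P_def lessThan_iff)
  also have "\<dots> = (\<Sum>t'<m. (\<Sum>t<m. (P ^\<^sub>m n) $$ (t', t) * P $$ (t, s)) *s u t')"
    by (simp add: scale_sum_right scale_sum_left mult.commute) (rule sum.swap)
  also have "\<dots> = (\<Sum>t'<m. ((P ^\<^sub>m Suc n) $$ (t', s)) *s u t')"
  proof (rule sum.cong[OF refl])
    fix t' assume "t' \<in> {..<m}"
    moreover have "P ^\<^sub>m n \<in> carrier_mat m m" using P by simp
    ultimately have "(P ^\<^sub>m Suc n) $$ (t', s) = (\<Sum>t<m. (P ^\<^sub>m n) $$ (t', t) * P $$ (t, s))"
      using P Suc.prems by (simp add: scalar_prod_def atLeast0LessThan)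
    then show "(\<Sum>t<m. (P ^\<^sub>m n) $$ (t', t) * P $$ (t, s)) *s u t' = ((P ^\<^sub>m Suc n) $$ (t', s)) *s u t'" by simp
  qed
  finally show ?case by (simp add: P_def)
qed

lemma op1_expansion:
  assumes c: "coordinates m u \<alpha>" and s: "s < m" and f: "f = (\<Sum>n\<le>d. Polynomial.smult (b n) ([:of_int k, 1:] ^ n))"
  shows "op1 f (u s) = (\<Sum>t<m. (\<Sum>n\<le>d. b n * (shift_mat m \<alpha> k ^\<^sub>m n) $$ (t, s)) *s u t)"
proof -
  have uW: "u s \<in> W i" using c s by (auto simp: coordinates_def)
  have "op1 f (u s) = (\<Sum>n\<le>d. b n *s (\<Sum>t<m. ((shift_mat m \<alpha> k ^\<^sub>m n) $$ (t, s)) *s u t))"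
    unfolding f by (simp only: E_sumf[OF one_idx one_idx uW] E_smult[OF one_idx one_idx uW] op1_power[OF c s])
  also have "\<dots> = (\<Sum>t<m. (\<Sum>n\<le>d. b n * (shift_mat m \<alpha> k ^\<^sub>m n) $$ (t, s)) *s u t)"
    by (simp add: scale_sum_right scale_sum_left) (rule sum.swap)
  finally show ?thesis .
qed

text \<open>
  The coordinate map carries invariant subspaces of \<open>\<alpha>\<close> to \<open>D\<close>-invariant subspaces of \<open>W i\<close>.
\<close>

lemma indecomposable_matrix:
  assumes indec: gindec and c: "coordinates m u \<alpha>"
  shows "indecomposable_mat m \<alpha>"
proof -
  have \<alpha>: "\<alpha> \<in> carrier_mat m m" and uW: "\<And>s. s < m \<Longrightarrow> u s \<in> W i"
    and sp: "\<And>v. v \<in> W i \<Longrightarrow> \<exists>c. v = (\<Sum>s<m. c s *s u s)"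
    and ind: "\<And>c. (\<Sum>s<m. c s *s u s) = 0 \<Longrightarrow> \<forall>s<m. c s = 0"
    and D: "\<And>s. s < m \<Longrightarrow> op1 [:0, 1:] (u s) = (\<Sum>t<m. (\<alpha> $$ (t, s)) *s u t)"
    using c unfolding coordinates_def by blast+
  define L where "L x = (\<Sum>s<m. (x $ s) *s u s)" for x :: "complex vec"
  have LW: "L x \<in> W i" for x unfolding L_def using uW by (intro W_sum W_scale) auto
  have Ladd: "L (x + y) = L x + L y" if "x \<in> carrier_vec m" "y \<in> carrier_vec m" for x y
    unfolding L_def using that by (simp add: scale_left_distrib sum.distrib)
  have Lscale: "L (a \<cdot>\<^sub>v x) = a *s L x" if "x \<in> carrier_vec m" for a x
    unfolding L_def using that by (simp add: scale_sum_right)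
  have L0: "L (0\<^sub>v m) = 0" unfolding L_def by simp
  have Linj: "x = 0\<^sub>v m" if "x \<in> carrier_vec m" "L x = 0" for x
    using ind[of "\<lambda>s. x $ s"] that unfolding L_def by (intro eq_vecI) auto
  have LD: "op1 [:0, 1:] (L x) = L (\<alpha> *\<^sub>v x)" if x: "x \<in> carrier_vec m" for x
  proof -
    have "op1 [:0, 1:] (L x) = (\<Sum>s<m. op1 [:0, 1:] ((x $ s) *s u s))"
      unfolding L_def using uW W_scale by (intro E_sum[OF one_idx one_idx]) auto
    also have "\<dots> = (\<Sum>s<m. (x $ s) *s (\<Sum>t<m. (\<alpha> $$ (t, s)) *s u t))"
      by (intro sum.cong refl) (simp only: E_scale[OF one_idx one_idx uW] D lessThan_iff)
    also have "\<dots> = (\<Sum>t<m. (\<Sum>s<m. \<alpha> $$ (t, s) * x $ s) *s u t)"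
      by (simp add: scale_sum_right scale_sum_left mult.commute) (rule sum.swap)
    also have "\<dots> = L (\<alpha> *\<^sub>v x)"
      unfolding L_def using \<alpha> x by (intro sum.cong) (auto simp: scalar_prod_def atLeast0LessThan)
    finally show ?thesis .
  qed
  have inv: "subspace (L ` U) \<and> L ` U \<subseteq> W i \<and> (\<forall>v\<in>L ` U. op1 [:0, 1:] v \<in> L ` U)"
    if U: "invariant_subspace m \<alpha> U" for U
  proof (intro conjI ballI)
    have Uc: "U \<subseteq> carrier_vec m" using U by (simp add: invariant_subspace_def)
    show "subspace (L ` U)"
    proof (rule subspaceI)
      show "0 \<in> L ` U" using U L0 unfolding invariant_subspace_def by (metis imageI)
      fix x y assume "x \<in> L ` U" "y \<in> L ` U"
      then obtain a b where ab: "a \<in> U" "b \<in> U" "x = L a" "y = L b" by blast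
      then have "x + y = L (a + b)" using Ladd[OF subsetD[OF Uc] subsetD[OF Uc], of a b] by simp
      moreover have "a + b \<in> U" using U ab unfolding invariant_subspace_def by blast
      ultimately show "x + y \<in> L ` U" by blast
    next
      fix r x assume "x \<in> L ` U"
      then obtain a where a: "a \<in> U" "x = L a" by blast
      then have "r *s x = L (r \<cdot>\<^sub>v a)" using Lscale[OF subsetD[OF Uc], of a r] by simp
      moreover have "r \<cdot>\<^sub>v a \<in> U" using U a unfolding invariant_subspace_def by blast
      ultimately show "r *s x \<in> L ` U" by blast
    qed
    show "L ` U \<subseteq> W i" using LW by blast
    fix v assume "v \<in> L ` U"
    then obtain a where a: "a \<in> U" "v = L a" by blast
    then have "op1 [:0, 1:] v = L (\<alpha> *\<^sub>v a)" using LD[OF subsetD[OF Uc], of a] by simp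
    moreover have "\<alpha> *\<^sub>v a \<in> U" using U a unfolding invariant_subspace_def by blast
    ultimately show "op1 [:0, 1:] v \<in> L ` U" by blast
  qed
  have "\<not> (\<exists>U V. invariant_subspace m \<alpha> U \<and> invariant_subspace m \<alpha> V \<and>
          U \<noteq> {0\<^sub>v m} \<and> V \<noteq> {0\<^sub>v m} \<and> U \<inter> V = {0\<^sub>v m} \<and>
          {u + w | u w. u \<in> U \<and> w \<in> V} = carrier_vec m)"
  proof
    assume "\<exists>U V. invariant_subspace m \<alpha> U \<and> invariant_subspace m \<alpha> V \<and>
          U \<noteq> {0\<^sub>v m} \<and> V \<noteq> {0\<^sub>v m} \<and> U \<inter> V = {0\<^sub>v m} \<and>
          {u + w | u w. u \<in> U \<and> w \<in> V} = carrier_vec m"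
    then obtain U V where U: "invariant_subspace m \<alpha> U" and V: "invariant_subspace m \<alpha> V"
      and nz: "U \<noteq> {0\<^sub>v m}" "V \<noteq> {0\<^sub>v m}" and disj: "U \<inter> V = {0\<^sub>v m}"
      and sum: "{u + w | u w. u \<in> U \<and> w \<in> V} = carrier_vec m" by blast
    have Uc: "U \<subseteq> carrier_vec m" and Vc: "V \<subseteq> carrier_vec m" and UV0: "0\<^sub>v m \<in> U" "0\<^sub>v m \<in> V"
      using U V by (auto simp: invariant_subspace_def)
    have d: "L ` U \<inter> L ` V = {0}"
    proof -
      have "x = 0" if x: "x \<in> L ` U" "x \<in> L ` V" for x
      proof -
        obtain a b where ab: "a \<in> U" "b \<in> V" "x = L a" "x = L b" using x by blast
        have ac: "a \<in> carrier_vec m" "b \<in> carrier_vec m" using ab Uc Vc by blast+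
        have "L (a + (- 1) \<cdot>\<^sub>v b) = x + (- 1) *s x"
          using Ladd[of a "(- 1) \<cdot>\<^sub>v b"] Lscale[of b "-1"] ac ab(3,4) by (simp only: smult_carrier_vec)
        then have "L (a + (- 1) \<cdot>\<^sub>v b) = 0" by (simp add: scale_minus_left)
        then have z: "a + (- 1) \<cdot>\<^sub>v b = 0\<^sub>v m" using Linj[of "a + (- 1) \<cdot>\<^sub>v b"] ac by simp
        have "a = b"
        proof (rule eq_vecI)
          show "dim_vec a = dim_vec b" using ac by simp
          fix t assume "t < dim_vec b"
          then have "(a + (- 1) \<cdot>\<^sub>v b) $ t = 0" using z ac by simp
          then show "a $ t = b $ t" using \<open>t < dim_vec b\<close> ac by simp
        qed
        then have "a \<in> U \<inter> V" using ab by simp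
        then show ?thesis using disj ab L0 by simp
      qed
      moreover have "0 \<in> L ` U" "0 \<in> L ` V" using UV0 L0 by (metis imageI)+
      ultimately show ?thesis by blast
    qed
    have s: "\<exists>a\<in>L ` U. \<exists>b\<in>L ` V. v = a + b" if v: "v \<in> W i" for v
    proof -
      obtain c where c: "v = (\<Sum>s<m. c s *s u s)" using sp[OF v] by blast
      have "v = L (vec m c)" unfolding L_def c by (intro sum.cong) auto
      moreover have "vec m c \<in> {u + w | u w. u \<in> U \<and> w \<in> V}" unfolding sum by simp
      ultimately obtain x y where "x \<in> U" "y \<in> V" "v = L (x + y)" by auto
      then show ?thesis using Ladd Uc Vc by blast
    qed
    have "L ` U = {0} \<or> L ` V = {0}"
      using indecomposable_base[OF indec, of "L ` U" "L ` V"] inv[OF U] inv[OF V] d s by blast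
    then have "U = {0\<^sub>v m} \<or> V = {0\<^sub>v m}" using Linj Uc Vc UV0 by blast
    then show False using nz by blast
  qed
  then show ?thesis unfolding indecomposable_mat_def using \<alpha> by blast
qed

end

section \<open>The central extension in coordinates\<close>

definition el :: "int \<Rightarrow> nat \<Rightarrow> nat \<Rightarrow> complex poly \<Rightarrow> cdiffop" where
  "el k p q f = (Poly_Mapping.single (k, p, q) f, 0)"

definition cel :: cdiffop where
  "cel = (0, 1)"

lemma el_add: "el k p q (f + g) = el k p q f + el k p q g"
  by (simp add: el_def single_add)

lemma el_smult: "el k p q (Polynomial.smult c f) = cdiffop_scale c (el k p q f)"
  by (auto simp: el_def cdiffop_scale_def lookup_diffop_scale lookup_single when_def intro!: poly_mapping_eqI)

lemma el_0: "el k p q 0 = 0"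
  by (simp add: el_def zero_prod_def)

lemma el_sum: "el k p q (\<Sum>i\<in>I. f i) = (\<Sum>i\<in>I. el k p q (f i))"
  by (induction I rule: infinite_finite_induct) (simp_all add: el_0 el_add)

lemma el_in: "p \<in> {1..N} \<Longrightarrow> q \<in> {1..N} \<Longrightarrow> el k p q f \<in> cdiffops N"
  by (auto simp: el_def cdiffops_def diffops_def)

lemma cel_in: "cel \<in> cdiffops N"
  by (auto simp: cel_def cdiffops_def diffops_def)

lemma subspace_cdiffops: "cdiffop.subspace (cdiffops N)"
proof (rule cdiffop.subspaceI)
  show "0 \<in> cdiffops N" by (auto simp: cdiffops_def diffops_def zero_prod_def)
  fix x y :: cdiffop assume "x \<in> cdiffops N" "y \<in> cdiffops N"
  then show "x + y \<in> cdiffops N"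
    using keys_add[of "fst x" "fst y"] unfolding cdiffops_def diffops_def mem_Times_iff mem_Collect_eq fst_add by blast
next
  fix c and x :: cdiffop assume "x \<in> cdiffops N"
  moreover have "Poly_Mapping.keys (diffop_scale c (fst x)) \<subseteq> Poly_Mapping.keys (fst x)"
    by (auto simp: in_keys_iff lookup_diffop_scale)
  ultimately show "cdiffop_scale c x \<in> cdiffops N"
    unfolding cdiffops_def diffops_def cdiffop_scale_def mem_Times_iff mem_Collect_eq fst_conv by blast
qed

lemma poly_mapping_sum_single: "x = (\<Sum>a\<in>Poly_Mapping.keys x. Poly_Mapping.single a (Poly_Mapping.lookup x a))"
  by (rule poly_mapping_eqI) (auto simp: lookup_sum lookup_single when_def in_keys_iff)

lemma cdiffop_expand:
  "x = (\<Sum>(k, p, q)\<in>Poly_Mapping.keys (fst x). el k p q (Poly_Mapping.lookup (fst x) (k, p, q)))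
      + cdiffop_scale (snd x) cel"
proof -
  have s: "(\<Sum>(k, p, q)\<in>A. el k p q (F (k, p, q))) = (\<Sum>a\<in>A. Poly_Mapping.single a (F a), 0)" for A F
    by (induction A rule: infinite_finite_induct) (auto simp: el_def zero_prod_def)
  have z: "diffop_scale c 0 = 0" for c by (rule poly_mapping_eqI) (simp add: lookup_diffop_scale)
  show ?thesis
    unfolding s poly_mapping_sum_single[symmetric] by (simp add: cdiffop_scale_def cel_def z)
qed

lemma cocycle_poly_zero: "cocycle_poly k 0 g = 0" "cocycle_poly k f 0 = 0"
  by (simp_all add: cocycle_poly_def ffall_coeff_def)

lemma diffop_mult_single:
  "diffop_mult (Poly_Mapping.single (k, p, q) f) (Poly_Mapping.single (l, r, s) g) =
     (if q = r then Poly_Mapping.single (k + l, p, s) (shiftp l f * g) else 0)"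
  by (cases "f = 0"; cases "g = 0") (simp_all add: diffop_mult_def shiftp_def)

lemma cocycle_single:
  "cocycle (Poly_Mapping.single (k, p, q) f) (Poly_Mapping.single (l, r, s) g) =
     (if k + l = 0 \<and> q = r \<and> p = s then cocycle_poly k f g else 0)"
  by (cases "f = 0"; cases "g = 0") (auto simp: cocycle_def cocycle_poly_zero)

lemma el_bracket:
  "cdiffop_bracket (el k p q f) (el l r s g) =
     (if q = r then el (k + l) p s (shiftp l f * g) else 0)
     - (if s = p then el (k + l) r q (shiftp k g * f) else 0)
     + (if k + l = 0 \<and> q = r \<and> p = s then cdiffop_scale (cocycle_poly k f g) cel else 0)"
proof -
  have z: "diffop_scale c 0 = 0" for c by (rule poly_mapping_eqI) (simp add: lookup_diffop_scale)
  have f: "fst (el k p q f) = Poly_Mapping.single (k, p, q) f" "snd (el k p q f) = 0" for k p q f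
    by (simp_all add: el_def)
  show ?thesis
    by (rule prod_eqI)
      (simp_all add: cdiffop_bracket_def f diffop_mult_single cocycle_single cdiffop_scale_def cel_def z add.commute)
qed

lemma cel_bracket: "cdiffop_bracket cel x = 0"
  by (simp add: cdiffop_bracket_def diffop_mult_def cocycle_def cel_def zero_prod_def)

lemma cocycle_poly_0: "cocycle_poly 0 f g = 0"
proof -
  have "(of_int (0 + int j) gchoose (j + l + 1) :: complex) = 0" for j l
    using binomial_gbinomial[of j "j + l + 1", where 'a = complex] by (simp add: binomial_eq_0)
  then show ?thesis by (simp add: cocycle_poly_def)
qed

lemma poly_ffall_neg: "poly (ffall j) (- of_nat (Suc k)) = (-1) ^ j * fact j * of_nat ((k + j) choose j)"
proof (induction j)
  case 0
  show ?case by (simp add: ffall_def)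
next
  case (Suc j)
  have "ffall (Suc j) = ffall j * [:- of_nat j, 1:]" by (simp add: ffall_def)
  then have "poly (ffall (Suc j)) (- of_nat (Suc k)) = poly (ffall j) (- of_nat (Suc k)) * (- of_nat (Suc (k + j)))"
    by (simp only: poly_mult poly_pCons poly_0) simp
  also have "\<dots> = (-1) ^ Suc j * fact j * of_nat (Suc (k + j) * ((k + j) choose j))"
    unfolding Suc by (simp add: algebra_simps)
  also have "Suc (k + j) * ((k + j) choose j) = (Suc (k + j) choose Suc j) * Suc j"
    by (rule Suc_times_binomial_eq)
  finally show ?case by (simp add: algebra_simps)
qed

text \<open>
  A hockey-stick identity: the values of falling factorials at negative integers are binomial
  coefficients up to a factor, and they are summed by Pascal's rule.
\<close>

lemma sum_ffall_neg:
  "(\<Sum>i=1..k. poly (ffall j) (- of_nat i)) = (-1) ^ j * fact j * (of_int (int k + int j) gchoose (j + 1))"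
proof (induction k)
  case 0
  then show ?case using binomial_gbinomial[of j "j + 1", where 'a = complex] by (simp add: binomial_eq_0)
next
  case (Suc k)
  have e: "(of_int (int k + int j) :: complex) = of_nat (k + j)" "(of_int (int (Suc k) + int j) :: complex) = of_nat (Suc (k + j))"
    by simp_all
  have "(\<Sum>i=1..Suc k. poly (ffall j) (- of_nat i))
      = (-1) ^ j * fact j * (of_nat ((k + j) choose (j + 1)) + of_nat ((k + j) choose j))"
    using Suc poly_ffall_neg[of j k] unfolding e binomial_gbinomial[symmetric] by (simp add: algebra_simps)
  also have "\<dots> = (-1) ^ j * fact j * of_nat (Suc (k + j) choose (j + 1))" by simp
  finally show ?case unfolding e binomial_gbinomial .
qed

lemma cocycle_poly_1: "cocycle_poly (int k) u 1 = (\<Sum>i=1..k. poly u (- of_nat i))"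
proof -
  have one: "ffall_coeff 1 0 = 1" by (simp add: ffall_coeff_def)
  have "cocycle_poly (int k) u 1
      = (\<Sum>j\<le>degree u. ffall_coeff u j * ((-1) ^ j * fact j * (of_int (int k + int j) gchoose (j + 1))))"
    by (simp add: cocycle_poly_def one)
  also have "\<dots> = (\<Sum>j\<le>degree u. \<Sum>i=1..k. ffall_coeff u j * poly (ffall j) (- of_nat i))"
    unfolding sum_ffall_neg[symmetric] sum_distrib_left ..
  also have "\<dots> = (\<Sum>i=1..k. \<Sum>j\<le>degree u. ffall_coeff u j * poly (ffall j) (- of_nat i))"
    by (rule sum.swap)
  also have "\<dots> = (\<Sum>i=1..k. poly (\<Sum>j\<le>degree u. Polynomial.smult (ffall_coeff u j) (ffall j)) (- of_nat i))"
    by (simp add: poly_sum)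
  finally show ?thesis unfolding poly_ffall_expansion[symmetric] .
qed

section \<open>From graded modules to families of operators\<close>

text \<open>
  A quasifinite module is viewed as the family of its components with the operators of the elements
  \<open>t\<^sup>k f(D) E\<^sub>p\<^sub>q\<close>.
\<close>

locale qmod =
  fixes N :: nat and M :: "'v::ab_group_add cdiffop_rep" and G :: "int \<Rightarrow> 'v set"
  assumes N_ge_1: "N \<ge> 1" and quasi: "quasifinite N M G"
begin

lemma mod: "cdiffop_module N M" and grad: "gradation N M G"
  and fin: "\<exists>B. finite B \<and> module.span (scale M) B = G j"
  using quasi by (auto simp: quasifinite_def)

sublocale complex_space "scale M"
  using mod by (auto simp: cdiffop_module_def intro: complex_space.intro)

lemma space_sub: "subspace (space M)"
  and act_in: "x \<in> cdiffops N \<Longrightarrow> v \<in> space M \<Longrightarrow> act M x v \<in> space M"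
  and act_add: "x \<in> cdiffops N \<Longrightarrow> v \<in> space M \<Longrightarrow> w \<in> space M \<Longrightarrow> act M x (v + w) = act M x v + act M x w"
  and act_scale: "x \<in> cdiffops N \<Longrightarrow> v \<in> space M \<Longrightarrow> act M x (scale M c v) = scale M c (act M x v)"
  and act_addx: "x \<in> cdiffops N \<Longrightarrow> y \<in> cdiffops N \<Longrightarrow> v \<in> space M \<Longrightarrow> act M (x + y) v = act M x v + act M y v"
  and act_scalex: "x \<in> cdiffops N \<Longrightarrow> v \<in> space M \<Longrightarrow> act M (cdiffop_scale c x) v = scale M c (act M x v)"
  and act_bracket: "x \<in> cdiffops N \<Longrightarrow> y \<in> cdiffops N \<Longrightarrow> v \<in> space M \<Longrightarrow>
      act M (cdiffop_bracket x y) v = act M x (act M y v) - act M y (act M x v)"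
  using mod unfolding cdiffop_module_def by blast+

lemma G_sub: "subspace (G j)" and G_space: "v \<in> G j \<Longrightarrow> v \<in> space M"
  and act_deg: "x \<in> cdiffop_deg N i \<Longrightarrow> v \<in> G j \<Longrightarrow> act M x v \<in> G (i + j)"
  and G_unique: "v \<in> space M \<Longrightarrow> \<exists>!w. (\<forall>j. w j \<in> G j) \<and> finite {j. w j \<noteq> 0} \<and> v = (\<Sum>j | w j \<noteq> 0. w j)"
  using grad unfolding gradation_def by blast+

lemma G_rank: "\<exists>K. rank_le K (G j)"
proof -
  obtain B where "finite B" "span B = G j" using fin by blast
  then show ?thesis using span_superset[of B] by (intro exI[of _ "card B"] rank_leI[of B]) auto
qed

lemma act_0x: "v \<in> space M \<Longrightarrow> act M 0 v = 0"
  using act_scalex[OF cel_in, of v 0] by simp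

lemma act_0v: "x \<in> cdiffops N \<Longrightarrow> act M x 0 = 0"
  using act_scale[of x 0 0] subspace_0[OF space_sub] by simp

lemma act_diffx: "x \<in> cdiffops N \<Longrightarrow> y \<in> cdiffops N \<Longrightarrow> v \<in> space M \<Longrightarrow> act M (x - y) v = act M x v - act M y v"
  using act_addx[of "x - y" y v] cdiffop.subspace_diff[OF subspace_cdiffops] by simp

lemma act_sumx: "(\<And>i. i \<in> I \<Longrightarrow> x i \<in> cdiffops N) \<Longrightarrow> v \<in> space M \<Longrightarrow>
    act M (\<Sum>i\<in>I. x i) v = (\<Sum>i\<in>I. act M (x i) v)"
proof (induction I rule: infinite_finite_induct)
  case (insert i I)
  then show ?case using cdiffop.subspace_sum[OF subspace_cdiffops, of I x] by (simp add: act_addx)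
qed (simp_all add: act_0x)

lemma act_sumv: "x \<in> cdiffops N \<Longrightarrow> (\<And>i. i \<in> I \<Longrightarrow> v i \<in> space M) \<Longrightarrow>
    act M x (\<Sum>i\<in>I. v i) = (\<Sum>i\<in>I. act M x (v i))"
proof (induction I rule: infinite_finite_induct)
  case (insert i I)
  then show ?case using subspace_sum[OF space_sub, of I v] by (simp add: act_add)
qed (simp_all add: act_0v)

lemma keys_idx: "x \<in> cdiffops N \<Longrightarrow> (k, p, q) \<in> Poly_Mapping.keys (fst x) \<Longrightarrow> p \<in> {1..N} \<and> q \<in> {1..N}"
  by (auto simp: cdiffops_def diffops_def)

lemma act_expand:
  assumes x: "x \<in> cdiffops N" and v: "v \<in> space M"
  shows "act M x v = (\<Sum>(k, p, q)\<in>Poly_Mapping.keys (fst x). act M (el k p q (Poly_Mapping.lookup (fst x) (k, p, q))) v)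
      + scale M (snd x) (act M cel v)"
proof -
  let ?y = "\<lambda>(k, p, q). el k p q (Poly_Mapping.lookup (fst x) (k, p, q))"
  have y: "?y a \<in> cdiffops N" if "a \<in> Poly_Mapping.keys (fst x)" for a
    using keys_idx[OF x] that by (cases a) (auto intro!: el_in)
  have "act M x v = act M ((\<Sum>a\<in>Poly_Mapping.keys (fst x). ?y a) + cdiffop_scale (snd x) cel) v"
    by (subst cdiffop_expand) simp
  also have "\<dots> = act M (\<Sum>a\<in>Poly_Mapping.keys (fst x). ?y a) v + act M (cdiffop_scale (snd x) cel) v"
    using y by (intro act_addx[OF _ _ v] cdiffop.subspace_sum[OF subspace_cdiffops]
      cdiffop.subspace_scale[OF subspace_cdiffops] cel_in) auto
  also have "\<dots> = (\<Sum>a\<in>Poly_Mapping.keys (fst x). act M (?y a) v) + scale M (snd x) (act M cel v)"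
    using act_sumx[OF y v] act_scalex[OF cel_in v] by simp
  finally show ?thesis by (simp add: case_prod_unfold)
qed

lemma el_deg:
  assumes "p \<in> {1..N}" "q \<in> {1..N}"
  shows "el k p q f \<in> cdiffop_deg N (k * int N + int p - int q)"
proof -
  have "f = (\<Sum>j\<le>degree f. Polynomial.smult (coeff f j) (monom 1 j))"
    by (simp add: smult_monom poly_as_sum_of_monoms)
  then have "el k p q f = (\<Sum>j\<le>degree f. cdiffop_scale (coeff f j) (el k p q (monom 1 j)))"
    by (metis (no_types, lifting) el_sum el_smult sum.cong)
  also have "\<dots> \<in> cdiffop_deg N (k * int N + int p - int q)"
    unfolding cdiffop_deg_def el_def using assms
    by (intro cdiffop.span_sum cdiffop.span_scale cdiffop.span_base) auto
  finally show ?thesis .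
qed

lemma cel_deg: "cel \<in> cdiffop_deg N 0"
  unfolding cdiffop_deg_def cel_def by (intro cdiffop.span_base) auto

sublocale gmod "scale M" N "\<lambda>k p q f. act M (el k p q f)" "act M cel" cocycle_poly G
proof (unfold_locales, goal_cases)
  case 1 show ?case by (rule N_ge_1)
next
  case (2 j) show ?case by (rule G_sub)
next
  case (3 j) show ?case by (rule G_rank)
next
  case (4 p q v j k f)
  then show ?case using act_deg[OF el_deg[OF 4(1,2)] 4(3), of k f] by (simp add: algebra_simps)
next
  case (5 p q v j w k f) then show ?case using act_add el_in G_space by blast
next
  case (6 p q v j k f c) then show ?case using act_scale el_in G_space by blast
next
  case (7 p q v j k f g) then show ?case unfolding el_add using act_addx el_in G_space by blast
next
  case (8 p q v j k c f) then show ?case unfolding el_smult using act_scalex el_in G_space by blast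
next
  case (9 v j) then show ?case using act_deg[OF cel_deg 9] by simp
next
  case (10 v j w) then show ?case using act_add cel_in G_space by blast
next
  case (11 v j c) then show ?case using act_scale cel_in G_space by blast
next
  case (12 p q v j k f)
  then show ?case using act_bracket[OF cel_in el_in G_space, of p q v j k f] act_0x G_space
    by (simp add: cel_bracket del: atLeastAtMost_iff)
next
  case (13 f g) show ?case by (rule cocycle_poly_0)
next
  case (14 p q r s v j k f l g)
  have v: "v \<in> space M" using 14 G_space by blast
  let ?a = "if q = r then el (k + l) p s (shiftp l f * g) else 0"
  let ?b = "if s = p then el (k + l) r q (shiftp k g * f) else 0"
  let ?c = "if k + l = 0 \<and> q = r \<and> p = s then cdiffop_scale (cocycle_poly k f g) cel else 0"
  have in0: "(0 :: cdiffop) \<in> cdiffops N" by (rule cdiffop.subspace_0[OF subspace_cdiffops])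
  have a: "?a \<in> cdiffops N" and b: "?b \<in> cdiffops N" using 14 el_in in0 by auto
  have c: "?c \<in> cdiffops N" using in0 cdiffop.subspace_scale[OF subspace_cdiffops cel_in] by auto
  have "act M (el k p q f) (act M (el l r s g) v) - act M (el l r s g) (act M (el k p q f) v)
      = act M (?a - ?b + ?c) v"
    unfolding el_bracket[symmetric] by (rule act_bracket[OF el_in el_in v, OF 14(1-4), symmetric])
  also have "\<dots> = act M ?a v - act M ?b v + act M ?c v"
    using act_addx[OF cdiffop.subspace_diff[OF subspace_cdiffops a b] c v] act_diffx[OF a b v] by simp
  finally show ?case using act_0x[OF v] act_scalex[OF cel_in v] by (simp split del: if_split add: if_distrib[of "\<lambda>x. act M x v"] cong: if_cong)
qed

lemma bmodI:
  assumes "\<And>j. rank_le K (G j)"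
  shows "bmod (scale M) N (\<lambda>k p q f. act M (el k p q f)) (act M cel) cocycle_poly G K"
  using assms cocycle_poly_1 by unfold_locales auto

section \<open>Homogeneous components\<close>

lemma G_decompose:
  assumes "v \<in> space M"
  obtains w F where "finite F" "\<And>j. w j \<in> G j" "\<And>j. j \<notin> F \<Longrightarrow> w j = 0" "v = (\<Sum>j\<in>F. w j)"
  using ex1_implies_ex[OF G_unique[OF assms]] that by blast

lemma G_independent:
  assumes F: "finite F" and w: "\<And>j. w j \<in> G j" "\<And>j. j \<notin> F \<Longrightarrow> w j = 0" and z: "(\<Sum>j\<in>F. w j) = 0"
  shows "w j = 0"
proof -
  have "(\<Sum>j | w j \<noteq> 0. w j) = (\<Sum>j\<in>F. w j)"
    using F w(2) by (intro sum.mono_neutral_left) auto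
  moreover have "finite {j. w j \<noteq> 0}" using F w(2) by (auto intro: finite_subset)
  ultimately have 1: "(\<forall>j. w j \<in> G j) \<and> finite {j. w j \<noteq> 0} \<and> 0 = (\<Sum>j | w j \<noteq> 0. w j)" using w z by simp
  have 2: "(\<forall>j. 0 \<in> G j) \<and> finite {j::int. (0::'v) \<noteq> 0} \<and> 0 = (\<Sum>j::int | (0::'v) \<noteq> 0. (0::'v))" by simp
  note ex = G_unique[OF subspace_0[OF space_sub]]
  have "w = (\<lambda>_. 0)"
    by (rule trans[OF the1_equality[OF ex, of w, OF 1, symmetric] the1_equality[OF ex, of "\<lambda>_. 0", OF 2]])
  then show ?thesis by simp
qed

definition total :: "(int \<Rightarrow> 'v set) \<Rightarrow> 'v set" where
  "total A = span (\<Union>j. A j)"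

lemma total_decompose:
  assumes A: "\<And>j. subspace (A j)" and v: "v \<in> total A"
  shows "\<exists>w F. finite F \<and> (\<forall>j. w j \<in> A j) \<and> (\<forall>j. j \<notin> F \<longrightarrow> w j = 0) \<and> v = (\<Sum>j\<in>F. w j)"
  using v unfolding total_def
proof (induction rule: span_induct_alt)
  case base
  show ?case using subspace_0[OF A] by (intro exI[of _ "\<lambda>_. 0"] exI[of _ "{}"]) auto
next
  case (step c x y)
  obtain i where i: "x \<in> A i" using step(1) by blast
  obtain w F where w: "finite F" "\<And>j. w j \<in> A j" "\<And>j. j \<notin> F \<Longrightarrow> w j = 0" "y = (\<Sum>j\<in>F. w j)" using step(2) by blast
  have "y = (\<Sum>j\<in>insert i F. w j)" unfolding w(4) using w(1,3) by (intro sum.mono_neutral_left) auto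
  moreover have "scale M c x = (\<Sum>j\<in>insert i F. if j = i then scale M c x else 0)"
    using w(1) by (subst sum.delta) auto
  ultimately have "scale M c x + y = (\<Sum>j\<in>insert i F. (if j = i then scale M c x else 0) + w j)"
    by (simp only: sum.distrib)
  moreover have "(if j = i then scale M c x else 0) + w j \<in> A j" for j
    using i w(2) subspace_add[OF A] subspace_scale[OF A] by auto
  ultimately show ?case using w(1,3)
    by (intro exI[of _ "\<lambda>j. (if j = i then scale M c x else 0) + w j"] exI[of _ "insert i F"]) auto
qed

text \<open>
  Homogeneous components are unique, so the submodule generated by a family has the members of the
  family as its components.
\<close>

lemma total_component:
  assumes A: "\<And>j. subspace (A j)" "\<And>j. A j \<subseteq> G j" and v: "v \<in> total A" "v \<in> G i"
  shows "v \<in> A i"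
proof -
  obtain w F where w: "finite F" "\<And>j. w j \<in> A j" "\<And>j. j \<notin> F \<Longrightarrow> w j = 0" "v = (\<Sum>j\<in>F. w j)"
    using total_decompose[OF A(1) v(1)] by blast
  let ?w = "\<lambda>j. w j - (if j = i then v else 0)"
  have "(\<Sum>j\<in>insert i F. w j) = v" unfolding w(4) using w(1,3) by (intro sum.mono_neutral_right) auto
  moreover have "(\<Sum>j\<in>insert i F. if j = i then v else 0) = v" using w(1) by (subst sum.delta) auto
  ultimately have z: "(\<Sum>j\<in>insert i F. ?w j) = 0" by (simp only: sum_subtractf diff_self)
  have "?w k \<in> G k" for k
  proof (rule W_diff)
    show "w k \<in> G k" using w(2) A(2) by blast
    show "(if k = i then v else 0) \<in> G k" using v(2) by simp
  qed
  moreover have "?w k = 0" if "k \<notin> insert i F" for k using that w(3) by simp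
  ultimately have "?w i = 0"
    by (rule G_independent[where F = "insert i F" and w = ?w and j = i, OF finite.insertI[OF w(1)] _ _ z])
  then show ?thesis using w(2)[of i] by simp
qed

lemma space_total: "space M = total G"
proof
  show "total G \<subseteq> space M" unfolding total_def using G_space by (intro span_minimal space_sub) auto
  show "space M \<subseteq> total G"
  proof
    fix v assume "v \<in> space M"
    then obtain w F where "\<And>j. w j \<in> G j" "v = (\<Sum>j\<in>F. w j)" using G_decompose by metis
    then show "v \<in> total G" unfolding total_def by (simp only:) (blast intro: span_sum span_base)
  qed
qed

lemma submodule_total:
  assumes A: "stable A"
  shows "submodule N M (total A)"
  unfolding submodule_def
proof (intro conjI ballI)
  have sub: "v \<in> space M" if "v \<in> A j" for v j using A G_space that unfolding stable_def by blast
  show "subspace (total A)" unfolding total_def by simp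
  show tot: "total A \<subseteq> space M" unfolding total_def using sub by (intro span_minimal space_sub) auto
  fix x v assume x: "x \<in> cdiffops N" and v: "v \<in> total A"
  have base: "act M x u \<in> total A" if u: "u \<in> A j" for u j
  proof -
    have "act M (el k p q f) u \<in> total A" if "p \<in> {1..N}" "q \<in> {1..N}" for k p q f
      using A u that unfolding stable_def total_def by (blast intro: span_base)
    moreover have "act M cel u \<in> total A" using A u unfolding stable_def total_def by (blast intro: span_base)
    ultimately show ?thesis unfolding act_expand[OF x sub[OF u]] total_def
      using keys_idx[OF x] by (intro span_add span_scale span_sum) (auto simp del: atLeastAtMost_iff)
  qed
  have "total A \<subseteq> {v \<in> space M. act M x v \<in> total A}"
    unfolding total_def
  proof (rule span_minimal)
    show "(\<Union>j. A j) \<subseteq> {v \<in> space M. act M x v \<in> span (\<Union>j. A j)}"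
      using sub base unfolding total_def by blast
    show "subspace {v \<in> space M. act M x v \<in> span (\<Union>j. A j)}"
      using act_0v[OF x] act_add[OF x] act_scale[OF x] subspace_0[OF space_sub] subspace_add[OF space_sub]
        subspace_scale[OF space_sub] span_zero span_add span_scale by (intro subspaceI) auto
  qed
  then show "act M x v \<in> total A" using v by blast
qed

lemma total_zero: "(\<And>j. A j = {0}) \<Longrightarrow> total A = {0}"
  by (simp add: total_def)

lemma component_subset: "A j \<subseteq> total A"
  unfolding total_def by (rule subset_trans[OF _ span_superset]) auto

lemma some_component:
  assumes "space M \<noteq> {0}"
  shows "\<exists>j. G j \<noteq> {0}"
proof (rule ccontr)
  assume "\<nexists>j. G j \<noteq> {0}"
  then have "total G = {0}" by (intro total_zero) auto
  then show False using assms space_total by simp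
qed

lemma gsimpleI:
  assumes "irreducible_module N M"
  shows gsimple
  unfolding gsimple_def
proof (intro conjI allI impI)
  show "\<exists>j. G j \<noteq> {0}" using some_component assms unfolding irreducible_module_def by blast
  fix A assume A: "stable A"
  have A1: "\<And>j. subspace (A j)" "\<And>j. A j \<subseteq> G j" using A unfolding stable_def by blast+
  have "total A = {0} \<or> total A = space M"
    using submodule_total[OF A] assms unfolding irreducible_module_def by blast
  then show "(\<forall>j. A j = {0}) \<or> (\<forall>j. A j = G j)"
  proof
    assume "total A = {0}"
    then have "A j = {0}" for j using component_subset[of A j] subspace_0[OF A1(1)[of j]] by auto
    then show ?thesis by simp
  next
    assume "total A = space M"
    then have "G j \<subseteq> A j" for j using total_component[OF A1] G_space by blast
    then show ?thesis using A1(2) by blast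
  qed
qed

lemma gindecI:
  assumes "indecomposable_module N M"
  shows gindec
  unfolding gindec_def
proof (intro allI impI)
  fix A B assume A: "stable A" and B: "stable B" and d: "\<forall>j. A j \<inter> B j = {0}"
    and s: "\<forall>j. \<forall>v\<in>G j. \<exists>a\<in>A j. \<exists>b\<in>B j. v = a + b"
  have A1: "\<And>j. subspace (A j)" "\<And>j. A j \<subseteq> G j" using A unfolding stable_def by blast+
  have B1: "\<And>j. subspace (B j)" "\<And>j. B j \<subseteq> G j" using B unfolding stable_def by blast+
  have "v = 0" if vA: "v \<in> total A" and vB: "v \<in> total B" for v
  proof -
    obtain w F where w: "finite F" "\<And>j. w j \<in> A j" "\<And>j. j \<notin> F \<Longrightarrow> w j = 0" "v = (\<Sum>j\<in>F. w j)"
      using total_decompose[OF A1(1) vA] by blast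
    obtain u H where u: "finite H" "\<And>j. u j \<in> B j" "\<And>j. j \<notin> H \<Longrightarrow> u j = 0" "v = (\<Sum>j\<in>H. u j)"
      using total_decompose[OF B1(1) vB] by blast
    have "v = (\<Sum>j\<in>F \<union> H. w j)" unfolding w(4) using w(1,3) u(1) by (intro sum.mono_neutral_left) auto
    moreover have "v = (\<Sum>j\<in>F \<union> H. u j)" unfolding u(4) using u(1,3) w(1) by (intro sum.mono_neutral_left) auto
    ultimately have "(\<Sum>j\<in>F \<union> H. w j - u j) = 0" by (simp add: sum_subtractf)
    note z = this
    have e: "w j - u j = 0" for j
    proof (rule G_independent[where F = "F \<union> H" and w = "\<lambda>j. w j - u j"])
      show "w j - u j \<in> G j" for j using w(2) u(2) A1(2) B1(2) by (intro W_diff) blast+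
    qed (use w(1,3) u(1,3) z in auto)
    have "w j = 0" for j
    proof -
      have "w j \<in> A j \<inter> B j" using e[of j] w(2)[of j] u(2)[of j] by simp
      then show ?thesis using d by blast
    qed
    then show ?thesis unfolding w(4) by simp
  qed
  moreover have "0 \<in> total A" "0 \<in> total B" by (simp_all add: total_def span_zero)
  ultimately have disj: "total A \<inter> total B = {0}" by blast
  have "\<exists>a\<in>total A. \<exists>b\<in>total B. v = a + b" if v: "v \<in> space M" for v
  proof -
    obtain w F where w: "\<And>j. w j \<in> G j" "v = (\<Sum>j\<in>F. w j)" using G_decompose[OF v] by metis
    have "\<forall>j. \<exists>a. a \<in> A j \<and> w j - a \<in> B j"
    proof
      fix j
      obtain a b where "a \<in> A j" "b \<in> B j" "w j = a + b" using s w(1)[of j] by blast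
      then show "\<exists>a. a \<in> A j \<and> w j - a \<in> B j" by (intro exI[of _ a]) simp
    qed
    from choice[OF this] obtain a where a: "\<And>j. a j \<in> A j" "\<And>j. w j - a j \<in> B j" by blast
    have "v = (\<Sum>j\<in>F. a j) + (\<Sum>j\<in>F. w j - a j)" unfolding w(2) sum.distrib[symmetric] by simp
    moreover have "(\<Sum>j\<in>F. a j) \<in> total A" "(\<Sum>j\<in>F. w j - a j) \<in> total B"
      using subsetD[OF component_subset a(1)] subsetD[OF component_subset a(2)]
      by (auto simp: total_def intro!: span_sum)
    ultimately show ?thesis by blast
  qed
  moreover have "u + w \<in> space M" if "u \<in> total A" "w \<in> total B" for u w
    using submodule_total[OF A] submodule_total[OF B] that subspace_add[OF space_sub]
    by (simp add: submodule_def subset_iff)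
  ultimately have sum: "{u + w | u w. u \<in> total A \<and> w \<in> total B} = space M"
    by (simp only: set_eq_iff mem_Collect_eq) metis
  have "total A = {0} \<or> total B = {0}"
  proof (rule ccontr)
    assume "\<not> (total A = {0} \<or> total B = {0})"
    then have "\<exists>U W. submodule N M U \<and> submodule N M W \<and> U \<noteq> {0} \<and> W \<noteq> {0} \<and>
          U \<inter> W = {0} \<and> {u + w | u w. u \<in> U \<and> w \<in> W} = space M"
      using submodule_total[OF A] submodule_total[OF B] disj sum
      by (intro exI[of _ "total A"] exI[of _ "total B"]) simp
    then show False using assms unfolding indecomposable_module_def by (simp only:)
  qed
  moreover have "A j = {0}" if "total A = {0}" for j
    using that component_subset[of A j] subspace_0[OF A1(1)[of j]] by auto
  moreover have "B j = {0}" if "total B = {0}" for j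
    using that component_subset[of B j] subspace_0[OF B1(1)[of j]] by auto
  ultimately show "(\<forall>j. A j = {0}) \<or> (\<forall>j. B j = {0})" by metis
qed

end

section \<open>Isomorphisms onto tensor modules\<close>

lemma lookup_tvec_scale: "Poly_Mapping.lookup (tvec_scale c t) a = c * Poly_Mapping.lookup t a"
  by (simp add: tvec_scale_def Poly_Mapping.map.rep_eq when_def)

lemma tvecs_0: "0 \<in> tvecs N m"
  by (simp add: tvecs_def)

lemma tvecs_add: "s \<in> tvecs N m \<Longrightarrow> t \<in> tvecs N m \<Longrightarrow> s + t \<in> tvecs N m"
  unfolding tvecs_def using keys_add[of s t] by blast

lemma tvecs_scale: "t \<in> tvecs N m \<Longrightarrow> tvec_scale c t \<in> tvecs N m"
proof -
  have "Poly_Mapping.keys (tvec_scale c t) \<subseteq> Poly_Mapping.keys t" by (auto simp: in_keys_iff lookup_tvec_scale)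
  then show "t \<in> tvecs N m \<Longrightarrow> tvec_scale c t \<in> tvecs N m" unfolding tvecs_def by blast
qed

lemma tvecs_sum: "(\<And>i. i \<in> I \<Longrightarrow> x i \<in> tvecs N m) \<Longrightarrow> (\<Sum>i\<in>I. x i) \<in> tvecs N m"
  by (induction I rule: infinite_finite_induct) (simp_all add: tvecs_0 tvecs_add)

lemma tvecs_single: "r \<in> {1..N} \<Longrightarrow> s < m \<Longrightarrow> Poly_Mapping.single (k, r, s) c \<in> tvecs N m"
  by (auto simp: tvecs_def)

lemma tvecs_keys: "t \<in> tvecs N m \<Longrightarrow> (k, r, s) \<in> Poly_Mapping.keys t \<Longrightarrow> r \<in> {1..N} \<and> s < m"
  unfolding tvecs_def by blast

context complex_space
begin

definition combine :: "('i \<Rightarrow> 'b) \<Rightarrow> ('i \<Rightarrow>\<^sub>0 complex) \<Rightarrow> 'b" where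
  "combine B t = (\<Sum>a\<in>Poly_Mapping.keys t. Poly_Mapping.lookup t a *s B a)"

lemma combine_superset:
  "finite F \<Longrightarrow> Poly_Mapping.keys t \<subseteq> F \<Longrightarrow> combine B t = (\<Sum>a\<in>F. Poly_Mapping.lookup t a *s B a)"
  unfolding combine_def by (intro sum.mono_neutral_left) (auto simp: in_keys_iff)

lemma combine_0: "combine B 0 = 0"
  by (simp add: combine_def)

lemma combine_add: "combine B (s + t) = combine B s + combine B t"
proof -
  let ?F = "Poly_Mapping.keys s \<union> Poly_Mapping.keys t"
  have "combine B (s + t) = (\<Sum>a\<in>?F. Poly_Mapping.lookup (s + t) a *s B a)"
    using keys_add[of s t] by (intro combine_superset) auto
  also have "\<dots> = (\<Sum>a\<in>?F. Poly_Mapping.lookup s a *s B a) + (\<Sum>a\<in>?F. Poly_Mapping.lookup t a *s B a)"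
    by (simp add: lookup_add scale_left_distrib sum.distrib)
  also have "\<dots> = combine B s + combine B t"
    using combine_superset[of ?F s B] combine_superset[of ?F t B] by simp
  finally show ?thesis .
qed

lemma combine_sum: "combine B (\<Sum>i\<in>I. x i) = (\<Sum>i\<in>I. combine B (x i))"
  by (induction I rule: infinite_finite_induct) (simp_all add: combine_0 combine_add)

lemma combine_single: "combine B (Poly_Mapping.single a c) = c *s B a"
  by (simp add: combine_def)

lemma combine_scale: "combine B (tvec_scale c t) = c *s combine B t"
proof -
  have "Poly_Mapping.keys (tvec_scale c t) \<subseteq> Poly_Mapping.keys t" by (auto simp: in_keys_iff lookup_tvec_scale)
  then have "combine B (tvec_scale c t) = (\<Sum>a\<in>Poly_Mapping.keys t. Poly_Mapping.lookup (tvec_scale c t) a *s B a)"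
    by (intro combine_superset) auto
  then show ?thesis by (simp add: lookup_tvec_scale combine_def scale_sum_right)
qed

end

text \<open>
  Homogeneous vectors \<open>B (k, r, s)\<close> that transform like the basis of a tensor module give an
  isomorphism: linear combination is a bijection because it is one in each degree. The functions
  \<open>src\<close> and \<open>tgt\<close> select the column and the row of \<open>E\<^sub>p\<^sub>q\<close>, or of its transpose in the dual case.
\<close>

lemma (in qmod) module_iso_from_basis:
  fixes B :: "int \<times> nat \<times> nat \<Rightarrow> 'v" and deg :: "int \<Rightarrow> nat \<Rightarrow> int"
  assumes rr: "\<And>j. rr j \<in> {1..N}" and deg: "\<And>j. deg (kk j) (rr j) = j"
    and deg': "\<And>k r. r \<in> {1..N} \<Longrightarrow> kk (deg k r) = k" "\<And>k r. r \<in> {1..N} \<Longrightarrow> rr (deg k r) = r"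
    and B_in: "\<And>j s. s < m \<Longrightarrow> B (kk j, rr j, s) \<in> G j"
    and B_span: "\<And>j v. v \<in> G j \<Longrightarrow> \<exists>c. v = (\<Sum>s<m. scale M (c s) (B (kk j, rr j, s)))"
    and B_ind: "\<And>j c. (\<Sum>s<m. scale M (c s) (B (kk j, rr j, s))) = 0 \<Longrightarrow> \<forall>s<m. c s = 0"
    and Z: "\<And>j v. v \<in> G j \<Longrightarrow> act M cel v = 0"
    and tgt: "\<And>p q. p \<in> {1..N} \<Longrightarrow> q \<in> {1..N} \<Longrightarrow> tgt p q \<in> {1..N}"
    and act_B: "\<And>i p q f k r s. p \<in> {1..N} \<Longrightarrow> q \<in> {1..N} \<Longrightarrow> r \<in> {1..N} \<Longrightarrow> s < m \<Longrightarrow>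
      act M (el i p q f) (B (k, r, s)) = (if src p q = r then \<Sum>u<m. scale M (cf i k f u s) (B (i + k, tgt p q, u)) else 0)"
    and A: "\<And>x t. A x t = (\<Sum>(i, p, q)\<in>Poly_Mapping.keys (fst x). \<Sum>(k, r, s)\<in>Poly_Mapping.keys t.
        let f = Poly_Mapping.lookup (fst x) (i, p, q) in
        if src p q = r then \<Sum>u<m. Poly_Mapping.single (i + k, tgt p q, u) (Poly_Mapping.lookup t (k, r, s) * cf i k f u s)
        else 0)"
  shows "module_iso N M \<lparr>space = tvecs N m, scale = tvec_scale, act = A\<rparr>"
proof -
  have Bkrs: "B (k, r, s) \<in> G (deg k r)" if "r \<in> {1..N}" "s < m" for k r s
    using B_in[OF that(2), of "deg k r"] deg'[OF that(1), of k] by simp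
  have B_space: "B (k, r, s) \<in> space M" if "r \<in> {1..N}" "s < m" for k r s
    using Bkrs[OF that] G_space by blast
  have inM: "combine B t \<in> space M" if t: "t \<in> tvecs N m" for t
    unfolding combine_def
  proof (intro subspace_sum[OF space_sub] subspace_scale[OF space_sub])
    fix a assume "a \<in> Poly_Mapping.keys t"
    then show "B a \<in> space M" using tvecs_keys[OF t] B_space by (cases a) blast
  qed
  define h where "h = (\<lambda>(j, s). (kk j, rr j, s :: nat))"
  have zero: "t = 0" if t: "t \<in> tvecs N m" and z: "combine B t = 0" for t
  proof -
    define F where "F = (\<lambda>(k, r, s). deg k r) ` Poly_Mapping.keys t"
    have F: "finite F" by (simp add: F_def)
    have inj: "inj_on h (F \<times> {..<m})"
      unfolding h_def using deg by (intro inj_onI) (auto, metis)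
    have key: "(k, r, s) = h (deg k r, s) \<and> deg k r \<in> F \<and> s < m" if a: "(k, r, s) \<in> Poly_Mapping.keys t" for k r s
      using a tvecs_keys[OF t a] deg' by (force simp: h_def F_def)
    have sub: "Poly_Mapping.keys t \<subseteq> h ` (F \<times> {..<m})"
    proof
      fix a assume a: "a \<in> Poly_Mapping.keys t"
      obtain k r s where krs: "a = (k, r, s)" by (cases a)
      have "(deg k r, s) \<in> F \<times> {..<m}" using key a unfolding krs by blast
      moreover have "a = h (deg k r, s)" using key a unfolding krs by blast
      ultimately show "a \<in> h ` (F \<times> {..<m})" by blast
    qed
    define w where "w j = (\<Sum>s<m. scale M (Poly_Mapping.lookup t (h (j, s))) (B (h (j, s))))" for j
    have "combine B t = (\<Sum>a\<in>h ` (F \<times> {..<m}). scale M (Poly_Mapping.lookup t a) (B a))"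
      using F sub by (intro combine_superset) auto
    also have "\<dots> = (\<Sum>a\<in>F \<times> {..<m}. scale M (Poly_Mapping.lookup t (h a)) (B (h a)))"
      by (simp add: sum.reindex[OF inj])
    also have "\<dots> = (\<Sum>j\<in>F. w j)" unfolding w_def by (simp add: sum.cartesian_product case_prod_unfold)
    finally have wz: "(\<Sum>j\<in>F. w j) = 0" using z by simp
    have wG: "w j \<in> G j" for j
      unfolding w_def h_def using B_in by (intro W_sum W_scale) auto
    have off: "w j = 0" if "j \<notin> F" for j
    proof -
      have "Poly_Mapping.lookup t (h (j, s)) = 0" for s
      proof (rule ccontr)
        assume "Poly_Mapping.lookup t (h (j, s)) \<noteq> 0"
        then have "(kk j, rr j, s) \<in> Poly_Mapping.keys t" by (simp add: in_keys_iff h_def)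
        then have "deg (kk j) (rr j) \<in> F" using key by blast
        then show False using that deg by simp
      qed
      then show ?thesis by (simp add: w_def)
    qed
    have w0: "w j = 0" for j by (rule G_independent[where F = F and w = w, OF F wG off wz])
    have coef: "Poly_Mapping.lookup t (h (j, s)) = 0" if "s < m" for j s
      using B_ind[of "\<lambda>s. Poly_Mapping.lookup t (h (j, s))" j] w0[of j] that unfolding w_def h_def by auto
    have "Poly_Mapping.keys t = {}"
    proof (rule ccontr)
      assume "Poly_Mapping.keys t \<noteq> {}"
      then obtain a where a: "a \<in> Poly_Mapping.keys t" by blast
      obtain k r s where krs: "a = (k, r, s)" by (cases a)
      have "a = h (deg k r, s)" "s < m" using key a unfolding krs by blast+
      then show False using coef a by (simp add: in_keys_iff)
    qed
    then show ?thesis by simp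
  qed
  have inj: "inj_on (combine B) (tvecs N m)"
  proof (rule inj_onI)
    fix s t assume st: "s \<in> tvecs N m" "t \<in> tvecs N m" and e: "combine B s = combine B t"
    have "s + tvec_scale (-1) t = 0"
      using st e by (intro zero tvecs_add tvecs_scale) (simp_all add: combine_add combine_scale scale_minus_left)
    moreover have "tvec_scale (-1) t = - t" by (rule poly_mapping_eqI) (simp add: lookup_tvec_scale)
    ultimately show "s = t" by simp
  qed
  have surj: "\<exists>t\<in>tvecs N m. combine B t = v" if v: "v \<in> space M" for v
  proof -
    obtain w F where w: "\<And>j. w j \<in> G j" "v = (\<Sum>j\<in>F. w j)" using G_decompose[OF v] by metis
    have "\<forall>j. \<exists>c. w j = (\<Sum>s<m. scale M (c s) (B (kk j, rr j, s)))" using B_span w(1) by blast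
    then obtain c where c: "\<And>j. w j = (\<Sum>s<m. scale M (c j s) (B (kk j, rr j, s)))" by metis
    let ?t = "\<Sum>j\<in>F. \<Sum>s<m. Poly_Mapping.single (kk j, rr j, s) (c j s)"
    have "?t \<in> tvecs N m" using rr by (intro tvecs_sum tvecs_single) auto
    moreover have "combine B ?t = v" unfolding w(2) c by (simp add: combine_sum combine_single)
    ultimately show ?thesis by blast
  qed
  have bij: "bij_betw (combine B) (tvecs N m) (space M)"
    using inj inM surj unfolding bij_betw_def by blast
  have A_in: "A x t \<in> tvecs N m" if x: "x \<in> cdiffops N" and t: "t \<in> tvecs N m" for x t
    unfolding A case_prod_unfold Let_def
  proof (intro tvecs_sum)
    fix a b assume a: "a \<in> Poly_Mapping.keys (fst x)" and b: "b \<in> Poly_Mapping.keys t"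
    have "fst (snd a) \<in> {1..N} \<and> snd (snd a) \<in> {1..N}" using keys_idx[OF x] a by (cases a) auto
    then show "(if src (fst (snd a)) (snd (snd a)) = fst (snd b)
        then \<Sum>u<m. Poly_Mapping.single (fst a + fst b, tgt (fst (snd a)) (snd (snd a)), u)
          (Poly_Mapping.lookup t (fst b, fst (snd b), snd (snd b)) *
            cf (fst a) (fst b) (Poly_Mapping.lookup (fst x) (fst a, fst (snd a), snd (snd a))) u (snd (snd b)))
        else 0) \<in> tvecs N m"
      using tgt by (auto intro!: tvecs_sum tvecs_single tvecs_0 simp del: atLeastAtMost_iff)
  qed
  have Zs: "act M cel v = 0" if v: "v \<in> space M" for v
  proof -
    obtain w F where w: "\<And>j. w j \<in> G j" "v = (\<Sum>j\<in>F. w j)" using G_decompose[OF v] by metis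
    show ?thesis unfolding w(2) using act_sumv[OF cel_in, of F w] G_space[OF w(1)] Z[OF w(1)] by simp
  qed
  have equi: "combine B (A x t) = act M x (combine B t)" if x: "x \<in> cdiffops N" and t: "t \<in> tvecs N m" for x t
  proof -
    have "combine B (A x t) = (\<Sum>a\<in>Poly_Mapping.keys (fst x). \<Sum>b\<in>Poly_Mapping.keys t.
        scale M (Poly_Mapping.lookup t b) (act M ((\<lambda>(i, p, q). el i p q (Poly_Mapping.lookup (fst x) (i, p, q))) a) (B b)))"
      unfolding A combine_sum
    proof (intro sum.cong refl)
      fix a assume a: "a \<in> Poly_Mapping.keys (fst x)"
      obtain i p q where ipq: "a = (i, p, q)" by (cases a)
      have pq: "p \<in> {1..N}" "q \<in> {1..N}" using keys_idx[OF x] a unfolding ipq by blast+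
      show "combine B (case a of (i, p, q) \<Rightarrow> \<Sum>(k, r, s)\<in>Poly_Mapping.keys t.
            let f = Poly_Mapping.lookup (fst x) (i, p, q) in
            if src p q = r then \<Sum>u<m. Poly_Mapping.single (i + k, tgt p q, u) (Poly_Mapping.lookup t (k, r, s) * cf i k f u s) else 0)
          = (\<Sum>b\<in>Poly_Mapping.keys t. scale M (Poly_Mapping.lookup t b)
              (act M ((\<lambda>(i, p, q). el i p q (Poly_Mapping.lookup (fst x) (i, p, q))) a) (B b)))"
        unfolding ipq prod.case combine_sum
      proof (intro sum.cong refl)
        fix b assume b: "b \<in> Poly_Mapping.keys t"
        obtain k r s where krs: "b = (k, r, s)" by (cases b)
        have rs: "r \<in> {1..N}" "s < m" using tvecs_keys[OF t] b unfolding krs by blast+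
        show "combine B (case b of (k, r, s) \<Rightarrow> let f = Poly_Mapping.lookup (fst x) (i, p, q) in
              if src p q = r then \<Sum>u<m. Poly_Mapping.single (i + k, tgt p q, u) (Poly_Mapping.lookup t (k, r, s) * cf i k f u s) else 0)
            = scale M (Poly_Mapping.lookup t b) (act M (el i p q (Poly_Mapping.lookup (fst x) (i, p, q))) (B b))"
          unfolding krs prod.case Let_def act_B[OF pq rs]
          by (simp add: combine_sum combine_single combine_0 scale_sum_right)
      qed
    qed
    also have "\<dots> = (\<Sum>a\<in>Poly_Mapping.keys (fst x).
        act M ((\<lambda>(i, p, q). el i p q (Poly_Mapping.lookup (fst x) (i, p, q))) a) (combine B t))"
    proof (intro sum.cong refl)
      fix a assume a: "a \<in> Poly_Mapping.keys (fst x)"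
      obtain i p q where ipq: "a = (i, p, q)" by (cases a)
      have e: "el i p q (Poly_Mapping.lookup (fst x) (i, p, q)) \<in> cdiffops N"
        using keys_idx[OF x] a unfolding ipq by (intro el_in) blast+
      have Bb: "B b \<in> space M" if "b \<in> Poly_Mapping.keys t" for b
        using tvecs_keys[OF t] B_space that by (cases b) blast
      show "(\<Sum>b\<in>Poly_Mapping.keys t. scale M (Poly_Mapping.lookup t b)
              (act M ((\<lambda>(i, p, q). el i p q (Poly_Mapping.lookup (fst x) (i, p, q))) a) (B b)))
          = act M ((\<lambda>(i, p, q). el i p q (Poly_Mapping.lookup (fst x) (i, p, q))) a) (combine B t)"
        unfolding ipq prod.case combine_def
        using act_sumv[OF e, of "Poly_Mapping.keys t" "\<lambda>b. scale M (Poly_Mapping.lookup t b) (B b)"]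
          subspace_scale[OF space_sub Bb] act_scale[OF e Bb] by simp
    qed
    also have "\<dots> = act M x (combine B t)"
      unfolding act_expand[OF x inM[OF t]] Zs[OF inM[OF t]] by (simp add: case_prod_unfold)
    finally show ?thesis .
  qed
  define \<phi> where "\<phi> = inv_into (tvecs N m) (combine B)"
  have \<phi>: "\<phi> v \<in> tvecs N m \<and> combine B (\<phi> v) = v" if "v \<in> space M" for v
    unfolding \<phi>_def using bij that by (metis bij_betw_imp_surj_on f_inv_into_f inv_into_into)
  have unique: "\<phi> v = t" if "t \<in> tvecs N m" "combine B t = v" for v t
    unfolding \<phi>_def using inv_into_f_f[OF inj that(1)] that(2) by simp
  show ?thesis unfolding module_iso_def
  proof (intro exI[of _ \<phi>] conjI ballI allI)
    show "bij_betw \<phi> (space M) (space \<lparr>space = tvecs N m, scale = tvec_scale, act = A\<rparr>)"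
      using bij_betw_inv_into[OF bij] by (simp add: \<phi>_def)
    fix v assume v: "v \<in> space M"
    show "\<phi> (v + w) = \<phi> v + \<phi> w" if w: "w \<in> space M" for w
      using \<phi>[OF v] \<phi>[OF w] by (intro unique tvecs_add) (auto simp: combine_add)
    show "\<phi> (scale M c v) = scale \<lparr>space = tvecs N m, scale = tvec_scale, act = A\<rparr> c (\<phi> v)" for c
      using \<phi>[OF v] by (auto intro!: unique tvecs_scale simp: combine_scale)
    show "\<phi> (act M x v) = act \<lparr>space = tvecs N m, scale = tvec_scale, act = A\<rparr> x (\<phi> v)" if x: "x \<in> cdiffops N" for x
      using \<phi>[OF v] x by (auto intro!: unique A_in simp: equi)
  qed
qed

lemma shiftp_expansion: "shiftp k f = (\<Sum>n\<le>degree f. Polynomial.smult (coeff f n) ([:of_int k, 1:] ^ n))"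
proof (rule poly_ext)
  fix x :: complex
  have "poly f (x + of_int k) = (\<Sum>n\<le>degree f. coeff f n * (x + of_int k) ^ n)" by (rule poly_altdef)
  then show "poly (shiftp k f) x = poly (\<Sum>n\<le>degree f. Polynomial.smult (coeff f n) ([:of_int k, 1:] ^ n)) x"
    by (simp add: poly_sum add.commute)
qed

lemma shiftp_dualp_expansion:
  "- shiftp k (dualp i f) = (\<Sum>n\<le>degree f. Polynomial.smult (coeff f n * (-1) ^ (n + 1)) ([:of_int (i + k), 1:] ^ n))"
proof (rule poly_ext)
  fix x :: complex
  have "- x - of_int k - of_int i = - (x + of_int (i + k))" by simp
  then have "poly f (- (x + of_int k) - of_int i) = poly f (- (x + of_int (i + k)))" by (simp add: algebra_simps)
  also have "\<dots> = (\<Sum>n\<le>degree f. coeff f n * ((-1) ^ n * (x + of_int (i + k)) ^ n))"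
    unfolding poly_altdef power_minus[of "x + of_int (i + k)"] ..
  finally show "poly (- shiftp k (dualp i f)) x
      = poly (\<Sum>n\<le>degree f. Polynomial.smult (coeff f n * (-1) ^ (n + 1)) ([:of_int (i + k), 1:] ^ n)) x"
    by (simp add: poly_sum sum_negf add.commute mult.assoc)
qed

context rmod
begin

text \<open>A basis of \<open>W i\<close> is carried to a basis of \<open>W j\<close>, since \<open>up\<close> and \<open>down\<close> are mutually inverse.\<close>

lemma translates:
  assumes c: "coordinates m u \<alpha>"
  shows "s < m \<Longrightarrow> up j (u s) \<in> W j"
    and "v \<in> W j \<Longrightarrow> \<exists>c. v = (\<Sum>s<m. c s *s up j (u s))"
    and "(\<Sum>s<m. c s *s up j (u s)) = 0 \<Longrightarrow> \<forall>s<m. c s = 0"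
proof -
  have uW: "u s \<in> W i" if "s < m" for s using c that by (auto simp: coordinates_def)
  have comb: "up j (\<Sum>s<m. c s *s u s) = (\<Sum>s<m. c s *s up j (u s))" for c
    using uW W_scale by (subst up_sum) (auto simp: up_scale)
  show "s < m \<Longrightarrow> up j (u s) \<in> W j" using uW up_in by blast
  show "\<exists>c. v = (\<Sum>s<m. c s *s up j (u s))" if v: "v \<in> W j"
  proof -
    obtain a where "down j v = (\<Sum>s<m. a s *s u s)" using c down_in[OF v] unfolding coordinates_def by blast
    then have "v = (\<Sum>s<m. a s *s up j (u s))" using up_down[OF v] comb by metis
    then show ?thesis by (rule exI[of _ a])
  qed
  show "\<forall>s<m. c s = 0" if z: "(\<Sum>s<m. c s *s up j (u s)) = 0"
  proof -
    have "down j (up j (\<Sum>s<m. c s *s u s)) = 0" unfolding comb z using down_scale[of 0 j 0] by simp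
    moreover have "(\<Sum>s<m. c s *s u s) \<in> W i" using uW by (intro W_sum W_scale) auto
    ultimately have "(\<Sum>s<m. c s *s u s) = 0" using down_up by simp
    then show ?thesis using c unfolding coordinates_def by blast
  qed
qed

lemma degree_row_lev: "r \<in> idx \<Longrightarrow> row (i + k * int N + int r - 1) = r" "r \<in> idx \<Longrightarrow> lev (i + k * int N + int r - 1) = k"
  using row_lev_unique by blast+

end

context qmod
begin

text \<open>
  The translates by \<open>up\<close> of a basis of \<open>G i\<close> transform like the basis of \<open>V(m, \<alpha>)\<close>, where \<open>\<alpha>\<close> is the
  matrix of \<open>D\<close> on \<open>G i\<close>.
\<close>

lemma V_iso:
  assumes R: "rmod (scale M) N (\<lambda>k p q f. act M (el k p q f)) (act M cel) cocycle_poly G i"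
    and rk: "rank_le K (G i)" and nz: "G j0 \<noteq> {0}"
  shows "\<exists>m \<alpha>. 1 \<le> m \<and> m \<le> K \<and> \<alpha> \<in> carrier_mat m m \<and> module_iso N M (V_mod N m \<alpha>) \<and> (gindec \<longrightarrow> indecomposable_mat m \<alpha>)"
proof -
  interpret R: rmod "scale M" N "\<lambda>k p q f. act M (el k p q f)" "act M cel" cocycle_poly G i by (rule R)
  obtain m u \<alpha> where m: "m \<le> K" and c: "R.coordinates m u \<alpha>" using R.coordinates_exist[OF rk] .
  have uG: "u s \<in> G i" if "s < m" for s using c that by (auto simp: R.coordinates_def)
  let ?deg = "\<lambda>k r. i + k * int N + int r - 1"
  let ?B = "\<lambda>(k, r, s). R.up (?deg k r) (u s)"
  have "module_iso N M \<lparr>space = tvecs N m, scale = tvec_scale, act = V_act m \<alpha>\<rparr>"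
  proof (rule module_iso_from_basis[where B = ?B and deg = ?deg and kk = R.lev and rr = R.row
        and src = "\<lambda>p q. q" and tgt = "\<lambda>p q. p"
        and cf = "\<lambda>i k f u s. \<Sum>j\<le>degree f. coeff f j * (shift_mat m \<alpha> k ^\<^sub>m j) $$ (u, s)"])
    fix i' p q f k r s assume pq: "p \<in> {1..N}" "q \<in> {1..N}" and r: "r \<in> {1..N}" and s: "s < m"
    have e: "?deg (i' + k) p = ?deg k r + i' * int N + int p - int q" if "q = r" using that by (simp add: algebra_simps)
    show "act M (el i' p q f) (?B (k, r, s)) = (if q = r
        then \<Sum>t<m. scale M (\<Sum>j\<le>degree f. coeff f j * (shift_mat m \<alpha> k ^\<^sub>m j) $$ (t, s)) (?B (i' + k, p, t)) else 0)"
    proof (cases "q = r")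
      case True
      have "act M (el i' p q f) (R.up (?deg k r) (u s)) = R.up (?deg (i' + k) p) (R.op1 (shiftp k f) (u s))"
        using R.E_up[OF pq uG[OF s] e[OF True], of f] R.degree_row_lev[OF r] True by simp
      also have "R.op1 (shiftp k f) (u s) = (\<Sum>t<m. scale M (\<Sum>j\<le>degree f. coeff f j * (shift_mat m \<alpha> k ^\<^sub>m j) $$ (t, s)) (u t))"
        by (rule R.op1_expansion[OF c s shiftp_expansion])
      also have "R.up (?deg (i' + k) p) \<dots> = (\<Sum>t<m. scale M (\<Sum>j\<le>degree f. coeff f j * (shift_mat m \<alpha> k ^\<^sub>m j) $$ (t, s)) (R.up (?deg (i' + k) p) (u t)))"
        using uG W_scale by (subst R.up_sum) (auto simp: R.up_scale)
      finally show ?thesis using True by simp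
    next
      case False
      then show ?thesis using R.E_up[OF pq uG[OF s] refl, of i' f "?deg k r"] R.degree_row_lev[OF r] by simp
    qed
  qed (use R.row(1) R.degree_eq R.degree_row_lev R.translates[OF c] R.Z_zero in
      \<open>simp_all add: V_act_def del: atLeastAtMost_iff flip: R.degree_eq\<close>)
  moreover have "1 \<le> m"
  proof (rule ccontr)
    assume "\<not> 1 \<le> m"
    then have "m = 0" by simp
    then have "v = 0" if "v \<in> G j0" for v using R.translates(2)[OF c that] by simp
    then show False using nz W_0 by blast
  qed
  ultimately show ?thesis using m c R.indecomposable_matrix[OF _ c]
    unfolding V_mod_def R.coordinates_def by blast
qed

end

text \<open>The dual operators are defined for modules on which the centre acts by zero.\<close>

locale qsmod = qmod N M G
    + smod "scale M" N "\<lambda>k p q f. act M (el k p q f)" "act M cel" cocycle_poly G d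
  for N and M :: "'v::ab_group_add cdiffop_rep" and G d
begin

lemma dual_dual:
  assumes "p \<in> {1..N}" "q \<in> {1..N}" "v \<in> G j"
  shows "act M (el k p q f) v = - dualE k (N + 1 - q) (N + 1 - p) (dualp k f) v"
proof -
  have "dualp k (dualp k f) = f" by (rule poly_ext) simp
  moreover have "N + 1 - (N + 1 - p) = p" "N + 1 - (N + 1 - q) = q" using assms by auto
  ultimately show ?thesis by (simp add: dualE_def)
qed

lemma dual_stable:
  assumes A: "gmod.stable (scale M) N dualE (act M cel) G A"
  shows "stable A"
proof -
  interpret D: gmod "scale M" N dualE "act M cel" cocycle_poly G by (rule dual_gmod)
  have sub: "subspace (A j)" and AG: "A j \<subseteq> G j" for j using A unfolding D.stable_def by blast+
  show ?thesis
  proof (rule stableI)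
    fix j k p q f v assume pq: "p \<in> {1..N}" "q \<in> {1..N}" and v: "v \<in> A j"
    have d: "dualE k (N + 1 - q) (N + 1 - p) (dualp k f) v \<in> A (j + k * int N + int (N + 1 - q) - int (N + 1 - p))"
      using A idx_flip[OF pq(1)] idx_flip[OF pq(2)] v unfolding D.stable_def by blast
    have e: "j + k * int N + int (N + 1 - q) - int (N + 1 - p) = j + k * int N + int p - int q" using pq by auto
    show "act M (el k p q f) v \<in> A (j + k * int N + int p - int q)"
      unfolding dual_dual[OF pq subsetD[OF AG v]] by (rule subspace_neg[OF sub d[unfolded e]])
  qed (use A sub AG in \<open>auto simp: D.stable_def\<close>)
qed

lemma dual_gindec: "gindec \<Longrightarrow> gmod.gindec (scale M) N dualE (act M cel) G"
  unfolding gmod.gindec_def[OF dual_gmod] using gindecD[OF _ dual_stable dual_stable] by blast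

lemma dual_gsimple: "gsimple \<Longrightarrow> gmod.gsimple (scale M) N dualE (act M cel) G"
  unfolding gmod.gsimple_def[OF dual_gmod] gsimple_def using dual_stable by blast

text \<open>
  The dual operators satisfy the relations of the associative algebra. Undoing the relabelling
  \<open>r \<mapsto> N + 1 - r\<close> and the substitution \<open>D \<mapsto> - D - k\<close> yields the formulas for \<open>Vbar(m, \<alpha>)\<close>.
\<close>

lemma Vbar_iso:
  assumes R: "rmod (scale M) N dualE (act M cel) cocycle_poly G i"
    and rk: "rank_le K (G i)" and nz: "G j0 \<noteq> {0}"
  shows "\<exists>m \<alpha>. 1 \<le> m \<and> m \<le> K \<and> \<alpha> \<in> carrier_mat m m \<and> module_iso N M (Vbar_mod N m \<alpha>) \<and> (gindec \<longrightarrow> indecomposable_mat m \<alpha>)"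
proof -
  interpret R: rmod "scale M" N dualE "act M cel" cocycle_poly G i by (rule R)
  obtain m u \<alpha> where m: "m \<le> K" and c: "R.coordinates m u \<alpha>" using R.coordinates_exist[OF rk] .
  have uG: "u s \<in> G i" if "s < m" for s using c that by (auto simp: R.coordinates_def)
  let ?deg = "\<lambda>k r. i + k * int N + int (N + 1 - r) - 1"
  let ?B = "\<lambda>(k, r, s). R.up (?deg k r) (u s)"
  let ?row = "\<lambda>j. N + 1 - R.row j"
  have flip: "N + 1 - (N + 1 - r) = r" if "r \<in> {1..N}" for r using that by auto
  have deg: "?deg (R.lev j) (?row j) = j" for j
    unfolding flip[OF R.row(1)] using R.degree_eq[of j] by simp
  have "module_iso N M \<lparr>space = tvecs N m, scale = tvec_scale, act = Vbar_act m \<alpha>\<rparr>"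
  proof (rule module_iso_from_basis[where B = ?B and deg = ?deg and kk = R.lev and rr = ?row
        and src = "\<lambda>p q. p" and tgt = "\<lambda>p q. q"
        and cf = "\<lambda>i k f u s. \<Sum>j\<le>degree f. coeff f j * (-1) ^ (j + 1) * (shift_mat m \<alpha> (i + k) ^\<^sub>m j) $$ (u, s)"])
    fix i' p q f k r s assume pq: "p \<in> {1..N}" "q \<in> {1..N}" and r: "r \<in> {1..N}" and s: "s < m"
    note pq' = idx_flip[OF pq(2)] idx_flip[OF pq(1)] and r' = idx_flip[OF r]
    have e: "?deg (i' + k) q = ?deg k r + i' * int N + int (N + 1 - q) - int (N + 1 - p)" if "p = r" using that by (simp add: algebra_simps)
    have eq: "act M (el i' p q f) (R.up (?deg k r) (u s)) = - dualE i' (N + 1 - q) (N + 1 - p) (dualp i' f) (R.up (?deg k r) (u s))"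
      by (rule dual_dual[OF pq R.up_in[OF uG[OF s]]])
    show "act M (el i' p q f) (?B (k, r, s)) = (if p = r
        then \<Sum>t<m. scale M (\<Sum>j\<le>degree f. coeff f j * (-1) ^ (j + 1) * (shift_mat m \<alpha> (i' + k) ^\<^sub>m j) $$ (t, s)) (?B (i' + k, q, t)) else 0)"
    proof (cases "p = r")
      case True
      have "act M (el i' p q f) (R.up (?deg k r) (u s)) = - R.up (?deg (i' + k) q) (R.op1 (shiftp k (dualp i' f)) (u s))"
        unfolding eq using R.E_up[OF pq' uG[OF s] e[OF True], of "dualp i' f"] R.degree_row_lev[OF r'] True by simp
      also have "\<dots> = R.up (?deg (i' + k) q) (R.op1 (- shiftp k (dualp i' f)) (u s))"
        using R.E_uminusf[OF R.one_idx R.one_idx uG[OF s]] R.up_scale[OF R.op1_in[OF uG[OF s]], of _ "-1"]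
        by (simp add: scale_minus_left)
      also have "R.op1 (- shiftp k (dualp i' f)) (u s)
          = (\<Sum>t<m. scale M (\<Sum>j\<le>degree f. coeff f j * (-1) ^ (j + 1) * (shift_mat m \<alpha> (i' + k) ^\<^sub>m j) $$ (t, s)) (u t))"
        by (rule R.op1_expansion[OF c s shiftp_dualp_expansion])
      also have "R.up (?deg (i' + k) q) \<dots> = (\<Sum>t<m. scale M (\<Sum>j\<le>degree f. coeff f j * (-1) ^ (j + 1) * (shift_mat m \<alpha> (i' + k) ^\<^sub>m j) $$ (t, s)) (R.up (?deg (i' + k) q) (u t)))"
        using uG W_scale by (subst R.up_sum) (auto simp: R.up_scale)
      finally show ?thesis using True by simp
    next
      case False
      then have "N + 1 - p \<noteq> N + 1 - r" using idx_flip_eq[OF pq(1) r] by simp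
      then show ?thesis using eq False R.E_up[OF pq' uG[OF s] refl, of i' "dualp i' f" "?deg k r"] R.degree_row_lev[OF r'] by simp
    qed
  next
    fix k r assume r: "r \<in> {1..N}"
    show "R.lev (?deg k r) = k" "N + 1 - R.row (?deg k r) = r"
      using R.degree_row_lev[OF idx_flip[OF r]] flip[OF r] by simp_all
  qed (use idx_flip[OF R.row(1)] deg R.translates[OF c] R.Z_zero in
      \<open>simp_all only: prod.case Vbar_act_def\<close>)
  moreover have "1 \<le> m"
  proof (rule ccontr)
    assume "\<not> 1 \<le> m"
    then have "m = 0" by simp
    then have "v = 0" if "v \<in> G j0" for v using R.translates(2)[OF c that] by simp
    then show False using nz W_0 by blast
  qed
  ultimately show ?thesis using m c R.indecomposable_matrix[OF dual_gindec c]
    unfolding Vbar_mod_def R.coordinates_def by blast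
qed

end

section \<open>Modules with one-dimensional components\<close>

lemma (in complex_space) rank_le_1_subspace:
  assumes S: "rank_le 1 S" and X: "subspace X" "X \<subseteq> S" and x: "x \<in> X" "x \<noteq> 0"
  shows "X = S"
proof -
  obtain B where B: "finite B" "card B \<le> 1" "S \<subseteq> span B" using S unfolding rank_le_def by blast
  have xB: "x \<in> span B" using X(2) x(1) B(3) by blast
  have "B \<noteq> {}" using xB x(2) by auto
  then have "card B = 1" using B(1,2) by (simp add: card_gt_0_iff le_antisym Suc_le_eq)
  then obtain b where b: "B = {b}" by (rule card_1_singletonE)
  obtain a where a: "x = a *s b" using xB unfolding b span_singleton by blast
  have "a \<noteq> 0" using x(2) a by auto
  then have "b = (1 / a) *s x" unfolding a by simp
  then have "b \<in> X" using subspace_scale[OF X(1) x(1)] by simp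
  then have "span B \<subseteq> X" unfolding b by (intro span_minimal X(1)) auto
  then show ?thesis using B(3) X(2) by blast
qed

lemma (in complex_space) dim_le_rank: "rank_le K S \<Longrightarrow> dim S \<le> K"
  unfolding rank_le_def using dim_le_card order_trans by blast

lemma (in amod) rmodI: "single_residue i \<Longrightarrow> rmod scale N E Z \<psi> W i"
  by (intro rmod.intro amod_axioms rmod_axioms.intro)

text \<open>
  A nonzero residue part meets every degree, and leaves no room for anything else in components of
  dimension one.
\<close>

lemma (in amod) full_single_residue:
  assumes v: "v \<in> W j0" "v \<noteq> 0" and G: "\<And>j. W j \<subseteq> G j" "\<And>j. rank_le 1 (G j)"
  shows "\<exists>i. rmod scale N E Z \<psi> G i"
proof -
  obtain q where q: "q \<in> idx" "E 0 q q 1 v \<noteq> 0" using exists_position[OF v] .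
  define i where "i = j0 + 1 - int q"
  let ?R = "residue_part (\<lambda>x. x = (- i) mod int N)"
  have R: "?R j = G j \<and> W j = G j" for j
  proof -
    have nz: "?R j \<noteq> {0}" by (rule residue_part_nonzero[OF v(1) q i_def])
    have sub: "subspace (?R j)" "?R j \<subseteq> W j" using stable_residue_part unfolding stable_def by blast+
    obtain x where x: "x \<in> ?R j" "x \<noteq> 0" using nz subspace_0[OF sub(1)] by blast
    have "?R j = G j" by (rule rank_le_1_subspace[OF G(2) sub(1) subset_trans[OF sub(2) G(1)] x])
    then show ?thesis using sub(2) G(1)[of j] by simp
  qed
  then have "single_residue i" unfolding single_residue_def by simp
  moreover have "W = G" using R by auto
  ultimately show ?thesis using rmodI by blast
qed

context qmod
begin

lemma rank_dim: "rank_le (dim (G j)) (G j)"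
proof -
  obtain C where C: "C \<subseteq> G j" "independent C" "G j \<subseteq> span C" "card C = dim (G j)" by (rule basis_exists)
  obtain K B where B: "finite B" "G j \<subseteq> span B" using G_rank[of j] unfolding rank_le_def by blast
  have "C \<subseteq> span B" using C(1) B(2) by blast
  from independent_span_bound[OF B(1) C(2) this] have "finite C" by blast
  then show ?thesis using C by (intro rank_leI[of C]) auto
qed

lemma trivialI:
  assumes E0: "\<And>j k p q f v. p \<in> {1..N} \<Longrightarrow> q \<in> {1..N} \<Longrightarrow> v \<in> G j \<Longrightarrow> act M (el k p q f) v = 0"
    and Z0: "\<And>j v. v \<in> G j \<Longrightarrow> act M cel v = 0"
  shows "trivial_module N M"
  unfolding trivial_module_def
proof (intro ballI)
  fix x v assume x: "x \<in> cdiffops N" and v: "v \<in> space M"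
  obtain w F where w: "\<And>j. w j \<in> G j" "v = (\<Sum>j\<in>F. w j)" using G_decompose[OF v] by metis
  have "act M x (w j) = 0" for j
    unfolding act_expand[OF x G_space[OF w(1)]] Z0[OF w(1)]
    using keys_idx[OF x] E0[OF _ _ w(1)] by (auto intro!: sum.neutral simp del: atLeastAtMost_iff)
  then show "act M x v = 0" unfolding w(2) using act_sumv[OF x, of F w] G_space[OF w(1)] by simp
qed

section \<open>Highest and lowest weight vectors\<close>

text \<open>
  The elements of degree \<open>0\<close> are the diagonal ones and the centre, which act on a component by
  commuting operators.
\<close>

lemma common_weight_vector:
  assumes nz: "G j \<noteq> {0}"
  shows "\<exists>v\<in>G j. v \<noteq> 0 \<and> (\<forall>x\<in>cdiffop_deg N 0. \<exists>c. act M x v = scale M c v)"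
proof -
  \<comment> \<open>The index \<open>q = 0\<close>, which is not a matrix position, stands for the central element.\<close>
  define T where "T = (\<lambda>(q, f). if q \<in> {1..N} then act M (el 0 q q f) else act M cel)"
  have endo: "endo (scale M) (G j) (T a)" for a
  proof (cases a)
    case (Pair q f)
    show ?thesis
    proof (cases "q \<in> {1..N}")
      case True
      then show ?thesis unfolding Pair T_def
        using G_sub E_in_diag[OF True] E_add[OF True True] E_scale[OF True True] by unfold_locales auto
    next
      case False
      then show ?thesis unfolding Pair T_def
        using G_sub Z_in Z_add Z_scale by unfold_locales auto
    qed
  qed
  have comm: "T a (T b v) = T b (T a v)" if v: "v \<in> G j" for a b v
  proof (cases a; cases b)
    fix q f r g assume "a = (q, f)" "b = (r, g)"
    then show ?thesis unfolding T_def
      using diag_comm[of q r v j f g] Z_E[of q q v j 0 f] Z_E[of r r v j 0 g] v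
      by (cases "q \<in> {1..N}"; cases "r \<in> {1..N}") simp_all
  qed
  obtain K where K: "rank_le K (G j)" using G_rank by blast
  have z: "subspace {0}" "{0} \<subseteq> G j" "{0} \<noteq> G j" using nz by auto
  have T0: "T a v \<in> {0}" if "v \<in> {0}" for a v using endo.T_zero[OF endo] that by simp
  show ?thesis
  proof (rule common_quotient_eigenvector[where T = T and S = "G j" and A = "{0}", OF endo K comm z T0])
    fix v c assume v: "v \<in> G j" "v \<notin> {0}" and ev: "\<And>a. T a v - scale M (c a) v \<in> {0}"
    have vM: "v \<in> space M" by (rule G_space[OF v(1)])
    have "cdiffop_deg N 0 \<subseteq> {x \<in> cdiffops N. \<exists>c. act M x v = scale M c v}"
      unfolding cdiffop_deg_def
    proof (rule cdiffop.span_minimal)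
      have el0: "el k p q f \<in> {x \<in> cdiffops N. \<exists>c. act M x v = scale M c v}"
        if pq: "p \<in> {1..N}" "q \<in> {1..N}" and e: "k * int N + int p - int q = 0" for k p q f
      proof -
        have "k = 0"
        proof (rule ccontr)
          assume "k \<noteq> 0"
          then consider "1 \<le> k" | "k \<le> -1" by linarith
          then show False
            by cases (use mult_right_mono[of 1 k "int N"] mult_right_mono[of k "-1" "int N"] e pq in auto)
        qed
        then have "p = q" using e by simp
        have "act M (el 0 q q f) v = scale M (c (q, f)) v" using ev[of "(q, f)"] pq(2) by (simp add: T_def)
        then show ?thesis using el_in[OF pq] \<open>k = 0\<close> \<open>p = q\<close> by blast
      qed
      have "cel \<in> {x \<in> cdiffops N. \<exists>c. act M x v = scale M c v}"
        using ev[of "(0, 0)"] cel_in by (auto simp: T_def)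
      then show "{(Poly_Mapping.single (k, p, q) (monom 1 j), 0) | k j p q.
         p \<in> {1..N} \<and> q \<in> {1..N} \<and> k * int N + int p - int q = 0}
         \<union> (if (0::int) = 0 then {(0, 1)} else {}) \<subseteq> {x \<in> cdiffops N. \<exists>c. act M x v = scale M c v}"
        using el0 unfolding el_def cel_def by (simp only: simp_thms if_True) blast
      show "cdiffop.subspace {x \<in> cdiffops N. \<exists>c. act M x v = scale M c v}"
      proof (rule cdiffop.subspaceI)
        show "0 \<in> {x \<in> cdiffops N. \<exists>c. act M x v = scale M c v}"
          using cdiffop.subspace_0[OF subspace_cdiffops] act_0x[OF vM] by (auto intro!: exI[of _ 0])
        fix x y assume "x \<in> {x \<in> cdiffops N. \<exists>c. act M x v = scale M c v}" "y \<in> {x \<in> cdiffops N. \<exists>c. act M x v = scale M c v}"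
        then obtain c d where "x \<in> cdiffops N" "act M x v = scale M c v" "y \<in> cdiffops N" "act M y v = scale M d v" by blast
        then show "x + y \<in> {x \<in> cdiffops N. \<exists>c. act M x v = scale M c v}"
          using cdiffop.subspace_add[OF subspace_cdiffops] act_addx[OF _ _ vM]
          by (auto intro!: exI[of _ "c + d"] simp: scale_left_distrib)
      next
        fix a x assume "x \<in> {x \<in> cdiffops N. \<exists>c. act M x v = scale M c v}"
        then obtain c where "x \<in> cdiffops N" "act M x v = scale M c v" by blast
        then show "cdiffop_scale a x \<in> {x \<in> cdiffops N. \<exists>c. act M x v = scale M c v}"
          using cdiffop.subspace_scale[OF subspace_cdiffops] act_scalex[OF _ vM] by (auto intro!: exI[of _ "a * c"])
      qed
    qed
    then show ?thesis using v by blast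
  qed
qed

text \<open>The hypothesis \<open>0 \<notin> I\<close> keeps the centre out of the span.\<close>

lemma kill_by_degree:
  assumes v: "v \<in> space M" and I: "0 \<notin> I"
    and kill: "\<And>k p q f. p \<in> {1..N} \<Longrightarrow> q \<in> {1..N} \<Longrightarrow> k * int N + int p - int q \<in> I \<Longrightarrow> act M (el k p q f) v = 0"
    and x: "x \<in> cdiffop.span (\<Union>i\<in>I. cdiffop_deg N i)"
  shows "act M x v = 0"
proof -
  let ?K = "{x \<in> cdiffops N. act M x v = 0}"
  have sub: "cdiffop.subspace ?K"
    using cdiffop.subspace_0[OF subspace_cdiffops] cdiffop.subspace_add[OF subspace_cdiffops]
      cdiffop.subspace_scale[OF subspace_cdiffops] act_0x[OF v] act_addx[OF _ _ v] act_scalex[OF _ v]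
    by (intro cdiffop.subspaceI) auto
  have "cdiffop_deg N i \<subseteq> ?K" if i: "i \<in> I" for i
    unfolding cdiffop_deg_def
  proof (rule cdiffop.span_minimal[OF _ sub])
    have "(if i = 0 then {(0, 1)} else {}) = ({} :: cdiffop set)" using i I by auto
    moreover have "(Poly_Mapping.single (k, p, q) (monom 1 j), 0) \<in> ?K"
      if "p \<in> {1..N}" "q \<in> {1..N}" "k * int N + int p - int q = i" for k p q j
      using kill[OF that(1,2), of k "monom 1 j"] el_in[OF that(1,2), of k "monom 1 j"] that(3) i by (simp add: el_def)
    ultimately show "{(Poly_Mapping.single (k, p, q) (monom 1 j), 0) | k j p q.
         p \<in> {1..N} \<and> q \<in> {1..N} \<and> k * int N + int p - int q = i} \<union> (if i = 0 then {(0, 1)} else {}) \<subseteq> ?K"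
      by (simp only: Un_empty_right) blast
  qed
  then have "cdiffop.span (\<Union>i\<in>I. cdiffop_deg N i) \<subseteq> ?K" by (intro cdiffop.span_minimal sub) blast
  then show ?thesis using x by blast
qed

lemma irreducible_generated:
  assumes irr: "irreducible_module N M" and v: "v \<in> space M" "v \<noteq> 0"
  shows "generated_by N M v"
  unfolding generated_by_def
proof (intro conjI allI impI)
  show "v \<in> space M" by (rule v(1))
  fix U assume U: "submodule N M U \<and> v \<in> U"
  then have "U = {0} \<or> U = space M" using irr unfolding irreducible_module_def by blast
  then show "U = space M" using U v(2) by auto
qed

lemma highest_weightI:
  assumes irr: "irreducible_module N M" and t: "top_degree j"
  shows "highest_weight_module N M G"
proof -
  obtain v where v: "v \<in> G j" "v \<noteq> 0" "\<forall>x\<in>cdiffop_deg N 0. \<exists>c. act M x v = scale M c v"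
    using common_weight_vector t unfolding top_degree_def by blast
  have "act M x v = 0" if "x \<in> cdiffop_pos N" for x
  proof (rule kill_by_degree[OF G_space[OF v(1)] _ _ that[unfolded cdiffop_pos_def]])
    fix k p q f assume "p \<in> {1..N}" "q \<in> {1..N}" "k * int N + int p - int q \<in> {0<..}"
    then show "act M (el k p q f) v = 0" using t v(1) unfolding top_degree_def by (simp del: atLeastAtMost_iff)
  qed simp
  then show ?thesis unfolding highest_weight_module_def highest_weight_vector_def
    using quasi v irreducible_generated[OF irr G_space[OF v(1)] v(2)] by blast
qed

lemma lowest_weightI:
  assumes irr: "irreducible_module N M" and t: "bottom_degree j"
  shows "lowest_weight_module N M G"
proof -
  obtain v where v: "v \<in> G j" "v \<noteq> 0" "\<forall>x\<in>cdiffop_deg N 0. \<exists>c. act M x v = scale M c v"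
    using common_weight_vector t unfolding bottom_degree_def by blast
  have "act M x v = 0" if "x \<in> cdiffop_neg N" for x
  proof (rule kill_by_degree[OF G_space[OF v(1)] _ _ that[unfolded cdiffop_neg_def]])
    fix k p q f assume "p \<in> {1..N}" "q \<in> {1..N}" "k * int N + int p - int q \<in> {..<0}"
    then show "act M (el k p q f) v = 0" using t v(1) unfolding bottom_degree_def by (simp del: atLeastAtMost_iff)
  qed simp
  then show ?thesis unfolding lowest_weight_module_def lowest_weight_vector_def
    using quasi v irreducible_generated[OF irr G_space[OF v(1)] v(2)] by blast
qed

lemma qsmodI:
  assumes "\<And>j. rank_le K (G j)"
  shows "qsmod N M G (2 * (K + 1) ^ (2 * K))"
  by (intro qsmod.intro qmod_axioms bmod.smod[OF bmodI[OF assms]])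

end

section \<open>The trichotomy for bounded modules\<close>

text \<open>
  An indecomposable module is a block; the three cases are the eigenvalues \<open>1\<close>, \<open>-1\<close> and all others
  of the identity matrix.
\<close>

lemma (in qsmod) action_trichotomy:
  assumes indec: gindec and nz: "G j0 \<noteq> {0}"
  shows "(\<exists>i. rmod (scale M) N (\<lambda>k p q f. act M (el k p q f)) (act M cel) cocycle_poly G i) \<or>
    (\<exists>i. rmod (scale M) N dualE (act M cel) cocycle_poly G i) \<or>
    (\<forall>j k p q f v. p \<in> {1..N} \<longrightarrow> q \<in> {1..N} \<longrightarrow> v \<in> G j \<longrightarrow> act M (el k p q f) v = 0)"
proof -
  obtain \<omega> z where b: "block (scale M) N (\<lambda>k p q f. act M (el k p q f)) (act M cel) cocycle_poly G d \<omega> z"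
    using indecomposable_block[OF indec nz] by blast
  consider "\<omega> = 1" | "\<omega> = -1" | "\<omega> \<noteq> 1" "\<omega> \<noteq> -1" by blast
  then show ?thesis
  proof cases
    case 1
    have a: "amod (scale M) N (\<lambda>k p q f. act M (el k p q f)) (act M cel) cocycle_poly G"
      by (rule assoc_block.amod[OF assoc_block.intro[OF b[unfolded 1]]])
    obtain i where "amod.single_residue N (\<lambda>k p q f. act M (el k p q f)) G i"
      using amod.single_residue_if_indecomposable[OF a indec nz] by blast
    from amod.rmodI[OF a this] show ?thesis by blast
  next
    case 2
    have a: "amod (scale M) N dualE (act M cel) cocycle_poly G"
      by (rule assoc_block.amod[OF assoc_block.intro[OF dual_block[OF b[unfolded 2]]]])
    obtain i where "amod.single_residue N dualE G i"
      using amod.single_residue_if_indecomposable[OF a dual_gindec[OF indec] nz] by blast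
    from amod.rmodI[OF a this] show ?thesis by blast
  next
    case 3
    then show ?thesis using block.block_trivial[OF b 3] by blast
  qed
qed

lemma (in qsmod) simple_rank_le_1:
  assumes simple: gsimple
  shows "rank_le 1 (G j)"
proof -
  obtain j0 where nz: "G j0 \<noteq> {0}" using simple unfolding gsimple_def by blast
  consider (V) i where "rmod (scale M) N (\<lambda>k p q f. act M (el k p q f)) (act M cel) cocycle_poly G i"
    | (Vbar) i where "rmod (scale M) N dualE (act M cel) cocycle_poly G i"
    | (trivial) "\<And>j k p q f v. p \<in> {1..N} \<Longrightarrow> q \<in> {1..N} \<Longrightarrow> v \<in> G j \<Longrightarrow> act M (el k p q f) v = 0"
    using action_trichotomy[OF gsimple_gindec[OF simple] nz] by blast
  then show ?thesis
  proof cases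
    case V
    then show ?thesis by (rule rmod.simple_rank_1[OF _ simple])
  next
    case Vbar
    then show ?thesis by (rule rmod.simple_rank_1[OF _ dual_gsimple[OF simple]])
  next
    case trivial
    \<comment> \<open>Every family of subspaces is stable, in particular a line in one degree.\<close>
    obtain v where v: "v \<in> G j0" "v \<noteq> 0" using nz W_0 by blast
    define A where "A j = (if j = j0 then span {v} else {0})" for j
    have A0: "0 \<in> A j" for j by (simp add: A_def span_zero)
    have "span {v} \<subseteq> G j0" using v(1) G_sub by (intro span_minimal) auto
    then have AG: "A j \<subseteq> G j" for j by (simp add: A_def)
    have "stable A"
    proof (rule stableI)
      show "subspace (A j)" for j by (simp add: A_def)
      show "A j \<subseteq> G j" for j by (rule AG)
      show "act M (el k p q f) w \<in> A (j + k * int N + int p - int q)" if "p \<in> {1..N}" "q \<in> {1..N}" "w \<in> A j" for j k p q f w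
        using trivial[OF that(1,2) subsetD[OF AG that(3)]] A0 by simp
      show "act M cel w \<in> A j" if "w \<in> A j" for j w
        using Z_zero[OF subsetD[OF AG that]] A0 by simp
    qed
    moreover have "A j0 \<noteq> {0}" using v(2) span_base[of v "{v}"] by (auto simp: A_def)
    ultimately have "\<forall>j. A j = G j" using simple unfolding gsimple_def by blast
    then have G: "G j = (if j = j0 then span {v} else {0})" unfolding A_def by simp
    show ?thesis
    proof (cases "j = j0")
      case True
      then show ?thesis using G v(1) by (intro rank_leI[of "{v}"]) auto
    next
      case False
      then show ?thesis using G by (intro rank_leI[of "{}"]) auto
    qed
  qed
qed

text \<open>
  A nontrivial family of components of dimension at most \<open>1\<close> contains a block, generated by
  eigenvectors of the identity and of the grading element, on which the action is nonzero. By the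
  classification of blocks this block is everything.
\<close>

lemma (in qsmod) intermediate_structure:
  assumes rk: "\<And>j. rank_le 1 (G j)"
    and nontriv: "p0 \<in> {1..N}" "q0 \<in> {1..N}" "v0 \<in> G j0" "act M (el k0 p0 q0 f0) v0 \<noteq> 0"
  shows "(\<exists>i. rmod (scale M) N (\<lambda>k p q f. act M (el k p q f)) (act M cel) cocycle_poly G i) \<or>
    (\<exists>i. rmod (scale M) N dualE (act M cel) cocycle_poly G i)"
proof -
  have v0: "v0 \<noteq> 0" using nontriv by auto
  have line: "\<exists>c. w = scale M c v0" if w: "w \<in> G j0" for w
  proof -
    have "span {v0} = G j0"
      using nontriv(3) G_sub v0 by (intro rank_le_1_subspace[OF rk _ _ span_base[of v0 "{v0}"]] span_minimal) auto
    then show ?thesis using w unfolding span_singleton by blast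
  qed
  obtain \<omega> where \<omega>: "Iop 0 v0 = scale M \<omega> v0" using line[OF endo.T_in[OF endo_Iop nontriv(3)]] by blast
  obtain e where e: "Dop 0 v0 = scale M e v0" using line[OF endo.T_in[OF endo_Dop nontriv(3)]] by blast
  define z where "z = e - of_int j0"
  define A where "A j = {w \<in> G j. Iop \<omega> w = 0 \<and> Dop (z + of_int j) w = 0}" for j
  have vA: "v0 \<in> A j0" using \<omega> e nontriv(3) by (simp add: A_def z_def Iop_def Dop_def)
  have AG: "A j \<subseteq> G j" for j by (auto simp: A_def)
  have st: "stable A"
  proof (rule stableI)
    fix j
    show "subspace (A j)" unfolding A_def
      using endo.T_zero[OF endo_Iop[of j]] endo.T_zero[OF endo_Dop[of j]] endo.T_add[OF endo_Iop[of j]] endo.T_add[OF endo_Dop[of j]]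
        endo.T_scale[OF endo_Iop[of j]] endo.T_scale[OF endo_Dop[of j]] W_add W_scale
      by (intro subspaceI) auto
    show "act M cel w \<in> A j" if "w \<in> A j" for w
      using Z_zero[OF subsetD[OF AG that]] endo.T_zero[OF endo_Iop[of j]] endo.T_zero[OF endo_Dop[of j]] by (simp add: A_def)
  next
    fix j k p q f w assume pq: "p \<in> {1..N}" "q \<in> {1..N}" and w: "w \<in> A j"
    have wG: "w \<in> G j" using w AG by blast
    have "Iop \<omega> (act M (el k p q f) w) = 0" using Iop_comm[OF pq wG] w pq by (simp add: A_def)
    moreover have "Dop (z + of_int (j + k * int N + int p - int q)) (act M (el k p q f) w) = 0"
      using Dop_comm[OF pq wG, of "z + of_int j" k f] w pq by (simp add: A_def algebra_simps)
    ultimately show "act M (el k p q f) w \<in> A (j + k * int N + int p - int q)" using E_in[OF pq wG] by (simp add: A_def)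
  qed (rule AG)
  interpret A: smod "scale M" N "\<lambda>k p q f. act M (el k p q f)" "act M cel" cocycle_poly A d by (rule restrict_smod[OF st])
  have b: "block (scale M) N (\<lambda>k p q f. act M (el k p q f)) (act M cel) cocycle_poly A d \<omega> z"
  proof (unfold_locales, goal_cases)
    case (1 v j) then show ?case by (intro exI[of _ 1]) (simp add: A_def)
  next
    case (2 v j) then show ?case by (intro exI[of _ 1]) (simp add: A_def)
  qed
  consider "\<omega> = 1" | "\<omega> = -1" | "\<omega> \<noteq> 1" "\<omega> \<noteq> -1" by blast
  then show ?thesis
  proof cases
    case 1
    have a: "amod (scale M) N (\<lambda>k p q f. act M (el k p q f)) (act M cel) cocycle_poly A"
      by (rule assoc_block.amod[OF assoc_block.intro[OF b[unfolded 1]]])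
    show ?thesis by (rule disjI1, rule amod.full_single_residue[OF a vA v0 AG rk])
  next
    case 2
    have a: "amod (scale M) N dualE (act M cel) cocycle_poly A"
      by (rule assoc_block.amod[OF assoc_block.intro[OF A.dual_block[OF b[unfolded 2]]]])
    show ?thesis by (rule disjI2, rule amod.full_single_residue[OF a vA v0 AG rk])
  next
    case 3
    then have False using block.block_trivial[OF b 3 nontriv(1,2) vA] nontriv(4) by blast
    then show ?thesis ..
  qed
qed

lemma mat_1_scalar: "\<alpha> \<in> carrier_mat 1 1 \<Longrightarrow> \<alpha> = scalar_mat1 (\<alpha> $$ (0, 0))"
  by (rule eq_matI) (auto simp: scalar_mat1_def)

context qmod
begin

lemma irreducible_trichotomy:
  assumes irr: "irreducible_module N M"
  shows "highest_weight_module N M G \<or> lowest_weight_module N M G \<or> intermediate_series N M G"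
proof (cases "(\<exists>j. top_degree j) \<or> (\<exists>j. bottom_degree j)")
  case True
  then show ?thesis using highest_weightI[OF irr] lowest_weightI[OF irr] by blast
next
  case False
  note simple = gsimpleI[OF irr]
  obtain K where K: "\<And>j. rank_le K (G j)" using top_bottom_or_bounded[OF simple] False by blast
  have "rank_le 1 (G j)" for j by (rule qsmod.simple_rank_le_1[OF qsmodI[OF K] simple])
  then show ?thesis unfolding intermediate_series_def using quasi dim_le_rank by blast
qed

lemma intermediate_classification:
  assumes int: "intermediate_series N M G" and nontriv: "\<not> trivial_module N M"
  shows "\<exists>a. module_iso N M (V_mod N 1 (scalar_mat1 a)) \<or> module_iso N M (Vbar_mod N 1 (scalar_mat1 a))"
proof -
  have rk: "rank_le 1 (G j)" for j
    using rank_dim[of j] int rank_le_mono unfolding intermediate_series_def by blast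
  interpret B: qsmod N M G "2 * (1 + 1) ^ (2 * 1)" by (rule qsmodI[OF rk])
  have "\<exists>p q v j k f. p \<in> {1..N} \<and> q \<in> {1..N} \<and> v \<in> G j \<and> act M (el k p q f) v \<noteq> 0"
  proof (rule ccontr)
    assume neg: "\<not> ?thesis"
    have "trivial_module N M"
    proof (rule trivialI)
      show "act M cel v = 0" if "v \<in> G j" for v j by (rule B.Z_zero[OF that])
    qed (use neg in blast)
    then show False using nontriv by blast
  qed
  then obtain p q v j k f where nt: "p \<in> {1..N}" "q \<in> {1..N}" "v \<in> G j" "act M (el k p q f) v \<noteq> 0"
    by blast
  have "v \<noteq> 0" using nt(4) E_0[OF nt(1,2)] by metis
  then have nz: "G j \<noteq> {0}" using nt(3) by blast
  from B.intermediate_structure[OF rk nt] show ?thesis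
  proof (elim disjE exE)
    fix i assume R: "rmod (scale M) N (\<lambda>k p q f. act M (el k p q f)) (act M cel) cocycle_poly G i"
    obtain m \<alpha> where m: "1 \<le> m" "m \<le> 1" "\<alpha> \<in> carrier_mat m m" "module_iso N M (V_mod N m \<alpha>)"
      using V_iso[OF R rk nz] by blast
    then have "m = 1" by simp
    then show ?thesis using m mat_1_scalar by metis
  next
    fix i assume R: "rmod (scale M) N B.dualE (act M cel) cocycle_poly G i"
    obtain m \<alpha> where m: "1 \<le> m" "m \<le> 1" "\<alpha> \<in> carrier_mat m m" "module_iso N M (Vbar_mod N m \<alpha>)"
      using B.Vbar_iso[OF R rk nz] by blast
    then have "m = 1" by simp
    then show ?thesis using m mat_1_scalar by metis
  qed
qed

lemma indecomposable_classification:
  assumes bounded: "uniformly_bounded N M G" and indec: "indecomposable_module N M" and nontriv: "\<not> trivial_module N M"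
  shows "\<exists>m \<alpha>. m \<ge> 1 \<and> indecomposable_mat m \<alpha> \<and> (module_iso N M (V_mod N m \<alpha>) \<or> module_iso N M (Vbar_mod N m \<alpha>))"
proof -
  obtain K where "\<And>j. dim (G j) \<le> K" using bounded unfolding uniformly_bounded_def by blast
  then have rk: "rank_le K (G j)" for j using rank_dim[of j] rank_le_mono by blast
  interpret B: qsmod N M G "2 * (K + 1) ^ (2 * K)" by (rule qsmodI[OF rk])
  note ind = gindecI[OF indec]
  have "space M \<noteq> {0}" using indec by (simp add: indecomposable_module_def)
  then obtain j0 where nz: "G j0 \<noteq> {0}" using some_component by blast
  from B.action_trichotomy[OF ind nz] show ?thesis
  proof (elim disjE exE)
    fix i assume R: "rmod (scale M) N (\<lambda>k p q f. act M (el k p q f)) (act M cel) cocycle_poly G i"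
    show ?thesis using V_iso[OF R rk nz] ind by blast
  next
    fix i assume R: "rmod (scale M) N B.dualE (act M cel) cocycle_poly G i"
    show ?thesis using B.Vbar_iso[OF R rk nz] ind by blast
  next
    assume E0: "\<forall>j k p q f v. p \<in> {1..N} \<longrightarrow> q \<in> {1..N} \<longrightarrow> v \<in> G j \<longrightarrow> act M (el k p q f) v = 0"
    have "trivial_module N M"
    proof (rule trivialI)
      show "act M cel v = 0" if "v \<in> G j" for v j by (rule B.Z_zero[OF that])
    qed (use E0 in blast)
    then show ?thesis using nontriv by blast
  qed
qed

end

theorem theorem2p2:
  fixes N :: nat
    and M :: "'v::ab_group_add cdiffop_rep"
    and G :: "int \<Rightarrow> 'v set"
  assumes "N \<ge> 1"
  shows
    "(quasifinite N M G \<and> irreducible_module N M \<longrightarrow>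
        highest_weight_module N M G \<or> lowest_weight_module N M G \<or> intermediate_series N M G) \<and>
     (intermediate_series N M G \<and> \<not> trivial_module N M \<longrightarrow>
        (\<exists>a. module_iso N M (V_mod N 1 (scalar_mat1 a)) \<or>
             module_iso N M (Vbar_mod N 1 (scalar_mat1 a)))) \<and>
     (uniformly_bounded N M G \<and> indecomposable_module N M \<and> \<not> trivial_module N M \<longrightarrow>
        (\<exists>m \<alpha>. m \<ge> 1 \<and> indecomposable_mat m \<alpha> \<and>
             (module_iso N M (V_mod N m \<alpha>) \<or> module_iso N M (Vbar_mod N m \<alpha>))))"
proof (intro conjI impI)
  assume h: "quasifinite N M G \<and> irreducible_module N M"
  interpret qmod N M G using assms h by unfold_locales auto
  show "highest_weight_module N M G \<or> lowest_weight_module N M G \<or> intermediate_series N M G"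
    using irreducible_trichotomy h by blast
next
  assume h: "intermediate_series N M G \<and> \<not> trivial_module N M"
  then interpret qmod N M G using assms by unfold_locales (auto simp: intermediate_series_def)
  show "\<exists>a. module_iso N M (V_mod N 1 (scalar_mat1 a)) \<or> module_iso N M (Vbar_mod N 1 (scalar_mat1 a))"
    using intermediate_classification h by blast
next
  assume h: "uniformly_bounded N M G \<and> indecomposable_module N M \<and> \<not> trivial_module N M"
  then interpret qmod N M G using assms by unfold_locales (auto simp: uniformly_bounded_def)
  show "\<exists>m \<alpha>. m \<ge> 1 \<and> indecomposable_mat m \<alpha> \<and> (module_iso N M (V_mod N m \<alpha>) \<or> module_iso N M (Vbar_mod N m \<alpha>))"
    using indecomposable_classification h by blast
qed

end
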